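(* Let $n\ge2$. For type $B_n$ with the numeration of positive roots and the monomial order specified in the context, let $p_{i,j}^{\pm}\ge0$ ($1\le i<j\le n$) denote the exponent of a signature corresponding to the root $\varepsilon_i\pm\varepsilon_j$, let $s_i\ge0$ be the exponent corresponding to $\varepsilon_i$, put $p_{i,i}^{\pm}:=\frac12 s_i$, and let $\sum_i k_i\omega_i$ be the (dominant) highest weight. Then the semigroup $\Sigma_{B_n}$ of essential signatures is given by the following inequalities, i.e. a signature is essential if and only if all of them hold: 1. $s_i-s_{i+1}+p_{i,j}^{+}+\sum_{k=j+1}^{n}(p_{i,k}^{+}+p_{i,k}^{-}-p_{i+1,k}^{+}-p_{i+1,k}^{-})\le k_i$ for $i\in\{1,\dots,n-2\}$, $j\in\{i+2,\dots,n\}$; 2. $s_i-s_{i+1}+p_{i+1,j}^{-}+\sum_{k=j}^{n}(p_{i,k}^{+}+p_{i,k}^{-}-p_{i+1,k}^{+}-p_{i+1,k}^{-})\le k_i$ for $i\in\{1,\dots,n-2\}$, $j\in\{i+2,\dots,n\}$; 3. $s_i-s_{i+1}+p_{i,i+1}^{-}+\sum_{k=i+2}^{n}(p_{i,k}^{+}+p_{i,k}^{-}-p_{i+1,k}^{+}-p_{i+1,k}^{-})\le k_i$ for $i\in\{1,\dots,n-1\}$; 4. $s_i+p_{i+1,i+2}^{-}+\sum_{k=i+2}^{n}(p_{i,k}^{+}+p_{i,k}^{-}-p_{i+2,k}^{+}-p_{i+2,k}^{-})\le k_i+k_{i+1}$ for $i\in\{1,\dots,n-2\}$; 5. $s_i-p_{i,i+1}^{-}+\sum_{k=i+1}^{n}(p_{i,k}^{+}+p_{i,k}^{-}+p_{i+1,k}^{+}+p_{i+1,k}^{-})\le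 k_i+k_n+2\sum_{j=i+1}^{n-1}k_j$ for $i\in\{1,\dots,n-1\}$; 6. $s_i\le k_i$ for $i\in\{1,\dots,n\}$. (Empty sums are zero.)
   Context: General notions. Let $\mathfrak g$ be a complex semisimple Lie algebra with triangular decomposition $\mathfrak g=\mathfrak u^-\oplus\mathfrak t\oplus\mathfrak u$, positive roots $\Delta_+$, root vectors $e_{\pm\alpha}$ ($\alpha\in\Delta_+$), and fundamental weights $\omega_1,\dots,\omega_n$. $V(\lambda)$ is the irreducible module with highest weight $\lambda$ and $v_\lambda$ a highest weight vector. Fix a numeration $\Delta_+=\{\alpha_1,\dots,\alpha_N\}$ and a monomial order on $\mathbb Z_{\ge0}^N$ (a total order compatible with addition, with $0$ least). A signature is a tuple $\sigma=(\lambda;p_1,\dots,p_N)$ with $\lambda$ a dominant integral weight (the highest weight of $\sigma$) and $p_i\in\mathbb Z_{\ge 0}$ (the exponents of $\sigma$; $p_i$ is the exponent corresponding to $\alpha_i$). Put $v(\sigma)=\frac{e_{-\alpha_1}^{p_1}}{p_1!}\cdots\frac{e_{-\alpha_N}^{p_N}}{p_N!}v_\lambda\in V(\lambda)$. Signatures of the same highest weight are ordered by their exponent tuples via the monomial order. A signature $\sigma$ of highest weight $\lambda$ is essential if $v(\sigma)$ is not in the linear span of the $v(\tau)$ with $\tau<\sigma$ of highest weight $\lambda$. The essential signatures form a semigroup $\Sigma_{\mathfrak g}$ under componentwise addition. Type $B_n$ ($\mathfrak{so}_{2n+1}$). $\pm\varepsilon_1,\dots,\pm\varepsilon_n$ are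 the nonzero weights of the standard representation. Positive roots: $\varepsilon_i\pm\varepsilon_j$ ($i<j$) and $\varepsilon_i$. Fundamental weights: $\omega_i=\varepsilon_1+\dots+\varepsilon_i$ ($i<n$), $\omega_n=\frac12(\varepsilon_1+\dots+\varepsilon_n)$. Numeration of positive roots: for $m=2,\dots,n$ successively, the roots $\varepsilon_1-\varepsilon_m,\dots,\varepsilon_{m-1}-\varepsilon_m$ followed by $\varepsilon_1+\varepsilon_m,\dots,\varepsilon_{m-1}+\varepsilon_m$; after all of these, the roots $\varepsilon_1,\dots,\varepsilon_n$. Monomial order (degree lexicographic order compares the sums of entries first and then compares lexicographically). For two signatures of the same highest weight: first compare the tuples of exponents corresponding to $\varepsilon_1,\dots,\varepsilon_n$ by the degree lexicographic order; if they coincide, then for $m=n,n-1,\dots,2$ successively compare first the tuples of exponents corresponding to $\varepsilon_1+\varepsilon_m,\dots,\varepsilon_{m-1}+\varepsilon_m$ by the degree lexicographic order, then those corresponding to $\varepsilon_1-\varepsilon_m,\dots,\varepsilon_{m-1}-\varepsilon_m$ by the degree lexicographic order, moving to the next step only if all earlier tuples coincide. *)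

theory Defs
  imports Complex_Main "Jordan_Normal_Form.Matrix"
begin

section \<open>Modules over a Lie algebra of complex matrices\<close>

definition lie_bracket :: "complex mat \<Rightarrow> complex mat \<Rightarrow> complex mat" where
  "lie_bracket x y = x * y - y * x"

locale lie_module = vector_space scale
  for scale :: "complex \<Rightarrow> 'v::ab_group_add \<Rightarrow> 'v" +
  fixes \<gg> :: "complex mat set"
    and act :: "complex mat \<Rightarrow> 'v \<Rightarrow> 'v"
  assumes act_linear: "x \<in> \<gg> \<Longrightarrow> Vector_Spaces.linear scale scale (act x)"
    and act_add: "x \<in> \<gg> \<Longrightarrow> y \<in> \<gg> \<Longrightarrow> act (x + y) w = act x w + act y w"
    and act_smult: "x \<in> \<gg> \<Longrightarrow> act (c \<cdot>\<^sub>m x) w = scale c (act x w)"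
    and act_bracket:
      "x \<in> \<gg> \<Longrightarrow> y \<in> \<gg> \<Longrightarrow> act (lie_bracket x y) w = act x (act y w) - act y (act x w)"
begin

definition submodule :: "'v set \<Rightarrow> bool" where
  "submodule W \<longleftrightarrow> subspace W \<and> (\<forall>x\<in>\<gg>. \<forall>w\<in>W. act x w \<in> W)"

definition irreducible_module :: bool where
  "irreducible_module \<longleftrightarrow> (\<exists>w::'v. w \<noteq> 0) \<and> (\<forall>W. submodule W \<longrightarrow> W = {0} \<or> W = UNIV)"

end

section \<open>Type B\<close>

text \<open>
  The algebra \<open>so(2n+1)\<close> preserves the symmetric form with antidiagonal Gram matrix.  With this
  choice the diagonal matrices in \<open>so(2n+1)\<close> form a Cartan subalgebra.  They are the matrices
  \<open>diag(h\<^sub>1, \<dots>, h\<^sub>n, 0, -h\<^sub>n, \<dots>, -h\<^sub>1)\<close>, and \<open>\<epsilon> i\<close> (with \<open>1 \<le> i \<le> n\<close>) reads off \<open>h\<^sub>i\<close>.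
\<close>

definition antidiag_form :: "nat \<Rightarrow> complex mat" where
  "antidiag_form n = mat (2 * n + 1) (2 * n + 1) (\<lambda>(i, j). if i + j = 2 * n then 1 else 0)"

definition so_odd :: "nat \<Rightarrow> complex mat set" where
  "so_odd n = {x \<in> carrier_mat (2 * n + 1) (2 * n + 1).
     transpose_mat x * antidiag_form n + antidiag_form n * x = 0\<^sub>m (2 * n + 1) (2 * n + 1)}"

definition torus :: "nat \<Rightarrow> complex mat set" where
  "torus n = {h \<in> so_odd n. diagonal_mat h}"

type_synonym weight = "complex mat \<Rightarrow> complex"

definition \<epsilon> :: "nat \<Rightarrow> weight" where
  "\<epsilon> i h = h $$ (i - 1, i - 1)"

definition fundamental_weight :: "nat \<Rightarrow> nat \<Rightarrow> weight" where
  "fundamental_weight n i h =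
     (if i < n then (\<Sum>l = 1..i. \<epsilon> l h) else (1 / 2) * (\<Sum>l = 1..n. \<epsilon> l h))"

definition dominant_weight :: "nat \<Rightarrow> (nat \<Rightarrow> nat) \<Rightarrow> weight" where
  "dominant_weight n k h = (\<Sum>i = 1..n. of_nat (k i) * fundamental_weight n i h)"

text \<open>
  \<open>Minus i j\<close>, \<open>Plus i j\<close> and \<open>Short i\<close> label the roots \<open>\<epsilon>\<^sub>i - \<epsilon>\<^sub>j\<close>, \<open>\<epsilon>\<^sub>i + \<epsilon>\<^sub>j\<close> and \<open>\<epsilon>\<^sub>i\<close>.
  Only the labels occurring in \<open>pos_roots n\<close> below are meaningful.
\<close>

datatype root = Minus nat nat | Plus nat nat | Short nat

fun root_weight :: "root \<Rightarrow> weight" where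
  "root_weight (Minus i j) h = \<epsilon> i h - \<epsilon> j h"
| "root_weight (Plus i j) h = \<epsilon> i h + \<epsilon> j h"
| "root_weight (Short i) h = \<epsilon> i h"

definition minus_roots :: "nat \<Rightarrow> root list" where
  "minus_roots m = map (\<lambda>i. Minus i m) [1..<m]"

definition plus_roots :: "nat \<Rightarrow> root list" where
  "plus_roots m = map (\<lambda>i. Plus i m) [1..<m]"

definition short_roots :: "nat \<Rightarrow> root list" where
  "short_roots n = map Short [1..<n + 1]"

definition pos_roots :: "nat \<Rightarrow> root list" where
  "pos_roots n = concat (map (\<lambda>m. minus_roots m @ plus_roots m) [2..<n + 1]) @ short_roots n"

definition is_root_vector :: "nat \<Rightarrow> weight \<Rightarrow> complex mat \<Rightarrow> bool" where
  "is_root_vector n \<alpha> x \<longleftrightarrow>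
     x \<in> so_odd n \<and> x \<noteq> 0\<^sub>m (2 * n + 1) (2 * n + 1) \<and>
     (\<forall>h\<in>torus n. lie_bracket h x = \<alpha> h \<cdot>\<^sub>m x)"

section \<open>Irreducible highest weight modules\<close>

locale irreducible_highest_weight_module = lie_module scale "so_odd n" act
  for scale :: "complex \<Rightarrow> 'v::ab_group_add \<Rightarrow> 'v"
    and n :: nat
    and act :: "complex mat \<Rightarrow> 'v \<Rightarrow> 'v" +
  fixes lam :: weight
    and v :: 'v
  assumes irreducible: "irreducible_module"
    and hw_nonzero: "v \<noteq> 0"
    and hw_weight: "h \<in> torus n \<Longrightarrow> act h v = scale (lam h) v"
    and hw_annihilated:
      "\<alpha> \<in> set (pos_roots n) \<Longrightarrow> is_root_vector n (root_weight \<alpha>) x \<Longrightarrow> act x v = 0"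

section \<open>Essential signatures\<close>

text \<open>
  A signature is represented by its highest weight and its exponents \<open>p\<close>, a function on root labels
  which is only ever evaluated on \<open>pos_roots n\<close>.
\<close>

definition deglex :: "(nat list \<times> nat list) set" where
  "deglex = {(xs, ys). sum_list xs < sum_list ys \<or>
     (sum_list xs = sum_list ys \<and> (xs, ys) \<in> lex less_than)}"

definition exponent_blocks :: "nat \<Rightarrow> (root \<Rightarrow> nat) \<Rightarrow> nat list list" where
  "exponent_blocks n p = map (map p)
     (short_roots n # concat (map (\<lambda>m. [plus_roots m, minus_roots m]) (rev [2..<n + 1])))"

definition exponents_less :: "nat \<Rightarrow> (root \<Rightarrow> nat) \<Rightarrow> (root \<Rightarrow> nat) \<Rightarrow> bool" where
  "exponents_less n q p \<longleftrightarrow> (exponent_blocks n q, exponent_blocks n p) \<in> lex deglex"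

text \<open>Here \<open>f \<alpha>\<close> plays the role of the root vector of weight \<open>-\<alpha>\<close>.\<close>

definition signature_vector ::
  "(complex \<Rightarrow> 'v::ab_group_add \<Rightarrow> 'v) \<Rightarrow> nat \<Rightarrow> (complex mat \<Rightarrow> 'v \<Rightarrow> 'v) \<Rightarrow>
   (root \<Rightarrow> complex mat) \<Rightarrow> 'v \<Rightarrow> (root \<Rightarrow> nat) \<Rightarrow> 'v" where
  "signature_vector scale n act f v p =
     foldr (\<lambda>\<alpha> w. scale (1 / fact (p \<alpha>)) ((act (f \<alpha>) ^^ p \<alpha>) w)) (pos_roots n) v"

definition essential ::
  "(complex \<Rightarrow> 'v::ab_group_add \<Rightarrow> 'v) \<Rightarrow> nat \<Rightarrow> (complex mat \<Rightarrow> 'v \<Rightarrow> 'v) \<Rightarrow>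
   (root \<Rightarrow> complex mat) \<Rightarrow> 'v \<Rightarrow> (root \<Rightarrow> nat) \<Rightarrow> bool" where
  "essential scale n act f v p \<longleftrightarrow>
     signature_vector scale n act f v p \<notin>
       module.span scale {signature_vector scale n act f v q | q. exponents_less n q p}"

definition exp_plus :: "(root \<Rightarrow> nat) \<Rightarrow> nat \<Rightarrow> nat \<Rightarrow> real" where
  "exp_plus p i j = (if i = j then real (p (Short i)) / 2 else real (p (Plus i j)))"

definition exp_minus :: "(root \<Rightarrow> nat) \<Rightarrow> nat \<Rightarrow> nat \<Rightarrow> real" where
  "exp_minus p i j = (if i = j then real (p (Short i)) / 2 else real (p (Minus i j)))"

definition exp_short :: "(root \<Rightarrow> nat) \<Rightarrow> nat \<Rightarrow> real" where
  "exp_short p i = real (p (Short i))"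

end

theory Submission
 imports Defs "HOL-Library.Multiset" "HOL-Library.Function_Algebras" "HOL-Library.Product_Plus"
begin

text \<open>
 With indices \<open>-n, \<dots>, n\<close>, the matrices \<open>F\<^sub>a\<^sub>b = E\<^sub>a\<^sub>b - E\<^sub>-\<^sub>b\<^sub>,\<^sub>-\<^sub>a\<close> span \<open>so(2n+1)\<close>.  The blocks of exponents are
 processed in the order in which they are compared.  After each block there remain a vector \<open>w\<close> and a
 subspace \<open>U\<close> of negligible vectors, such that modulo \<open>U\<close> the vector \<open>w\<close> is a highest weight vector for a
 smaller orthogonal algebra; whether the next block survives then depends on the weight of \<open>w\<close> only.

 That the inequalities are necessary follows from strings of \<open>sl\<^sub>2\<close> and from one relation between lowering
 operators of \<open>gl\<^sub>3\<close>.  For sufficiency, compare with a unitary module \<open>M\<close> having a highest weight vector \<open>v\<close>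
 of the same weight: in \<open>V \<times> M\<close> the submodule generated by \<open>(w, v)\<close> and \<open>U \<times> 0\<close> meets \<open>U \<times> M\<close> in
 \<open>U \<times> 0\<close>, by orthogonality, so every relation between monomials applied to \<open>w\<close> modulo \<open>U\<close> also holds
 for \<open>v\<close>.  Essential exponents of tensor factors add up, which reduces the claim to exterior powers and
 the spin module.  The same comparison shows that root vectors act locally nilpotently on \<open>V\<close>.
\<close>

section \<open>Linear operators and sorting of words\<close>

text \<open>The order is what makes the blocks separate. Comparing the degree of a block first makes
  every commutator inside the block negligible; comparing lexicographically then lets the raising
  operators \<open>F i j\<close>, \<open>i < j\<close>, of the smaller algebra act by decreasing
  exponents. So a block monomial applied to a highest weight vector is again one, modulo smaller
  monomials. The obstacle is that \<epsilon>_i + \<epsilon>_m and \<epsilon>_i - \<epsilon>_m form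
  separate blocks. After the first of them only a parabolic subalgebra preserves the negligible
  vectors. The comparison with \<open>M\<close> works in one direction only: relations pass from
  \<open>w\<close> to \<open>v\<close>. This is enough, because each violated inequality is shown
  separately to produce a relation modulo \<open>U\<close>. For one index \<open>m\<close> the
  admissible exponents are generated by 0-1 exponents attached to fundamental weights and one
  attached to \<omega>_(m-1) + \<omega>_m.\<close>

locale complex_space = vector_space scale for scale :: "complex => 'v::ab_group_add => 'v"
begin

definition lin :: "('v => 'v) => bool" where
 "lin f \<longleftrightarrow> (\<forall>x y. f (x + y) = f x + f y) \<and> (\<forall>c x. f (scale c x) = scale c (f x))"

lemma lin_add: "lin f ==> f (x + y) = f x + f y"
 and lin_scale: "lin f ==> f (scale c x) = scale c (f x)"
 by (auto simp: lin_def)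

lemma lin_0: "lin f ==> f 0 = 0" using lin_scale[of f 0 0] by simp

lemma lin_minus: "lin f ==> f (- x) = - f x" using lin_scale[of f "- 1" x] by simp

lemma lin_diff: "lin f ==> f (x - y) = f x - f y"
 using lin_add[of f x "- y"] lin_minus[of f y] by simp

lemma lin_sum: "lin f ==> f (\<Sum>i\<in>I. g i) = (\<Sum>i\<in>I. f (g i))"
 by (induction I rule: infinite_finite_induct) (auto simp: lin_0 lin_add)

lemma lin_comp: "lin f ==> lin g ==> lin (%x. f (g x))" by (simp add: lin_def)

lemma lin_pow: "lin f ==> lin (f ^^ k)" by (induction k) (auto simp: lin_def)

lemma lin_foldr: "(\<And>x. x \<in> set ws ==> lin (X x)) ==> lin (foldr X ws)"
 by (induction ws) (auto simp: lin_def)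

lemma lin_span_into:
 assumes f: "lin f" and S: "subspace S" and A: "\<And>x. x \<in> A ==> f x \<in> S" and x: "x \<in> span A"
 shows "f x \<in> S"
proof -
 have "subspace {x. f x \<in> S}" unfolding subspace_def
  using f S by (auto simp: lin_0 lin_add lin_scale subspace_0 subspace_add subspace_scale)
 hence "span A \<subseteq> {x. f x \<in> S}" using A by (intro span_minimal) auto
 with x show ?thesis by auto
qed

lemma subspace_cong_mem:
 assumes "subspace S" "x - y \<in> S" shows "x \<in> S \<longleftrightarrow> y \<in> S"
proof
 assume "x \<in> S"
 from subspace_diff[OF assms(1) this assms(2)] show "y \<in> S" by simp
next
 assume "y \<in> S"
 from subspace_add[OF assms(1) this assms(2)] show "x \<in> S" by simp
qed

lemma subspace_scale_cancel:
 assumes "subspace S" "scale c x \<in> S" "c \<noteq> 0" shows "x \<in> S"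
 using subspace_scale[OF assms(1,2), of "inverse c"] assms(3) by simp

lemma subspace_diff_trans:
 assumes "subspace S" "x - y \<in> S" "y - z \<in> S" shows "x - z \<in> S"
 using subspace_add[OF assms] by simp

text \<open>Any permutation is a product of adjacent transpositions. The swap hypothesis is
  restricted to words with the multiset of \<open>ws\<close>, a property shared by all intermediate
  words.\<close>

lemma foldr_permute_mod:
 assumes S: "subspace S" and lin: "\<And>x. x \<in> set ws ==> lin (X x)"
  and swap: "\<And>us x y vs. mset (us @ x # y # vs) = mset ws ==>
   foldr X us (X x (X y (foldr X vs w)) - X y (X x (foldr X vs w))) \<in> S"
  and perm: "mset ws = mset ws'"
 shows "foldr X ws w - foldr X ws' w \<in> S"
proof -
 have lin': "lin (foldr X us)" if "set us \<subseteq> set ws" for us using lin that by (intro lin_foldr) auto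
 have swap': "foldr X (us @ x # y # vs) w - foldr X (us @ y # x # vs) w \<in> S"
  if "mset (us @ x # y # vs) = mset ws" for us x y vs
 proof -
  have "set ws = set (us @ x # y # vs)" using mset_eq_setD[OF that] by simp
  hence "set us \<subseteq> set ws" by auto
  thus ?thesis using swap[OF that] by (simp add: lin_diff[OF lin'])
 qed
 have move: "foldr X (pre @ x # ys1 @ ys2) w - foldr X (pre @ ys1 @ x # ys2) w \<in> S"
  if "mset (pre @ x # ys1 @ ys2) = mset ws" for pre x ys1 ys2
  using that
 proof (induction ys1 arbitrary: pre)
  case (Cons y ys1)
  have 1: "foldr X (pre @ x # y # ys1 @ ys2) w - foldr X (pre @ y # x # ys1 @ ys2) w \<in> S"
   using Cons.prems by (intro swap') simp
  have 2: "foldr X ((pre @ [y]) @ x # ys1 @ ys2) w - foldr X ((pre @ [y]) @ ys1 @ x # ys2) w \<in> S"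
   using Cons.prems by (intro Cons.IH) (simp add: add_mset_commute)
  show ?case using subspace_diff_trans[OF S 1] 2 by simp
 qed (use subspace_0[OF S] in simp)
 have "foldr X (pre @ xs) w - foldr X (pre @ ys) w \<in> S"
  if "mset (pre @ xs) = mset ws" "mset xs = mset ys" for pre xs ys
  using that
 proof (induction xs arbitrary: pre ys)
  case (Cons x xs)
  hence "x \<in> set ys" using mset_eq_setD[of "x # xs" ys] by auto
  then obtain ys1 ys2 where ys: "ys = ys1 @ x # ys2" by (meson split_list)
  with Cons.prems have m: "mset xs = mset (ys1 @ ys2)" by simp
  have 1: "foldr X ((pre @ [x]) @ xs) w - foldr X ((pre @ [x]) @ ys1 @ ys2) w \<in> S"
   using Cons.prems(1) m by (intro Cons.IH) simp_all
  have 2: "foldr X (pre @ x # ys1 @ ys2) w - foldr X (pre @ ys1 @ x # ys2) w \<in> S"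
   using Cons.prems(1) m by (intro move) simp
  show ?case using subspace_diff_trans[OF S _ 2] 1 ys by simp
 qed (use subspace_0[OF S] in simp)
 from this[of "[]" ws ws'] perm show ?thesis by simp
qed

text \<open>The spanning half of the Poincare--Birkhoff--Witt theorem, compatible with the filtration
 given by \<open>deg\<close>.\<close>

lemma pbw_spanning:
 fixes rank :: "'l => nat" and deg :: "'l => nat"
 assumes lin: "\<And>x. x \<in> A ==> lin (X x)" and comm: "\<And>x y u. x \<in> A ==> y \<in> A ==>
   X x (X y u) - X y (X x u) \<in> span {X z u | z. z \<in> A \<and> deg z \<le> deg x + deg y}"
  and ws: "set ws \<subseteq> A"
 shows "foldr X ws w \<in> span {foldr X vs w | vs. set vs \<subseteq> A \<and> sorted (map rank vs) \<and>
  sum_list (map deg vs) \<le> sum_list (map deg ws)}"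
 using ws
proof (induction "length ws" arbitrary: ws rule: less_induct)
 case less
 define S where "S d = span {foldr X vs w | vs. set vs \<subseteq> A \<and> sorted (map rank vs) \<and>
  sum_list (map deg vs) \<le> d}" for d
 have mono: "S d \<subseteq> S d'" if "d \<le> d'" for d d'
  unfolding S_def using that by (intro span_mono) (auto intro: order_trans)
 let ?d = "sum_list (map deg ws)"
 have S: "subspace (S ?d)" by (simp add: S_def)
 \<comment> \<open>Each swap made while sorting costs words that are one letter shorter, which the
   induction on the length covers; their degree does not grow, since the new letter has at most the
   degree of the two letters it replaces.\<close>
 have "foldr X ws w - foldr X (sort_key rank ws) w \<in> S ?d"
 proof (rule foldr_permute_mod[OF S])
  fix us x y vs assume m: "mset (us @ x # y # vs) = mset ws"
  have set: "set ws = set (us @ x # y # vs)" using mset_eq_setD[OF m] by simp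
  have len: "length ws = length (us @ x # y # vs)" using mset_eq_length[OF m] by simp
  have "mset (map deg ws) = mset (map deg (us @ x # y # vs))"
   using arg_cong[OF m, of "image_mset deg"] by (simp only: mset_map)
  hence d: "?d = sum_list (map deg (us @ x # y # vs))" by (metis sum_mset_sum_list)
  let ?u = "foldr X vs w"
  have c: "X x (X y ?u) - X y (X x ?u) \<in> span {X z ?u | z. z \<in> A \<and> deg z \<le> deg x + deg y}"
   using less.prems set by (intro comm) auto
  show "foldr X us (X x (X y ?u) - X y (X x ?u)) \<in> S ?d"
  proof (rule lin_span_into[OF _ S _ c])
   show "lin (foldr X us)" using less.prems set lin by (intro lin_foldr) auto
   fix t assume "t \<in> {X z ?u | z. z \<in> A \<and> deg z \<le> deg x + deg y}"
   then obtain z where z: "t = X z ?u" "z \<in> A" "deg z \<le> deg x + deg y" by auto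
   have "foldr X (us @ z # vs) w \<in> S (sum_list (map deg (us @ z # vs)))"
    unfolding S_def using less.prems set len z by (intro less.hyps) auto
   moreover have "sum_list (map deg (us @ z # vs)) \<le> ?d" using d z by simp
   ultimately show "foldr X us t \<in> S ?d" using z mono by auto
  qed
 qed (use less.prems lin in auto)
 moreover have "foldr X (sort_key rank ws) w \<in> S ?d"
 proof -
  have "mset (map deg (sort_key rank ws)) = mset (map deg ws)" by simp
  hence "sum_list (map deg (sort_key rank ws)) = ?d" by (metis sum_mset_sum_list)
  thus ?thesis unfolding S_def using less.prems
   by (intro span_base CollectI exI[of _ "sort_key rank ws"]) auto
 qed
 ultimately have "foldr X ws w \<in> S ?d" using subspace_cong_mem[OF S] by blast
 thus ?case by (simp add: S_def)
qed

end

text \<open>A sorted word over letters of pairwise different rank is determined by its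
  multiplicities. This turns the sorted words of the spanning lemma into monomials with an exponent
  function.\<close>

lemma sorted_eq_concat_replicate:
 fixes rank :: "'l => nat"
 assumes "sorted (map rank ws)" "set ws \<subseteq> set rs" "sorted_wrt (%x y. rank x < rank y) rs"
 shows "ws = concat (map (%r. replicate (count_list ws r) r) rs)"
 using assms
proof (induction rs arbitrary: ws)
 case (Cons r rs)
 define k where "k = length (takeWhile (%x. x = r) ws)"
 define vs where "vs = dropWhile (%x. x = r) ws"
 have tw: "takeWhile (%x. x = r) ws = replicate k r"
  unfolding k_def by (rule replicate_eqI) (auto dest: set_takeWhileD)
 have ws: "ws = replicate k r @ vs" by (simp only: vs_def tw[symmetric] takeWhile_dropWhile_id)
 have notin: "r \<notin> set vs"
 proof
  assume r: "r \<in> set vs"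
  then obtain y ys where vs: "vs = y # ys" by (cases vs) auto
  have "y \<noteq> r" using hd_dropWhile[of "%x. x = r" ws] vs unfolding vs_def by auto
  moreover have "y \<in> set (r # rs)" using Cons.prems(2) ws vs by auto
  ultimately have "rank r < rank y" using Cons.prems(3) by auto
  moreover have "rank y \<le> rank r" using Cons.prems(1) r vs ws \<open>y \<noteq> r\<close> by (auto simp: sorted_append)
  ultimately show False by simp
 qed
 have rep: "count_list (replicate j y) x = (if x = y then j else 0)" for j and x y :: 'l
  by (induction j) auto
 have cnt: "count_list ws r = k" using notin ws by (simp add: count_notin rep)
 have cnt': "count_list ws x = count_list vs x" if "x \<in> set rs" for x
 proof -
  have "x \<noteq> r" using Cons.prems(3) that by auto
  thus ?thesis using ws by (simp add: rep)
 qed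
 have IH: "concat (map (%r. replicate (count_list vs r) r) rs) = vs"
  using Cons.prems ws notin by (intro Cons.IH[symmetric]) (auto simp: sorted_append)
 have eq: "map (%x. replicate (count_list ws x) x) rs = map (%x. replicate (count_list vs x) x) rs"
  using cnt' by simp
 show ?case unfolding list.map concat.simps eq IH cnt by (rule ws)
qed simp

section \<open>Comparison of exponents\<close>

definition lexless :: "'r list => ('r => nat) => ('r => nat) => bool" where
 "lexless b q p \<longleftrightarrow> (map q b, map p b) \<in> lex less_than"

definition block_less :: "'r list => ('r => nat) => ('r => nat) => bool" where
 "block_less b q p \<longleftrightarrow> (map q b, map p b) \<in> deglex"

definition blocks_less :: "'r list list => ('r => nat) => ('r => nat) => bool" where
 "blocks_less bs q p \<longleftrightarrow> (map (map q) bs, map (map p) bs) \<in> lex deglex"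

definition agree :: "'r set => ('r => nat) => ('r => nat) => bool" where
 "agree R q p \<longleftrightarrow> (\<forall>r\<in>R. q r = p r)"

lemma lexless_simps [simp]: "\<not> lexless [] q p"
 "lexless (r # b) q p \<longleftrightarrow> q r < p r \<or> q r = p r \<and> lexless b q p"
 by (auto simp: lexless_def)

lemma block_less_alt: "block_less b q p \<longleftrightarrow> sum_list (map q b) < sum_list (map p b) \<or>
   sum_list (map q b) = sum_list (map p b) \<and> lexless b q p"
 by (simp add: block_less_def deglex_def lexless_def)

lemma blocks_less_simps [simp]: "\<not> blocks_less [] q p"
 "blocks_less (b # bs) q p \<longleftrightarrow> block_less b q p \<or> agree (set b) q p \<and> blocks_less bs q p"
 by (auto simp: blocks_less_def block_less_def agree_def)

lemma agree_Un: "agree (A \<union> B) q p \<longleftrightarrow> agree A q p \<and> agree B q p" by (auto simp: agree_def)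

lemma agree_sum_list: "agree (set b) q p ==> sum_list (map q b) = sum_list (map p b)"
 unfolding agree_def by (induction b) auto

lemma agree_map: "agree (set b) q p \<longleftrightarrow> map q b = map p b" by (simp add: agree_def)

lemma lexless_irrefl: "\<not> lexless b q q" by (induction b) auto

lemma lexless_total: "lexless b q p \<or> agree (set b) q p \<or> lexless b p q"
 by (induction b) (auto simp: agree_def)

lemma lexless_trans: "lexless b q p ==> lexless b p r ==> lexless b q r" by (induction b) auto

lemma block_less_irrefl: "\<not> block_less b q q" by (simp add: block_less_alt lexless_irrefl)

lemma block_less_total: "block_less b q p \<or> agree (set b) q p \<or> block_less b p q"
 using lexless_total[of b q p] unfolding block_less_alt by auto

lemma block_less_trans: "block_less b q p ==> block_less b p r ==> block_less b q r"
 using lexless_trans[of b q p r] unfolding block_less_alt by auto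

lemma block_less_cong:
 "agree (set b) q q' ==> agree (set b) p p' ==> block_less b q p = block_less b q' p'"
 unfolding block_less_def by (simp only: agree_map)

lemma wf_deglex: "wf deglex"
proof -
 have "deglex = inv_image (less_than <*lex*> lex less_than) (%xs. (sum_list xs, xs))"
  by (auto simp: deglex_def)
 moreover have "wf (inv_image (less_than <*lex*> lex less_than) (%xs::nat list. (sum_list xs, xs)))"
  by (intro wf_inv_image wf_lex_prod wf_lex wf_less_than)
 ultimately show ?thesis by simp
qed

lemma wf_block_less: "wf {(q, p). block_less b q p}"
proof -
 have "{(q, p). block_less b q p} = inv_image deglex (%q. map q b)" by (auto simp: block_less_def)
 thus ?thesis by (simp add: wf_deglex)
qed

lemma blocks_less_irrefl: "\<not> blocks_less bs q q" by (induction bs) (auto simp: block_less_irrefl)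

lemma blocks_less_total: "blocks_less bs q p \<or> agree (set (concat bs)) q p \<or> blocks_less bs p q"
proof (induction bs)
 case (Cons b bs)
 thus ?case using block_less_total[of b q p] by (auto simp: agree_def)
qed (simp add: agree_def)

lemma blocks_less_trans: "blocks_less bs q p ==> blocks_less bs p r ==> blocks_less bs q r"
proof (induction bs)
 case (Cons b bs)
 have "block_less b q r" if "block_less b q p \<or> agree (set b) q p" "block_less b p r"
  using that block_less_trans block_less_cong[of b q p r r] by (auto simp: agree_def)
 moreover have "block_less b q r" if "block_less b q p" "agree (set b) p r"
  using that block_less_cong[of b q q p r] by (auto simp: agree_def)
 ultimately show ?case using Cons by (auto simp: agree_def)
qed simp

section \<open>Compatibility of the comparison with addition of exponents\<close>

lemma lexless_add: "lexless b p q ==> lexless b p' q' \<or> agree (set b) p' q' ==>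
  lexless b (%r. p r + p' r) (%r. q r + q' r)"
 by (induction b) (auto simp: agree_def)

lemma block_less_add: "block_less b p q ==> block_less b p' q' \<or> agree (set b) p' q' ==>
  block_less b (%r. p r + p' r) (%r. q r + q' r)"
 using lexless_add[of b p q p' q'] agree_sum_list[of b p' q']
 unfolding block_less_alt by (auto simp: sum_list_addf)

lemma blocks_less_add: "blocks_less bs p q ==> blocks_less bs p' q' \<or> agree (set (concat bs)) p' q' ==>
  blocks_less bs (%r. p r + p' r) (%r. q r + q' r)"
proof (induction bs)
 case (Cons b bs)
 have 1: "block_less b (%r. p r + p' r) (%r. q r + q' r)" if "block_less b p q"
  using that Cons.prems(2) by (intro block_less_add) (auto simp: agree_def)
 have 2: "block_less b (%r. p r + p' r) (%r. q r + q' r)"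
  if "agree (set b) p q" "block_less b p' q'"
  using block_less_add[of b p' q' p q] that by (simp add: add.commute)
 show ?case using Cons 1 2 by (auto simp: agree_def)
qed simp

lemma blocks_less_cong: "agree (set (concat bs)) q q' ==> blocks_less bs q p = blocks_less bs q' p"
proof (induction bs)
 case (Cons b bs)
 hence "agree (set b) q q'" by (simp add: agree_Un)
 hence "block_less b q p = block_less b q' p" "agree (set b) q p = agree (set b) q' p"
  using block_less_cong[of b q q' p p] by (auto simp: agree_def)
 thus ?case using Cons by (simp add: agree_Un)
qed simp

text \<open>Addition is strictly monotone and the order is total: if neither summand of
  \<open>q\<close> were smaller and not both agreed with those of \<open>p1 + p2\<close>, then
  \<open>p1 + p2\<close> would be below \<open>q\<close>. This is why leading terms multiply in
  tensor products.\<close>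

lemma blocks_less_split:
 assumes "\<not> blocks_less bs (%r. p1 r + p2 r) q" "agree (set (concat bs)) q (%r. q1 r + q2 r)"
 shows "blocks_less bs q1 p1 \<or> blocks_less bs q2 p2 \<or>
  agree (set (concat bs)) q1 p1 \<and> agree (set (concat bs)) q2 p2"
proof (rule ccontr)
 assume neg: "\<not> ?thesis"
 have cong: "blocks_less bs p q" if "blocks_less bs p q'" "agree (set (concat bs)) q q'" for p q q'
  using that by (induction bs) (auto simp: agree_def cong: block_less_cong
   intro: block_less_cong[THEN iffD1, rotated -1])
 note t = blocks_less_total[of bs q1 p1] blocks_less_total[of bs q2 p2]
 have sw: "blocks_less bs (%r. p1 r + p2 r) (%r. q1 r + q2 r)"
  if "blocks_less bs p2 q2" "blocks_less bs p1 q1 \<or> agree (set (concat bs)) p1 q1"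
  using blocks_less_add[OF that] by (simp add: add.commute)
 have sym: "agree A p q ==> agree A q p" for A p and q :: "'a => nat" by (auto simp: agree_def)
 have "blocks_less bs (%r. p1 r + p2 r) (%r. q1 r + q2 r)"
  using neg t sw blocks_less_add[of bs p1 q1 p2 q2] sym by blast
 thus False using assms cong by blast
qed

section \<open>Actions of orthogonal Lie algebras\<close>

declare split_paired_Ex [simp del] split_paired_All [simp del]

fun letter :: "root => int \<times> int" where
 "letter (Minus i j) = (int j, int i)"
| "letter (Plus i j) = (- int j, int i)"
| "letter (Short i) = (0, int i)"

abbreviation letters :: "root list => (root => nat) => (int \<times> int) list" where
 "letters rs q \<equiv> concat (map (%r. replicate (q r) (letter r)) rs)"

definition mirror :: "int \<times> int => int \<times> int" where
 "mirror x = (- snd x, - fst x)"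

text \<open>By decreasing height the indices are ordered as
  \<open>1, ..., n, 0, -n, ..., -1\<close>. The function is odd, so a letter and its mirror have the
  same height difference.\<close>

definition height :: "nat => int => int" where
 "height n a = sgn a * (int n + 1 - \<bar>a\<bar>)"

definition raising :: "nat => int \<times> int => bool" where
 "raising n x \<longleftrightarrow> height n (fst x) > height n (snd x)"

text \<open>The letters \<open>x\<close> and \<open>mirror x\<close> give the same operator up to
  sign; this selects one of the two for each negative root, namely the one produced by
  \<open>letter\<close>.\<close>

definition normal_lowering :: "int \<times> int => bool" where
 "normal_lowering x \<longleftrightarrow> snd x > 0 \<and> (fst x = 0 \<or> \<bar>fst x\<bar> > snd x)"

definition letter_range :: "nat => (int \<times> int) set" where
 "letter_range n = {(a, b). \<bar>a\<bar> \<le> int n \<and> \<bar>b\<bar> \<le> int n}"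

text \<open>Encodes the numeration of the positive roots: \<open>Minus _ m\<close> has first index
  \<open>m\<close>, \<open>Plus _ m\<close> has first index \<open>- m\<close> and comes directly
  after it, and \<open>Short _\<close> has first index 0 and comes last.\<close>

definition column_rank :: "nat => int => nat" where
 "column_rank n a = (if a = 0 then 2 * n + 2 else if a > 0 then 2 * nat a else 2 * nat (- a) + 1)"

text \<open>Diagonal letters, and after them all remaining ones, are ranked beyond every normal
  lowering letter. In a sorted word the raising letters therefore stand on the right and act
  first.\<close>

definition letter_rank :: "nat => int \<times> int => nat" where
 "letter_rank n x = (if normal_lowering x then column_rank n (fst x) * (n + 1) + nat (snd x)
   else if fst x = snd x then (2 * n + 3) * (n + 1) else (2 * n + 3) * (n + 1) + 1)"

text \<open>The four clauses are the four terms of \<open>so_bracket\<close>. The alternative in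
  each clause is the case in which the resulting letter is antidiagonal, so that its operator
  vanishes.\<close>

definition bracket_in :: "(int \<times> int) set => (int \<times> int) set => (int \<times> int) set => bool" where
 "bracket_in S T R \<longleftrightarrow> (\<forall>a b c d. (a, b) \<in> S --> (c, d) \<in> T -->
   (b = c --> a + d = 0 \<or> (a, d) \<in> R) \<and> (a = d --> b + c = 0 \<or> (c, b) \<in> R) \<and>
   (c = - a --> b = d \<or> (- b, d) \<in> R) \<and> (d = - b --> a = c \<or> (c, - a) \<in> R))"

lemma letter_range_iff: "x \<in> letter_range n \<longleftrightarrow> \<bar>fst x\<bar> \<le> int n \<and> \<bar>snd x\<bar> \<le> int n"
 by (cases x) (simp add: letter_range_def)

lemma letter_cases:
 assumes "x \<in> letter_range n"
 shows "normal_lowering x \<or> fst x = snd x \<or> raising n x \<or> normal_lowering (mirror x) \<or>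
  fst x + snd x = 0"
proof -
 obtain a b where [simp]: "x = (a, b)" by (cases x)
 show ?thesis using assms by (cases "a > 0"; cases "b > 0"; cases "a = 0"; cases "b = 0")
   (auto simp: letter_range_def normal_lowering_def raising_def height_def mirror_def sgn_if)
qed

lemma letter_rank_normal:
 assumes "x \<in> letter_range n" "normal_lowering x"
 shows "letter_rank n x < (2 * n + 3) * (n + 1)"
proof -
 have "column_rank n (fst x) \<le> 2 * n + 2"
  using assms(1) by (auto simp: column_rank_def letter_range_iff)
 hence "column_rank n (fst x) * (n + 1) \<le> (2 * n + 2) * (n + 1)" by (rule mult_le_mono1)
 moreover have "nat (snd x) \<le> n" using assms(1) by (auto simp: letter_range_iff nat_le_iff)
 moreover have "(2 * n + 3) * (n + 1) = (2 * n + 2) * (n + 1) + (n + 1)"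
  by (simp add: algebra_simps)
 ultimately show ?thesis using assms(2) unfolding letter_rank_def by simp
qed

abbreviation so_bracket :: "(int => int => 'v => 'v::ab_group_add) => int => int => int => int => 'v => 'v" where
 "so_bracket G a b c d u \<equiv> (if b = c then G a d u else 0) - (if a = d then G c b u else 0)
   - (if c = - a then G (- b) d u else 0) + (if d = - b then G c (- a) u else 0)"

locale so_rep = complex_space scale for scale :: "complex => 'v::ab_group_add => 'v" +
 fixes n :: nat and F :: "int => int => 'v => 'v"
 assumes F_lin: "\<bar>a\<bar> \<le> int n ==> \<bar>b\<bar> \<le> int n ==> lin (F a b)"
  and F_mirror: "\<bar>a\<bar> \<le> int n ==> \<bar>b\<bar> \<le> int n ==> F (- b) (- a) u = - F a b u"
  and F_comm: "\<bar>a\<bar> \<le> int n ==> \<bar>b\<bar> \<le> int n ==> \<bar>c\<bar> \<le> int n ==> \<bar>d\<bar> \<le> int n ==>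
   F a b (F c d u) - F c d (F a b u) = so_bracket F a b c d u"
begin

definition X :: "int \<times> int => 'v => 'v" where
 "X x = F (fst x) (snd x)"

definition mono :: "root list => (root => nat) => 'v => 'v" where
 "mono rs p w = foldr (%\<alpha> u. (X (letter \<alpha>) ^^ p \<alpha>) u) rs w"

lemma X_pair [simp]: "X (a, b) = F a b" by (simp add: X_def)

lemma X_lin: "x \<in> letter_range n ==> lin (X x)" by (simp add: X_def F_lin letter_range_iff)

lemma X_mirror: "x \<in> letter_range n ==> X (mirror x) u = - X x u"
 by (simp add: X_def F_mirror letter_range_iff mirror_def)

lemma F_antidiag:
 assumes "\<bar>a\<bar> \<le> int n" shows "F a (- a) u = 0"
proof -
 have "F a (- a) u = - F a (- a) u" using F_mirror[of a "- a" u] assms by simp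
 hence "scale 2 (F a (- a) u) = 0"
  by (metis add.right_inverse one_add_one scale_left_distrib scale_one)
 thus ?thesis by simp
qed

lemma X_antidiag: "x \<in> letter_range n ==> fst x + snd x = 0 ==> X x u = 0"
 using F_antidiag[of "fst x" u] by (simp add: X_def letter_range_iff add_eq_0_iff)

lemma bracket_in_span:
 assumes "bracket_in S T R" "x \<in> S" "y \<in> T" "S \<subseteq> letter_range n" "T \<subseteq> letter_range n"
 shows "X x (X y u) - X y (X x u) \<in> span {X z u | z. z \<in> R}"
proof -
 obtain a b c d where xy [simp]: "x = (a, b)" "y = (c, d)" by (metis surj_pair)
 have r: "\<bar>a\<bar> \<le> int n" "\<bar>b\<bar> \<le> int n" "\<bar>c\<bar> \<le> int n" "\<bar>d\<bar> \<le> int n"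
  using assms(2-5) by (auto simp: letter_range_def)
 let ?S = "span {X z u | z. z \<in> R}"
 have mem: "F a' b' u \<in> ?S" if "a' + b' = 0 \<or> (a', b') \<in> R" "\<bar>a'\<bar> \<le> int n" for a' b' using that(1)
 proof
  assume "a' + b' = 0"
  hence "b' = - a'" by simp
  thus ?thesis using F_antidiag[OF that(2), of u] by (simp add: span_zero)
 next
  assume "(a', b') \<in> R"
  thus ?thesis by (intro span_base) (auto intro!: exI[of _ "(a', b')"])
 qed
 have B: "b = c --> a + d = 0 \<or> (a, d) \<in> R" "a = d --> c + b = 0 \<or> (c, b) \<in> R"
  "c = - a --> - b + d = 0 \<or> (- b, d) \<in> R" "d = - b --> c + - a = 0 \<or> (c, - a) \<in> R"
  using assms(1-3) unfolding bracket_in_def by (auto simp: add.commute)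
 have 1: "(if b = c then F a d u else 0) \<in> ?S" using mem[of a d] r B by (auto simp: span_zero)
 have 2: "(if a = d then F c b u else 0) \<in> ?S" using mem[of c b] r B by (auto simp: span_zero)
 have 3: "(if c = - a then F (- b) d u else 0) \<in> ?S"
  using mem[of "- b" d] r B by (auto simp: span_zero)
 have 4: "(if d = - b then F c (- a) u else 0) \<in> ?S"
  using mem[of c "- a"] r B by (auto simp: span_zero)
 show ?thesis unfolding xy X_pair F_comm[OF r] by (intro span_add span_diff 1 2 3 4)
qed

lemma word_lin: "set ws \<subseteq> letter_range n ==> lin (foldr X ws)" by (intro lin_foldr X_lin) auto

lemma mono_eq_word: "mono rs p w = foldr X (letters rs p) w"
proof -
 have "foldr X (replicate k x) u = (X x ^^ k) u" for k x u by (induction k) auto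
 thus ?thesis unfolding mono_def by (induction rs) auto
qed

lemma mono_append: "mono (rs @ rs') p w = mono rs p (mono rs' p w)" by (simp add: mono_def)

lemma mono_Nil [simp]: "mono [] p w = w" by (simp add: mono_def)

lemma mono_Cons [simp]: "mono (r # rs) p w = (X (letter r) ^^ p r) (mono rs p w)"
 by (simp add: mono_def)

lemma mono_cong: "agree (set rs) p q ==> mono rs p w = mono rs q w"
 by (induction rs) (auto simp: agree_def)

lemma mono_zero: "(\<And>r. r \<in> set rs ==> p r = 0) ==> mono rs p w = w" by (induction rs) auto

section \<open>Highest weight vectors modulo a subspace\<close>

definition stable :: "(int \<times> int) set => 'v set => bool" where
 "stable G U \<longleftrightarrow> subspace U \<and> (\<forall>x\<in>G. \<forall>u\<in>U. X x u \<in> U)"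

text \<open>Diagonal letters with negative index are determined by \<open>F_mirror\<close>, so only
  positive ones carry a weight. The vector is allowed to lie in \<open>U\<close>; that it does not
  is always stated separately, since this is what survival means.\<close>

definition datum :: "(int \<times> int) set => 'v => 'v set => (int => real) => bool" where
 "datum G w U \<mu> \<longleftrightarrow> stable G U \<and> (\<forall>x\<in>G. raising n x --> X x w \<in> U) \<and>
   (\<forall>i>0. (i, i) \<in> G --> F i i w = scale (of_real (\<mu> i)) w)"

lemma stable_subspace: "stable G U ==> subspace U" by (simp add: stable_def)

lemma stable_X: "stable G U ==> x \<in> G ==> u \<in> U ==> X x u \<in> U" by (simp add: stable_def)

lemma stable_word: "stable G U ==> set ws \<subseteq> G ==> u \<in> U ==> foldr X ws u \<in> U"
 by (induction ws) (auto simp: stable_def)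

lemma stable_pow: "stable G U ==> x \<in> G ==> u \<in> U ==> (X x ^^ k) u \<in> U"
 by (induction k) (auto simp: stable_def)

lemma stable_mono: "stable G U ==> letter ` set rs \<subseteq> G ==> u \<in> U ==> mono rs p u \<in> U"
 by (induction rs) (auto intro: stable_pow)

lemma datum_stable: "datum G w U \<mu> ==> stable G U" by (simp add: datum_def)

lemma datum_raising: "datum G w U \<mu> ==> x \<in> G ==> raising n x ==> X x w \<in> U" unfolding datum_def by blast

lemma datum_weight: "datum G w U \<mu> ==> 0 < i ==> (i, i) \<in> G ==> F i i w = scale (of_real (\<mu> i)) w"
 unfolding datum_def by blast

lemma datum_subset: "datum G w U \<mu> ==> H \<subseteq> G ==> datum H w U \<mu>" unfolding datum_def stable_def by blast

text \<open>Because of \<open>rev\<close>, the block compared first stands rightmost in the product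
  and acts on \<open>w\<close> first. Hence the blocks can be removed one by one in the order of
  comparison.\<close>

definition ess :: "root list list => 'v => 'v set => (root => nat) => bool" where
 "ess bs w U p \<longleftrightarrow> mono (concat (rev bs)) p w \<notin>
   span (U \<union> {mono (concat (rev bs)) q w | q. blocks_less bs q p})"

definition lowering_list :: "(int \<times> int) set => root list => bool" where
 "lowering_list G rs \<longleftrightarrow> {x \<in> G. normal_lowering x} = letter ` set rs \<and>
   sorted_wrt (%r r'. letter_rank n (letter r) < letter_rank n (letter r')) rs"

text \<open>In a sorted word the raising letters send \<open>w\<close> into \<open>U\<close> and the
  diagonal ones multiply it by scalars, so only lowering monomials remain. The function
  \<open>deg\<close> is carried along because the number of column letters must be controlled
  later.\<close>

lemma datum_pbw:
 fixes deg :: "int \<times> int => nat"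
 assumes datum: "datum G w U \<mu>" and G: "G \<subseteq> letter_range n" "mirror ` G \<subseteq> G"
  and deg_mirror: "\<And>x. x \<in> G ==> deg (mirror x) = deg x"
  and comm: "\<And>x y u. x \<in> G ==> y \<in> G ==>
   X x (X y u) - X y (X x u) \<in> span {X z u | z. z \<in> G \<and> deg z \<le> deg x + deg y}"
  and rs: "lowering_list G rs"
  and ws: "set ws \<subseteq> G"
 shows "foldr X ws w \<in> span (U \<union> {mono rs q w | q.
  sum_list (map (%r. q r * deg (letter r)) rs) \<le> sum_list (map deg ws)})"
proof -
 define A where "A = {x \<in> G. normal_lowering x \<or> fst x = snd x \<or> raising n x}"
 have AG: "A \<subseteq> G" by (auto simp: A_def)
 have U: "subspace U" using datum by (simp add: datum_def stable_def)
 \<comment> \<open>A letter outside \<open>A\<close> is either the mirror of one in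
   \<open>A\<close>, at the cost of a sign, or antidiagonal; in the latter case the scalar is 0 and
   \<open>z\<close> is arbitrary.\<close>
 have to_A: "\<exists>c z. (c \<noteq> 0 --> z \<in> A \<and> deg z = deg x) \<and> (\<forall>u. X x u = scale c (X z u))" if x: "x \<in> G" for x
 proof -
  have xr: "x \<in> letter_range n" using x G by auto
  have mx: "mirror x \<in> G" using x G(2) by blast
  consider "x \<in> A" | "mirror x \<in> A" | "fst x + snd x = 0"
   using letter_cases[OF xr] x mx unfolding A_def by blast
  thus ?thesis
  proof cases
   case 1
   thus ?thesis by (intro exI[of _ 1] exI[of _ x]) simp
  next
   case 2
   thus ?thesis using X_mirror[OF xr] deg_mirror[OF x] by (intro exI[of _ "- 1"] exI[of _ "mirror x"]) simp
  qed (use X_antidiag[OF xr] in \<open>auto intro!: exI[of _ 0]\<close>)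
 qed
 define S where "S d = span (U \<union> {mono rs q w | q.
  sum_list (map (%r. q r * deg (letter r)) rs) \<le> d})" for d
 have S: "subspace (S d)" for d by (simp add: S_def)
 have Smono: "S d \<subseteq> S d'" if "d \<le> d'" for d d'
  unfolding S_def using that by (intro span_mono) (auto intro: order_trans)
 have comm_A: "X x (X y u) - X y (X x u) \<in> span {X z u | z. z \<in> A \<and> deg z \<le> deg x + deg y}"
  if "x \<in> A" "y \<in> A" for x y u
 proof -
  have "span {X z u | z. z \<in> G \<and> deg z \<le> deg x + deg y}
    \<subseteq> span {X z u | z. z \<in> A \<and> deg z \<le> deg x + deg y}" (is "_ \<subseteq> ?T")
  proof (intro span_minimal subsetI)
   fix t assume "t \<in> {X z u | z. z \<in> G \<and> deg z \<le> deg x + deg y}"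
   then obtain z where z: "t = X z u" "z \<in> G" "deg z \<le> deg x + deg y" by auto
   obtain c z' where z': "c \<noteq> 0 --> z' \<in> A \<and> deg z' = deg z" "X z u = scale c (X z' u)" using to_A[OF z(2)] by blast
   hence "c \<noteq> 0 ==> X z' u \<in> ?T" using z(3) by (intro span_base) auto
   thus "t \<in> ?T" unfolding z(1) z'(2) by (cases "c = 0") (auto intro: span_scale span_zero)
  qed simp
  with comm[of x y u] that AG show ?thesis by auto
 qed
 have sorted_case: "foldr X vs w \<in> S (sum_list (map deg vs))"
  if "set vs \<subseteq> A" "sorted (map (letter_rank n) vs)" for vs
  using that
 proof (induction vs rule: rev_induct)
  case Nil
  have "w = mono rs (%_. 0) w" by (simp add: mono_zero)
  thus ?case unfolding S_def by (intro span_base) (auto intro!: exI[of _ "%_. 0"])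
 next
  case (snoc x vs)
  hence vsA: "set vs \<subseteq> A" and sv: "sorted (map (letter_rank n) vs)"
   and xA: "x \<in> A" by (auto simp: sorted_append)
  have xr: "x \<in> letter_range n" using xA AG G by auto
  have IH: "foldr X vs w \<in> S (sum_list (map deg vs))" using snoc vsA sv by blast
  consider "normal_lowering x" | "\<not> normal_lowering x" "fst x = snd x" | "raising n x"
   using xA by (auto simp: A_def)
  thus ?case
  proof cases
   case 1
   have nl: "normal_lowering y" if "y \<in> set (vs @ [x])" for y
   proof (rule ccontr)
    assume "\<not> normal_lowering y"
    hence "letter_rank n y \<ge> (2 * n + 3) * (n + 1)" by (simp add: letter_rank_def)
    moreover have "letter_rank n y \<le> letter_rank n x"
     using snoc.prems that by (auto simp: sorted_append)
    ultimately show False using letter_rank_normal[OF xr 1] by simp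
   qed
   have sub: "set (vs @ [x]) \<subseteq> set (map letter rs)"
   proof
    fix y assume y: "y \<in> set (vs @ [x])"
    hence "y \<in> {x \<in> G. normal_lowering x}" using nl[OF y] snoc.prems(1) AG by blast
    thus "y \<in> set (map letter rs)" using rs unfolding lowering_list_def by simp
   qed
   have srt: "sorted_wrt (%x y. letter_rank n x < letter_rank n y) (map letter rs)"
    using rs by (simp add: lowering_list_def sorted_wrt_map)
   define q where "q r = count_list (vs @ [x]) (letter r)" for r
   have eq: "vs @ [x] = letters rs q" using sorted_eq_concat_replicate[OF snoc.prems(2) sub srt]
    unfolding q_def by (simp only: map_map comp_def)
   have "sum_list (map deg (letters rs q)) = sum_list (map (%r. q r * deg (letter r)) rs)" for rs
    by (induction rs) (auto simp: sum_list_replicate)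
   hence "sum_list (map deg (vs @ [x])) = sum_list (map (%r. q r * deg (letter r)) rs)"
    using eq by simp
   moreover have "foldr X (vs @ [x]) w = mono rs q w" using eq by (simp add: mono_eq_word)
   ultimately show ?thesis unfolding S_def by (intro span_base) auto
  next
   case 2
   obtain i where i: "x = (i, i)" using 2 by (cases x) auto
   have "\<exists>c. X x w = scale c w"
   proof (cases "i > 0")
    case True
    thus ?thesis using datum xA AG i unfolding datum_def by auto
   next
    case False
    show ?thesis
    proof (cases "i = 0")
     case True
     hence "X x w = 0" using X_antidiag[OF xr] i by simp
     thus ?thesis by (metis scale_zero_left)
    next
     case neg: False
     have "(- i, - i) \<in> G" using xA AG G(2) i by (force simp: mirror_def image_iff)
     hence "F (- i) (- i) w = scale (of_real (\<mu> (- i))) w"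
      using datum False neg unfolding datum_def by auto
     moreover have "F (- i) (- i) w = - F i i w" using F_mirror[of i i w] xr i
      by (simp add: letter_range_def)
     ultimately have "F i i w = scale (- of_real (\<mu> (- i))) w"
      by (metis minus_minus scale_minus_left)
     hence "X x w = scale (- of_real (\<mu> (- i))) w" using i by simp
     thus ?thesis by blast
    qed
   qed
   then obtain c where "X x w = scale c w" by blast
   hence "foldr X (vs @ [x]) w = scale c (foldr X vs w)"
    using word_lin[of vs] vsA AG G by (auto simp: lin_scale)
   hence "foldr X (vs @ [x]) w \<in> S (sum_list (map deg vs))" using IH S by (simp add: subspace_scale)
   thus ?thesis using Smono[of "sum_list (map deg vs)" "sum_list (map deg (vs @ [x]))"] by auto
  next
   case 3
   have "X x w \<in> U" using datum xA AG 3 by (auto simp: datum_def)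
   hence "foldr X (vs @ [x]) w \<in> U" using datum vsA AG by (auto simp: datum_def intro!: stable_word)
   thus ?thesis unfolding S_def by (intro span_base) auto
  qed
 qed
 have "\<exists>c vs. set vs \<subseteq> A \<and> (c \<noteq> 0 --> sum_list (map deg vs) = sum_list (map deg ws)) \<and>
   foldr X ws w = scale c (foldr X vs w)"
  using ws
 proof (induction ws)
  case Nil
  show ?case by (intro exI[of _ 1] exI[of _ "[]"]) simp
 next
  case (Cons x ws)
  then obtain c vs where vs: "set vs \<subseteq> A" "c \<noteq> 0 --> sum_list (map deg vs) = sum_list (map deg ws)"
   "foldr X ws w = scale c (foldr X vs w)" by auto
  have x: "x \<in> G" using Cons.prems by simp
  obtain d z where z: "d \<noteq> 0 --> z \<in> A \<and> deg z = deg x" "\<And>u. X x u = scale d (X z u)" using to_A[OF x] by blast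
  have lx: "lin (X x)" using x G by (auto intro: X_lin)
  have eq: "foldr X (x # ws) w = scale (c * d) (X z (foldr X vs w))"
   by (simp only: foldr.simps comp_apply vs(3) lin_scale[OF lx] z(2)[of "foldr X vs w"] scale_scale)
  show ?case
  proof (cases "d = 0")
   case True
   thus ?thesis using eq by (intro exI[of _ 0] exI[of _ "[]"]) simp
  next
   case False
   thus ?thesis using eq vs z(1) by (intro exI[of _ "c * d"] exI[of _ "z # vs"]) simp
  qed
 qed
 then obtain c vs where vs: "set vs \<subseteq> A" "c \<noteq> 0 --> sum_list (map deg vs) = sum_list (map deg ws)"
  "foldr X ws w = scale c (foldr X vs w)" by blast
 have "foldr X vs w \<in> span {foldr X vs' w | vs'. set vs' \<subseteq> A \<and> sorted (map (letter_rank n) vs') \<and>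
   sum_list (map deg vs') \<le> sum_list (map deg vs)}"
  using AG G vs(1) by (intro pbw_spanning comm_A) (auto intro: X_lin)
 also have "\<dots> \<subseteq> S (sum_list (map deg vs))"
  using sorted_case Smono by (intro span_minimal S) fastforce
 finally have "foldr X ws w \<in> S (sum_list (map deg ws))"
  using vs(2) subspace_0[OF S] subspace_scale[OF S] unfolding vs(3) by (cases "c = 0") auto
 thus ?thesis by (simp add: S_def)
qed

end

section \<open>Columns of lowering operators\<close>

lemma lexless_append: "agree (set b1) q p ==> q x < p x ==> lexless (b1 @ x # b2) q p"
 by (induction b1) (auto simp: agree_def)

text \<open>For \<open>c = 0\<close> and \<open>r = n\<close> this is the complement of so(2n) in
  so(2n+1). For \<open>c = - int m\<close> or \<open>c = int m\<close> and \<open>r = m - 1\<close>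
  it is one of the two abelian nilradicals of so(2m) belonging to the index
  \<open>m\<close>.\<close>

definition col_letters :: "int => nat => (int \<times> int) set" where
 "col_letters c r = {(a, b). a = c \<and> 1 \<le> \<bar>b\<bar> \<and> \<bar>b\<bar> \<le> int r \<or> b = - c \<and> 1 \<le> \<bar>a\<bar> \<and> \<bar>a\<bar> \<le> int r}"

definition sq_letters :: "nat => (int \<times> int) set" where
 "sq_letters r = {(a, b). 1 \<le> \<bar>a\<bar> \<and> \<bar>a\<bar> \<le> int r \<and> 1 \<le> \<bar>b\<bar> \<and> \<bar>b\<bar> \<le> int r \<and> a + b \<noteq> 0}"

abbreviation "all_letters n \<equiv> sq_letters n \<union> col_letters 0 n"

definition col_lowering :: "int => nat => (int \<times> int) set" where
 "col_lowering c r = {(a, b). a = c \<and> 1 \<le> b \<and> b \<le> int r}"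

definition col_raising :: "int => nat => (int \<times> int) set" where
 "col_raising c r = {(a, b). a = c \<and> 1 \<le> - b \<and> - b \<le> int r \<or> b = - c \<and> 1 \<le> a \<and> a \<le> int r}"

definition pos_raising :: "nat => int \<times> int => bool" where
 "pos_raising r y \<longleftrightarrow> 1 \<le> fst y \<and> fst y < snd y \<and> snd y \<le> int r"

section \<open>A column as the part of degree one of a filtered algebra\<close>

locale so_column = so_rep scale n F
 for scale :: "complex => 'v::ab_group_add => 'v" and n :: nat and F :: "int => int => 'v => 'v" +
 fixes L :: "(int \<times> int) set" and c :: int and r :: nat and R :: "nat => root" and K :: "root list"
 assumes L_range: "L \<subseteq> letter_range n" and c_range: "\<bar>c\<bar> \<le> int n" and r_range: "r \<le> n"
  and c_outside: "c = 0 \<or> \<bar>c\<bar> > int r"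
  and L_mirror: "mirror ` L \<subseteq> L"
  and L_disjoint: "L \<inter> col_letters c r = {}"
  and bracket_LL: "bracket_in L L L"
  and bracket_LC: "bracket_in L (col_letters c r) (L \<union> col_letters c r)"
  and bracket_CL: "bracket_in (col_letters c r) L (L \<union> col_letters c r)"
  and bracket_CC: "bracket_in (col_letters c r) (col_letters c r) L"
  and square_sub: "sq_letters r \<subseteq> L"
  and raising_cases: "\<And>y. y \<in> L ==> raising n y ==> pos_raising r y \<or> pos_raising r (mirror y) \<or>
   bracket_in (col_lowering c r) {y} (L \<union> col_raising c r)"
  and col_raising_raising: "\<And>y. y \<in> col_raising c r ==> raising n y"
  and K_list: "lowering_list L K"
  and G_list: "lowering_list (L \<union> col_letters c r) (K @ map R [1..<Suc r])"
  and letter_R: "\<And>i. 1 \<le> i ==> i \<le> r ==> letter (R i) = (c, int i)"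
begin

abbreviation C where "C \<equiv> col_letters c r"
abbreviation G where "G \<equiv> L \<union> C"

definition col :: "root list" where
 "col = map R [1..<Suc r]"

definition deg :: "int \<times> int => nat" where
 "deg x = (if x \<in> C then 1 else 0)"

definition word :: "(root => nat) => (int \<times> int) list" where
 "word p = letters col p"

text \<open>The terms of lower order for the filtration by the number of column letters. Letters of
  \<open>L\<close> have degree 0 and may occur anywhere in the words.\<close>

definition Low :: "'v => nat => 'v set" where
 "Low u d = span {foldr X vs u | vs. set vs \<subseteq> G \<and> sum_list (map deg vs) < d}"

text \<open>Every monomial in \<open>K\<close> is allowed in front of a smaller column monomial;
  this is what makes the space stable under all of \<open>L\<close>.\<close>

definition Unew :: "'v => 'v set => (root => nat) => 'v set" where
 "Unew w U p = span (U \<union> {mono K q (mono col q w) | q. block_less col q p})"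

lemma C_range: "C \<subseteq> letter_range n"
 using c_range r_range by (auto simp: col_letters_def letter_range_def)

lemma G_range: "G \<subseteq> letter_range n" using C_range L_range by simp

lemma C_mirror: "mirror ` C \<subseteq> C" by (auto simp: col_letters_def mirror_def)

lemma G_mirror: "mirror ` G \<subseteq> G" using C_mirror L_mirror by blast

lemma col_lowering_sub: "col_lowering c r \<subseteq> C" by (auto simp: col_lowering_def col_letters_def)

lemma col_raising_sub: "col_raising c r \<subseteq> C" by (auto simp: col_raising_def col_letters_def)

lemma mirror_mirror [simp]: "mirror (mirror x) = x" by (simp add: mirror_def)

lemma deg_mirror: "deg (mirror x) = deg x"
proof -
 have "mirror x \<in> C \<longleftrightarrow> x \<in> C" using C_mirror mirror_mirror by (metis image_subset_iff)
 thus ?thesis by (simp add: deg_def)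
qed

lemma deg_L: "x \<in> L ==> deg x = 0" using L_disjoint by (auto simp: deg_def)

lemma deg_C: "x \<in> C ==> deg x = 1" by (simp add: deg_def)

lemma deg_le: "deg x \<le> 1" by (simp add: deg_def)

lemma comm_deg:
 assumes "x \<in> G" "y \<in> G"
 shows "X x (X y u) - X y (X x u) \<in> span {X z u | z. z \<in> G \<and> deg z \<le> deg x + deg y}"
proof -
 have sub: "span {X z u | z. z \<in> S} \<subseteq> span {X z u | z. z \<in> G \<and> deg z \<le> deg x + deg y}"
  if "\<And>z. z \<in> S ==> z \<in> G \<and> deg z \<le> deg x + deg y" for S
  using that by (intro span_mono) blast
 consider "x \<in> L" "y \<in> L" | "x \<in> L" "y \<in> C" | "x \<in> C" "y \<in> L" | "x \<in> C" "y \<in> C" using assms by blast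
 thus ?thesis
 proof cases
  case 1
  thus ?thesis
   using bracket_in_span[OF bracket_LL, of x y u] sub[of L] L_range by (auto simp: deg_L)
 next
  case 2
  have "z \<in> G \<and> deg z \<le> deg x + deg y" if "z \<in> G" for z
   using that deg_le[of z] deg_C[OF 2(2)] by simp
  thus ?thesis using bracket_in_span[OF bracket_LC 2 L_range C_range, of u] sub[of G] by blast
 next
  case 3
  have "z \<in> G \<and> deg z \<le> deg x + deg y" if "z \<in> G" for z
   using that deg_le[of z] deg_C[OF 3(1)] by simp
  thus ?thesis using bracket_in_span[OF bracket_CL 3 C_range L_range, of u] sub[of G] by blast
 next
  case 4
  thus ?thesis
   using bracket_in_span[OF bracket_CC, of x y u] sub[of L] C_range by (auto simp: deg_L)
 qed
qed

lemma word_lin_G: "set ws \<subseteq> G ==> lin (foldr X ws)" using G_range by (intro word_lin) blast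

lemma Low_subspace: "subspace (Low u d)" by (simp add: Low_def)

lemma Low_base: "set vs \<subseteq> G ==> sum_list (map deg vs) < d ==> foldr X vs u \<in> Low u d"
 unfolding Low_def by (intro span_base) blast

lemma Low_word:
 assumes "x \<in> Low u d" "set ws \<subseteq> G"
 shows "foldr X ws x \<in> Low u (d + sum_list (map deg ws))"
proof (rule lin_span_into[OF word_lin_G[OF assms(2)] Low_subspace _ assms(1)[unfolded Low_def]])
 fix t assume "t \<in> {foldr X vs u | vs. set vs \<subseteq> G \<and> sum_list (map deg vs) < d}"
 then obtain vs where "t = foldr X vs u" "set vs \<subseteq> G" "sum_list (map deg vs) < d" by blast
 thus "foldr X ws t \<in> Low u (d + sum_list (map deg ws))"
  using Low_base[of "ws @ vs"] assms(2) by simp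
qed

lemma Low_shift: "set ws \<subseteq> G ==> Low (foldr X ws u) d \<subseteq> Low u (d + sum_list (map deg ws))"
proof -
 assume ws: "set ws \<subseteq> G"
 have "{foldr X vs (foldr X ws u) | vs. set vs \<subseteq> G \<and> sum_list (map deg vs) < d}
   \<subseteq> Low u (d + sum_list (map deg ws))"
 proof
  fix t assume "t \<in> {foldr X vs (foldr X ws u) | vs. set vs \<subseteq> G \<and> sum_list (map deg vs) < d}"
  then obtain vs where "t = foldr X (vs @ ws) u" "set vs \<subseteq> G" "sum_list (map deg vs) < d" by auto
  thus "t \<in> Low u (d + sum_list (map deg ws))" using Low_base[of "vs @ ws"] ws by simp
 qed
 thus ?thesis unfolding Low_def[of "foldr X ws u"] by (intro span_minimal Low_subspace)
qed

lemma sum_deg_C: "set ws \<subseteq> C ==> sum_list (map deg ws) = length ws"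
 by (induction ws) (auto simp: deg_C)

text \<open>The commutator of two column letters lies in \<open>L\<close>, so each swap loses two
  column letters: to leading order the column is commutative.\<close>

lemma perm_Low:
 assumes "set ws \<subseteq> C" "mset ws = mset ws'"
 shows "foldr X ws u - foldr X ws' u \<in> Low u (length ws)"
proof (rule foldr_permute_mod[OF Low_subspace _ _ assms(2)])
 show "lin (X x)" if "x \<in> set ws" for x using that assms C_range by (intro X_lin) blast
 fix us x y vs assume m: "mset (us @ x # y # vs) = mset ws"
 have s: "set (us @ x # y # vs) \<subseteq> C" using mset_eq_setD[OF m] assms(1) by simp
 have l: "length ws = length (us @ x # y # vs)" using mset_eq_length[OF m] by simp
 let ?u = "foldr X vs u"
 have "X x (X y ?u) - X y (X x ?u) \<in> span {X z ?u | z. z \<in> L}"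
  using s C_range by (intro bracket_in_span[OF bracket_CC]) auto
 thus "foldr X us (X x (X y ?u) - X y (X x ?u)) \<in> Low u (length ws)"
 proof (rule lin_span_into[OF word_lin_G Low_subspace, rotated 2])
  fix t assume "t \<in> {X z ?u | z. z \<in> L}"
  then obtain z where z: "t = X z ?u" "z \<in> L" by blast
  have "foldr X (us @ z # vs) u \<in> Low u (length ws)"
   using s z l by (intro Low_base) (auto simp: sum_deg_C deg_L)
  thus "foldr X us t \<in> Low u (length ws)" using z by simp
 qed (use s in auto)
qed

lemma pass_Low:
 assumes "set ws \<subseteq> C" "y \<in> G"
  and br: "\<And>x u. x \<in> set ws ==> X x (X y u) - X y (X x u) \<in> span {X z u | z. z \<in> L}"
 shows "foldr X ws (X y u) - X y (foldr X ws u) \<in> Low u (length ws + deg y)"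
 using assms(1) br
proof (induction ws)
 case (Cons x ws)
 let ?d = "length (x # ws) + deg y"
 have x: "x \<in> C" "x \<in> letter_range n" using Cons.prems C_range by auto
 have "foldr X ws (X y u) - X y (foldr X ws u) \<in> Low u (length ws + deg y)" using Cons by simp
 from Low_word[OF this, of "[x]"]
 have 1: "X x (foldr X ws (X y u)) - X x (X y (foldr X ws u)) \<in> Low u ?d"
  using x by (simp add: deg_C lin_diff X_lin)
 have "span {X z (foldr X ws u) | z. z \<in> L} \<subseteq> Low u ?d"
 proof (intro span_minimal Low_subspace subsetI)
  fix t assume "t \<in> {X z (foldr X ws u) | z. z \<in> L}"
  then obtain z where "t = foldr X (z # ws) u" "z \<in> L" by auto
  thus "t \<in> Low u ?d" using Low_base[of "z # ws" ?d u] Cons.prems(1) by (auto simp: sum_deg_C deg_L)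
 qed
 hence "X x (X y (foldr X ws u)) - X y (X x (foldr X ws u)) \<in> Low u ?d"
  using Cons.prems(2)[of x "foldr X ws u"] by auto
 from subspace_diff_trans[OF Low_subspace 1 this] show ?case by simp
qed (use subspace_0[OF Low_subspace] in simp)

lemma col_bracket:
 assumes "1 \<le> k" "k \<le> int r" "1 \<le> i" "i \<le> int r" "1 \<le> j" "j \<le> int r"
 shows "F c k (F i j u) - F i j (F c k u) = (if k = i then F c j u else 0)"
 using F_comm[of c k i j u] assms c_range r_range c_outside by auto

text \<open>The operator \<open>F i j\<close> acts on words as a derivation that replaces one letter
  \<open>(c, i)\<close> by \<open>(c, j)\<close>. The words obtained from the different occurrences
  agree to leading order by \<open>perm_Low\<close>, which produces the multiplicity.\<close>

lemma derivation_Low: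
 assumes ws: "set ws \<subseteq> col_lowering c r" and ij: "1 \<le> i" "i \<le> int r" "1 \<le> j" "j \<le> int r" "i \<noteq> j"
 shows "foldr X ws (F i j u) - F i j (foldr X ws u)
  - scale (of_nat (count_list ws (c, i))) (foldr X ((c, j) # remove1 (c, i) ws) u)
  \<in> Low u (length ws)"
 using ws
proof (induction ws)
 case (Cons x ws)
 let ?g = "(c, i)" and ?f = "(c, j)"
 have wsC: "set (x # ws) \<subseteq> C" using Cons.prems col_lowering_sub by blast
 have fC: "?f \<in> C" and gC: "?g \<in> C" using ij by (auto simp: col_letters_def)
 have x: "x \<in> C" "x \<in> letter_range n" using wsC C_range by auto
 obtain k where k: "x = (c, k)" "1 \<le> k" "k \<le> int r"
  using Cons.prems by (auto simp: col_lowering_def)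
 define v where "v = foldr X ws u"
 define m where "m = count_list ws ?g"
 define t where "t = foldr X (?f # remove1 ?g ws) u"
 have "foldr X ws (F i j u) - F i j v - scale (of_nat m) t \<in> Low u (length ws)"
  using Cons by (simp add: v_def m_def t_def)
 from Low_word[OF this, of "[x]"]
 have 1: "X x (foldr X ws (F i j u)) - X x (F i j v) - scale (of_nat m) (X x t)
   \<in> Low u (length (x # ws))"
  using x by (simp add: deg_C lin_diff lin_scale X_lin)
 have 2: "X x (F i j v) = F i j (X x v) + (if x = ?g then X ?f v else 0)"
  using col_bracket[of k i j v] k ij by (auto simp: diff_eq_eq add.commute)
 \<comment> \<open>If \<open>(c, i)\<close> does not occur in \<open>ws\<close>, then
   \<open>remove1\<close> removes nothing and the lengths do not match; in that case the coefficient
   is 0.\<close>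
 have d: "scale (of_nat m) (X x t - foldr X (?f # remove1 ?g (x # ws)) u) \<in> Low u (length (x # ws))"
 proof (cases "m = 0")
  case False
  hence g: "?g \<in> set ws" unfolding m_def by (metis count_notin)
  have "mset (x # ?f # remove1 ?g ws) = mset (?f # remove1 ?g (x # ws))"
   using g by (cases "x = ?g") (simp_all add: add_mset_commute)
  hence "foldr X (x # ?f # remove1 ?g ws) u - foldr X (?f # remove1 ?g (x # ws)) u
    \<in> Low u (length (x # ?f # remove1 ?g ws))"
   using wsC fC set_remove1_subset[of ?g ws] by (intro perm_Low) auto
  moreover have "length (x # ?f # remove1 ?g ws) = length (x # ws)"
   using g length_pos_if_in_set[OF g] by (simp add: length_remove1)
  ultimately show ?thesis by (intro subspace_scale[OF Low_subspace]) (simp add: t_def)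
 qed (use subspace_0[OF Low_subspace] in simp)
 have 3: "scale (of_nat m) (X x t) + (if x = ?g then X ?f v else 0)
   - scale (of_nat (count_list (x # ws) ?g)) (foldr X (?f # remove1 ?g (x # ws)) u)
   \<in> Low u (length (x # ws))"
  using d by (cases "x = ?g") (simp_all add: m_def v_def scale_right_diff_distrib scale_left_distrib algebra_simps)
 define a where "a = X x (foldr X ws (F i j u))"
 define e where "e = (if x = ?g then X ?f v else 0)"
 define s where "s = scale (of_nat (count_list (x # ws) ?g)) (foldr X (?f # remove1 ?g (x # ws)) u)"
 define mt where "mt = scale (of_nat m) (X x t)"
 have "a - F i j (X x v) - s = (a - X x (F i j v) - mt) + (mt + e - s)" unfolding 2 e_def by simp
 also have "\<dots> \<in> Low u (length (x # ws))"
  using subspace_add[OF Low_subspace 1 3] by (simp only: a_def e_def s_def mt_def)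
 finally show ?case by (simp only: a_def s_def v_def foldr.simps comp_apply)
qed (use subspace_0[OF Low_subspace] in simp)

end

declare upt_Suc [simp del]

context so_column
begin

lemma set_col: "set col = R ` {1..r}" by (auto simp: col_def)

lemma G_list_col: "lowering_list G (K @ col)" using G_list by (simp add: col_def)

lemma set_word: "set (word p) \<subseteq> col_lowering c r"
 unfolding word_def using letter_R by (auto simp: col_lowering_def set_col)

lemma set_word_C: "set (word p) \<subseteq> C" using set_word col_lowering_sub by blast

lemma word_mono: "foldr X (word p) u = mono col p u" by (simp add: word_def mono_eq_word)

lemma length_word: "length (word p) = sum_list (map p col)"
 unfolding word_def by (simp add: length_concat comp_def)

lemma letter_inj: "1 \<le> i ==> i \<le> r ==> 1 \<le> j ==> j \<le> r ==> R i = R j \<longleftrightarrow> i = j"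
proof
 assume ij: "1 \<le> i" "i \<le> r" "1 \<le> j" "j \<le> r" and "R i = R j"
 hence "letter (R i) = letter (R j)" by simp
 thus "i = j" unfolding letter_R[OF ij(1,2)] letter_R[OF ij(3,4)] by simp
qed simp

lemma count_word_gen:
 assumes "set is \<subseteq> {1..r}" "distinct is"
 shows "count (mset (concat (map (%r. replicate (p r) (letter r)) (map R is)))) x
  = (if x \<in> (%i. (c, int i)) ` set is then p (R (nat (snd x))) else 0)"
 using assms
proof (induction "is")
 case (Cons i js)
 have "letter (R i) = (c, int i)" using Cons.prems letter_R by auto
 thus ?case using Cons by auto
qed simp

lemma count_word:
 "count (mset (word p)) x = (if x \<in> col_lowering c r then p (R (nat (snd x))) else 0)"
proof -
 have "x \<in> (%i. (c, int i)) ` set [1..<Suc r] \<longleftrightarrow> x \<in> col_lowering c r"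
 proof
  assume "x \<in> col_lowering c r"
  hence "x = (c, int (nat (snd x)))" "nat (snd x) \<in> set [1..<Suc r]"
   by (auto simp: col_lowering_def)
  thus "x \<in> (%i. (c, int i)) ` set [1..<Suc r]" by (rule image_eqI)
 qed (auto simp: col_lowering_def)
 moreover have "set [1..<Suc r] \<subseteq> {1..r}" by auto
 ultimately show ?thesis unfolding word_def col_def using count_word_gen[of "[1..<Suc r]" p x] by simp
qed

lemma count_list_word: "1 \<le> i ==> i \<le> r ==> count_list (word p) (c, int i) = p (R i)"
 using count_word[of p "(c, int i)"] by (simp add: col_lowering_def count_mset)

definition move :: "nat => nat => nat => (root => nat) => root => nat" where
 "move t i j p = p(R i := p (R i) - t, R j := p (R j) + t)"

lemma mset_word_move:
 assumes "1 \<le> i" "i \<le> r" "1 \<le> j" "j \<le> r" "i \<noteq> j" "p (R i) > 0"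
 shows "mset ((c, int j) # remove1 (c, int i) (word p)) = mset (word (move 1 i j p))"
proof (rule multiset_eqI)
 fix x
 have ne: "R i \<noteq> R j" using assms letter_inj by blast
 show "count (mset ((c, int j) # remove1 (c, int i) (word p))) x
   = count (mset (word (move 1 i j p))) x"
 proof (cases "x \<in> col_lowering c r")
  case True
  then obtain k where k: "x = (c, int k)" "1 \<le> k" "k \<le> r"
   by (auto simp: col_lowering_def intro: that[of "nat (snd x)"])
  have "R k = R i \<longleftrightarrow> k = i" "R k = R j \<longleftrightarrow> k = j" using letter_inj k assms by blast+
  thus ?thesis using True k assms ne by (auto simp: count_word move_def)
 next
  case False
  moreover have "x \<noteq> (c, int i)" "x \<noteq> (c, int j)" using False assms by (auto simp: col_lowering_def)
  ultimately show ?thesis by (simp add: count_word)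
 qed
qed

lemma sum_move:
 assumes "1 \<le> i" "i \<le> r" "1 \<le> j" "j \<le> r" "i \<noteq> j" "t \<le> p (R i)"
 shows "sum_list (map (move t i j p) col) = sum_list (map p col)"
proof -
 have ne: "R i \<noteq> R j" using assms letter_inj by blast
 have inj: "inj_on R (set [1..<Suc r])" using letter_inj by (auto simp: inj_on_def)
 have d: "distinct col" using inj by (simp add: distinct_map col_def)
 have s: "sum_list (map f col) = sum f (set col)" for f :: "root => nat"
  using d by (rule sum_list_distinct_conv_sum_set)
 have mem: "R i \<in> set col" "R j \<in> set col - {R i}" using assms ne by (auto simp: set_col)
 have "sum f (set col) = f (R i) + (f (R j) + sum f (set col - {R i} - {R j}))" for f :: "root => nat"
  using sum.remove[of "set col" "R i" f] sum.remove[of "set col - {R i}" "R j" f] mem by simp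
 moreover have "sum (move t i j p) (set col - {R i} - {R j}) = sum p (set col - {R i} - {R j})"
  by (intro sum.cong) (auto simp: move_def)
 moreover have "move t i j p (R i) + move t i j p (R j) = p (R i) + p (R j)"
  using ne assms by (simp add: move_def)
 ultimately show ?thesis unfolding s by simp
qed

lemma block_less_at:
 assumes "sum_list (map q col) = sum_list (map p col)" "1 \<le> i" "i \<le> r"
  and "\<And>k. 1 \<le> k ==> k < i ==> q (R k) = p (R k)" "q (R i) < p (R i)"
 shows "block_less col q p"
proof -
 have "[1..<Suc r] = [1..<i] @ i # [Suc i..<Suc r]"
  using assms(2,3) upt_add_eq_append[of 1 i "Suc r - i"] by (simp add: upt_conv_Cons)
 hence "col = map R [1..<i] @ R i # map R [Suc i..<Suc r]" by (simp add: col_def)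
 moreover have "lexless (map R [1..<i] @ R i # map R [Suc i..<Suc r]) q p"
  using assms by (intro lexless_append) (auto simp: agree_def)
 ultimately show ?thesis using assms(1) unfolding block_less_alt by simp
qed

text \<open>The degree is unchanged and the first exponent that changes goes down. This is why
  raising letters \<open>F i j\<close>, which act on exponents by \<open>move 1 i j\<close>, produce
  only smaller column monomials.\<close>

lemma block_less_move:
 assumes "1 \<le> i" "i \<le> r" "1 \<le> j" "j \<le> r" "i < j" "0 < t" "t \<le> p (R i)"
 shows "block_less col (move t i j p) p"
proof (rule block_less_at[of _ _ i])
 show "sum_list (map (move t i j p) col) = sum_list (map p col)" using assms by (intro sum_move) auto
 show "move t i j p (R k) = p (R k)" if "1 \<le> k" "k < i" for k
  using that assms letter_inj[of k i] letter_inj[of k j] by (auto simp: move_def)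
 show "move t i j p (R i) < p (R i)" using assms letter_inj[of i j] by (auto simp: move_def)
qed (use assms in auto)

lemma derivation_mono:
 assumes ij: "1 \<le> i" "i \<le> r" "1 \<le> j" "j \<le> r" "i \<noteq> j"
 shows "mono col p (F (int i) (int j) u) - F (int i) (int j) (mono col p u)
  - scale (of_nat (p (R i))) (mono col (move 1 i j p) u) \<in> Low u (sum_list (map p col))"
proof -
 let ?k = "of_nat (p (R i)) :: complex"
 let ?v = "foldr X ((c, int j) # remove1 (c, int i) (word p)) u"
 have 1: "mono col p (F (int i) (int j) u) - F (int i) (int j) (mono col p u) - scale ?k ?v
   \<in> Low u (sum_list (map p col))"
  using derivation_Low[OF set_word, of "int i" "int j" p u] ij
  by (simp add: word_mono length_word count_list_word del: foldr.simps)
 have 2: "scale ?k ?v - scale ?k (mono col (move 1 i j p) u) \<in> Low u (sum_list (map p col))"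
 proof (cases "p (R i) = 0")
  case False
  have m: "mset ((c, int j) # remove1 (c, int i) (word p)) = mset (word (move 1 i j p))"
   using False ij by (intro mset_word_move) auto
  have l: "length ((c, int j) # remove1 (c, int i) (word p)) = sum_list (map p col)"
   using mset_eq_length[OF m] sum_move[of i j 1 p] ij False by (simp add: length_word)
  have s: "set ((c, int j) # remove1 (c, int i) (word p)) \<subseteq> C"
   unfolding mset_eq_setD[OF m] by (rule set_word_C)
  have "?v - mono col (move 1 i j p) u \<in> Low u (sum_list (map p col))"
   using perm_Low[OF s m, of u] unfolding l word_mono .
  from subspace_scale[OF Low_subspace this, of ?k] show ?thesis
   by (simp add: scale_right_diff_distrib del: foldr.simps)
 qed (use subspace_0[OF Low_subspace] in simp)
 show ?thesis using subspace_add[OF Low_subspace 1 2] by (simp del: foldr.simps)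
qed

lemma Unew_subspace: "subspace (Unew w U p)" by (simp add: Unew_def)

lemma U_sub_Unew: "U \<subseteq> Unew w U p" unfolding Unew_def using span_superset by blast

lemma lowering_letters: "letter ` set K \<subseteq> L" "letter ` set col \<subseteq> C"
proof -
 show "letter ` set K \<subseteq> L" using K_list unfolding lowering_list_def by blast
 show "letter ` set col \<subseteq> C" using letter_R by (auto simp: col_letters_def set_col)
qed

lemma stable_col: "stable G U ==> u \<in> U ==> mono col p u \<in> U"
 by (rule stable_mono[of G]) (use lowering_letters(2) in auto)

lemma K_col_disjoint: "set K \<inter> set col = {}" using lowering_letters L_disjoint by blast

lemma exponents_merge: obtains q'' where "agree (set K) q'' q'" "agree (set col) q'' q"
proof
 show "agree (set K) (%r. if r \<in> set K then q' r else q r) q'" by (simp add: agree_def)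
 show "agree (set col) (%r. if r \<in> set K then q' r else q r) q"
  using K_col_disjoint by (auto simp: agree_def)
qed

lemma Unew_base:
 assumes "block_less col q p" shows "mono K q' (mono col q w) \<in> Unew w U p"
proof -
 obtain q'' where q: "agree (set K) q'' q'" "agree (set col) q'' q" by (rule exponents_merge)
 have "block_less col q'' p" using block_less_cong[of col q'' q p p] q assms
  by (simp add: agree_def)
 hence "mono K q'' (mono col q'' w) \<in> Unew w U p" unfolding Unew_def by (intro span_base) blast
 thus ?thesis using mono_cong[OF q(1)] mono_cong[OF q(2)] by simp
qed

lemma Unew_base': "block_less col q p ==> mono col q w \<in> Unew w U p"
 using Unew_base[of q p "%_. 0" w U] by (simp add: mono_zero)

lemma Unew_mono:
 assumes "block_less col q p" shows "Unew w U q \<subseteq> Unew w U p"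
 unfolding Unew_def using block_less_trans[OF _ assms] by (intro span_mono) blast

text \<open>By \<open>datum_pbw\<close> a word with fewer column letters becomes a combination of
  monomials of smaller column degree, and the degree is what \<open>deglex\<close> compares
  first.\<close>

lemma Low_sub_Unew:
 assumes "datum G w U \<mu>" "d \<le> sum_list (map p col)"
 shows "Low w d \<subseteq> Unew w U p"
proof -
 have "foldr X vs w \<in> Unew w U p" if vs: "set vs \<subseteq> G" "sum_list (map deg vs) < d" for vs
 proof -
  have "foldr X vs w \<in> span (U \<union> {mono (K @ col) q w | q.
    sum_list (map (%r. q r * deg (letter r)) (K @ col)) \<le> sum_list (map deg vs)})"
   by (rule datum_pbw[OF assms(1) G_range G_mirror deg_mirror comm_deg G_list_col vs(1)])
  also have "\<dots> \<subseteq> Unew w U p"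
  proof (intro span_minimal Unew_subspace Un_least U_sub_Unew subsetI)
   fix t assume "t \<in> {mono (K @ col) q w | q.
    sum_list (map (%r. q r * deg (letter r)) (K @ col)) \<le> sum_list (map deg vs)}"
   then obtain q where q: "t = mono K q (mono col q w)"
    "sum_list (map (%r. q r * deg (letter r)) (K @ col)) \<le> sum_list (map deg vs)"
    by (auto simp: mono_append)
   have "deg (letter x) = 1" if "x \<in> set col" for x using lowering_letters(2) that deg_C by blast
   hence "map (%r. q r * deg (letter r)) col = map q col" by (intro map_cong refl) simp
   hence "sum_list (map (%r. q r * deg (letter r)) (K @ col)) \<ge> sum_list (map q col)"
    by (simp only: map_append sum_list_append)
   hence "sum_list (map q col) < sum_list (map p col)" using q(2) vs(2) assms(2) by linarith
   thus "t \<in> Unew w U p" unfolding q(1) by (intro Unew_base) (simp add: block_less_alt)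
  qed
  finally show ?thesis .
 qed
 thus ?thesis unfolding Low_def by (intro span_minimal Unew_subspace) blast
qed

text \<open>While \<open>y\<close> crosses the word it leaves letters of \<open>L\<close>, which
  means fewer column letters, or raising column letters. The latter are moved on to \<open>w\<close>
  at the cost of further terms of lower order, and \<open>w\<close> is sent into \<open>U\<close> by
  them.\<close>

lemma pass_raising:
 assumes datum: "datum G w U \<mu>" and ws: "set ws \<subseteq> col_lowering c r"
  and y: "y \<in> L" "bracket_in (col_lowering c r) {y} (L \<union> col_raising c r)"
  and S: "subspace S" "U \<subseteq> S" "Low w (length ws) \<subseteq> S"
 shows "foldr X ws (X y w) - X y (foldr X ws w) \<in> S"
proof -
 have U: "stable G U" using datum by (simp add: datum_def)
 have "foldr X ws (X y w) - X y (foldr X ws w) \<in> span (U \<union> Low w (length ws))" using ws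
 proof (induction ws)
  case (Cons x ws)
  let ?T = "span (U \<union> Low w (length (x # ws)))"
  have xl: "x \<in> col_lowering c r" using Cons.prems by simp
  hence x: "x \<in> C" "x \<in> letter_range n" using col_lowering_sub C_range by auto
  have wsC: "set ws \<subseteq> C" using Cons.prems col_lowering_sub by auto
  let ?v = "foldr X ws w"
  have "foldr X ws (X y w) - X y ?v \<in> span (U \<union> Low w (length ws))" using Cons by simp
  hence 1: "X x (foldr X ws (X y w) - X y ?v) \<in> ?T"
  proof (rule lin_span_into[OF X_lin[OF x(2)] _ _, rotated 2])
   fix t assume "t \<in> U \<union> Low w (length ws)"
   thus "X x t \<in> ?T"
   proof
    assume "t \<in> U"
    hence "X x t \<in> U" using x by (intro stable_X[OF U]) auto
    thus ?thesis by (intro span_base) simp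
   next
    assume "t \<in> Low w (length ws)"
    from Low_word[OF this, of "[x]"] x have "X x t \<in> Low w (length (x # ws))" by (simp add: deg_C)
    thus ?thesis by (intro span_base) simp
   qed
  qed simp
  have "X x (X y ?v) - X y (X x ?v) \<in> span {X z ?v | z. z \<in> L \<union> col_raising c r}"
   using bracket_in_span[OF y(2) xl, of y ?v] y(1) L_range col_lowering_sub C_range by auto
  moreover have "span {X z ?v | z. z \<in> L \<union> col_raising c r} \<subseteq> ?T"
  proof (intro span_minimal subsetI)
   fix t assume "t \<in> {X z ?v | z. z \<in> L \<union> col_raising c r}"
   then obtain z where z: "t = X z ?v" "z \<in> L \<union> col_raising c r" by blast
   show "t \<in> ?T"
   proof (cases "z \<in> L")
    case True
    hence "foldr X (z # ws) w \<in> Low w (length (x # ws))"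
     using wsC by (intro Low_base) (auto simp: sum_deg_C deg_L)
    thus ?thesis using z by (intro span_base) simp
   next
    case False
    hence zr: "z \<in> col_raising c r" using z by simp
    hence zC: "z \<in> C" using col_raising_sub by blast
    have "foldr X ws (X z w) - X z ?v \<in> Low w (length ws + deg z)"
    proof (rule pass_Low[OF wsC])
     show "z \<in> G" using zC by simp
     show "X x' (X z u) - X z (X x' u) \<in> span {X z' u | z'. z' \<in> L}" if "x' \<in> set ws" for x' u
      using that wsC zC C_range by (intro bracket_in_span[OF bracket_CC]) auto
    qed
    hence "foldr X ws (X z w) - X z ?v \<in> ?T" using zC by (intro span_base) (simp add: deg_C)
    moreover have "X z w \<in> U" using datum zC col_raising_raising[OF zr] by (simp add: datum_def)
    hence "foldr X ws (X z w) \<in> ?T" using wsC by (intro span_base UnI1 stable_word[OF U]) auto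
    ultimately have "foldr X ws (X z w) - (foldr X ws (X z w) - X z ?v) \<in> ?T"
     by (rule span_diff[rotated])
    thus ?thesis using z by simp
   qed
  qed simp
  ultimately have 2: "X x (X y ?v) - X y (X x ?v) \<in> ?T" by blast
  have alg: "a - d = (a - b) + (b - d)" for a b d :: 'v by simp
  have "foldr X (x # ws) (X y w) - X y (foldr X (x # ws) w)
    = X x (foldr X ws (X y w) - X y ?v) + (X x (X y ?v) - X y (X x ?v))"
   unfolding foldr.simps comp_apply lin_diff[OF X_lin[OF x(2)]] by (rule alg)
  thus ?case using span_add[OF 1 2] by (simp only:)
 qed (simp add: span_zero)
 moreover have "span (U \<union> Low w (length ws)) \<subseteq> S" using S by (intro span_minimal) auto
 ultimately show ?thesis by blast
qed

text \<open>A letter \<open>(c, k)\<close> of the column has weight \<epsilon>_c - \<epsilon>_k,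
  where \<epsilon>_(-i) means - \<epsilon>_i and \<epsilon>_0 means 0.\<close>

definition shift_weight :: "(root => nat) => (int => real) => int => real" where
 "shift_weight p \<mu> i = \<mu> i + (if i = c then 1 else if i = - c then - 1 else 0) * real (sum_list (map p col))
   - (if i \<le> int r then real (p (R (nat i))) else 0)"

lemma weight_word:
 assumes "i > 0" "i \<le> int n" "F i i w = scale (of_real m) w" "set ws \<subseteq> col_lowering c r"
 shows "F i i (foldr X ws w) = scale (of_real (m
  + (if i = c then 1 else if i = - c then - 1 else 0) * real (length ws)
  - real (count_list ws (c, i)))) (foldr X ws w)"
 using assms(4)
proof (induction ws)
 case (Cons x ws)
 obtain k where k: "x = (c, k)" "1 \<le> k" "k \<le> int r"
  using Cons.prems by (auto simp: col_lowering_def)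
 let ?v = "foldr X ws w"
 define s :: real where "s = (if i = c then 1 else if i = - c then - 1 else 0)"
 define e :: real where "e = (if k = i then 1 else 0)"
 have kn: "\<bar>k\<bar> \<le> int n" using k r_range by simp
 have "F i i (F c k ?v) - F c k (F i i ?v) = scale (of_real (s - e)) (F c k ?v)"
 proof (cases "i = k")
  case True
  hence "i \<noteq> c" "i \<noteq> - c" using c_outside k by auto
  thus ?thesis using F_comm[of i i c k ?v] assms(1,2) c_range kn True k by (auto simp: s_def e_def)
 next
  case False
  have m: "F (- i) k ?v = F c k ?v" if "c = - i" using that by simp
  show ?thesis using F_comm[of i i c k ?v] assms(1,2) c_range kn False k m
   by (auto simp: s_def e_def)
 qed
 moreover have "F i i ?v = scale (of_real (m + s * real (length ws) - real (count_list ws (c, i)))) ?v"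
  using Cons by (simp add: s_def)
 moreover have "lin (F c k)" using c_range kn by (rule F_lin)
 ultimately have "F i i (F c k ?v)
   = scale (of_real (m + s * real (length ws) - real (count_list ws (c, i)))) (F c k ?v)
    + scale (of_real (s - e)) (F c k ?v)"
  by (simp add: lin_scale diff_eq_eq add.commute)
 also have "\<dots> = scale (of_real (m + s * real (length (x # ws)) - real (count_list (x # ws) (c, i))))
   (F c k ?v)"
  unfolding scale_left_distrib[symmetric] of_real_add[symmetric]
  by (rule arg_cong[of _ _ "%z. scale (of_real z) _"]) (auto simp: e_def k algebra_simps)
 finally show ?case using k by (simp add: s_def)
qed (use assms(3) in simp)

lemma weight_mono:
 assumes "datum G w U \<mu>" "i > 0" "(i, i) \<in> G"
 shows "F i i (mono col p w) = scale (of_real (shift_weight p \<mu> i)) (mono col p w)"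
proof -
 have "i \<le> int n" using assms(2,3) G_range by (auto simp: letter_range_def)
 moreover have "F i i w = scale (of_real (\<mu> i)) w" using assms unfolding datum_def by blast
 moreover have "count_list (word p) (c, i) = (if i \<le> int r then p (R (nat i)) else 0)"
 proof (cases "i \<le> int r")
  case False
  hence "(c, i) \<notin> set (word p)" using set_word by (auto simp: col_lowering_def)
  thus ?thesis using False by simp
 qed (use count_list_word[of "nat i" p] assms(2) in simp)
 ultimately show ?thesis using weight_word[of i w "\<mu> i" "word p"] assms(2) set_word
  by (simp add: word_mono length_word shift_weight_def)
qed

end

section \<open>Passing from the algebra to the smaller one across one column\<close>

context so_column
begin

text \<open>The induction on \<open>p\<close> is needed for the stability of the new subspace: for
  smaller \<open>q\<close> the vector \<open>mono col q w\<close> is already a highest weight vector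
  modulo \<open>Unew w U q\<close>, so a letter of \<open>L\<close> in front of it can be
  straightened inside \<open>Unew w U p\<close>.\<close>

theorem datum_step:
 assumes datum: "datum G w U \<mu>"
 shows "datum L (mono col p w) (Unew w U p) (shift_weight p \<mu>)"
 using wf_block_less[of col]
proof (induction p rule: wf_induct_rule)
 case (less p)
 have U: "stable G U" using datum by (simp add: datum_def)
 have IH: "datum L (mono col q w) (Unew w U q) (shift_weight q \<mu>)" if "block_less col q p" for q
  using less that by simp
 have stable: "stable L (Unew w U p)" unfolding stable_def
 proof (intro conjI Unew_subspace ballI)
  fix x u assume x: "x \<in> L" and u: "u \<in> Unew w U p"
  show "X x u \<in> Unew w U p"
  proof (rule lin_span_into[OF _ Unew_subspace _ u[unfolded Unew_def]])
   show "lin (X x)" using x L_range by (intro X_lin) blast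
   fix t assume "t \<in> U \<union> {mono K q (mono col q w) | q. block_less col q p}"
   thus "X x t \<in> Unew w U p"
   proof
    assume "t \<in> U"
    hence "X x t \<in> U" using x by (intro stable_X[OF U]) auto
    thus ?thesis using U_sub_Unew by blast
   next
    assume "t \<in> {mono K q (mono col q w) | q. block_less col q p}"
    then obtain q where q: "t = mono K q (mono col q w)" "block_less col q p" by blast
    let ?ws = "x # letters K q"
    have "set ?ws \<subseteq> L" using x lowering_letters(1) by auto
    \<comment> \<open>Only the spanning by monomials in \<open>K\<close> matters here, so the degree
      function is taken to be 0.\<close>
    hence "foldr X ?ws (mono col q w) \<in> span (Unew w U q \<union> {mono K q' (mono col q w) | q'.
      sum_list (map (%r. q' r * 0) K) \<le> sum_list (map (%_. 0) ?ws)})"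
     using bracket_in_span[OF bracket_LL _ _ L_range L_range]
     by (intro datum_pbw[OF IH[OF q(2)] L_range L_mirror _ _ K_list]) auto
    also have "\<dots> \<subseteq> Unew w U p" using Unew_mono[OF q(2)] Unew_base[OF q(2)]
     by (intro span_minimal Unew_subspace) blast
    finally show ?thesis using q(1) by (simp add: mono_eq_word)
   qed
  qed
 qed
 have low: "Low w (sum_list (map p col)) \<subseteq> Unew w U p" using datum by (rule Low_sub_Unew) simp
 have pos: "F (int i) (int j) (mono col p w) \<in> Unew w U p" if "1 \<le> i" "i < j" "j \<le> r" for i j
 proof -
  have ij: "(int i, int j) \<in> L" using square_sub that by (auto simp: sq_letters_def)
  have ij_raising: "raising n (int i, int j)"
   using that r_range by (simp add: raising_def height_def)
  have "X (int i, int j) w \<in> U" using ij ij_raising by (intro datum_raising[OF datum]) auto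
  hence 1: "mono col p (F (int i) (int j) w) \<in> Unew w U p"
   by (intro subsetD[OF U_sub_Unew] stable_col[OF U]) simp
  have 2: "mono col p (F (int i) (int j) w) - F (int i) (int j) (mono col p w)
   - scale (of_nat (p (R i))) (mono col (move 1 i j p) w) \<in> Unew w U p"
   using that by (intro subsetD[OF low] derivation_mono) auto
  have 3: "scale (of_nat (p (R i))) (mono col (move 1 i j p) w) \<in> Unew w U p"
  proof (cases "p (R i) = 0")
   case False
   hence "block_less col (move 1 i j p) p" using that by (intro block_less_move) auto
   from subspace_scale[OF Unew_subspace Unew_base'[OF this]] show ?thesis .
  qed (use subspace_0[OF Unew_subspace] in simp)
  have alg: "a - (a - b - d + d) = b" for a b d :: 'v by simp
  show ?thesis
   using subspace_diff[OF Unew_subspace 1 subspace_add[OF Unew_subspace 2 3]] unfolding alg .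
 qed
 have "X y (mono col p w) \<in> Unew w U p" if y: "y \<in> L" "raising n y" for y using raising_cases[OF y]
 proof (elim disjE)
  assume "pos_raising r y"
  hence b: "1 \<le> fst y" "fst y < snd y" "snd y \<le> int r" by (simp_all add: pos_raising_def)
  have "F (int (nat (fst y))) (int (nat (snd y))) (mono col p w) \<in> Unew w U p"
   using b by (intro pos) auto
  thus ?thesis using b by (simp add: X_def)
 next
  assume m: "pos_raising r (mirror y)"
  define z where "z = mirror y"
  have b: "1 \<le> fst z" "fst z < snd z" "snd z \<le> int r"
   using m by (simp_all add: pos_raising_def z_def)
  have "F (int (nat (fst z))) (int (nat (snd z))) (mono col p w) \<in> Unew w U p"
   using b by (intro pos) auto
  hence "X (mirror y) (mono col p w) \<in> Unew w U p" using b by (simp add: X_def z_def)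
  hence "- X y (mono col p w) \<in> Unew w U p" using X_mirror[of y] y(1) L_range by auto
  from subspace_neg[OF Unew_subspace this] show ?thesis by simp
 next
  assume b: "bracket_in (col_lowering c r) {y} (L \<union> col_raising c r)"
  have "mono col p (X y w) - X y (mono col p w) \<in> Unew w U p"
   using pass_raising[OF datum set_word y(1) b Unew_subspace U_sub_Unew] low
   by (simp add: word_mono length_word)
  moreover have "X y w \<in> U" using y by (intro datum_raising[OF datum]) auto
  hence "mono col p (X y w) \<in> Unew w U p" by (intro subsetD[OF U_sub_Unew] stable_col[OF U])
  ultimately show ?thesis using subspace_cong_mem[OF Unew_subspace] by blast
 qed
 thus ?case unfolding datum_def using stable
  by (intro conjI allI ballI impI weight_mono[OF datum]) auto
qed

text \<open>When \<open>F (i+1) i\<close> crosses the monomial, it moves one unit of exponent from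
  \<open>i+1\<close> to \<open>i\<close>, with the current exponent as coefficient. After
  \<open>t\<close> crossings the coefficient is a falling factorial, which is nonzero for
  \<open>t\<close> up to the exponent.\<close>

lemma col_upper_aux:
 assumes datum: "datum G w U \<mu>" and i: "1 \<le> i" "Suc i \<le> r"
 shows "t \<le> p (R (Suc i)) ==> \<exists>a. a \<noteq> 0 \<and>
  mono col p ((F (int (Suc i)) (int i) ^^ t) w) - scale a (mono col (move t (Suc i) i p) w)
   \<in> Unew w U (move t (Suc i) i p)"
proof (induction t arbitrary: p)
 case 0
 have "move 0 (Suc i) i p = p" by (simp add: move_def)
 thus ?case using subspace_0[OF Unew_subspace] by (intro exI[of _ 1]) simp
next
 case (Suc t)
 let ?F = "F (int (Suc i)) (int i)"
 define u where "u = (?F ^^ t) w"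
 define p1 where "p1 = move 1 (Suc i) i p"
 define p' where "p' = move (Suc t) (Suc i) i p"
 let ?S = "Unew w U p'"
 have ne: "R (Suc i) \<noteq> R i" using letter_inj[of "Suc i" i] i by simp
 have p1': "move t (Suc i) i p1 = p'" using ne unfolding p1_def p'_def move_def by (intro ext) simp
 have sum': "sum_list (map p' col) = sum_list (map p col)"
  unfolding p'_def using Suc.prems i by (intro sum_move) auto
 have fL: "(int (Suc i), int i) \<in> L" using square_sub i by (auto simp: sq_letters_def)
 have "foldr X (replicate k x) w = (X x ^^ k) w" for k x by (induction k) auto
 hence "u = foldr X (replicate t (int (Suc i), int i)) w" unfolding u_def by simp
 moreover have "sum_list (map deg (replicate t (int (Suc i), int i))) = 0"
  unfolding map_replicate sum_list_replicate deg_L[OF fL] by simp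
 moreover have "set (replicate t (int (Suc i), int i)) \<subseteq> G" using fL by auto
 ultimately have "Low u d \<subseteq> Low w d" for d
  using Low_shift[of "replicate t (int (Suc i), int i)" w d] by (simp only: add_0_right)
 moreover have "Low w (sum_list (map p col)) \<subseteq> ?S" using sum' by (intro Low_sub_Unew[OF datum]) simp
 ultimately have low: "Low u (sum_list (map p col)) \<subseteq> ?S" by blast
 have 1: "mono col p (?F u) - ?F (mono col p u) - scale (of_nat (p (R (Suc i)))) (mono col p1 u) \<in> ?S"
  unfolding p1_def using i by (intro subsetD[OF low] derivation_mono) auto
 have "t \<le> p1 (R (Suc i))" using Suc.prems ne by (simp add: p1_def move_def)
 from Suc.IH[of p1, OF this] obtain a where a: "a \<noteq> 0" "mono col p1 u - scale a (mono col p' w) \<in> ?S"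
  unfolding p1' u_def by blast
 have "stable L ?S" using datum_step[OF datum, of p'] by (simp add: datum_def)
 \<comment> \<open>The uncrossed term is negligible: after \<open>t\<close> moves the exponent at
   the earlier index \<open>i\<close> is still smaller than in \<open>p'\<close>, so the monomial is
   below \<open>p'\<close>, and \<open>?S\<close> is stable under \<open>?F\<close>.\<close>
 have 2: "?F (mono col p u) \<in> ?S"
 proof -
  have "t \<le> p (R (Suc i))" using Suc.prems by simp
  from Suc.IH[of p, OF this] obtain b where
   b: "mono col p u - scale b (mono col (move t (Suc i) i p) w) \<in> Unew w U (move t (Suc i) i p)"
   unfolding u_def by blast
  have less: "block_less col (move t (Suc i) i p) p'"
  proof (rule block_less_at[of _ _ i])
   show "sum_list (map (move t (Suc i) i p) col) = sum_list (map p' col)"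
    unfolding sum' using Suc.prems i by (intro sum_move) auto
   show "move t (Suc i) i p (R k) = p' (R k)" if "1 \<le> k" "k < i" for k
    using that i letter_inj[of k i] letter_inj[of k "Suc i"] by (auto simp: p'_def move_def)
   show "move t (Suc i) i p (R i) < p' (R i)" using ne by (auto simp: p'_def move_def)
  qed (use i in auto)
  have "mono col p u - scale b (mono col (move t (Suc i) i p) w) \<in> ?S"
   using b Unew_mono[OF less] by blast
  moreover have "scale b (mono col (move t (Suc i) i p) w) \<in> ?S"
   using less by (intro subspace_scale[OF Unew_subspace] Unew_base')
  ultimately have "mono col p u \<in> ?S" by (simp only: subspace_cong_mem[OF Unew_subspace])
  thus ?thesis using \<open>stable L ?S\<close> fL stable_X[of L ?S "(int (Suc i), int i)"] by simp
 qed
 define k :: complex where "k = of_nat (p (R (Suc i)))"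
 have k: "k \<noteq> 0" using Suc.prems by (simp add: k_def)
 have 3: "scale k (mono col p1 u) - scale (k * a) (mono col p' w) \<in> ?S"
  using subspace_scale[OF Unew_subspace a(2), of k]
  unfolding scale_right_diff_distrib scale_scale .
 have "mono col p (?F u) - scale (k * a) (mono col p' w) \<in> ?S"
 proof -
  have alg: "x - y - z + y + (z - v) = x - v" for x y z v :: 'v by simp
  show ?thesis using subspace_add[OF Unew_subspace subspace_add[OF Unew_subspace 1 2] 3]
   unfolding k_def[symmetric] alg .
 qed
 moreover have Fu: "(?F ^^ Suc t) w = ?F u" unfolding u_def funpow.simps comp_apply ..
 ultimately have main: "mono col p ((?F ^^ Suc t) w) - scale (k * a) (mono col p' w) \<in> ?S"
  unfolding Fu by (simp only:)
 have ka: "k * a \<noteq> 0" using a(1) k by simp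
 show ?case
 proof (rule exI, rule conjI)
  show "k * a \<noteq> 0" by (rule ka)
  show "mono col p ((?F ^^ Suc t) w) - scale (k * a) (mono col (move (Suc t) (Suc i) i p) w)
    \<in> Unew w U (move (Suc t) (Suc i) i p)"
   using main unfolding p'_def .
 qed
qed

text \<open>In \<open>p0\<close> the whole exponent at \<open>i\<close> is moved to
  \<open>i+1\<close>. The power of \<open>F (i+1) i\<close> that annihilates \<open>w\<close> modulo
  \<open>U\<close> moves exactly this amount back, so its crossing gives a multiple of the monomial
  \<open>p\<close>.\<close>

lemma col_upper:
 assumes datum: "datum G w U \<mu>" and i: "1 \<le> i" "Suc i \<le> r"
  and nil: "(F (int (Suc i)) (int i) ^^ (p (R i))) w \<in> U"
 shows "mono col p w \<in> Unew w U p"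
proof -
 have U: "stable G U" using datum by (simp add: datum_def)
 have ne: "R (Suc i) \<noteq> R i" using letter_inj[of "Suc i" i] i by simp
 define p0 where "p0 = move (p (R i)) i (Suc i) p"
 have p: "move (p (R i)) (Suc i) i p0 = p" using ne unfolding p0_def move_def by (intro ext) simp
 have "p (R i) \<le> p0 (R (Suc i))" using ne by (simp add: p0_def move_def)
 from col_upper_aux[OF datum i, of "p (R i)" p0, OF this] obtain a where
  a: "a \<noteq> 0" "mono col p0 ((F (int (Suc i)) (int i) ^^ (p (R i))) w) - scale a (mono col p w)
   \<in> Unew w U p" unfolding p by blast
 have "mono col p0 ((F (int (Suc i)) (int i) ^^ (p (R i))) w) \<in> Unew w U p"
  by (intro subsetD[OF U_sub_Unew] stable_col[OF U] nil)
 hence "scale a (mono col p w) \<in> Unew w U p" using subspace_cong_mem[OF Unew_subspace a(2)] by blast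
 thus ?thesis by (rule subspace_scale_cancel[OF Unew_subspace _ a(1)])
qed

text \<open>The last letter of the column acts on \<open>w\<close> before all others, so nothing has
  to be commuted.\<close>

lemma col_upper_last:
 assumes "stable G U" "1 \<le> r" "(F c (int r) ^^ (p (R r))) w \<in> U"
 shows "mono col p w \<in> U"
proof -
 have "[1..<Suc r] = [1..<r] @ [r]" using assms(2) by (simp add: upt_Suc)
 hence "col = map R [1..<r] @ [R r]" by (simp add: col_def)
 hence "mono col p w = mono (map R [1..<r]) p ((F c (int r) ^^ (p (R r))) w)"
  using letter_R[of r] assms(2) by (simp add: mono_append)
 moreover have "set (map R [1..<r]) \<subseteq> set col" by (auto simp: set_col)
 hence "letter ` set (map R [1..<r]) \<subseteq> G" using lowering_letters(2) by blast
 ultimately show ?thesis by (simp only: stable_mono[OF assms(1) _ assms(3)])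
qed

text \<open>A smaller exponent either is smaller on the column, and then contributes to
  \<open>Unew\<close>, or agrees with \<open>p\<close> there and is smaller on \<open>bs\<close>.
  Exponents on \<open>K\<close> and on the column can be prescribed independently because these root
  lists are disjoint.\<close>

lemma ess_step:
 assumes K: "K = concat (rev bs)"
 shows "ess (col # bs) w U p \<longleftrightarrow> ess bs (mono col p w) (Unew w U p) p"
proof -
 let ?A = "U \<union> {mono (concat (rev (col # bs))) q w | q. blocks_less (col # bs) q p}"
 let ?B = "Unew w U p \<union> {mono (concat (rev bs)) q (mono col p w) | q. blocks_less bs q p}"
 have cat: "concat (rev (col # bs)) = K @ col" using K by simp
 have "?A \<subseteq> span ?B"
 proof
  fix t assume "t \<in> ?A"
  then consider "t \<in> U" | q where "t = mono K q (mono col q w)" "block_less col q p"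
   | q where "t = mono K q (mono col q w)" "agree (set col) q p" "blocks_less bs q p"
   unfolding cat mono_append by auto
  thus "t \<in> span ?B"
  proof cases
   case 1
   thus ?thesis using U_sub_Unew by (intro span_base) auto
  next
   case 2
   thus ?thesis using Unew_base[of q p q w U] by (intro span_base) auto
  next
   case 3
   hence "t = mono (concat (rev bs)) q (mono col p w)" using mono_cong[of col q p w] K by simp
   thus ?thesis using 3 by (intro span_base) auto
  qed
 qed
 moreover have "?B \<subseteq> span ?A"
 proof
  fix t assume "t \<in> ?B"
  then consider "t \<in> Unew w U p" | q where "t = mono K q (mono col p w)" "blocks_less bs q p"
   using K by auto
  thus "t \<in> span ?A"
  proof cases
   case 1
   have "Unew w U p \<subseteq> span ?A" unfolding Unew_def cat mono_append by (intro span_mono) auto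
   thus ?thesis using 1 by blast
  next
   case 2
   obtain q'' where q: "agree (set K) q'' q" "agree (set col) q'' p" by (rule exponents_merge)
   have "blocks_less bs q'' p" using blocks_less_cong[of bs q'' q p] q(1) 2(2) by (simp add: K)
   moreover have "t = mono (K @ col) q'' w"
    using 2(1) mono_cong[OF q(1)] mono_cong[OF q(2)] by (simp add: mono_append)
   ultimately show ?thesis
    using q(2) unfolding cat by (intro span_base UnI2 CollectI exI[of _ q'']) simp
  qed
 qed
 ultimately have "span ?A = span ?B" by (meson span_minimal subspace_span subset_antisym)
 thus ?thesis unfolding ess_def cat mono_append K[symmetric] by simp
qed

end

section \<open>The algebra so(2m), its parabolic and Levi subalgebras, and the lists of their
  lowering letters\<close>

definition levi_letters :: "nat => (int \<times> int) set" where
 "levi_letters m = {(a, b). 1 \<le> \<bar>a\<bar> \<and> \<bar>a\<bar> \<le> int m \<and> 1 \<le> \<bar>b\<bar> \<and> \<bar>b\<bar> \<le> int m \<and>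
   a + b \<noteq> 0 \<and> (\<bar>a\<bar> = int m \<longleftrightarrow> \<bar>b\<bar> = int m)}"

text \<open>The maximal parabolic subalgebra of so(2m) with Levi part \<open>levi_letters m\<close>,
  whose nilradical consists of the weights \<epsilon>_m \<plusminus> \<epsilon>_b. It is what
  remains of \<open>sq_letters m\<close> without the column \<open>- int m\<close>; it contains the
  lowering letters \<open>(int m, b)\<close>, \<open>0 < b < int m\<close>, but not their
  transposes.\<close>

definition par_letters :: "nat => (int \<times> int) set" where
 "par_letters m = {(a, b). 1 \<le> \<bar>a\<bar> \<and> \<bar>a\<bar> \<le> int m \<and> 1 \<le> \<bar>b\<bar> \<and> \<bar>b\<bar> \<le> int m \<and>
   a + b \<noteq> 0 \<and> (a = - int m --> b = a) \<and> (b = int m --> a = b)}"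

definition long_roots :: "nat => root list" where
 "long_roots m = concat (map (%j. minus_roots j @ plus_roots j) [2..<Suc m])"

lemma long_roots_Suc:
 assumes "2 \<le> m"
 shows "long_roots m = long_roots (m - 1) @ minus_roots m @ plus_roots m"
proof -
 have "[2..<Suc m] = [2..<m] @ [m]" using assms by (simp add: upt_Suc)
 moreover have "Suc (m - 1) = m" using assms by simp
 ultimately show ?thesis by (simp add: long_roots_def)
qed

lemma long_roots_small: "m < 2 ==> long_roots m = []" by (simp add: long_roots_def)

lemma set_minus_roots: "set (minus_roots m) = (%i. Minus i m) ` {1..<m}"
 and set_plus_roots: "set (plus_roots m) = (%i. Plus i m) ` {1..<m}"
 and set_short_roots: "set (short_roots m) = Short ` {1..m}"
 by (auto simp: minus_roots_def plus_roots_def short_roots_def)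

lemma letter_minus: "letter ` set (minus_roots m) = {(a, b). a = int m \<and> 1 \<le> b \<and> b < int m}"
proof -
 have "(int m, b) \<in> letter ` set (minus_roots m)" if "1 \<le> b" "b < int m" for b
 proof (rule image_eqI)
  show "(int m, b) = letter (Minus (nat b) m)" using that by simp
  show "Minus (nat b) m \<in> set (minus_roots m)" unfolding set_minus_roots using that by (intro imageI) auto
 qed
 thus ?thesis by (auto simp: set_minus_roots)
qed

lemma letter_plus: "letter ` set (plus_roots m) = {(a, b). a = - int m \<and> 1 \<le> b \<and> b < int m}"
proof -
 have "(- int m, b) \<in> letter ` set (plus_roots m)" if "1 \<le> b" "b < int m" for b
 proof (rule image_eqI)
  show "(- int m, b) = letter (Plus (nat b) m)" using that by simp
  show "Plus (nat b) m \<in> set (plus_roots m)" unfolding set_plus_roots using that by (intro imageI) auto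
 qed
 thus ?thesis by (auto simp: set_plus_roots)
qed

lemma letter_short: "letter ` set (short_roots m) = {(a, b). a = 0 \<and> 1 \<le> b \<and> b \<le> int m}"
proof -
 have "(0, b) \<in> letter ` set (short_roots m)" if "1 \<le> b" "b \<le> int m" for b
 proof (rule image_eqI)
  show "(0, b) = letter (Short (nat b))" using that by simp
  show "Short (nat b) \<in> set (short_roots m)" unfolding set_short_roots using that by (intro imageI) auto
 qed
 thus ?thesis by (auto simp: set_short_roots)
qed

lemma letter_long: "letter ` set (long_roots m) = {(a, b). 1 \<le> b \<and> b < \<bar>a\<bar> \<and> \<bar>a\<bar> \<le> int m}"
proof (induction m)
 case (Suc m)
 show ?case
 proof (cases "m = 0")
  case False
  hence "letter ` set (long_roots (Suc m)) = letter ` set (long_roots m) \<union>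
   letter ` set (minus_roots (Suc m)) \<union> letter ` set (plus_roots (Suc m))"
   using long_roots_Suc[of "Suc m"] by (simp add: image_Un Un_assoc)
  also have "\<dots> = {(a, b). 1 \<le> b \<and> b < \<bar>a\<bar> \<and> \<bar>a\<bar> \<le> int (Suc m)}"
   unfolding Suc.IH letter_minus letter_plus by auto
  finally show ?thesis .
 qed (auto simp: long_roots_small)
qed (auto simp: long_roots_small)

lemma column_rank_less:
 assumes "column_rank n a < column_rank n a'" "0 < b" "b \<le> int n" "normal_lowering (a, b)"
  "normal_lowering (a', b')" "0 < b'"
 shows "letter_rank n (a, b) < letter_rank n (a', b')"
proof -
 have "(column_rank n a + 1) * (n + 1) \<le> column_rank n a' * (n + 1)"
  using assms(1) by (intro mult_le_mono1) simp
 moreover have "nat b \<le> n" using assms by simp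
 ultimately show ?thesis using assms(4,5) by (simp add: letter_rank_def)
qed

abbreviation rank_sorted :: "nat => root list => bool" where
 "rank_sorted n rs \<equiv> sorted_wrt (%r r'. letter_rank n (letter r) < letter_rank n (letter r')) rs"

lemma rank_sorted_column:
 assumes "\<And>i. 1 \<le> i ==> i < m ==> letter (R i) = (c, int i)"
  "\<And>i. 1 \<le> i ==> i < m ==> normal_lowering (c, int i)"
 shows "rank_sorted n (map R [1..<m])"
proof -
 have "letter_rank n (letter (R i)) < letter_rank n (letter (R j))" if "1 \<le> i" "i < j" "j < m" for i j
  using assms[of i] assms[of j] that by (simp add: letter_rank_def)
 thus ?thesis by (auto simp: sorted_wrt_map sorted_wrt_iff_nth_less)
qed

lemma rank_sorted_minus: "rank_sorted n (minus_roots m)"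
 unfolding minus_roots_def by (rule rank_sorted_column) (auto simp: normal_lowering_def)

lemma rank_sorted_plus: "rank_sorted n (plus_roots m)"
 unfolding plus_roots_def by (rule rank_sorted_column) (auto simp: normal_lowering_def)

lemma rank_sorted_short: "rank_sorted n (short_roots m)"
 unfolding short_roots_def by (rule rank_sorted_column) (auto simp: normal_lowering_def)

lemma rank_sorted_append:
 assumes "rank_sorted n xs" "rank_sorted n ys"
  and "\<And>a b a' b'. (a, b) \<in> letter ` set xs ==> (a', b') \<in> letter ` set ys ==>
   column_rank n a < column_rank n a' \<and> 0 < b \<and> b \<le> int n \<and> normal_lowering (a, b) \<and>
   normal_lowering (a', b') \<and> 0 < b'"
 shows "rank_sorted n (xs @ ys)"
proof -
 have "letter_rank n (letter x) < letter_rank n (letter y)" if "x \<in> set xs" "y \<in> set ys" for x y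
 proof -
  obtain a b a' b' where e: "letter x = (a, b)" "letter y = (a', b')" by fastforce
  hence m: "(a, b) \<in> letter ` set xs" "(a', b') \<in> letter ` set ys"
   using that by (auto intro: rev_image_eqI)
  show ?thesis unfolding e using assms(3)[OF m] by (intro column_rank_less) auto
 qed
 thus ?thesis using assms(1,2) by (simp add: sorted_wrt_append)
qed

lemma rank_sorted_long_minus:
 assumes "rank_sorted n (long_roots (m - 1))" "m \<le> n" "1 \<le> m"
 shows "rank_sorted n (long_roots (m - 1) @ minus_roots m)"
proof (rule rank_sorted_append[OF assms(1) rank_sorted_minus])
 fix a b a' b' assume "(a, b) \<in> letter ` set (long_roots (m - 1))" "(a', b') \<in> letter ` set (minus_roots m)"
 thus "column_rank n a < column_rank n a' \<and> 0 < b \<and> b \<le> int n \<and> normal_lowering (a, b) \<and>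
   normal_lowering (a', b') \<and> 0 < b'"
  unfolding letter_long letter_minus using assms(2,3)
  by (auto simp: column_rank_def normal_lowering_def)
qed

lemma rank_sorted_long: "m \<le> n ==> rank_sorted n (long_roots m)"
proof (induction m)
 case (Suc m)
 show ?case
 proof (cases "m = 0")
  case False
  have "rank_sorted n ((long_roots m @ minus_roots (Suc m)) @ plus_roots (Suc m))"
  proof (rule rank_sorted_append[OF _ rank_sorted_plus])
   show "rank_sorted n (long_roots m @ minus_roots (Suc m))"
    using rank_sorted_long_minus[of n "Suc m"] Suc by simp
  next
   fix a b a' b' assume "(a, b) \<in> letter ` set (long_roots m @ minus_roots (Suc m))"
    "(a', b') \<in> letter ` set (plus_roots (Suc m))"
   thus "column_rank n a < column_rank n a' \<and> 0 < b \<and> b \<le> int n \<and> normal_lowering (a, b) \<and>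
     normal_lowering (a', b') \<and> 0 < b'"
    unfolding set_append image_Un letter_long letter_minus letter_plus using Suc.prems
    by (auto simp: column_rank_def normal_lowering_def)
  qed
  thus ?thesis using False long_roots_Suc[of "Suc m"] by simp
 qed (simp add: long_roots_small)
qed (simp add: long_roots_small)

lemma rank_sorted_long_short: "rank_sorted n (long_roots n @ short_roots n)"
proof (rule rank_sorted_append[OF rank_sorted_long[OF order_refl] rank_sorted_short])
 fix a b a' b' assume "(a, b) \<in> letter ` set (long_roots n)" "(a', b') \<in> letter ` set (short_roots n)"
 thus "column_rank n a < column_rank n a' \<and> 0 < b \<and> b \<le> int n \<and> normal_lowering (a, b) \<and>
   normal_lowering (a', b') \<and> 0 < b'"
  unfolding letter_long letter_short by (auto simp: column_rank_def normal_lowering_def)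
qed

lemma normal_square: "{x \<in> sq_letters m. normal_lowering x} = letter ` set (long_roots m)"
 unfolding letter_long by (auto simp: sq_letters_def normal_lowering_def)

lemma mem_square: "(a, b) \<in> sq_letters m \<longleftrightarrow> 1 \<le> \<bar>a\<bar> \<and> \<bar>a\<bar> \<le> int m \<and> 1 \<le> \<bar>b\<bar> \<and> \<bar>b\<bar> \<le> int m \<and> a + b \<noteq> 0"
 by (simp add: sq_letters_def)

lemma mem_par: "(a, b) \<in> par_letters m \<longleftrightarrow> 1 \<le> \<bar>a\<bar> \<and> \<bar>a\<bar> \<le> int m \<and> 1 \<le> \<bar>b\<bar> \<and> \<bar>b\<bar> \<le> int m \<and>
  a + b \<noteq> 0 \<and> (a = - int m --> b = a) \<and> (b = int m --> a = b)"
 by (simp add: par_letters_def)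

lemma mem_levi: "(a, b) \<in> levi_letters m \<longleftrightarrow>
  1 \<le> \<bar>a\<bar> \<and> \<bar>a\<bar> \<le> int m \<and> 1 \<le> \<bar>b\<bar> \<and> \<bar>b\<bar> \<le> int m \<and> a + b \<noteq> 0 \<and>
  (\<bar>a\<bar> = int m \<longleftrightarrow> \<bar>b\<bar> = int m)"
 by (simp add: levi_letters_def)

lemma mem_column:
 assumes "1 \<le> m"
 shows "(a, b) \<in> col_letters c (m - 1) \<longleftrightarrow>
  a = c \<and> 1 \<le> \<bar>b\<bar> \<and> \<bar>b\<bar> < int m \<or> b = - c \<and> 1 \<le> \<bar>a\<bar> \<and> \<bar>a\<bar> < int m"
 using assms unfolding col_letters_def by (auto simp: of_nat_diff)

lemma letter_set_eqI: "(\<And>a b. (a, b) \<in> A \<longleftrightarrow> (a, b) \<in> B) ==> A = (B :: (int \<times> int) set)"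
 by (auto simp: set_eq_iff)

lemma square_split:
 assumes "1 \<le> m"
 shows "sq_letters m = par_letters m \<union> col_letters (- int m) (m - 1)"
proof -
 have "(a, b) \<in> sq_letters m \<longleftrightarrow>
   (a, b) \<in> par_letters m \<or> (a, b) \<in> col_letters (- int m) (m - 1)" for a b
  unfolding mem_square mem_par mem_column[OF assms] by (smt (verit))
 thus ?thesis by (intro letter_set_eqI) (simp only: Un_iff)
qed

lemma parabolic_split:
 assumes "1 \<le> m"
 shows "par_letters m = levi_letters m \<union> col_letters (int m) (m - 1)"
proof -
 have "(a, b) \<in> par_letters m \<longleftrightarrow>
   (a, b) \<in> levi_letters m \<or> (a, b) \<in> col_letters (int m) (m - 1)" for a b
  unfolding mem_levi mem_par mem_column[OF assms] by (smt (verit))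
 thus ?thesis by (intro letter_set_eqI) (simp only: Un_iff)
qed

lemma raising_sgn:
 assumes "\<bar>a\<bar> \<le> int n" "\<bar>b\<bar> \<le> int n"
 shows "raising n (a, b) \<longleftrightarrow> a > 0 \<and> b \<le> 0 \<or> a > 0 \<and> b > a \<or> a = 0 \<and> b < 0 \<or> a < 0 \<and> b < 0 \<and> b > a"
proof -
 have "height n x = (if x > 0 then int n + 1 - x else if x = 0 then 0 else - (int n + 1 + x))" for x
  by (auto simp: height_def sgn_if)
 thus ?thesis using assms unfolding raising_def by (smt (verit) fst_conv snd_conv)
qed

text \<open>As \<open>S\<close> is closed under \<open>mirror\<close>, the last two terms of the
  bracket are the first two for the mirrored letter. Only compositions of letters with a common
  inner index have to be checked.\<close>

lemma bracket_inI:
 assumes "mirror ` S \<subseteq> S" and "\<And>a b d. (a, b) \<in> S ==> (b, d) \<in> T ==> a + d \<noteq> 0 ==> (a, d) \<in> R"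
  and "\<And>a b d. (a, b) \<in> T ==> (b, d) \<in> S ==> a + d \<noteq> 0 ==> (a, d) \<in> R"
 shows "bracket_in S T R"
 unfolding bracket_in_def
proof (intro allI impI)
 fix a b c d assume S: "(a, b) \<in> S" and T: "(c, d) \<in> T"
 have S': "(- b, - a) \<in> S" using S assms(1) by (force simp: mirror_def image_subset_iff)
 show "(b = c --> a + d = 0 \<or> (a, d) \<in> R) \<and> (a = d --> b + c = 0 \<or> (c, b) \<in> R) \<and>
   (c = - a --> b = d \<or> (- b, d) \<in> R) \<and> (d = - b --> a = c \<or> (c, - a) \<in> R)"
 proof (intro conjI impI)
  assume "b = c" thus "a + d = 0 \<or> (a, d) \<in> R" using assms(2)[of a b d] S T by auto
 next
  assume "a = d" thus "b + c = 0 \<or> (c, b) \<in> R" using assms(3)[of c a b] S T by (auto simp: add.commute)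
 next
  assume "c = - a" thus "b = d \<or> (- b, d) \<in> R" using assms(2)[of "- b" "- a" d] S' T by auto
 next
  assume "d = - b" thus "a = c \<or> (c, - a) \<in> R" using assms(3)[of c "- b" "- a"] S' T by auto
 qed
qed

lemma mirror_subsetI: "(\<And>a b. (a, b) \<in> S ==> (- b, - a) \<in> S) ==> mirror ` S \<subseteq> S"
 by (auto simp: mirror_def)

lemma mirror_column: "mirror ` col_letters c m \<subseteq> col_letters c m"
 by (rule mirror_subsetI) (auto simp: col_letters_def)

lemma raising_nonzero_cases:
 assumes "raising n (a, b)" "\<bar>a\<bar> \<le> int n" "\<bar>b\<bar> \<le> int n" "a \<noteq> 0" "b \<noteq> 0"
 obtains "a > 0" "b > a" | "a < 0" "b < 0" "b > a" | "a > 0" "b < 0"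
proof -
 have "a > 0 \<and> b \<le> 0 \<or> a > 0 \<and> b > a \<or> a = 0 \<and> b < 0 \<or> a < 0 \<and> b < 0 \<and> b > a"
  using raising_sgn[OF assms(2,3)] assms(1) by simp
 thus thesis using assms(4,5) by (elim disjE conjE) (use that in linarith)+
qed

lemma bracket_in_singleI:
 assumes "1 \<le> a ==> a \<le> int r ==> c + b = 0 \<or> (c, b) \<in> R"
  and "\<And>k. 1 \<le> k ==> k \<le> int r ==> b = c ==> (a, k) \<in> R"
  and "\<And>k. 1 \<le> k ==> k \<le> int r ==> a = - c ==> k = b \<or> (- k, b) \<in> R"
  and "1 \<le> - b ==> - b \<le> int r ==> c = a \<or> (a, - c) \<in> R"
 shows "bracket_in (col_lowering c r) {(a, b)} R"
 unfolding bracket_in_def col_lowering_def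
proof (intro allI impI, goal_cases)
 case (1 c' k a' b')
 hence e: "c' = c" "a' = a" "b' = b" and k: "1 \<le> k" "k \<le> int r" by auto
 show ?case unfolding e
 proof (intro conjI impI)
  assume "k = a" thus "c + b = 0 \<or> (c, b) \<in> R" using assms(1) k by simp
 next
  assume "c = b" thus "k + a = 0 \<or> (a, k) \<in> R" using assms(2) k by simp
 next
  assume "a = - c" thus "k = b \<or> (- k, b) \<in> R" using assms(3) k by simp
 next
  assume "b = - k" thus "c = a \<or> (a, - c) \<in> R" using assms(4) k by simp
 qed
qed

section \<open>The three kinds of columns\<close>

context so_rep
begin

lemma so_column_short: "so_column scale n F (sq_letters n) 0 n Short (long_roots n)"
proof
 show "pos_raising n y \<or> pos_raising n (mirror y) \<or>
   bracket_in (col_lowering 0 n) {y} (sq_letters n \<union> col_raising 0 n)"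
  if y: "y \<in> sq_letters n" "raising n y" for y
 proof -
  obtain a b where [simp]: "y = (a, b)" by fastforce
  have r: "\<bar>a\<bar> \<le> int n" "\<bar>b\<bar> \<le> int n" "a \<noteq> 0" "b \<noteq> 0" using y by (auto simp: sq_letters_def)
  have "raising n (a, b)" using y by simp
  from this r show ?thesis
  proof (cases rule: raising_nonzero_cases)
   case 3
   \<comment> \<open>A letter with positive first and negative second index turns a lowering letter
     of the column into a raising one: the bracket of \<open>F 0 a\<close> with \<open>F a b\<close>
     is \<open>F 0 b\<close> with \<open>b < 0\<close>.\<close>
   have "bracket_in (col_lowering 0 n) {y} (sq_letters n \<union> col_raising 0 n)"
    using 3 r unfolding bracket_in_def by (auto simp: col_lowering_def col_raising_def)
   thus ?thesis by blast
  qed (use r in \<open>auto simp: pos_raising_def mirror_def\<close>)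
 qed
 show "lowering_list (sq_letters n) (long_roots n)"
  unfolding lowering_list_def using normal_square rank_sorted_long by blast
 have "{x \<in> all_letters n. normal_lowering x}
   = letter ` set (long_roots n) \<union> letter ` set (short_roots n)"
  unfolding letter_long letter_short
  by (auto simp: sq_letters_def col_letters_def normal_lowering_def)
 moreover have "map Short [1..<Suc n] = short_roots n" by (simp add: short_roots_def)
 ultimately show "lowering_list (all_letters n) (long_roots n @ map Short [1..<Suc n])"
  unfolding lowering_list_def using rank_sorted_long_short by (simp add: image_Un)
 show "raising n y" if "y \<in> col_raising 0 n" for y
  using that by (auto simp: col_raising_def raising_sgn)
 show ms: "mirror ` sq_letters n \<subseteq> sq_letters n"
  by (rule mirror_subsetI) (auto simp: sq_letters_def)
 have mem0: "(a, b) \<in> col_letters 0 n \<longleftrightarrow>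
   a = 0 \<and> 1 \<le> \<bar>b\<bar> \<and> \<bar>b\<bar> \<le> int n \<or> b = 0 \<and> 1 \<le> \<bar>a\<bar> \<and> \<bar>a\<bar> \<le> int n" for a b
  by (simp add: col_letters_def)
 show "bracket_in (sq_letters n) (sq_letters n) (sq_letters n)"
  by (rule bracket_inI[OF ms]; unfold mem_square; smt (verit))
 show "bracket_in (sq_letters n) (col_letters 0 n) (all_letters n)"
  by (rule bracket_inI[OF ms]; unfold mem_square mem0 Un_iff; smt (verit))
 show "bracket_in (col_letters 0 n) (sq_letters n) (all_letters n)"
  by (rule bracket_inI[OF mirror_column]; unfold mem_square mem0 Un_iff; smt (verit))
 show "bracket_in (col_letters 0 n) (col_letters 0 n) (sq_letters n)"
  by (rule bracket_inI[OF mirror_column]; unfold mem_square mem0; smt (verit))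
qed (auto simp: sq_letters_def letter_range_def col_letters_def)

lemma normal_parabolic:
 assumes "2 \<le> m" "m \<le> n"
 shows "{x \<in> par_letters m. normal_lowering x}
   = letter ` set (long_roots (m - 1)) \<union> letter ` set (minus_roots m)"
proof (rule letter_set_eqI)
 have mi: "int (m - 1) = int m - 1" "int m \<le> int n" "2 \<le> int m" using assms by auto
 fix a b
 show "(a, b) \<in> {x \<in> par_letters m. normal_lowering x} \<longleftrightarrow>
   (a, b) \<in> letter ` set (long_roots (m - 1)) \<union> letter ` set (minus_roots m)"
  unfolding letter_long letter_minus mem_Collect_eq Un_iff mem_par normal_lowering_def
   fst_conv snd_conv prod.case mi(1) using mi(2,3) by (smt (verit))
qed

lemma so_column_plus:
 assumes m: "2 \<le> m" "m \<le> n"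
 shows "so_column scale n F (par_letters m) (- int m) (m - 1) (%i. Plus i m)
  (long_roots (m - 1) @ minus_roots m)"
proof
 have m1: "1 \<le> m" and mi: "int (m - 1) = int m - 1" and mn: "int m \<le> int n" "2 \<le> int m"
  using m by auto
 note mem = mem_par mem_square mem_column[OF m1]
 show "pos_raising (m - 1) y \<or> pos_raising (m - 1) (mirror y) \<or>
   bracket_in (col_lowering (- int m) (m - 1)) {y} (par_letters m \<union> col_raising (- int m) (m - 1))"
  if y: "y \<in> par_letters m" "raising n y" for y
 proof -
  obtain a b where ab: "y = (a, b)" by fastforce
  have P: "(a, b) \<in> par_letters m" using y ab by simp
  have r: "\<bar>a\<bar> \<le> int n" "\<bar>b\<bar> \<le> int n" "a \<noteq> 0" "b \<noteq> 0" using P mn unfolding mem_par by auto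
  have "raising n (a, b)" using y ab by simp
  from this r show ?thesis
  proof (cases rule: raising_nonzero_cases)
   case 3
   have col: "(x, z) \<in> col_raising (- int m) (m - 1) \<longleftrightarrow>
     x = - int m \<and> 1 \<le> - z \<and> - z \<le> int m - 1 \<or> z = int m \<and> 1 \<le> x \<and> x \<le> int m - 1" for x z
    unfolding col_raising_def mi by simp
   have "bracket_in (col_lowering (- int m) (m - 1)) {y}
     (par_letters m \<union> col_raising (- int m) (m - 1))"
    unfolding ab by (rule bracket_in_singleI; unfold Un_iff col mem_par;
     use 3 P[unfolded mem_par] mn mi in \<open>smt (verit)\<close>)
   thus ?thesis by blast
  qed (use P[unfolded mem_par] mi in \<open>auto simp: ab pos_raising_def mirror_def\<close>)
 qed
 show "lowering_list (par_letters m) (long_roots (m - 1) @ minus_roots m)"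
  unfolding lowering_list_def normal_parabolic[OF m]
  using rank_sorted_long_minus[OF rank_sorted_long] m by (simp add: image_Un)
 have "map (%i. Plus i m) [1..<Suc (m - 1)] = plus_roots m" using m by (simp add: plus_roots_def)
 hence "(long_roots (m - 1) @ minus_roots m) @ map (%i. Plus i m) [1..<Suc (m - 1)] = long_roots m"
  using long_roots_Suc[of m] m by simp
 thus "lowering_list (par_letters m \<union> col_letters (- int m) (m - 1))
   ((long_roots (m - 1) @ minus_roots m) @ map (%i. Plus i m) [1..<Suc (m - 1)])"
  unfolding lowering_list_def square_split[OF m1, symmetric]
  using m by (simp add: normal_square rank_sorted_long)
 show "raising n y" if "y \<in> col_raising (- int m) (m - 1)" for y
  using that mn unfolding col_raising_def mi by (auto simp: raising_sgn)
 show mp: "mirror ` par_letters m \<subseteq> par_letters m" by (rule mirror_subsetI) (auto simp: mem_par)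
 show "bracket_in (par_letters m) (par_letters m) (par_letters m)"
  by (rule bracket_inI[OF mp]; unfold mem; smt (verit))
 show "bracket_in (par_letters m) (col_letters (- int m) (m - 1))
   (par_letters m \<union> col_letters (- int m) (m - 1))"
  unfolding square_split[OF m1, symmetric]
  by (rule bracket_inI[OF mp]; unfold mem; smt (verit))
 show "bracket_in (col_letters (- int m) (m - 1)) (par_letters m)
   (par_letters m \<union> col_letters (- int m) (m - 1))"
  unfolding square_split[OF m1, symmetric]
  by (rule bracket_inI[OF mirror_column]; unfold mem; smt (verit))
 show "bracket_in (col_letters (- int m) (m - 1)) (col_letters (- int m) (m - 1)) (par_letters m)"
  by (rule bracket_inI[OF mirror_column]; unfold mem; smt (verit))
 have "(a, b) \<notin> par_letters m \<inter> col_letters (- int m) (m - 1)" for a b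
  unfolding mem Int_iff by (smt (verit))
 thus "par_letters m \<inter> col_letters (- int m) (m - 1) = {}" by (intro letter_set_eqI) simp
 show "sq_letters (m - 1) \<subseteq> par_letters m" by (auto simp: sq_letters_def mem_par mi)
 show "par_letters m \<subseteq> letter_range n" using mn by (auto simp: mem_par letter_range_def)
qed (use m in \<open>auto simp: of_nat_diff\<close>)

lemma so_column_minus:
 assumes m: "2 \<le> m" "m \<le> n"
 shows "so_column scale n F (levi_letters m) (int m) (m - 1) (%i. Minus i m) (long_roots (m - 1))"
proof
 have m1: "1 \<le> m" and mi: "int (m - 1) = int m - 1" and mn: "int m \<le> int n" "2 \<le> int m"
  using m by auto
 note mem = mem_par mem_levi mem_column[OF m1]
 show "pos_raising (m - 1) y \<or> pos_raising (m - 1) (mirror y) \<or>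
   bracket_in (col_lowering (int m) (m - 1)) {y} (levi_letters m \<union> col_raising (int m) (m - 1))"
  if y: "y \<in> levi_letters m" "raising n y" for y
 proof -
  obtain a b where ab: "y = (a, b)" by fastforce
  have P: "(a, b) \<in> levi_letters m" using y ab by simp
  have r: "\<bar>a\<bar> \<le> int n" "\<bar>b\<bar> \<le> int n" "a \<noteq> 0" "b \<noteq> 0" using P mn unfolding mem_levi by auto
  have "raising n (a, b)" using y ab by simp
  from this r show ?thesis
  proof (cases rule: raising_nonzero_cases)
   case 3
   have col: "(x, z) \<in> col_raising (int m) (m - 1) \<longleftrightarrow>
     x = int m \<and> 1 \<le> - z \<and> - z \<le> int m - 1 \<or> z = - int m \<and> 1 \<le> x \<and> x \<le> int m - 1" for x z
    unfolding col_raising_def mi by simp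
   have "bracket_in (col_lowering (int m) (m - 1)) {y} (levi_letters m \<union> col_raising (int m) (m - 1))"
    unfolding ab by (rule bracket_in_singleI; unfold Un_iff col mem_levi;
     use 3 P[unfolded mem_levi] mn mi in \<open>smt (verit)\<close>)
   thus ?thesis by blast
  qed (use P[unfolded mem_levi] mi in \<open>auto simp: ab pos_raising_def mirror_def\<close>)
 qed
 have n1: "{x \<in> levi_letters m. normal_lowering x} = letter ` set (long_roots (m - 1))"
 proof (rule letter_set_eqI)
  fix a b
  show "(a, b) \<in> {x \<in> levi_letters m. normal_lowering x} \<longleftrightarrow>
    (a, b) \<in> letter ` set (long_roots (m - 1))"
   unfolding letter_long mem_Collect_eq mem_levi normal_lowering_def
    fst_conv snd_conv prod.case mi using mn by (smt (verit))
 qed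
 show "lowering_list (levi_letters m) (long_roots (m - 1))"
  unfolding lowering_list_def n1 using m by (simp add: rank_sorted_long)
 have "map (%i. Minus i m) [1..<Suc (m - 1)] = minus_roots m" using m by (simp add: minus_roots_def)
 thus "lowering_list (levi_letters m \<union> col_letters (int m) (m - 1))
   (long_roots (m - 1) @ map (%i. Minus i m) [1..<Suc (m - 1)])"
  unfolding lowering_list_def parabolic_split[OF m1, symmetric] normal_parabolic[OF m]
  using rank_sorted_long_minus[OF rank_sorted_long] m by (simp add: image_Un)
 show "raising n y" if "y \<in> col_raising (int m) (m - 1)" for y
  using that mn unfolding col_raising_def mi by (auto simp: raising_sgn)
 show mp: "mirror ` levi_letters m \<subseteq> levi_letters m" by (rule mirror_subsetI) (auto simp: mem_levi)
 show "bracket_in (levi_letters m) (levi_letters m) (levi_letters m)"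
  by (rule bracket_inI[OF mp]; unfold mem; smt (verit))
 show "bracket_in (levi_letters m) (col_letters (int m) (m - 1))
   (levi_letters m \<union> col_letters (int m) (m - 1))"
  unfolding parabolic_split[OF m1, symmetric]
  by (rule bracket_inI[OF mp]; unfold mem; smt (verit))
 show "bracket_in (col_letters (int m) (m - 1)) (levi_letters m)
   (levi_letters m \<union> col_letters (int m) (m - 1))"
  unfolding parabolic_split[OF m1, symmetric]
  by (rule bracket_inI[OF mirror_column]; unfold mem; smt (verit))
 show "bracket_in (col_letters (int m) (m - 1)) (col_letters (int m) (m - 1)) (levi_letters m)"
  by (rule bracket_inI[OF mirror_column]; unfold mem; smt (verit))
 have "(a, b) \<notin> levi_letters m \<inter> col_letters (int m) (m - 1)" for a b
  unfolding mem Int_iff by (smt (verit))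
 thus "levi_letters m \<inter> col_letters (int m) (m - 1) = {}" by (intro letter_set_eqI) simp
 show "sq_letters (m - 1) \<subseteq> levi_letters m" by (auto simp: sq_letters_def mem_levi mi)
 show "levi_letters m \<subseteq> letter_range n" using mn by (auto simp: mem_levi letter_range_def)
qed (use m in \<open>auto simp: of_nat_diff\<close>)

end

section \<open>Upper bounds\<close>

context so_column
begin

text \<open>Here each crossing lands in \<open>L\<close> alone and hence loses a column letter, so
  entire words in \<open>L\<close> cross the column to leading order. In this way relations on
  \<open>w\<close> between letters of the next block are carried past the current one.\<close>

lemma pass_Low_word:
 assumes "set ys \<subseteq> L" "\<And>y. y \<in> set ys ==> bracket_in (col_lowering c r) {y} L"
 shows "mono col p (foldr X ys u) - foldr X ys (mono col p u) \<in> Low u (sum_list (map p col))"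
 using assms
proof (induction ys)
 case (Cons y ys)
 let ?d = "sum_list (map p col)" and ?v = "foldr X ys u"
 have y: "y \<in> L" "y \<in> G" "y \<in> letter_range n" using Cons.prems(1) L_range by auto
 have ysG: "set ys \<subseteq> G" using Cons.prems(1) by auto
 have ysL: "set ys \<subseteq> L" using Cons.prems(1) by auto
 have deg0: "sum_list (map deg ys) = 0" using ysL by (induction ys) (auto simp: deg_L)
 have "foldr X (word p) (X y ?v) - X y (foldr X (word p) ?v) \<in> Low ?v (length (word p) + deg y)"
 proof (rule pass_Low[OF set_word_C y(2)])
  show "X x (X y u') - X y (X x u') \<in> span {X z u' | z. z \<in> L}" if "x \<in> set (word p)" for x u'
  proof (rule bracket_in_span)
   show "bracket_in (col_lowering c r) {y} L" using Cons.prems(2) by simp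
   show "col_lowering c r \<subseteq> letter_range n" using col_lowering_sub C_range by blast
  qed (use that set_word y in auto)
 qed
 hence "mono col p (X y ?v) - X y (mono col p ?v) \<in> Low ?v ?d"
  unfolding word_mono length_word deg_L[OF y(1)] by simp
 hence 1: "mono col p (X y ?v) - X y (mono col p ?v) \<in> Low u ?d"
  using Low_shift[OF ysG, of u ?d] unfolding deg0 by auto
 have IH: "mono col p ?v - foldr X ys (mono col p u) \<in> Low u ?d"
  using Cons.IH[OF ysL] Cons.prems(2) by simp
 have "set [y] \<subseteq> G" using y by simp
 from Low_word[OF IH this] have 2: "X y (mono col p ?v) - X y (foldr X ys (mono col p u)) \<in> Low u ?d"
  using y by (simp add: deg_L lin_diff[OF X_lin])
 from subspace_diff_trans[OF Low_subspace 1 2] show ?case by simp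
qed (use subspace_0[OF Low_subspace] in simp)

end

section \<open>Strings of sl2 modulo a subspace\<close>

context complex_space
begin

text \<open>At the first power of \<open>f\<close> that is negligible, applying \<open>e\<close>
  returns a multiple of the preceding power, which is not negligible; so the coefficient must
  vanish.\<close>

lemma sl2_aux:
 assumes S: "subspace S" and e: "\<And>u. u \<in> S ==> e u \<in> S"
  and step: "\<And>j. e ((f ^^ Suc j) w) - scale (of_real (real (Suc j) * (\<kappa> - \<gamma> / 2 * real j))) ((f ^^ j) w) \<in> S"
  and nil: "(f ^^ N) w \<in> S"
 shows "w \<in> S \<or> (\<exists>j. \<kappa> = \<gamma> / 2 * real j \<and> (f ^^ Suc j) w \<in> S)"
proof (cases "w \<in> S")
 case False
 define N0 where "N0 = (LEAST N. (f ^^ N) w \<in> S)"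
 have N0: "(f ^^ N0) w \<in> S" unfolding N0_def using nil by (rule LeastI)
 have less: "(f ^^ k) w \<notin> S" if "k < N0" for k using that not_less_Least unfolding N0_def by blast
 have "N0 \<noteq> 0"
 proof
  assume "N0 = 0"
  thus False using N0 False by simp
 qed
 then obtain j where j: "N0 = Suc j" by (cases N0) auto
 have "e ((f ^^ Suc j) w) \<in> S" using N0 unfolding j by (rule e)
 hence "scale (of_real (real (Suc j) * (\<kappa> - \<gamma> / 2 * real j))) ((f ^^ j) w) \<in> S"
  using subspace_cong_mem[OF S step[of j]] by blast
 moreover have "(f ^^ j) w \<notin> S" using less j by simp
 ultimately have "complex_of_real (real (Suc j) * (\<kappa> - \<gamma> / 2 * real j)) = 0"
  using subspace_scale_cancel[OF S] by blast
 hence "real (Suc j) * (\<kappa> - \<gamma> / 2 * real j) = 0" unfolding of_real_eq_0_iff .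
 hence "\<kappa> = \<gamma> / 2 * real j" by simp
 thus ?thesis using N0 unfolding j by blast
qed simp

end

context so_rep
begin

lemma sl2_dichotomy:
 assumes ab: "\<bar>a\<bar> \<le> int n" "\<bar>b\<bar> \<le> int n" "a \<noteq> b" "a + b \<noteq> 0" "a \<noteq> 0"
  and S: "subspace S" and stab: "\<And>u. u \<in> S ==> F a b u \<in> S" "\<And>u. u \<in> S ==> F b a u \<in> S"
  and w: "F a b w \<in> S" "F a a w - F b b w = scale (of_real \<kappa>) w"
  and nil: "(F b a ^^ N) w \<in> S"
 shows "w \<in> S \<or> (\<exists>j. \<kappa> = (if b = 0 then 1 else 2) / 2 * real j \<and> (F b a ^^ Suc j) w \<in> S)"
proof (rule sl2_aux[where e = "F a b" and f = "F b a", OF S stab(1) _ nil])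
 fix j
 \<comment> \<open>The amount by which \<open>F b a\<close> lowers the eigenvalue of
   \<open>F a a - F b b\<close>. For a short root \<open>F 0 0\<close> vanishes and the step is 1
   instead of 2, so half-integral values of \<kappa> occur.\<close>
 define \<gamma> :: real where "\<gamma> = (if b = 0 then 1 else 2)"
 have lin_ba: "lin (F b a)" and lin_aa: "lin (F a a)" and lin_bb: "lin (F b b)" and lin_ab: "lin (F a b)"
  using ab by (auto intro: F_lin)
 have comm: "F a b (F b a u) = F b a (F a b u) + (F a a u - F b b u)" for u
  using F_comm[of a b b a u] ab by (auto simp: algebra_simps)
 have h: "F a a (F b a u) - F b b (F b a u)
   = F b a (F a a u - F b b u) - scale (of_real \<gamma>) (F b a u)" for u
 proof -
  have 1: "F a a (F b a u) = F b a (F a a u) - F b a u"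
   using F_comm[of a a b a u] ab by (auto simp: algebra_simps)
  have 2: "F b b (F b a u) = F b a (F b b u) + (if b = 0 then 0 else F b a u)"
   using F_comm[of b b b a u] ab by (auto simp: algebra_simps)
  show ?thesis unfolding 1 2 lin_diff[OF lin_ba]
   using scale_left_distrib[of 1 1 "F b a u"] by (auto simp: \<gamma>_def algebra_simps)
 qed
 have hj: "F a a ((F b a ^^ j) w) - F b b ((F b a ^^ j) w)
   = scale (of_real (\<kappa> - \<gamma> * real j)) ((F b a ^^ j) w)" for j
 proof (induction j)
  case (Suc j)
  have "F a a ((F b a ^^ Suc j) w) - F b b ((F b a ^^ Suc j) w)
    = scale (of_real (\<kappa> - \<gamma> * real j) - of_real \<gamma>) ((F b a ^^ Suc j) w)"
   using h[of "(F b a ^^ j) w"] unfolding Suc.IH lin_scale[OF lin_ba] scale_left_diff_distrib by simp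
  also have "of_real (\<kappa> - \<gamma> * real j) - of_real \<gamma> = complex_of_real (\<kappa> - \<gamma> * real (Suc j))"
   by (simp add: algebra_simps)
  finally show ?case .
 qed (use w in simp)
 show "F a b ((F b a ^^ Suc j) w)
   - scale (of_real (real (Suc j) * (\<kappa> - (if b = 0 then 1 else 2) / 2 * real j))) ((F b a ^^ j) w) \<in> S"
  unfolding \<gamma>_def[symmetric]
 proof (induction j)
  case 0
  have "F a b ((F b a ^^ Suc 0) w) - scale (of_real (real (Suc 0) * (\<kappa> - \<gamma> / 2 * real 0))) ((F b a ^^ 0) w)
    = F b a (F a b w)"
   using comm[of w] w(2) by simp
  thus ?case using stab(2)[OF w(1)] by (simp only:)
 next
  case (Suc j)
  define c :: complex where "c = of_real (real (Suc j) * (\<kappa> - \<gamma> / 2 * real j))"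
  define d :: complex where "d = of_real (\<kappa> - \<gamma> * real (Suc j))"
  have cd: "complex_of_real (real (Suc (Suc j)) * (\<kappa> - \<gamma> / 2 * real (Suc j))) = c + d"
   unfolding c_def d_def of_real_add[symmetric] of_real_eq_iff by (simp add: field_simps)
  define t where "t = (F b a ^^ Suc j) w"
  have "F b a (F a b t - scale c ((F b a ^^ j) w)) \<in> S"
   unfolding t_def c_def by (rule stab(2)[OF Suc.IH])
  hence 1: "F b a (F a b t) - scale c t \<in> S"
   unfolding lin_diff[OF lin_ba] lin_scale[OF lin_ba] t_def by simp
  have "F a b ((F b a ^^ Suc (Suc j)) w) = F b a (F a b t) + scale d t"
   using comm[of t] hj[of "Suc j"] by (simp add: t_def d_def)
  hence "F a b ((F b a ^^ Suc (Suc j)) w) - scale (c + d) t = F b a (F a b t) - scale c t"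
   by (simp add: scale_left_distrib)
  thus ?case using 1 unfolding cd t_def[symmetric] by (simp only:)
 qed
qed

lemma funpow_mem_mono:
 assumes "\<And>u. u \<in> S ==> f u \<in> S" "(f ^^ j) w \<in> S" "j \<le> k"
 shows "(f ^^ k) w \<in> S"
 using assms(3)
proof (induction k rule: dec_induct)
 case (step k)
 thus ?case using assms(1) by simp
qed (rule assms(2))

lemma sl2_kill:
 assumes ab: "\<bar>a\<bar> \<le> int n" "\<bar>b\<bar> \<le> int n" "a \<noteq> b" "a + b \<noteq> 0" "a \<noteq> 0"
  and S: "subspace S" and stab: "\<And>u. u \<in> S ==> F a b u \<in> S" "\<And>u. u \<in> S ==> F b a u \<in> S"
  and w: "F a b w \<in> S" "F a a w - F b b w = scale (of_real \<kappa>) w"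
  and nil: "(F b a ^^ N) w \<in> S"
  and k: "\<kappa> < (if b = 0 then 1 else 2) / 2 * real k"
 shows "(F b a ^^ k) w \<in> S"
 using sl2_dichotomy[OF ab S stab w nil]
proof
 assume "w \<in> S"
 thus ?thesis using funpow_mem_mono[of S "F b a" 0 w k] stab(2) by simp
next
 assume "\<exists>j. \<kappa> = (if b = 0 then 1 else 2) / 2 * real j \<and> (F b a ^^ Suc j) w \<in> S"
 then obtain j where j: "\<kappa> = (if b = 0 then 1 else 2) / 2 * real j" "(F b a ^^ Suc j) w \<in> S" by blast
 have "real j < real k" using k j(1) by (cases "b = 0") simp_all
 hence "Suc j \<le> k" by simp
 thus ?thesis using funpow_mem_mono[of S "F b a" "Suc j" w k] stab(2) j(2) by blast
qed

text \<open>Stands in for finite dimensionality: it makes every string terminate.\<close>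

definition loc_nilpotent :: bool where
 "loc_nilpotent \<longleftrightarrow> (\<forall>a b u. \<bar>a\<bar> \<le> int n --> \<bar>b\<bar> \<le> int n --> a \<noteq> b --> a + b \<noteq> 0 -->
   (\<exists>N. (F a b ^^ N) u = 0))"

lemma datum_sl2:
 assumes datum: "datum G w U \<mu>" and nil: loc_nilpotent
  and ab: "(a, b) \<in> G" "(b, a) \<in> G" "raising n (a, b)"
   "\<bar>a\<bar> \<le> int n" "\<bar>b\<bar> \<le> int n" "a \<noteq> b" "a + b \<noteq> 0" "a \<noteq> 0"
  and w: "F a a w - F b b w = scale (of_real \<kappa>) w"
 shows "w \<in> U \<or> (\<exists>j. \<kappa> = (if b = 0 then 1 else 2) / 2 * real j)"
  and "\<kappa> < (if b = 0 then 1 else 2) / 2 * real k ==> (F b a ^^ k) w \<in> U"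
proof -
 have U: "stable G U" using datum by (rule datum_stable)
 have S: "subspace U" using U by (rule stable_subspace)
 have st: "F a b u \<in> U" "F b a u \<in> U" if "u \<in> U" for u
  using stable_X[OF U ab(1) that] stable_X[OF U ab(2) that] by simp_all
 have e: "F a b w \<in> U" using datum_raising[OF datum ab(1,3)] by simp
 obtain N where "(F b a ^^ N) w = 0" using nil ab unfolding loc_nilpotent_def by (metis add.commute)
 hence N: "(F b a ^^ N) w \<in> U" using subspace_0[OF S] by simp
 show "w \<in> U \<or> (\<exists>j. \<kappa> = (if b = 0 then 1 else 2) / 2 * real j)"
  using sl2_dichotomy[OF ab(4-8) S st e w N] by blast
 show "(F b a ^^ k) w \<in> U" if "\<kappa> < (if b = 0 then 1 else 2) / 2 * real k"
  using sl2_kill[OF ab(4-8) S st e w N that] .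
qed

end

text \<open>Here \<mu> is the weight before both blocks of index \<open>m\<close>. The clause with a
  difference of \<open>Plus\<close> exponents is the string condition for the weight after the block
  of \<open>Plus\<close> roots, expressed in \<mu>. The last two clauses come from strings inside
  so(2m) that leave the parabolic, so they are governed directly by the weight before that
  block.\<close>

definition column_cond :: "nat => (int => real) => (root => nat) => bool" where
 "column_cond m \<mu> p \<longleftrightarrow> (\<forall>i\<in>{1..m - 2}. real (p (Plus i m)) \<le> \<mu> (int i) - \<mu> (int (Suc i))) \<and>
  real (p (Plus (m - 1) m)) \<le> \<mu> (int (m - 1)) + \<mu> (int m) \<and>
  (\<forall>i\<in>{1..m - 2}. real (p (Minus i m)) + real (p (Plus i m)) - real (p (Plus (Suc i) m))
   \<le> \<mu> (int i) - \<mu> (int (Suc i))) \<and>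
  real (p (Minus (m - 1) m)) \<le> \<mu> (int (m - 1)) - \<mu> (int m) \<and>
  (3 \<le> m --> real (p (Minus (m - 1) m)) + real (p (Plus (m - 2) m)) + real (p (Minus (m - 2) m))
   \<le> \<mu> (int (m - 2)) - \<mu> (int m))"

fun long_blocks :: "nat => root list list" where
 "long_blocks m = concat (map (%j. [plus_roots j, minus_roots j]) (rev [2..<Suc m]))"

declare long_blocks.simps [simp del]

lemma long_blocks_Suc:
 assumes "2 \<le> m"
 shows "long_blocks m = plus_roots m # minus_roots m # long_blocks (m - 1)"
proof -
 have "[2..<Suc m] = [2..<m] @ [m]" using assms by (simp add: upt_Suc)
 moreover have "Suc (m - 1) = m" using assms by simp
 ultimately show ?thesis by (simp add: long_blocks.simps)
qed

lemma long_blocks_small: "m < 2 ==> long_blocks m = []" by (simp add: long_blocks.simps)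

lemma concat_long_blocks: "concat (rev (long_blocks m)) = long_roots m"
proof (induction m)
 case (Suc m)
 thus ?case using long_blocks_Suc[of "Suc m"] long_roots_Suc[of "Suc m"]
  by (cases "m = 0") (simp_all add: long_blocks_small long_roots_small)
qed (simp add: long_blocks_small long_roots_small)

section \<open>Weights and negligible vectors block by block\<close>

context so_rep
begin

definition Ublock :: "root list => root list => 'v => 'v set => (root => nat) => 'v set" where
 "Ublock K b w U p = span (U \<union> {mono K q (mono b q w) | q. block_less b q p})"

lemma U_sub_Ublock: "U \<subseteq> Ublock K b w U p" unfolding Ublock_def using span_superset by blast

lemma datum_cong:
 assumes "datum G w U \<mu>" "\<And>i. 0 < i ==> (i, i) \<in> G ==> \<mu> i = \<nu> i"
 shows "datum G w U \<nu>"
 using assms unfolding datum_def by simp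

definition short_shift :: "(root => nat) => (int => real) => int => real" where
 "short_shift p \<mu> i = \<mu> i - real (p (Short (nat i)))"

definition plus_shift :: "nat => (root => nat) => (int => real) => int => real" where
 "plus_shift m p \<mu> i = (if i = int m then \<mu> i - real (sum_list (map p (plus_roots m)))
   else \<mu> i - real (p (Plus (nat i) m)))"

text \<open>Meant for coordinates below \<open>m\<close>, which are the ones that so(2m-2) still
  sees.\<close>

definition minus_shift :: "nat => (root => nat) => (int => real) => int => real" where
 "minus_shift m p \<mu> i = \<mu> i - real (p (Minus (nat i) m))"

abbreviation "U_short w U p \<equiv> Ublock (long_roots n) (short_roots n) w U p"
abbreviation "U_plus m w U p \<equiv> Ublock (long_roots (m - 1) @ minus_roots m) (plus_roots m) w U p"
abbreviation "U_minus m w U p \<equiv> Ublock (long_roots (m - 1)) (minus_roots m) w U p"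

interpretation S: so_column scale n F "sq_letters n" 0 n Short "long_roots n"
 by (rule so_column_short)

lemma S_col: "S.col = short_roots n" "S.Unew w U p = U_short w U p"
 by (simp_all add: S.col_def S.Unew_def Ublock_def short_roots_def)

lemma short_block:
 assumes "datum (all_letters n) w U \<mu>"
 shows "datum (sq_letters n) (mono (short_roots n) p w) (U_short w U p) (short_shift p \<mu>)"
  and "ess (short_roots n # long_blocks n) w U p \<longleftrightarrow>
   ess (long_blocks n) (mono (short_roots n) p w) (U_short w U p) p"
proof -
 show "datum (sq_letters n) (mono (short_roots n) p w) (U_short w U p) (short_shift p \<mu>)"
 proof (rule datum_cong[OF S.datum_step[OF assms, of p, unfolded S_col]])
  fix i :: int assume "0 < i" "(i, i) \<in> sq_letters n"
  thus "S.shift_weight p \<mu> i = short_shift p \<mu> i"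
   by (simp add: S.shift_weight_def short_shift_def mem_square)
 qed
 show "ess (short_roots n # long_blocks n) w U p \<longleftrightarrow>
   ess (long_blocks n) (mono (short_roots n) p w) (U_short w U p) p"
  using S.ess_step[of "long_blocks n" w U p] unfolding S_col by (simp add: concat_long_blocks)
qed

lemma datum_eigen_diff:
 assumes "datum G w U \<mu>" "(a, a) \<in> G" "(b, b) \<in> G" "0 < a" "0 < b"
 shows "F a a w - F b b w = scale (of_real (\<mu> a - \<mu> b)) w"
 using datum_weight[OF assms(1,4,2)] datum_weight[OF assms(1,5,3)]
 by (simp add: scale_left_diff_distrib)

lemma chain_kill:
 assumes datum: "datum G w U \<mu>" and nil: loc_nilpotent
  and ab: "0 < a" "a < b" "b \<le> int n" "(a, b) \<in> G" "(b, a) \<in> G" "(a, a) \<in> G" "(b, b) \<in> G"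
  and k: "\<mu> a - \<mu> b < real k"
 shows "(F b a ^^ k) w \<in> U"
proof (rule datum_sl2(2)[OF datum nil ab(4,5)])
 show "raising n (a, b)" using ab by (subst raising_sgn) auto
 show "F a a w - F b b w = scale (of_real (\<mu> a - \<mu> b)) w"
  using ab by (intro datum_eigen_diff[OF datum]) auto
qed (use ab k in auto)

text \<open>For \<open>i < n\<close> the string of the simple root \<epsilon>_i - \<epsilon>_(i+1)
  is transferred into the column by \<open>col_upper\<close>. The root \<epsilon>_n is simple itself
  and its letter is the last of the column; the factor 2 is due to the half step for short
  roots.\<close>

lemma short_upper:
 assumes n: "1 \<le> n" and datum: "datum (all_letters n) w U \<mu>" and nil: loc_nilpotent
  and viol: "(\<exists>i\<in>{1..<n}. real (p (Short i)) > \<mu> (int i) - \<mu> (int (Suc i))) \<or> real (p (Short n)) > 2 * \<mu> (int n)"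
 shows "mono (short_roots n) p w \<in> U_short w U p"
proof -
 from viol show ?thesis
 proof
  assume "\<exists>i\<in>{1..<n}. real (p (Short i)) > \<mu> (int i) - \<mu> (int (Suc i))"
  then obtain i where i: "1 \<le> i" "i < n" "real (p (Short i)) > \<mu> (int i) - \<mu> (int (Suc i))" by auto
  have "(F (int (Suc i)) (int i) ^^ p (Short i)) w \<in> U"
   by (rule chain_kill[OF datum nil]) (use i in \<open>auto simp: mem_square\<close>)
  thus ?thesis using S.col_upper[OF datum, of i p] i unfolding S_col by simp
 next
  assume v: "real (p (Short n)) > 2 * \<mu> (int n)"
  have mem: "(int n, 0) \<in> all_letters n"
   "(0, int n) \<in> all_letters n" "(int n, int n) \<in> all_letters n"
   using n by (auto simp: col_letters_def mem_square)
  have "F 0 0 w = 0" using F_antidiag[of 0 w] by simp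
  hence wt: "F (int n) (int n) w - F 0 0 w = scale (of_real (\<mu> (int n))) w"
   using datum_weight[OF datum _ mem(3)] n by simp
  have "(F 0 (int n) ^^ p (Short n)) w \<in> U"
   by (rule datum_sl2(2)[OF datum nil mem(1,2) _ _ _ _ _ _ wt])
    (use n v in \<open>auto simp: raising_sgn\<close>)
  hence "mono (short_roots n) p w \<in> U"
   using S.col_upper_last[OF datum_stable[OF datum] n] unfolding S_col by simp
  thus ?thesis using U_sub_Ublock by blast
 qed
qed

section \<open>A relation between lowering operators of gl3\<close>

lemma comm_pow:
 assumes "lin f" "\<And>u. d (f u) = f (d u) + g u" "\<And>u. g (f u) = f (g u)"
 shows "d ((f ^^ k) u) = (f ^^ k) (d u) + scale (of_nat k) ((f ^^ (k - 1)) (g u))"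
proof (induction k)
 case (Suc k)
 have gf: "g ((f ^^ k) u) = (f ^^ k) (g u)" by (induction k) (auto simp: assms(3))
 have s: "f (scale (of_nat k) ((f ^^ (k - 1)) (g u))) = scale (of_nat k) ((f ^^ k) (g u))"
  using assms(1) by (cases k) (auto simp: lin_scale lin_0)
 have "d ((f ^^ Suc k) u) = f (d ((f ^^ k) u)) + (f ^^ k) (g u)" by (simp add: assms(2) gf)
 also have "\<dots> = (f ^^ Suc k) (d u) + (scale (of_nat k) ((f ^^ k) (g u)) + scale 1 ((f ^^ k) (g u)))"
  unfolding Suc.IH lin_add[OF assms(1)] s by simp
 also have "\<dots> = (f ^^ Suc k) (d u) + scale (of_nat (Suc k)) ((f ^^ k) (g u))"
  unfolding scale_left_distrib[symmetric] by (simp add: add.commute)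
 finally show ?case by simp
qed simp

text \<open>In the span of the three lowering operators \<open>X\<close>, \<open>Y\<close>, \<open>Z\<close> of a copy of \<open>gl\<^sub>3\<close>, the relation
 \<open>X\<^sup>N w = 0\<close> propagates to \<open>X\<^sup>x Y\<^sup>y Z\<^sup>z w\<close> by applying raising operators.\<close>

lemma gl3_relation:
 assumes abc: "0 < a" "a < b" "b < c" "c \<le> int n"
  and U: "subspace U" and stab: "\<And>i j u. i \<in> {a, b, c} ==> j \<in> {a, b, c} ==> u \<in> U ==> F i j u \<in> U"
  and w: "F a b w \<in> U" "F b c w \<in> U" "F b b w = scale \<beta> w" "F c c w = scale \<gamma> w"
  and N: "\<And>k. N \<le> k ==> (F c a ^^ k) w \<in> U" and xyz: "N \<le> x + y + z"
 shows "(F c a ^^ x) ((F c b ^^ y) ((F b a ^^ z) w)) \<in> span (U \<union>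
  {(F c a ^^ (x + z - k)) ((F c b ^^ (y - (z - k))) ((F b a ^^ k) w)) | k. k < z})"
proof -
 let ?X = "F c a" and ?Y = "F c b" and ?Z = "F b a" and ?e = "F b c" and ?d = "F a b"
 define v where "v x y z = (?X ^^ x) ((?Y ^^ y) ((?Z ^^ z) w))" for x y z
 have lin: "lin (F i j)" if "i \<in> {a, b, c}" "j \<in> {a, b, c}" for i j
  using that abc by (intro F_lin) auto
 have pow_stab: "(F i j ^^ k) u \<in> U" if "i \<in> {a, b, c}" "j \<in> {a, b, c}" "u \<in> U" for i j k u
  using that stab by (induction k) auto
 have YX: "?X (?Y u) = ?Y (?X u)" for u using F_comm[of c a c b u] abc by (simp add: algebra_simps)
 have pX: "?Z (?X u) = ?X (?Z u)" for u using F_comm[of b a c a u] abc by (simp add: algebra_simps)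
 have pY: "?Z (?Y u) = ?Y (?Z u) - ?X u" for u
  using F_comm[of b a c b u] abc by (simp add: algebra_simps)
 have eX: "?e (?X u) = ?X (?e u) + ?Z u" for u
  using F_comm[of b c c a u] abc by (simp add: algebra_simps)
 have eY: "?e (?Y u) = ?Y (?e u) + (F b b u - F c c u)" for u
  using F_comm[of b c c b u] abc by (simp add: algebra_simps)
 have ep: "?e (?Z u) = ?Z (?e u)" for u using F_comm[of b c b a u] abc by (simp add: algebra_simps)
 have dX: "?d (?X u) = ?X (?d u) - ?Y u" for u
  using F_comm[of a b c a u] abc by (simp add: algebra_simps)
 have dY: "?d (?Y u) = ?Y (?d u)" for u using F_comm[of a b c b u] abc by (simp add: algebra_simps)
 have XkY: "(?X ^^ k) (?Y u) = ?Y ((?X ^^ k) u)" for k u by (induction k) (auto simp: YX)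
 have XYk: "?X ((?Y ^^ k) u) = (?Y ^^ k) (?X u)" for k u by (induction k) (auto simp: YX)
 \<comment> \<open>Applying \<open>F a b\<close> to \<open>v (Suc x) y 0\<close> trades one factor
   \<open>?X\<close> for one \<open>?Y\<close>, with the nonzero coefficient \<open>Suc x\<close> up
   to sign.\<close>
 have base: "v x y 0 \<in> U" if "N \<le> x + y" for x y using that
 proof (induction y arbitrary: x)
  case (Suc y)
  have IH: "v (Suc x) y 0 \<in> U" using Suc by simp
  have "?d ((?X ^^ Suc x) u) = (?X ^^ Suc x) (?d u) + scale (of_nat (Suc x)) ((?X ^^ x) (- ?Y u))" for u
   using comm_pow[where d = "?d" and f = "?X" and g = "%u. - ?Y u" and k = "Suc x"] lin[of c a] dX YX
   by (simp add: lin_minus)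
  hence 1: "?d (v (Suc x) y 0) = (?X ^^ Suc x) (?d ((?Y ^^ y) w))
    - scale (of_nat (Suc x)) (v x (Suc y) 0)"
   unfolding v_def lin_minus[OF lin_pow[OF lin[of c a]], simplified] by simp
  have "?d ((?Y ^^ y) w) = (?Y ^^ y) (?d w)" for y by (induction y) (auto simp: dY)
  moreover have "(?X ^^ Suc x) ((?Y ^^ y) (?d w)) \<in> U" by (intro pow_stab) (use w in auto)
  ultimately have 2: "(?X ^^ Suc x) (?d ((?Y ^^ y) w)) \<in> U" by (simp only:)
  have "?d (v (Suc x) y 0) \<in> U" using IH by (intro stab) auto
  from subspace_diff[OF U 2 this] have "scale (of_nat (Suc x)) (v x (Suc y) 0) \<in> U"
   unfolding 1 by simp
  thus ?case by (rule subspace_scale_cancel[OF U]) (simp del: of_nat_Suc)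
 qed (use N in \<open>simp add: v_def\<close>)
 \<comment> \<open>Only the existence of an eigenvalue matters, because the terms multiplied by it
   are absorbed into the span.\<close>
 have h: "\<exists>\<eta>. F b b ((?Y ^^ i) ((?Z ^^ k) w)) - F c c ((?Y ^^ i) ((?Z ^^ k) w))
   = scale \<eta> ((?Y ^^ i) ((?Z ^^ k) w))" for i k
 proof (induction i)
  case 0
  show ?case
  proof (induction k)
   case 0
   show ?case using w(3,4) by (intro exI[of _ "\<beta> - \<gamma>"]) (simp add: scale_left_diff_distrib)
  next
   case (Suc k)
   then obtain \<eta> where \<eta>: "F b b ((?Z ^^ k) w) - F c c ((?Z ^^ k) w) = scale \<eta> ((?Z ^^ k) w)"
    by auto
   define t where "t = (?Z ^^ k) w"
   have "F b b (?Z t) - F c c (?Z t) = ?Z (F b b t - F c c t) + ?Z t"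
    using F_comm[of b b b a t] F_comm[of c c b a t] abc lin[of b a] by (simp add: lin_diff algebra_simps)
   also have "\<dots> = scale (\<eta> + 1) (?Z t)"
    using \<eta> lin[of b a] by (simp add: t_def[symmetric] lin_scale scale_left_distrib)
   finally show ?case by (intro exI[of _ "\<eta> + 1"]) (simp add: t_def)
  qed
 next
  case (Suc i)
  define t where "t = (?Y ^^ i) ((?Z ^^ k) w)"
  obtain \<eta> where \<eta>: "F b b t - F c c t = scale \<eta> t" using Suc by (auto simp: t_def)
  have "F b b (?Y t) - F c c (?Y t) = ?Y (F b b t - F c c t) - scale 2 (?Y t)"
   using F_comm[of b b c b t] F_comm[of c c c b t] abc lin[of c b] scale_left_distrib[of 1 1 "?Y t"]
   by (simp add: lin_diff algebra_simps)
  also have "\<dots> = scale (\<eta> - 2) (?Y t)"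
   using \<eta> lin[of c b] by (simp add: lin_scale scale_left_diff_distrib)
  finally show ?case by (intro exI[of _ "\<eta> - 2"]) (simp add: t_def)
 qed
 have eYk: "\<exists>\<beta>. ?e ((?Y ^^ y) ((?Z ^^ k) w))
   - (if y = 0 then 0 else scale \<beta> ((?Y ^^ (y - 1)) ((?Z ^^ k) w))) \<in> U" for y k
 proof (induction y)
  case 0
  have "?e ((?Z ^^ k) w) = (?Z ^^ k) (?e w)" by (induction k) (auto simp: ep)
  thus ?case using w(2) pow_stab by simp
 next
  case (Suc y)
  define t where "t = (?Y ^^ y) ((?Z ^^ k) w)"
  from Suc obtain \<beta> where \<beta>: "?e t
   - (if y = 0 then 0 else scale \<beta> ((?Y ^^ (y - 1)) ((?Z ^^ k) w))) \<in> U" by (auto simp: t_def)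
  obtain \<eta> where \<eta>: "F b b t - F c c t = scale \<eta> t" using h by (auto simp: t_def)
  define \<beta>' where "\<beta>' = (if y = 0 then 0 else \<beta>)"
  have "?Y (if y = 0 then 0 else scale \<beta> ((?Y ^^ (y - 1)) ((?Z ^^ k) w))) = scale \<beta>' t"
   using lin[of c b] by (cases y) (auto simp: \<beta>'_def t_def lin_0 lin_scale)
  hence "?Y (?e t) - scale \<beta>' t \<in> U"
   using stab[of c b, OF _ _ \<beta>] lin[of c b] by (simp add: lin_diff)
  moreover have "?e (?Y t) - scale (\<beta>' + \<eta>) t = ?Y (?e t) - scale \<beta>' t"
   unfolding eY \<eta> scale_left_distrib by simp
  ultimately have "?e (?Y t) - scale (\<beta>' + \<eta>) t \<in> U" by simp
  thus ?case by (intro exI[of _ "\<beta>' + \<eta>"]) (simp add: t_def)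
 qed
 \<comment> \<open>The operator \<open>F b c\<close> trades one \<open>?X\<close> for one
   \<open>?Z\<close>, with coefficient \<open>x\<close>; the remaining contribution is a multiple of
   the vector with one \<open>?Y\<close> fewer.\<close>
 have ev: "\<exists>\<beta>. ?e (v x y k) - scale (of_nat x) (v (x - 1) y (Suc k))
   - (if y = 0 then 0 else scale \<beta> (v x (y - 1) k)) \<in> U" for x y k
 proof -
  define u where "u = (?Z ^^ k) w"
  define t where "t = (?Y ^^ y) u"
  obtain \<beta> where \<beta>: "?e t - (if y = 0 then 0 else scale \<beta> ((?Y ^^ (y - 1)) u)) \<in> U"
   using eYk[of y k] unfolding t_def u_def by blast
  have 1: "?e (v x y k) = (?X ^^ x) (?e t) + scale (of_nat x) ((?X ^^ (x - 1)) (?Z t))"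
   unfolding v_def t_def u_def using lin[of c a] eX pX by (intro comm_pow) auto
  have "?Z t = (?Y ^^ y) (?Z u) + scale (of_nat y) ((?Y ^^ (y - 1)) (- ?X u))"
   unfolding t_def using lin[of c b] pY YX by (intro comm_pow) (auto simp: lin_minus)
  also have "(?Y ^^ (y - 1)) (- ?X u) = - ?X ((?Y ^^ (y - 1)) u)"
   using lin_minus[OF lin_pow[OF lin[of c b]]] XYk by simp
  finally have 2: "?Z t = (?Y ^^ y) (?Z u) - scale (of_nat y) (?X ((?Y ^^ (y - 1)) u))" by simp
  have lX: "lin (?X ^^ i)" for i using lin[of c a] by (intro lin_pow) auto
  have 3: "scale (of_nat x) ((?X ^^ (x - 1)) (?Z t))
    = scale (of_nat x) (v (x - 1) y (Suc k)) - scale (of_nat x * of_nat y) (v x (y - 1) k)"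
  proof (cases x)
   case (Suc x')
   have "(?X ^^ x') (?X s) = (?X ^^ Suc x') s" for s by (induction x') auto
   moreover have "?Z u = (?Z ^^ Suc k) w" by (simp add: u_def)
   ultimately show ?thesis unfolding 2 Suc lin_diff[OF lX] lin_scale[OF lX]
    by (simp add: v_def u_def scale_right_diff_distrib del: of_nat_Suc funpow.simps)
  qed simp
  have "(?X ^^ x) (?e t - (if y = 0 then 0 else scale \<beta> ((?Y ^^ (y - 1)) u))) \<in> U"
   using pow_stab[of c a, OF _ _ \<beta>] by simp
  hence 4: "(?X ^^ x) (?e t) - (if y = 0 then 0 else scale \<beta> (v x (y - 1) k)) \<in> U"
   unfolding lin_diff[OF lX] by (cases "y = 0") (simp_all add: v_def u_def lin_scale[OF lX] lin_0[OF lX])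
  show ?thesis
  proof (cases "y = 0")
   case True
   thus ?thesis using 4 unfolding 1 3 by simp
  next
   case False
   have "?e (v x y k) - scale (of_nat x) (v (x - 1) y (Suc k)) - scale (\<beta> - of_nat x * of_nat y) (v x (y - 1) k)
     = (?X ^^ x) (?e t) - scale \<beta> (v x (y - 1) k)"
    unfolding 1 3 scale_left_diff_distrib by simp
   thus ?thesis using 4 False by (intro exI[of _ "\<beta> - of_nat x * of_nat y"]) simp
  qed
 qed
 \<comment> \<open>Bookkeeping after \<open>j\<close> applications of \<open>F b c\<close>: in a
   discarded term \<open>k\<close> of them have created a factor \<open>?Z\<close> and the other
   \<open>j - k\<close> have removed a factor \<open>?Y\<close>.\<close>
 define S where "S j x0 y0 = span (U \<union> {v (x0 - k) (y0 - (j - k)) k | k. k < j})" for j x0 y0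
 have S: "subspace (S j x0 y0)" for j x0 y0 by (simp add: S_def)
 have US: "U \<subseteq> S j x0 y0" for j x0 y0 unfolding S_def using span_superset by blast
 have memS: "v (x0 - k) (y0 - (j - k)) k \<in> S j x0 y0" if "k < j" for k j x0 y0
  unfolding S_def using that by (intro span_base) blast
 have ev_mem: "?e (v x y k) - scale (of_nat x) (v (x - 1) y (Suc k)) \<in> T"
  if "subspace T" "U \<subseteq> T" "y \<noteq> 0 ==> v x (y - 1) k \<in> T" for T x y k
 proof -
  obtain \<beta> where \<beta>: "?e (v x y k) - scale (of_nat x) (v (x - 1) y (Suc k))
   - (if y = 0 then 0 else scale \<beta> (v x (y - 1) k)) \<in> U" using ev by blast
  have "(if y = 0 then 0 else scale \<beta> (v x (y - 1) k)) \<in> T"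
   using that by (auto intro: subspace_0 subspace_scale)
  from subspace_add[OF that(1) subsetD[OF that(2) \<beta>] this] show ?thesis by simp
 qed
 have eS: "?e u \<in> S (Suc j) x0 y0" if "u \<in> S j x0 y0" for u j x0 y0
 proof (rule lin_span_into[OF _ S _ that[unfolded S_def]])
  show "lin (?e)" using lin by simp
  fix t assume "t \<in> U \<union> {v (x0 - k) (y0 - (j - k)) k | k. k < j}"
  then consider "t \<in> U" | k where "t = v (x0 - k) (y0 - (j - k)) k" "k < j" by blast
  thus "?e t \<in> S (Suc j) x0 y0"
  proof cases
   case 2
   have "v (x0 - k) (y0 - (Suc j - k)) k \<in> S (Suc j) x0 y0" using 2(2) by (intro memS) simp
   moreover have "y0 - (Suc j - k) = y0 - (j - k) - 1" using 2(2) by simp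
   ultimately have 3: "?e t - scale (of_nat (x0 - k)) (v (x0 - k - 1) (y0 - (j - k)) (Suc k)) \<in> S (Suc j) x0 y0"
    unfolding 2(1) by (intro ev_mem S US) simp
   have "v (x0 - Suc k) (y0 - (Suc j - Suc k)) (Suc k) \<in> S (Suc j) x0 y0" using 2(2) by (intro memS) simp
   moreover have "x0 - k - 1 = x0 - Suc k" by simp
   ultimately have "scale (of_nat (x0 - k)) (v (x0 - k - 1) (y0 - (j - k)) (Suc k)) \<in> S (Suc j) x0 y0"
    by (intro subspace_scale[OF S]) simp
   with 3 show ?thesis using subspace_cong_mem[OF S 3] by simp
  qed (use stab[of b c t] US in auto)
 qed
 \<comment> \<open>The scalar is the falling factorial of \<open>x0\<close> with \<open>j\<close>
   factors, nonzero as long as \<open>j\<close> does not exceed \<open>x0\<close>.\<close>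
 have claim: "j \<le> x0 ==> \<exists>q. q \<noteq> 0 \<and> (?e ^^ j) (v x0 y0 0) - scale q (v (x0 - j) y0 j) \<in> S j x0 y0" for j x0 y0
 proof (induction j)
  case 0
  show ?case using subspace_0[OF S] by (intro exI[of _ 1]) simp
 next
  case (Suc j)
  then obtain q where q: "q \<noteq> 0" "(?e ^^ j) (v x0 y0 0) - scale q (v (x0 - j) y0 j) \<in> S j x0 y0" by auto
  have lbc: "lin (?e)" using lin by simp
  have 1: "(?e ^^ Suc j) (v x0 y0 0) - scale q (?e (v (x0 - j) y0 j)) \<in> S (Suc j) x0 y0"
   using eS[OF q(2)] by (simp add: lin_diff[OF lbc] lin_scale[OF lbc])
  have "v (x0 - j) (y0 - 1) j \<in> S (Suc j) x0 y0" using memS[of j "Suc j" x0 y0] by simp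
  hence "?e (v (x0 - j) y0 j) - scale (of_nat (x0 - j)) (v (x0 - j - 1) y0 (Suc j)) \<in> S (Suc j) x0 y0"
   by (intro ev_mem S US)
  from subspace_scale[OF S this, of q]
  have 2: "scale q (?e (v (x0 - j) y0 j)) - scale (q * of_nat (x0 - j)) (v (x0 - Suc j) y0 (Suc j)) \<in> S (Suc j) x0 y0"
   by (simp add: scale_right_diff_distrib)
  have "q * of_nat (x0 - j) \<noteq> 0" using q(1) Suc.prems by simp
  thus ?case using subspace_diff_trans[OF S 1 2] by blast
 qed
 obtain q where q: "q \<noteq> 0" "(?e ^^ z) (v (x + z) y 0) - scale q (v x y z) \<in> S z (x + z) y"
  using claim[of z "x + z" y] by auto
 have "v (x + z) y 0 \<in> U" using xyz by (intro base) simp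
 hence "(?e ^^ z) (v (x + z) y 0) \<in> S z (x + z) y" using pow_stab[of b c] US by blast
 hence "scale q (v x y z) \<in> S z (x + z) y" using subspace_cong_mem[OF S q(2)] by simp
 hence "v x y z \<in> S z (x + z) y" by (rule subspace_scale_cancel[OF S _ q(1)])
 thus ?thesis unfolding S_def v_def .
qed

end

context so_column
begin

lemma Low_pow:
 assumes "x \<in> L" shows "Low ((X x ^^ k) u) d \<subseteq> Low u d"
proof -
 have "foldr X (replicate k x) u = (X x ^^ k) u" by (induction k) auto
 moreover have "sum_list (map deg (replicate k x)) = 0"
  unfolding map_replicate sum_list_replicate deg_L[OF assms] by simp
 moreover have "set (replicate k x) \<subseteq> G" using assms by auto
 ultimately show ?thesis using Low_shift[of "replicate k x" u d] by (simp only: add_0_right)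
qed

end

context so_rep
begin

lemma mono_snoc: "mono (rs @ [r]) p w = mono rs p ((X (letter r) ^^ p r) w)"
 by (simp add: mono_append)

lemma minus_bracket:
 assumes "1 \<le> j" "j < int m"
 shows "bracket_in (col_lowering (- int m) (m - 1)) {(int m, j)} (par_letters m)"
proof (rule bracket_in_singleI)
 fix k assume k: "1 \<le> k" "k \<le> int (m - 1)"
 have "k < int m" using k by simp
 thus "k = j \<or> (- k, j) \<in> par_letters m" unfolding mem_par using assms k(1) by (smt (verit))
qed (use assms in auto)

lemma mem_lower_parabolic: "1 \<le> j ==> j < int m ==> (int m, j) \<in> par_letters m" by (simp add: mem_par)

lemma letters_minus_square: "letter ` set (minus_roots m) \<subseteq> sq_letters m"
 unfolding letter_minus by (auto simp: mem_square)

lemma letters_plus_square: "letter ` set (plus_roots m) \<subseteq> sq_letters m"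
 unfolding letter_plus by (auto simp: mem_square)

lemma letters_minus_parabolic: "letter ` set (minus_roots m) \<subseteq> par_letters m"
 unfolding letter_minus using mem_lower_parabolic by blast

section \<open>Upper bounds for the two blocks of index m\<close>

context
 fixes m :: nat
 assumes m: "2 \<le> m" "m \<le> n"
begin

interpretation P: so_column scale n F "par_letters m" "- int m" "m - 1" "%i. Plus i m"
  "long_roots (m - 1) @ minus_roots m"
 by (rule so_column_plus[OF m])

interpretation M: so_column scale n F "levi_letters m" "int m" "m - 1" "%i. Minus i m" "long_roots (m - 1)"
 by (rule so_column_minus[OF m])

lemma m1: "1 \<le> m" and sm: "Suc (m - 1) = m" using m by auto

lemma P_col: "P.col = plus_roots m" "P.Unew w U p = U_plus m w U p"
 by (simp_all add: P.col_def P.Unew_def Ublock_def plus_roots_def sm del: One_nat_def)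

lemma M_col: "M.col = minus_roots m" "M.Unew w U p = U_minus m w U p"
 by (simp_all add: M.col_def M.Unew_def Ublock_def minus_roots_def sm del: One_nat_def)

lemma plus_block:
 assumes datum: "datum (sq_letters m) w U \<mu>"
 shows "datum (par_letters m) (mono (plus_roots m) p w) (U_plus m w U p) (plus_shift m p \<mu>)"
  and "ess (long_blocks m) w U p \<longleftrightarrow>
   ess (minus_roots m # long_blocks (m - 1)) (mono (plus_roots m) p w) (U_plus m w U p) p"
proof -
 show "datum (par_letters m) (mono (plus_roots m) p w) (U_plus m w U p) (plus_shift m p \<mu>)"
 proof (rule datum_cong)
  show "datum (par_letters m) (mono (plus_roots m) p w) (U_plus m w U p) (P.shift_weight p \<mu>)"
   using P.datum_step[of w U \<mu> p] datum unfolding P_col square_split[OF m1] .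
  fix i :: int assume "0 < i" "(i, i) \<in> par_letters m"
  hence "0 < i" "i \<le> int m" by (auto simp: mem_par)
  thus "P.shift_weight p \<mu> i = plus_shift m p \<mu> i"
   unfolding P.shift_weight_def plus_shift_def P_col using m by (auto simp: of_nat_diff)
 qed
 show "ess (long_blocks m) w U p \<longleftrightarrow>
   ess (minus_roots m # long_blocks (m - 1)) (mono (plus_roots m) p w) (U_plus m w U p) p"
  using P.ess_step[of "minus_roots m # long_blocks (m - 1)" w U p]
  unfolding P_col long_blocks_Suc[OF m(1)] by (simp add: concat_long_blocks)
qed

lemma minus_block:
 assumes datum: "datum (par_letters m) w U \<mu>"
 shows "datum (sq_letters (m - 1)) (mono (minus_roots m) p w) (U_minus m w U p) (minus_shift m p \<mu>)"
  and "ess (minus_roots m # long_blocks (m - 1)) w U p \<longleftrightarrow>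
   ess (long_blocks (m - 1)) (mono (minus_roots m) p w) (U_minus m w U p) p"
proof -
 show "datum (sq_letters (m - 1)) (mono (minus_roots m) p w) (U_minus m w U p) (minus_shift m p \<mu>)"
 proof (rule datum_cong)
  have "datum (levi_letters m) (mono (minus_roots m) p w) (U_minus m w U p) (M.shift_weight p \<mu>)"
   using M.datum_step[of w U \<mu> p] datum unfolding M_col parabolic_split[OF m1] .
  thus "datum (sq_letters (m - 1)) (mono (minus_roots m) p w) (U_minus m w U p) (M.shift_weight p \<mu>)"
   by (rule datum_subset) (rule M.square_sub)
  fix i :: int assume "0 < i" "(i, i) \<in> sq_letters (m - 1)"
  hence "0 < i" "i \<le> int (m - 1)" "i \<le> int m - 1" using m by (auto simp: mem_square of_nat_diff)
  thus "M.shift_weight p \<mu> i = minus_shift m p \<mu> i"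
   unfolding M.shift_weight_def minus_shift_def by simp
 qed
 show "ess (minus_roots m # long_blocks (m - 1)) w U p \<longleftrightarrow>
   ess (long_blocks (m - 1)) (mono (minus_roots m) p w) (U_minus m w U p) p"
  using M.ess_step[of "long_blocks (m - 1)" w U p] unfolding M_col by (simp add: concat_long_blocks)
qed

lemma D_upper_plus:
 assumes datum: "datum (sq_letters m) w U \<mu>" and nil: loc_nilpotent
  and viol: "(\<exists>i\<in>{1..m - 2}. real (p (Plus i m)) > \<mu> (int i) - \<mu> (int (Suc i))) \<or>
   real (p (Plus (m - 1) m)) > \<mu> (int (m - 1)) + \<mu> (int m)"
 shows "mono (plus_roots m) p w \<in> U_plus m w U p"
proof -
 note datum' = datum[unfolded square_split[OF m1]]
 from viol show ?thesis
 proof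
  assume "\<exists>i\<in>{1..m - 2}. real (p (Plus i m)) > \<mu> (int i) - \<mu> (int (Suc i))"
  then obtain i where i: "1 \<le> i" "i \<le> m - 2" "real (p (Plus i m)) > \<mu> (int i) - \<mu> (int (Suc i))" by auto
  have "(F (int (Suc i)) (int i) ^^ p (Plus i m)) w \<in> U"
   by (rule chain_kill[OF datum nil]) (use i m in \<open>auto simp: mem_square\<close>)
  moreover have "Suc i \<le> m - 1" using i m by simp
  ultimately show ?thesis using P.col_upper[OF datum' i(1), of p] unfolding P_col by blast
 next
  assume v: "real (p (Plus (m - 1) m)) > \<mu> (int (m - 1)) + \<mu> (int m)"
  define a where "a = int (m - 1)"
  have a: "1 \<le> a" "a < int m" using m by (auto simp: a_def)
  have mem: "(a, - int m) \<in> sq_letters m" "(- int m, a) \<in> sq_letters m" "(a, a) \<in> sq_letters m"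
   "(int m, int m) \<in> sq_letters m"
   using a by (auto simp: mem_square)
  have w1: "F a a w = scale (of_real (\<mu> a)) w" and w2: "F (int m) (int m) w = scale (of_real (\<mu> (int m))) w"
   using datum_weight[OF datum _ mem(3)] datum_weight[OF datum _ mem(4)] a by auto
  have wt: "F a a w - F (- int m) (- int m) w = scale (of_real (\<mu> a + \<mu> (int m))) w"
   using F_mirror[of "int m" "int m" w] m w1 w2 by (simp add: scale_left_distrib)
  have ra: "raising n (a, - int m)" using a m by (subst raising_sgn) auto
  have an: "\<bar>a\<bar> \<le> int n" "\<bar>- int m\<bar> \<le> int n" "a \<noteq> - int m" "a + - int m \<noteq> 0" "a \<noteq> 0"
   using a m by auto
  have "\<mu> a + \<mu> (int m) < (if - int m = 0 then 1 else 2) / 2 * real (p (Plus (m - 1) m))"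
   using v m by (simp add: a_def)
  from datum_sl2(2)[OF datum nil mem(1,2) ra an wt this]
  have "(F (- int m) (int (m - 1)) ^^ p (Plus (m - 1) m)) w \<in> U" unfolding a_def .
  moreover have "1 \<le> m - 1" using m by simp
  ultimately have "mono (plus_roots m) p w \<in> U"
   using P.col_upper_last[OF datum_stable[OF datum']] unfolding P_col by blast
  thus ?thesis using U_sub_Ublock by blast
 qed
qed

lemma D_upper_minus:
 assumes datum: "datum (par_letters m) w U \<mu>" and nil: loc_nilpotent
  and viol: "\<exists>i\<in>{1..m - 2}. real (p (Minus i m)) > \<mu> (int i) - \<mu> (int (Suc i))"
 shows "mono (minus_roots m) p w \<in> U_minus m w U p"
proof -
 note datum' = datum[unfolded parabolic_split[OF m1]]
 obtain i where i: "1 \<le> i" "i \<le> m - 2" "real (p (Minus i m)) > \<mu> (int i) - \<mu> (int (Suc i))"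
  using viol by auto
 have "(F (int (Suc i)) (int i) ^^ p (Minus i m)) w \<in> U"
  by (rule chain_kill[OF datum nil]) (use i m in \<open>auto simp: mem_par\<close>)
 moreover have "Suc i \<le> m - 1" using i m by simp
 ultimately show ?thesis using M.col_upper[OF datum' i(1), of p] unfolding M_col by blast
qed

text \<open>The transpose of \<open>(int m, int (m - 1))\<close> is missing in the parabolic, so its
  string is used on \<open>w\<close> in so(2m), and the resulting relation is carried across the
  block of \<open>Plus\<close> roots by \<open>pass_Low_word\<close>.\<close>

lemma D_upper_minus_last:
 assumes datum: "datum (sq_letters m) w U \<mu>" and nil: loc_nilpotent
  and viol: "real (p (Minus (m - 1) m)) > \<mu> (int (m - 1)) - \<mu> (int m)"
 shows "mono (minus_roots m) p (mono (plus_roots m) p w) \<in> U_plus m w U p"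
proof -
 note datum' = datum[unfolded square_split[OF m1]]
 have U: "stable (sq_letters m) U" by (rule datum_stable[OF datum])
 have kill: "(F (int m) (int (m - 1)) ^^ p (Minus (m - 1) m)) w \<in> U"
  by (rule chain_kill[OF datum nil]) (use viol m in \<open>auto simp: mem_square\<close>)
 have "[1..<Suc (m - 1)] = [1..<m - 1] @ [m - 1]" using m by (intro upt_Suc_append) simp
 hence minus: "minus_roots m = map (%i. Minus i m) [1..<m - 1] @ [Minus (m - 1) m]"
  unfolding minus_roots_def sm by simp
 have "letter ` set (map (%i. Minus i m) [1..<m - 1]) \<subseteq> sq_letters m"
  by (rule order_trans[OF image_mono letters_minus_square[of m]]) (auto simp: minus)
 hence in_U: "mono (minus_roots m) p w \<in> U"
  unfolding minus mono_snoc using kill by (intro stable_mono[OF U]) simp_all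
 define ys where "ys = concat (map (%r. replicate (p r) (letter r)) (minus_roots m))"
 have "set ys \<subseteq> letter ` set (minus_roots m)" unfolding ys_def by auto
 hence ys: "set ys \<subseteq> {(a, b). a = int m \<and> 1 \<le> b \<and> b < int m}" unfolding letter_minus .
 have "mono P.col p (foldr X ys w) - foldr X ys (mono P.col p w) \<in> P.Low w (sum_list (map p P.col))"
 proof (rule P.pass_Low_word)
  show "set ys \<subseteq> par_letters m" using ys mem_lower_parabolic by blast
  show "bracket_in (col_lowering (- int m) (m - 1)) {y} (par_letters m)" if "y \<in> set ys" for y
   using ys that minus_bracket by blast
 qed
 hence "mono P.col p (foldr X ys w) - foldr X ys (mono P.col p w) \<in> P.Unew w U p"
  using P.Low_sub_Unew[OF datum' order_refl, of p] by blast
 hence 1: "mono (plus_roots m) p (mono (minus_roots m) p w)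
   - mono (minus_roots m) p (mono (plus_roots m) p w) \<in> P.Unew w U p"
  unfolding P_col ys_def mono_eq_word[symmetric] .
 have "mono (plus_roots m) p (mono (minus_roots m) p w) \<in> U"
  by (rule stable_mono[OF U letters_plus_square in_U])
 hence "mono (plus_roots m) p (mono (minus_roots m) p w) \<in> P.Unew w U p" using P.U_sub_Unew by blast
 from this[unfolded subspace_cong_mem[OF P.Unew_subspace 1]] show ?thesis unfolding P_col .
qed

text \<open>The relation of gl3 is applied on the indices \<open>m-2\<close>, \<open>m-1\<close>,
  \<open>m\<close>. Its factors \<open>F c a\<close> and \<open>F c b\<close> cross the block of
  \<open>Plus\<close> roots as in the previous lemma, while the powers of \<open>F b a\<close> are
  consumed inside that block, where they shift exponent from \<open>m-1\<close> to
  \<open>m-2\<close>.\<close>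

lemma D_upper_minus_pair:
 assumes m3: "3 \<le> m" and datum: "datum (sq_letters m) w U \<mu>" and nil: loc_nilpotent
  and viol: "real (p (Minus (m - 1) m)) + real (p (Plus (m - 2) m)) + real (p (Minus (m - 2) m))
   > \<mu> (int (m - 2)) - \<mu> (int m)"
 shows "mono (minus_roots m) p (mono (plus_roots m) p w) \<in> U_plus m w U p"
proof -
 have sm2: "Suc (m - 2) = m - 1" using m3 by auto
 note datum' = datum[unfolded square_split[OF m1]]
 have U: "stable (sq_letters m) U" by (rule datum_stable[OF datum])
 define a b c where "a = int (m - 2)" and "b = int (m - 1)" and "c = int m"
 have abc: "1 \<le> a" "a < b" "b < c" "c \<le> int n" using m m3 by (auto simp: a_def b_def c_def)
 have sq: "(i, j) \<in> sq_letters m" if "i \<in> {a, b, c}" "j \<in> {a, b, c}" for i j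
 proof -
  have "1 \<le> i" "i \<le> int m" "1 \<le> j" "j \<le> int m" using that abc by (auto simp: c_def)
  thus ?thesis by (simp add: mem_square)
 qed
 \<comment> \<open>The first two are the exponents of \<open>F c a\<close> and \<open>F c b\<close>
   in the block of \<open>Minus\<close> roots; the third is the number of times \<open>F b a\<close>
   has to act in order to restore the exponent of \<open>Plus (m - 2) m\<close>.\<close>
 define x y z where "x = p (Minus (m - 2) m)" and "y = p (Minus (m - 1) m)" and "z = p (Plus (m - 2) m)"
 let ?S = "P.Unew w U p"
 have S: "subspace ?S" by (rule P.Unew_subspace)
 have Sst: "stable (par_letters m) ?S" by (rule datum_stable[OF P.datum_step[OF datum']])
 have rel: "(F c a ^^ x) ((F c b ^^ y) ((F b a ^^ z) w)) \<in> span (U \<union>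
  {(F c a ^^ (x + z - k)) ((F c b ^^ (y - (z - k))) ((F b a ^^ k) w)) | k. k < z})"
 proof (rule gl3_relation)
  show "F i j u \<in> U" if "i \<in> {a, b, c}" "j \<in> {a, b, c}" "u \<in> U" for i j u
   using stable_X[OF U sq[OF that(1,2)] that(3)] by simp
  have "raising n (a, b)" "raising n (b, c)" using abc by (auto simp: raising_sgn)
  thus "F a b w \<in> U" "F b c w \<in> U"
   using datum_raising[OF datum sq[of a b]] datum_raising[OF datum sq[of b c]] by simp_all
  show "F b b w = scale (of_real (\<mu> b)) w" "F c c w = scale (of_real (\<mu> c)) w"
   using datum_weight[OF datum _ sq[of b b]] datum_weight[OF datum _ sq[of c c]] abc by simp_all
  show "(F c a ^^ k) w \<in> U" if "x + y + z \<le> k" for k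
  proof (rule chain_kill[OF datum nil])
   have "real (x + y + z) \<le> real k" using that by (rule of_nat_mono)
   thus "\<mu> a - \<mu> c < real k" using viol unfolding x_def y_def z_def a_def c_def by simp
  qed (use abc sq in simp_all)
  show "subspace U" by (rule stable_subspace[OF U])
 qed (use abc in simp_all)
 \<comment> \<open>With the exponent at \<open>m-2\<close> emptied into \<open>m-1\<close>, the
   power \<open>z\<close> of \<open>F b a\<close> leads back to \<open>p\<close>, whereas a power
   \<open>k < z\<close> leads to an exponent with a smaller entry at \<open>m-2\<close>, which is
   negligible.\<close>
 define p0 where "p0 = P.move z (m - 2) (m - 1) p"
 have ne: "m - 2 \<noteq> m - 1" using m m3 by auto
 have p0: "p0 (Plus (m - 2) m) = 0" "p0 (Plus (m - 1) m) = p (Plus (m - 1) m) + z"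
  "\<And>i. i \<noteq> m - 2 ==> i \<noteq> m - 1 ==> p0 (Plus i m) = p (Plus i m)"
  using ne unfolding p0_def P.move_def z_def by simp_all
 have back_eq: "P.move z (m - 1) (m - 2) p0 = p"
  using ne unfolding p0_def P.move_def z_def by (intro ext) simp
 have r12: "1 \<le> m - 2" "m - 2 \<le> m - 1" "1 \<le> m - 1" "m - 1 \<le> m - 1" "m - 1 \<noteq> m - 2" using m m3 by auto
 have sum0: "sum_list (map p0 P.col) = sum_list (map p P.col)"
  unfolding p0_def by (rule P.sum_move[OF r12(1-4) ne]) (simp add: z_def)
 have aux: "\<exists>q. q \<noteq> 0 \<and> mono P.col p0 ((F b a ^^ k) w) - scale q (mono P.col (P.move k (m - 1) (m - 2) p0) w)
   \<in> P.Unew w U (P.move k (m - 1) (m - 2) p0)" if "k \<le> z" for k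
  unfolding a_def b_def
  by (rule P.col_upper_aux[OF datum', of "m - 2", unfolded sm2, OF r12(1,4)]) (use that p0(2) in simp)
 have less: "block_less P.col (P.move k (m - 1) (m - 2) p0) p" if k: "k < z" for k
 proof (rule P.block_less_at[of _ _ "m - 2"])
  show "sum_list (map (P.move k (m - 1) (m - 2) p0) P.col) = sum_list (map p P.col)"
   unfolding sum0[symmetric] by (rule P.sum_move[OF r12(3,4,1,2,5)]) (use p0(2) k in simp)
  show "P.move k (m - 1) (m - 2) p0 (Plus i m) = p (Plus i m)" if "1 \<le> i" "i < m - 2" for i
   using that p0(3)[of i] unfolding P.move_def by simp
  show "P.move k (m - 1) (m - 2) p0 (Plus (m - 2) m) < p (Plus (m - 2) m)"
   using k p0(1) ne unfolding P.move_def z_def by simp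
 qed (use m m3 in simp_all)
 have small: "mono P.col p0 ((F b a ^^ k) w) \<in> ?S" if kz: "k < z" for k
 proof -
  obtain q where "mono P.col p0 ((F b a ^^ k) w) - scale q (mono P.col (P.move k (m - 1) (m - 2) p0) w)
   \<in> P.Unew w U (P.move k (m - 1) (m - 2) p0)" using aux[OF less_imp_le[OF kz]] by blast
  hence 1: "mono P.col p0 ((F b a ^^ k) w) - scale q (mono P.col (P.move k (m - 1) (m - 2) p0) w) \<in> ?S"
   using P.Unew_mono[OF less[OF that]] by blast
  have "scale q (mono P.col (P.move k (m - 1) (m - 2) p0) w) \<in> ?S"
   by (intro subspace_scale[OF S] P.Unew_base' less that)
  thus ?thesis unfolding subspace_cong_mem[OF S 1] .
 qed
 define B where "B = map (%i. Minus i m) [1..<m - 2]"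
 have "[1..<Suc (m - 1)] = [1..<m - 1] @ [m - 1]" "[1..<Suc (m - 2)] = [1..<m - 2] @ [m - 2]"
  using m m3 by (intro upt_Suc_append; simp)+
 hence "[1..<m] = [1..<m - 2] @ [m - 2, m - 1]" unfolding sm sm2 by simp
 hence minus: "minus_roots m = B @ [Minus (m - 2) m, Minus (m - 1) m]"
  by (simp add: minus_roots_def B_def)
 have Bsq: "letter ` set B \<subseteq> sq_letters m"
  by (rule order_trans[OF image_mono letters_minus_square[of m]]) (auto simp: minus)
 have minus_mono: "mono (minus_roots m) p u = mono B p ((F c a ^^ x) ((F c b ^^ y) u))" for u
  unfolding minus mono_append by (simp add: x_def y_def a_def b_def c_def)
 define Bw where "Bw = letters B p"
 define ys where "ys x' y' = Bw @ replicate x' (c, a) @ replicate y' (c, b)" for x' y'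
 have pow: "foldr X (replicate k l) u = (X l ^^ k) u" for k l u by (induction k) auto
 have ysw: "foldr X (ys x' y') u = mono B p ((F c a ^^ x') ((F c b ^^ y') u))" for x' y' u
  unfolding ys_def by (simp add: pow mono_eq_word Bw_def)
 have Bwm: "set Bw \<subseteq> letter ` set (minus_roots m)" unfolding Bw_def minus by auto
 have ys: "set (ys x' y') \<subseteq> {(i, j). i = int m \<and> 1 \<le> j \<and> j < int m}" for x' y'
  using abc Bwm unfolding ys_def letter_minus c_def by auto
 have ysL: "set (ys x' y') \<subseteq> par_letters m" for x' y'
  using ys[of x' y'] mem_lower_parabolic by blast
 have baL: "(b, a) \<in> par_letters m" using abc unfolding c_def by (simp add: mem_par)
 have pass: "mono P.col p0 (foldr X (ys x' y') ((F b a ^^ k) w))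
   - foldr X (ys x' y') (mono P.col p0 ((F b a ^^ k) w)) \<in> ?S" for x' y' k
 proof -
  have "mono P.col p0 (foldr X (ys x' y') ((F b a ^^ k) w))
   - foldr X (ys x' y') (mono P.col p0 ((F b a ^^ k) w)) \<in> P.Low ((F b a ^^ k) w) (sum_list (map p0 P.col))"
  proof (rule P.pass_Low_word[OF ysL])
   show "bracket_in (col_lowering (- int m) (m - 1)) {y} (par_letters m)" if "y \<in> set (ys x' y')" for y
    using ys[of x' y'] that minus_bracket by blast
  qed
  moreover have "P.Low ((F b a ^^ k) w) (sum_list (map p0 P.col)) \<subseteq> P.Low w (sum_list (map p0 P.col))"
   using P.Low_pow[OF baL, of k w] by simp
  moreover have "P.Low w (sum_list (map p0 P.col)) \<subseteq> ?S"
   using P.Low_sub_Unew[OF datum', of "sum_list (map p0 P.col)" p] sum0 by simp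
  ultimately show ?thesis by blast
 qed
 have lin_col: "lin (%u. mono P.col p0 (mono B p u))"
 proof -
  have "lin (mono rs q)" if "letter ` set rs \<subseteq> letter_range n" for rs q
   using that unfolding mono_eq_word[abs_def] by (intro word_lin) auto
  moreover have "letter ` set P.col \<subseteq> letter_range n" using P.lowering_letters(2) P.C_range by blast
  moreover have "letter ` set B \<subseteq> letter_range n"
   using Bsq m unfolding sq_letters_def letter_range_def by fastforce
  ultimately have "lin (mono P.col p0)" "lin (mono B p)" by blast+
  thus ?thesis by (rule lin_comp)
 qed
 have "mono P.col p0 (mono B p ((F c a ^^ x) ((F c b ^^ y) ((F b a ^^ z) w)))) \<in> ?S"
 proof (rule lin_span_into[OF lin_col S _ rel])
  fix t assume "t \<in> U \<union> {(F c a ^^ (x + z - k)) ((F c b ^^ (y - (z - k))) ((F b a ^^ k) w)) | k. k < z}"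
  then consider "t \<in> U" | k where "t = (F c a ^^ (x + z - k)) ((F c b ^^ (y - (z - k))) ((F b a ^^ k) w))" "k < z"
   by blast
  thus "mono P.col p0 (mono B p t) \<in> ?S"
  proof cases
   case 1
   have "mono B p t \<in> U" by (rule stable_mono[OF U Bsq 1])
   hence "mono P.col p0 (mono B p t) \<in> U" by (rule P.stable_col[OF datum_stable[OF datum']])
   thus ?thesis using P.U_sub_Unew by blast
  next
   case 2
   let ?ys = "ys (x + z - k) (y - (z - k))"
   have "foldr X ?ys (mono P.col p0 ((F b a ^^ k) w)) \<in> ?S"
    by (intro stable_word[OF Sst ysL] small 2)
   hence "mono P.col p0 (foldr X ?ys ((F b a ^^ k) w)) \<in> ?S"
    using subspace_cong_mem[OF S pass] by blast
   thus ?thesis unfolding ysw 2(1) .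
  qed
 qed
 hence "mono P.col p0 (foldr X (ys x y) ((F b a ^^ z) w)) \<in> ?S" unfolding ysw .
 from this[unfolded subspace_cong_mem[OF S pass]]
 have 1: "foldr X (ys x y) (mono P.col p0 ((F b a ^^ z) w)) \<in> ?S" .
 obtain q where q: "q \<noteq> 0" "mono P.col p0 ((F b a ^^ z) w) - scale q (mono P.col p w) \<in> ?S"
  using aux[OF order_refl] unfolding back_eq by blast
 have ysr: "set (ys x y) \<subseteq> letter_range n" using ysL P.L_range by blast
 have "foldr X (ys x y) (mono P.col p0 ((F b a ^^ z) w) - scale q (mono P.col p w)) \<in> ?S"
  by (rule stable_word[OF Sst ysL q(2)])
 hence 2: "foldr X (ys x y) (mono P.col p0 ((F b a ^^ z) w)) - scale q (foldr X (ys x y) (mono P.col p w)) \<in> ?S"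
  unfolding lin_diff[OF word_lin[OF ysr]] lin_scale[OF word_lin[OF ysr]] .
 have "scale q (foldr X (ys x y) (mono P.col p w)) \<in> ?S" using 1 subspace_cong_mem[OF S 2] by blast
 hence "foldr X (ys x y) (mono P.col p w) \<in> ?S" by (rule subspace_scale_cancel[OF S _ q(1)])
 thus ?thesis unfolding ysw minus_mono P_col .
qed

lemma D_upper:
 assumes datum: "datum (sq_letters m) w U \<mu>" and nil: loc_nilpotent and viol: "\<not> column_cond m \<mu> p"
 defines "w1 \<equiv> mono (plus_roots m) p w" and "U1 \<equiv> U_plus m w U p"
 shows "mono (minus_roots m) p w1 \<in> U_minus m w1 U1 p"
proof -
 have d1: "datum (par_letters m) w1 U1 (plus_shift m p \<mu>)"
  unfolding w1_def U1_def by (rule plus_block(1)[OF datum])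
 have st: "stable (par_letters m) U1" by (rule datum_stable[OF d1])
 have sub: "U1 \<subseteq> U_minus m w1 U1 p" by (rule U_sub_Ublock)
 consider "(\<exists>i\<in>{1..m - 2}. real (p (Plus i m)) > \<mu> (int i) - \<mu> (int (Suc i))) \<or>
   real (p (Plus (m - 1) m)) > \<mu> (int (m - 1)) + \<mu> (int m)"
  | i where "i \<in> {1..m - 2}" "real (p (Minus i m)) + real (p (Plus i m)) - real (p (Plus (Suc i) m))
   > \<mu> (int i) - \<mu> (int (Suc i))"
  | "real (p (Minus (m - 1) m)) > \<mu> (int (m - 1)) - \<mu> (int m)"
  | "3 \<le> m" "real (p (Minus (m - 1) m)) + real (p (Plus (m - 2) m)) + real (p (Minus (m - 2) m))
   > \<mu> (int (m - 2)) - \<mu> (int m)"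
  using viol unfolding column_cond_def not_le[symmetric] by blast
 thus ?thesis
 proof cases
  case 1
  have "w1 \<in> U1" unfolding w1_def U1_def by (rule D_upper_plus[where p = p, OF datum nil 1])
  hence "mono (minus_roots m) p w1 \<in> U1" by (rule stable_mono[OF st letters_minus_parabolic])
  thus ?thesis using sub by blast
 next
  case 2
  have i: "1 \<le> i" "Suc i < m" using 2(1) m by auto
  have "plus_shift m p \<mu> (int i) = \<mu> (int i) - real (p (Plus i m))"
   using i unfolding plus_shift_def by simp
  moreover have "plus_shift m p \<mu> (int (Suc i)) = \<mu> (int (Suc i)) - real (p (Plus (Suc i) m))"
   using i(2) unfolding plus_shift_def nat_int by simp
  ultimately have "real (p (Minus i m)) > plus_shift m p \<mu> (int i) - plus_shift m p \<mu> (int (Suc i))"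
   using 2(2) by linarith
  hence "\<exists>i\<in>{1..m - 2}. real (p (Minus i m)) > plus_shift m p \<mu> (int i) - plus_shift m p \<mu> (int (Suc i))"
   using 2(1) by blast
  thus ?thesis by (rule D_upper_minus[where p = p, OF d1 nil])
 next
  case 3
  have "mono (minus_roots m) p w1 \<in> U1"
   unfolding w1_def U1_def by (rule D_upper_minus_last[where p = p, OF datum nil 3])
  thus ?thesis using sub by blast
 next
  case 4
  have "mono (minus_roots m) p w1 \<in> U1"
   unfolding w1_def U1_def by (rule D_upper_minus_pair[where p = p, OF 4(1) datum nil 4(2)])
  thus ?thesis using sub by blast
 qed
qed

end

end

section \<open>Unitary modules\<close>

context complex_space
begin

text \<open>Applying \<open>h - (\<kappa> - d)\<close> removes one eigenvector from the remainder
  and multiplies \<open>x\<close> by the nonzero number \<open>d\<close>, without leaving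
  \<open>U\<close>.\<close>

lemma lowest_eigen_mem:
 assumes h: "lin h" and U: "subspace U" "\<And>u. u \<in> U ==> h u \<in> U" and x: "h x = scale \<kappa> x"
  and l: "l \<in> span {t. \<exists>d. d \<noteq> 0 \<and> h t = scale (\<kappa> - d) t}" and mem: "x + l \<in> U"
 shows "x \<in> U"
proof -
 have step: "finite T ==> T \<subseteq> {t. \<exists>d. d \<noteq> 0 \<and> h t = scale (\<kappa> - d) t} ==> h x = scale \<kappa> x ==>
   x + (\<Sum>t\<in>T. scale (r t) t) \<in> U ==> x \<in> U" for T r x
 proof (induction T arbitrary: r x rule: finite_induct)
  case (insert t T)
  have "\<forall>s\<in>insert t T. \<exists>d. d \<noteq> 0 \<and> h s = scale (\<kappa> - d) s" using insert.prems(1) by blast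
  from bchoice[OF this] obtain dt
   where dt: "\<And>s. s \<in> insert t T ==> dt s \<noteq> 0 \<and> h s = scale (\<kappa> - dt s) s" by blast
  let ?e = "dt t"
  define y where "y = x + (\<Sum>s\<in>insert t T. scale (r s) s)"
  have "h y - scale (\<kappa> - ?e) y \<in> U"
   using insert.prems(3) U unfolding y_def by (intro subspace_diff subspace_scale) auto
  moreover have "h y = scale \<kappa> x + (\<Sum>s\<in>insert t T. scale (r s * (\<kappa> - dt s)) s)"
  proof -
   have "h y = h x + (\<Sum>s\<in>insert t T. h (scale (r s) s))"
    unfolding y_def lin_add[OF h] lin_sum[OF h] ..
   also have "(\<Sum>s\<in>insert t T. h (scale (r s) s)) = (\<Sum>s\<in>insert t T. scale (r s * (\<kappa> - dt s)) s)"
    using dt by (intro sum.cong refl) (simp only: lin_scale[OF h] scale_scale)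
   finally show ?thesis using insert.prems(2) by simp
  qed
  moreover have "scale (\<kappa> - ?e) y = scale (\<kappa> - ?e) x + (\<Sum>s\<in>insert t T. scale (r s * (\<kappa> - ?e)) s)"
   unfolding y_def scale_right_distrib scale_sum_right by (simp add: mult.commute)
  moreover have "(a + s1) - (b + s2) = (a - b) + (s1 - s2)" for a b s1 s2 :: 'v by simp
  ultimately have "(scale \<kappa> x - scale (\<kappa> - ?e) x) + ((\<Sum>s\<in>insert t T. scale (r s * (\<kappa> - dt s)) s)
    - (\<Sum>s\<in>insert t T. scale (r s * (\<kappa> - ?e)) s)) \<in> U"
   by (simp only:)
  moreover have "scale \<kappa> x - scale (\<kappa> - ?e) x = scale ?e x"
   unfolding scale_left_diff_distrib[symmetric] by simp
  moreover have "(\<Sum>s\<in>insert t T. scale (r s * (\<kappa> - dt s)) s) - (\<Sum>s\<in>insert t T. scale (r s * (\<kappa> - ?e)) s)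
    = (\<Sum>s\<in>T. scale (r s * (?e - dt s)) s)"
   unfolding sum_subtractf[symmetric] scale_left_diff_distrib[symmetric]
   using insert.hyps by (simp add: algebra_simps)
  ultimately have "scale ?e x + (\<Sum>s\<in>T. scale (r s * (?e - dt s)) s) \<in> U" by simp
  moreover have "h (scale ?e x) = scale \<kappa> (scale ?e x)"
   using insert.prems(2) by (simp add: lin_scale[OF h] mult.commute)
  ultimately have "scale ?e x \<in> U"
   using insert.IH[of "scale ?e x" "%s. r s * (?e - dt s)"] insert.prems(1) by simp
  thus ?case using dt[of t] subspace_scale_cancel[OF U(1)] by blast
 qed simp
 obtain T r where "finite T" "T \<subseteq> {t. \<exists>d. d \<noteq> 0 \<and> h t = scale (\<kappa> - d) t}" "l = (\<Sum>t\<in>T. scale (r t) t)"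
  using l unfolding span_explicit by blast
 thus ?thesis using step[of T x r] x mem by blast
qed

end

text \<open>Modules are spaces of functions on sets of indices; \<open>Leaf\<close> carries fermionic states and \<open>Node\<close> keeps
 the type of indices closed under tensor products.\<close>

datatype idx = Leaf "int set" | Node idx idx

type_synonym vec = "idx => complex"

definition fscale :: "complex => vec => vec" where
 "fscale c t = (%i. c * t i)"

definition inner :: "idx set => vec => vec => complex" where
 "inner B s t = (\<Sum>i\<in>B. s i * cnj (t i))"

definition single :: "idx => vec" where
 "single k = (%i. if i = k then 1 else 0)"

interpretation vec: complex_space fscale
 by unfold_locales (auto simp: fscale_def fun_eq_iff algebra_simps)

lemma inner_add_left: "inner B (s + s') t = inner B s t + inner B s' t"
 by (simp add: inner_def algebra_simps sum.distrib)

lemma inner_scale_left: "inner B (fscale c s) t = c * inner B s t"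
 by (simp add: inner_def fscale_def sum_distrib_left mult.assoc)

lemma inner_add_right: "inner B t (s + s') = inner B t s + inner B t s'"
 by (simp add: inner_def algebra_simps sum.distrib)

lemma inner_scale_right: "inner B t (fscale c s) = cnj c * inner B t s"
 by (simp add: inner_def fscale_def sum_distrib_left algebra_simps)

lemma inner_zero [simp]: "inner B 0 t = 0" "inner B t 0 = 0" by (simp_all add: inner_def)

lemma inner_commute: "inner B t s = cnj (inner B s t)" by (simp add: inner_def mult.commute)

lemma inner_self_eq_0:
 assumes "finite B" "inner B t t = 0" "i \<in> B"
 shows "t i = 0"
proof -
 have "inner B t t = of_real (\<Sum>i\<in>B. (cmod (t i))\<^sup>2)"
  unfolding inner_def of_real_sum by (intro sum.cong refl) (simp only: complex_norm_square)
 hence "complex_of_real (\<Sum>i\<in>B. (cmod (t i))\<^sup>2) = 0" using assms(2) by simp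
 hence "(\<Sum>i\<in>B. (cmod (t i))\<^sup>2) = 0" unfolding of_real_eq_0_iff .
 thus ?thesis using assms(1,3) by (simp add: sum_nonneg_eq_0_iff)
qed

text \<open>Vectors are functions on all indices, so finite dimensionality is expressed by
  \<open>matrix_form\<close>: the operators read and write only coordinates in \<open>B\<close>. The
  adjunction between \<open>G a b\<close> and \<open>G b a\<close> is invariance of the inner
  product under the compact real form.\<close>

locale unitary_rep = so_rep fscale n G for n :: nat and G :: "int => int => vec => vec" +
 fixes B :: "idx set"
 assumes finite_B: "finite B" and matrix_form: "\<bar>a\<bar> \<le> int n ==> \<bar>b\<bar> \<le> int n ==>
   G a b t i = (if i \<in> B then \<Sum>k\<in>B. G a b (single k) i * t k else 0)"
  and adjoint: "\<bar>a\<bar> \<le> int n ==> \<bar>b\<bar> \<le> int n ==> inner B (G a b s) t = inner B s (G b a t)"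
  and diagonal: "\<bar>a\<bar> \<le> int n ==> i \<noteq> k ==> G a a (single k) i = 0"
begin

definition supported :: "vec => bool" where
 "supported t \<longleftrightarrow> (\<forall>i. i \<notin> B --> t i = 0)"

lemma supported_X: "x \<in> letter_range n ==> supported (X x t)"
 unfolding supported_def X_def letter_range_iff using matrix_form by auto

lemma supported_subspace: "vec.subspace {t. supported t}"
 by (auto simp: vec.subspace_def supported_def fscale_def)

lemma supported_word: "set ws \<subseteq> letter_range n ==> supported t ==> supported (foldr X ws t)"
 by (cases ws) (auto intro: supported_X)

lemma supported_inner_self: "supported t ==> inner B t t = 0 ==> t = 0"
 using inner_self_eq_0[OF finite_B] by (auto simp: supported_def fun_eq_iff)

definition swap_letter :: "int \<times> int => int \<times> int" where
 "swap_letter x = (snd x, fst x)"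

lemma adjoint_word: "set ws \<subseteq> letter_range n ==>
  inner B (foldr X ws s) t = inner B s (foldr X (map swap_letter (rev ws)) t)"
proof (induction ws arbitrary: t)
 case (Cons x ws)
 have "inner B (foldr X (x # ws) s) t = inner B (foldr X ws s) (X (swap_letter x) t)"
  using Cons.prems adjoint by (simp add: X_def letter_range_iff swap_letter_def)
 thus ?case using Cons by simp
qed simp

lemma diagonal_apply:
 assumes "\<bar>a\<bar> \<le> int n" "i \<in> B"
 shows "G a a t i = G a a (single i) i * t i"
proof -
 have "G a a t i = (\<Sum>k\<in>B. G a a (single k) i * t k)" using matrix_form[of a a t i] assms by simp
 also have "\<dots> = (\<Sum>k\<in>B. if k = i then G a a (single i) i * t i else 0)"
  using diagonal[OF assms(1)] by (intro sum.cong refl) auto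
 also have "\<dots> = G a a (single i) i * t i" using finite_B assms(2) by simp
 finally show ?thesis .
qed

lemma rep_loc_nilpotent: "loc_nilpotent" unfolding loc_nilpotent_def
proof (intro allI impI)
 fix a b t assume ab: "\<bar>a\<bar> \<le> int n" "\<bar>b\<bar> \<le> int n" "a \<noteq> b" "a + b \<noteq> 0"
 \<comment> \<open>\<open>G c c\<close> raises or lowers under \<open>G a b\<close> by
   \<open>s\<close>. If \<open>a = 0\<close>, then \<open>G a a\<close> vanishes, and the other
   index is used.\<close>
 define c and s :: complex where "c = (if a = 0 then b else a)" and "s = (if a = 0 then - 1 else 1)"
 have c: "\<bar>c\<bar> \<le> int n" using ab by (simp add: c_def)
 have s: "s \<noteq> 0" by (simp add: s_def)
 have lab: "vec.lin (G a b)" using ab by (intro F_lin)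
 have cm: "G c c (G a b u) = G a b (G c c u) + fscale s (G a b u)" for u
 proof (cases "a = 0")
  case False
  thus ?thesis using F_comm[of a a a b u] ab by (simp add: c_def s_def algebra_simps)
 qed (use F_comm[of b b a b u] ab in \<open>simp add: c_def s_def algebra_simps\<close>)
 define h where "h i = G c c (single i) i" for i
 have shift: "h i = h k + s" if k: "G a b (single k) i \<noteq> 0" and i: "i \<in> B" for i k
 proof -
  have "G c c (single k) = fscale (h k) (single k)"
   using diagonal[OF c] by (auto simp: h_def fun_eq_iff fscale_def single_def)
  hence "G c c (G a b (single k)) i = (h k + s) * G a b (single k) i"
   unfolding cm by (simp add: vec.lin_scale[OF lab]) (simp add: fscale_def algebra_simps)
  thus ?thesis using k diagonal_apply[OF c i, of "G a b (single k)"] by (simp add: h_def)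
 qed
 have chain: "\<forall>j\<le>N. h i - of_nat j * s \<in> h ` B" if "(G a b ^^ Suc N) t i \<noteq> 0" for N i using that
 proof (induction N arbitrary: i)
  case 0
  thus ?case using matrix_form[OF ab(1,2), of t i] by (auto split: if_splits)
 next
  case (Suc N)
  let ?u = "(G a b ^^ Suc N) t"
  have nz: "G a b ?u i \<noteq> 0" using Suc.prems by simp
  hence i: "i \<in> B" and "(\<Sum>k\<in>B. G a b (single k) i * ?u k) \<noteq> 0"
   using matrix_form[OF ab(1,2), of ?u i] by (auto split: if_splits)
  then obtain k where "G a b (single k) i * ?u k \<noteq> 0" by (meson sum.neutral)
  hence k: "G a b (single k) i \<noteq> 0" "?u k \<noteq> 0" by auto
  show ?case
  proof (intro allI impI)
   fix j assume j: "j \<le> Suc N"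
   show "h i - of_nat j * s \<in> h ` B"
   proof (cases j)
    case (Suc j')
    hence "h i - of_nat j * s = h k - of_nat j' * s"
     unfolding shift[OF k(1) i] by (simp add: algebra_simps)
    thus ?thesis using Suc.IH[OF k(2)] j \<open>j = Suc j'\<close> by simp
   qed (use i in simp)
  qed
 qed
 let ?N = "card (h ` B)"
 \<comment> \<open>A nonzero coordinate of this power would give \<open>?N + 1\<close> different
   eigenvalues of \<open>G c c\<close>, one more than there are.\<close>
 have "(G a b ^^ Suc ?N) t = 0"
 proof (rule ccontr)
  assume "(G a b ^^ Suc ?N) t \<noteq> 0"
  then obtain i where "(G a b ^^ Suc ?N) t i \<noteq> 0" by (auto simp: fun_eq_iff)
  hence "(%j. h i - of_nat j * s) ` {..?N} \<subseteq> h ` B" using chain by auto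
  moreover have "inj_on (%j. h i - of_nat j * s) {..?N}" using s by (auto simp: inj_on_def)
  ultimately have "card {..?N} \<le> ?N" using finite_B by (metis card_image card_mono finite_imageI)
  thus False by simp
 qed
 thus "\<exists>N. (G a b ^^ N) t = 0" by blast
qed

end

text \<open>Closure under transposition keeps adjoints of words inside \<open>D\<close>. The
  diagonal letters are those from which \<open>cartan_sum\<close> is built.\<close>

definition transpose_closed :: "(int \<times> int) set => bool" where
 "transpose_closed D \<longleftrightarrow> (\<forall>a b. (a, b) \<in> D --> (b, a) \<in> D \<and>
   (a \<noteq> 0 --> (\<bar>a\<bar>, \<bar>a\<bar>) \<in> D) \<and> (b \<noteq> 0 --> (\<bar>b\<bar>, \<bar>b\<bar>) \<in> D))"

definition pscale :: "(complex => 'v => 'v) => complex => 'v \<times> vec => 'v \<times> vec" where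
 "pscale scale c z = (scale c (fst z), fscale c (snd z))"

context so_rep
begin

text \<open>An operator whose eigenvalue on weight vectors drops under every lowering letter.\<close>

definition cartan_sum :: "(int \<times> int) set => 'v => 'v" where
 "cartan_sum D u = (\<Sum>i\<in>{i\<in>{1..int n}. (i, i) \<in> D}. scale (of_int (height n i)) (F i i u))"

lemma cartan_sum_lin: "lin (cartan_sum D)"
proof -
 have sum: "lin (%u. \<Sum>i\<in>I. scale (of_int (height n i)) (F i i u))" if "I \<subseteq> {1..int n}" "finite I" for I
  using that(2,1)
 proof (induction I rule: finite_induct)
  case (insert i I)
  have "lin (F i i)" using insert.prems by (intro F_lin) auto
  thus ?case using insert by (auto simp: lin_def scale_right_distrib algebra_simps)
 qed (simp add: lin_def)
 have "finite {i\<in>{1..int n}. (i, i) \<in> D}" by (rule finite_subset[of _ "{1..int n}"]) auto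
 thus ?thesis unfolding cartan_sum_def[abs_def] by (intro sum) auto
qed

lemma cartan_sum_X:
 assumes D: "transpose_closed D" "D \<subseteq> letter_range n" and x: "(a, b) \<in> D"
 shows "cartan_sum D (F a b u) = F a b (cartan_sum D u) + scale (of_int (height n a - height n b)) (F a b u)"
proof -
 have ab: "\<bar>a\<bar> \<le> int n" "\<bar>b\<bar> \<le> int n" using D(2) x by (auto simp: letter_range_def)
 have lin: "lin (F a b)" using ab by (rule F_lin)
 let ?I = "{i\<in>{1..int n}. (i, i) \<in> D}"
 have fin: "finite ?I" by (rule finite_subset[of _ "{1..int n}"]) auto
 define e where "e i c = (if i = c then 1 else if i = - c then - 1 else (0::int))" for i c :: int
 have comm: "F i i (F a b u) = F a b (F i i u) + scale (of_int (e i a - e i b)) (F a b u)" if "i \<in> ?I" for i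
 proof -
  have i: "\<bar>i\<bar> \<le> int n" "0 < i" using that by auto
  have 1: "(if i = a then F i b u else 0) = (if i = a then F a b u else 0)" by simp
  have 2: "(if i = b then F a i u else 0) = (if i = b then F a b u else 0)" by simp
  have 3: "(if a = - i then F (- i) b u else 0) = (if a = - i then F a b u else 0)" by simp
  have 4: "(if b = - i then F a (- i) u else 0) = (if b = - i then F a b u else 0)" by simp
  have s: "scale (of_int (e i a - e i b)) (F a b u)
    = (if i = a then F a b u else 0) - (if i = b then F a b u else 0)
    - (if a = - i then F a b u else 0) + (if b = - i then F a b u else 0)"
   using i(2) unfolding e_def by (auto simp: scale_left_diff_distrib)
  show ?thesis using F_comm[OF i(1,1) ab, of u] unfolding 1 2 3 4 s by (simp add: algebra_simps)
 qed
 have tot: "(\<Sum>i\<in>?I. height n i * e i c) = height n c" if "c \<noteq> 0 ==> (\<bar>c\<bar>, \<bar>c\<bar>) \<in> D" "\<bar>c\<bar> \<le> int n" for c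
 proof (cases "c = 0")
  case False
  hence "\<bar>c\<bar> \<in> ?I" using that by auto
  have "(\<Sum>i\<in>?I. height n i * e i c) = (\<Sum>i\<in>?I. if i = \<bar>c\<bar> then height n c else 0)"
   by (intro sum.cong refl) (auto simp: e_def height_def sgn_if)
  also have "\<dots> = height n c" using \<open>\<bar>c\<bar> \<in> ?I\<close> fin by simp
  finally show ?thesis .
 qed (auto simp: e_def height_def intro!: sum.neutral)
 have "cartan_sum D (F a b u) = (\<Sum>i\<in>?I. scale (of_int (height n i)) (F a b (F i i u))
   + scale (of_int (height n i * (e i a - e i b))) (F a b u))"
  unfolding cartan_sum_def using comm by (intro sum.cong refl) (simp add: scale_right_distrib)
 also have "\<dots> = F a b (cartan_sum D u) + scale (of_int (\<Sum>i\<in>?I. height n i * (e i a - e i b))) (F a b u)"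
  unfolding sum.distrib cartan_sum_def lin_sum[OF lin] of_int_sum scale_sum_left lin_scale[OF lin] ..
 also have "(\<Sum>i\<in>?I. height n i * (e i a - e i b)) = height n a - height n b"
  using tot[of a] tot[of b] D(1) x ab unfolding transpose_closed_def
  by (simp add: right_diff_distrib sum_subtractf)
 finally show ?thesis .
qed

lemma cartan_sum_stable:
 assumes "stable D U" "u \<in> U" shows "cartan_sum D u \<in> U"
proof -
 have "F i i u \<in> U" if "(i, i) \<in> D" for i using stable_X[OF assms(1) that assms(2)] by simp
 thus ?thesis unfolding cartan_sum_def
  by (intro subspace_sum[OF stable_subspace[OF assms(1)]] subspace_scale[OF stable_subspace[OF assms(1)]]) auto
qed

definition cartan_value :: "(int \<times> int) set => (int => real) => complex" where
 "cartan_value D \<mu> = (\<Sum>i\<in>{i\<in>{1..int n}. (i, i) \<in> D}. of_int (height n i) * of_real (\<mu> i))"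

lemma cartan_sum_datum:
 assumes "datum D w U \<mu>" shows "cartan_sum D w = scale (cartan_value D \<mu>) w"
 unfolding cartan_sum_def cartan_value_def scale_sum_left
proof (intro sum.cong refl)
 fix i assume "i \<in> {i\<in>{1..int n}. (i, i) \<in> D}"
 hence "F i i w = scale (of_real (\<mu> i)) w" by (intro datum_weight[OF assms]) auto
 thus "scale (of_int (height n i)) (F i i w) = scale (of_int (height n i) * of_real (\<mu> i)) w" by simp
qed

lemma cartan_sum_lowering:
 assumes D: "transpose_closed D" "D \<subseteq> letter_range n" and datum: "datum D w U \<mu>"
  and ws: "set ws \<subseteq> {x \<in> D. normal_lowering x}"
 shows "\<exists>d\<ge>0. cartan_sum D (foldr X ws w) = scale (cartan_value D \<mu> - of_int d) (foldr X ws w) \<and>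
  (ws \<noteq> [] --> d > 0)"
 using ws
proof (induction ws)
 case Nil
 thus ?case using cartan_sum_datum[OF datum] by (intro exI[of _ 0]) simp
next
 case (Cons x ws)
 obtain a b where x: "x = (a, b)" by fastforce
 then obtain d where d: "d \<ge> 0"
  "cartan_sum D (foldr X ws w) = scale (cartan_value D \<mu> - of_int d) (foldr X ws w)" using Cons by auto
 have xD: "(a, b) \<in> D" "normal_lowering (a, b)" using Cons.prems x by auto
 hence ab: "\<bar>a\<bar> \<le> int n" "\<bar>b\<bar> \<le> int n" using D(2) by (auto simp: letter_range_def)
 have lt: "height n a < height n b"
  using xD(2) ab by (auto simp: normal_lowering_def height_def sgn_if)
 have "cartan_sum D (F a b (foldr X ws w))
   = scale (cartan_value D \<mu> - of_int (d + height n b - height n a)) (F a b (foldr X ws w))"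
  unfolding cartan_sum_X[OF D xD(1)] d(2) lin_scale[OF F_lin[OF ab]] scale_left_distrib[symmetric]
  by (simp add: algebra_simps)
 thus ?case using d(1) lt x by (intro exI[of _ "d + height n b - height n a"]) simp
qed

end

section \<open>Comparison of a highest weight vector modulo U with one in a unitary module\<close>

locale rep_pair = V: so_rep scale n F + M: unitary_rep n G B
 for scale :: "complex => 'v::ab_group_add => 'v" and n :: nat
  and F :: "int => int => 'v => 'v" and G :: "int => int => vec => vec" and B :: "idx set" +
 fixes D :: "(int \<times> int) set" and rs :: "root list"
  and w :: 'v and U :: "'v set" and v :: vec and \<mu> :: "int => real"
 assumes D_range: "D \<subseteq> letter_range n" and D_mirror: "mirror ` D \<subseteq> D"
  and D_closed: "transpose_closed D" and D_bracket: "bracket_in D D D"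
  and D_list: "V.lowering_list D rs"
  and w_datum: "V.datum D w U \<mu>" and w_notin: "w \<notin> U"
  and v_datum: "M.datum D v {0} \<mu>" and v_supported: "M.supported v" and v_nonzero: "v \<noteq> 0"
begin

definition P :: "int => int => 'v \<times> vec => 'v \<times> vec" where
 "P a b z = (F a b (fst z), G a b (snd z))"

sublocale Pr: complex_space "pscale scale"
 by unfold_locales (auto simp: pscale_def prod_eq_iff V.scale_right_distrib V.scale_left_distrib
  vec.scale_right_distrib vec.scale_left_distrib)

sublocale Pr: so_rep "pscale scale" n P
proof
 fix a b :: int assume ab: "\<bar>a\<bar> \<le> int n" "\<bar>b\<bar> \<le> int n"
 show "Pr.lin (P a b)" unfolding Pr.lin_def P_def pscale_def fst_add snd_add fst_conv snd_conv
   V.lin_add[OF V.F_lin[OF ab]] V.lin_scale[OF V.F_lin[OF ab]]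
   vec.lin_add[OF M.F_lin[OF ab]] vec.lin_scale[OF M.F_lin[OF ab]] by simp
 show "P (- b) (- a) u = - P a b u" for u
  using V.F_mirror[OF ab] M.F_mirror[OF ab] by (simp add: P_def)
next
 fix a b c d u assume r: "\<bar>a\<bar> \<le> int n" "\<bar>b\<bar> \<le> int n" "\<bar>c\<bar> \<le> int n" "\<bar>d\<bar> \<le> int n"
 show "P a b (P c d u) - P c d (P a b u) = so_bracket P a b c d u"
 proof (rule prod_eqI)
  have f: "fst (if Q then z else 0) = (if Q then fst z else 0)"
   "snd (if Q then z else 0) = (if Q then snd z else 0)" for Q and z :: "'v \<times> vec" by simp_all
  show "fst (P a b (P c d u) - P c d (P a b u)) = fst (so_bracket P a b c d u)"
   unfolding fst_add fst_diff f P_def fst_conv by (rule V.F_comm[OF r])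
  show "snd (P a b (P c d u) - P c d (P a b u)) = snd (so_bracket P a b c d u)"
   unfolding snd_add snd_diff f P_def snd_conv by (rule M.F_comm[OF r])
 qed
qed

lemma P_X: "Pr.X x z = (V.X x (fst z), M.X x (snd z))" by (simp add: Pr.X_def V.X_def M.X_def P_def)

lemma P_word: "foldr Pr.X ws z = (foldr V.X ws (fst z), foldr M.X ws (snd z))"
 by (induction ws) (auto simp: P_X)

definition R :: "('v \<times> vec) set" where
 "R = Pr.span (U \<times> {0} \<union> {foldr Pr.X ws (w, v) | ws. set ws \<subseteq> D})"

lemma R_subspace: "Pr.subspace R" by (simp add: R_def)

lemma R_add: "(x, y) \<in> R ==> (x', y') \<in> R ==> (x + x', y + y') \<in> R"
 using Pr.subspace_add[OF R_subspace] by fastforce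

lemma R_scale: "(x, y) \<in> R ==> (scale c x, fscale c y) \<in> R"
 using Pr.subspace_scale[OF R_subspace, of "(x, y)" c] by (simp add: pscale_def)

lemma R_diff: "(x, y) \<in> R ==> (x', y') \<in> R ==> (x - x', y - y') \<in> R"
 using Pr.subspace_diff[OF R_subspace] by fastforce

lemma R_word: "set ws \<subseteq> D ==> (foldr V.X ws w, foldr M.X ws v) \<in> R"
 unfolding R_def using P_word[of ws "(w, v)"] by (intro Pr.span_base) auto

lemma R_U: "u \<in> U ==> (u, 0) \<in> R" unfolding R_def by (intro Pr.span_base) auto

lemma pair_U_subspace: "Pr.subspace (U \<times> {0})"
 using V.stable_subspace[OF V.datum_stable[OF w_datum]]
 by (auto simp: Pr.subspace_def V.subspace_def pscale_def zero_prod_def)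

lemma pair_datum: "Pr.datum D (w, v) (U \<times> {0}) \<mu>" unfolding Pr.datum_def Pr.stable_def
proof (intro conjI ballI impI allI pair_U_subspace)
 fix x and z :: "'v \<times> vec" assume x: "x \<in> D" and z: "z \<in> U \<times> {0}"
 hence "M.X x 0 = 0" using D_range by (intro vec.lin_0 M.X_lin) auto
 thus "Pr.X x z \<in> U \<times> {0}" using V.stable_X[OF V.datum_stable[OF w_datum] x] z by (auto simp: P_X)
next
 fix x assume x: "x \<in> D" "raising n x"
 thus "Pr.X x (w, v) \<in> U \<times> {0}"
  using V.datum_raising[OF w_datum x] M.datum_raising[OF v_datum x] by (simp add: P_X)
next
 fix i :: int assume i: "0 < i" "(i, i) \<in> D"
 thus "P i i (w, v) = pscale scale (of_real (\<mu> i)) (w, v)"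
  using V.datum_weight[OF w_datum i] M.datum_weight[OF v_datum i] by (simp add: P_def pscale_def)
qed

lemma R_stable:
 assumes "(x, y) \<in> R" "z \<in> D" shows "(V.X z x, M.X z y) \<in> R"
proof -
 have "Pr.X z (x, y) \<in> R"
 proof (rule Pr.lin_span_into[OF _ R_subspace _ assms(1)[unfolded R_def]])
  show "Pr.lin (Pr.X z)" using assms(2) D_range by (intro Pr.X_lin) auto
  fix t assume "t \<in> U \<times> {0} \<union> {foldr Pr.X ws (w, v) | ws. set ws \<subseteq> D}"
  then consider "t \<in> U \<times> {0}" | ws where "t = foldr Pr.X ws (w, v)" "set ws \<subseteq> D" by blast
  thus "Pr.X z t \<in> R"
  proof cases
   case 1
   hence "Pr.X z t \<in> U \<times> {0}" by (rule Pr.stable_X[OF Pr.datum_stable[OF pair_datum] assms(2)])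
   thus ?thesis unfolding R_def by (intro Pr.span_base) auto
  next
   case 2
   hence "Pr.X z t = foldr Pr.X (z # ws) (w, v)" "set (z # ws) \<subseteq> D" using assms(2) by auto
   thus ?thesis unfolding R_def by (intro Pr.span_base) blast
  qed
 qed
 thus ?thesis by (simp add: P_X)
qed

definition lower :: "'v set" where
 "lower = V.span {t. \<exists>d. d \<noteq> 0 \<and> V.cartan_sum D t = scale (V.cartan_value D \<mu> - d) t}"

text \<open>By the spanning theorem only lowering monomials applied to \<open>(w, v)\<close> matter.
  The empty one contributes the common coefficient \<open>c\<close>; any other gives a lower
  eigenvector on the left, and on the right a vector orthogonal to \<open>v\<close>, since the
  adjoint of its first letter is raising and annihilates \<open>v\<close>.\<close>

lemma R_decompose:
 assumes "(x, y) \<in> R"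
 shows "\<exists>c u l. u \<in> U \<and> l \<in> lower \<and> x = u + scale c w + l \<and> inner B y v = c * inner B v v"
proof -
 define T where "T = {z. \<exists>c u l. u \<in> U \<and> l \<in> lower \<and> fst z = u + scale c w + l \<and>
  inner B (snd z) v = c * inner B v v}"
 have U: "V.subspace U" by (rule V.stable_subspace[OF V.datum_stable[OF w_datum]])
 have L: "V.subspace lower" by (simp add: lower_def)
 have T: "Pr.subspace T" unfolding Pr.subspace_def
 proof (intro conjI ballI allI)
  show "0 \<in> T" unfolding T_def
   using V.subspace_0[OF U] V.subspace_0[OF L] by (auto intro!: exI[of _ 0])
  fix z z' assume "z \<in> T" "z' \<in> T"
  then obtain c u l c' u' l' where
   "u \<in> U" "l \<in> lower" "fst z = u + scale c w + l" "inner B (snd z) v = c * inner B v v"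
   "u' \<in> U" "l' \<in> lower" "fst z' = u' + scale c' w + l'" "inner B (snd z') v = c' * inner B v v"
   unfolding T_def by blast
  thus "z + z' \<in> T" unfolding T_def using V.subspace_add[OF U] V.subspace_add[OF L]
   by (intro CollectI exI[of _ "c + c'"] exI[of _ "u + u'"] exI[of _ "l + l'"])
    (simp add: inner_add_left V.scale_left_distrib algebra_simps)
 next
  fix e z assume "z \<in> T"
  then obtain c u l where
   "u \<in> U" "l \<in> lower" "fst z = u + scale c w + l" "inner B (snd z) v = c * inner B v v"
   unfolding T_def by blast
  thus "pscale scale e z \<in> T" unfolding T_def using V.subspace_scale[OF U] V.subspace_scale[OF L]
   by (intro CollectI exI[of _ "e * c"] exI[of _ "scale e u"] exI[of _ "scale e l"])
    (simp add: pscale_def inner_scale_left V.scale_right_distrib)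
 qed
 have "R \<subseteq> T" unfolding R_def
 proof (intro Pr.span_minimal T Un_least subsetI)
  fix z :: "'v \<times> vec" assume "z \<in> U \<times> {0}"
  thus "z \<in> T" unfolding T_def
   using V.subspace_0[OF L] by (intro CollectI exI[of _ 0] exI[of _ "fst z"]) auto
 next
  fix z assume "z \<in> {foldr Pr.X ws (w, v) | ws. set ws \<subseteq> D}"
  then obtain ws where ws: "z = foldr Pr.X ws (w, v)" "set ws \<subseteq> D" by blast
  have "z \<in> Pr.span (U \<times> {0} \<union> {Pr.mono rs q (w, v) | q.
   sum_list (map (%r. q r * 0) rs) \<le> sum_list (map (%_. 0) ws)})"
   unfolding ws(1)
  proof (rule Pr.datum_pbw[OF pair_datum D_range D_mirror _ _ _ ws(2)])
   show "Pr.lowering_list D rs" using D_list unfolding Pr.lowering_list_def V.lowering_list_def .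
   show "Pr.X x (Pr.X y u) - Pr.X y (Pr.X x u) \<in> Pr.span {Pr.X z u |z. z \<in> D \<and> 0 \<le> 0 + (0::nat)}"
    if "x \<in> D" "y \<in> D" for x y u
    using Pr.bracket_in_span[OF D_bracket that D_range D_range, of u] by simp
  qed simp
  also have "\<dots> \<subseteq> T"
  proof (intro Pr.span_minimal T Un_least subsetI)
   fix z :: "'v \<times> vec" assume "z \<in> U \<times> {0}"
   thus "z \<in> T" unfolding T_def
    using V.subspace_0[OF L] by (intro CollectI exI[of _ 0] exI[of _ "fst z"]) auto
  next
   fix z assume "z \<in> {Pr.mono rs q (w, v) | q. sum_list (map (%r. q r * 0) rs) \<le> sum_list (map (%_. 0) ws)}"
   then obtain q where q: "z = Pr.mono rs q (w, v)" by blast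
   define vs where "vs = letters rs q"
   have z: "z = (foldr V.X vs w, foldr M.X vs v)"
    unfolding q Pr.mono_eq_word vs_def[symmetric] P_word by simp
   have vs: "set vs \<subseteq> {x \<in> D. normal_lowering x}"
    using D_list unfolding V.lowering_list_def vs_def by auto
   show "z \<in> T"
   proof (cases "vs = []")
    case True
    thus ?thesis unfolding T_def z
     using V.subspace_0[OF L] V.subspace_0[OF U] by (intro CollectI exI[of _ 1] exI[of _ 0]) simp
   next
    case False
    obtain d where "cartan_sum_eq": "V.cartan_sum D (foldr V.X vs w)
      = scale (V.cartan_value D \<mu> - of_int d) (foldr V.X vs w)" "d > 0"
     using V.cartan_sum_lowering[OF D_closed D_range w_datum vs] False by auto
    hence "foldr V.X vs w \<in> lower"
     unfolding lower_def by (intro V.span_base CollectI exI[of _ "of_int d"]) simp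
    moreover have "inner B (foldr M.X vs v) v = 0"
    proof -
     obtain x xs where xs: "vs = x # xs" using False by (cases vs) auto
     have x: "x \<in> D" "normal_lowering x" "x \<in> letter_range n" using vs xs D_range by auto
     have tx: "M.swap_letter x \<in> D"
      using D_closed x(1) unfolding transpose_closed_def M.swap_letter_def by (cases x) simp
     have "raising n (M.swap_letter x)" using letter_cases[of "M.swap_letter x" n] x
      by (auto simp: M.swap_letter_def letter_range_iff raising_def height_def normal_lowering_def sgn_if)
     hence "M.X (M.swap_letter x) v = 0" using M.datum_raising[OF v_datum tx] by simp
     moreover have "inner B (M.X x s) v = inner B s (M.X (M.swap_letter x) v)" for s
      using M.adjoint_word[of "[x]" s v] x(3) by simp
     ultimately show ?thesis unfolding xs by simp
    qed
    ultimately show ?thesis unfolding T_def z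
     using V.subspace_0[OF U] by (intro CollectI exI[of _ 0] exI[of _ "foldr V.X vs w"]) simp
   qed
  qed
  finally show "z \<in> T" .
 qed
 thus ?thesis using assms unfolding T_def by fastforce
qed

lemma R_snd_supported: "(x, y) \<in> R ==> M.supported y"
proof -
 assume xy: "(x, y) \<in> R"
 have "Pr.subspace {z. M.supported (snd z)}"
  using M.supported_subspace by (auto simp: Pr.subspace_def vec.subspace_def pscale_def)
 moreover have "U \<times> {0} \<union> {foldr Pr.X ws (w, v) | ws. set ws \<subseteq> D} \<subseteq> {z. M.supported (snd z)}"
  using M.supported_word v_supported D_range by (auto simp: P_word M.supported_def)
 ultimately have "R \<subseteq> {z. M.supported (snd z)}" unfolding R_def by (intro Pr.span_minimal)
 thus ?thesis using xy by auto
qed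

lemma R_snd_orthogonal:
 assumes "\<And>ws. set ws \<subseteq> D ==> inner B y (foldr M.X ws v) = 0" "(x', y') \<in> R"
 shows "inner B y y' = 0"
proof -
 have "Pr.subspace {z. inner B y (snd z) = 0}"
  by (auto simp: Pr.subspace_def pscale_def inner_add_right inner_scale_right)
 moreover have "U \<times> {0} \<union> {foldr Pr.X ws (w, v) | ws. set ws \<subseteq> D} \<subseteq> {z. inner B y (snd z) = 0}"
  using assms(1) by (auto simp: P_word)
 ultimately have "R \<subseteq> {z. inner B y (snd z) = 0}" unfolding R_def by (intro Pr.span_minimal)
 thus ?thesis using assms(2) by auto
qed

lemma coefficient_zero:
 assumes "u \<in> U" "l \<in> lower" "u + scale c w + l \<in> U"
 shows "c = 0"
proof (rule ccontr)
 assume c: "c \<noteq> 0"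
 have st: "V.stable D U" by (rule V.datum_stable[OF w_datum])
 have U: "V.subspace U" by (rule V.stable_subspace[OF st])
 have "scale c w + l \<in> U" using V.subspace_diff[OF U assms(3,1)] by (simp add: algebra_simps)
 moreover have "V.cartan_sum D (scale c w) = scale (V.cartan_value D \<mu>) (scale c w)"
  using V.cartan_sum_datum[OF w_datum] by (simp add: V.lin_scale[OF V.cartan_sum_lin] mult.commute)
 ultimately have "scale c w \<in> U"
  using V.lowest_eigen_mem[OF V.cartan_sum_lin U V.cartan_sum_stable[OF st], of "scale c w" "V.cartan_value D \<mu>" l]
   assms(2) unfolding lower_def by blast
 thus False using w_notin V.subspace_scale_cancel[OF U _ c] by blast
qed

text \<open>If \<open>x\<close> lies in \<open>U\<close>, its coefficient at \<open>w\<close>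
  vanishes, hence \<open>y\<close> is orthogonal to \<open>v\<close>. The same holds after applying
  any word, so by adjunction \<open>y\<close> is orthogonal to all words applied to
  \<open>v\<close>. Since \<open>y\<close> is itself a combination of such vectors, it is orthogonal
  to itself.\<close>

theorem compare_left:
 assumes "(x, y) \<in> R" "x \<in> U" shows "y = 0"
proof -
 have orth: "inner B y' v = 0" if R': "(x', y') \<in> R" and U': "x' \<in> U" for x' y'
 proof -
  obtain c u l where "u \<in> U" "l \<in> lower" "x' = u + scale c w + l" "inner B y' v = c * inner B v v"
   using R_decompose[OF R'] by blast
  thus ?thesis using coefficient_zero[of u l c] U' by simp
 qed
 have word: "inner B y (foldr M.X ws v) = 0" if ws: "set ws \<subseteq> D" for ws
 proof -
  define vs where "vs = map M.swap_letter (rev ws)"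
  have vs: "set vs \<subseteq> D"
  proof
   fix z assume "z \<in> set vs"
   then obtain x where "x \<in> set ws" and z: "z = M.swap_letter x" by (auto simp: vs_def)
   hence "x \<in> D" using ws by blast
   with z
   show "z \<in> D" using D_closed unfolding transpose_closed_def M.swap_letter_def by (cases x) simp
  qed
  have "(foldr V.X vs x, foldr M.X vs y) \<in> R" using vs
   by (induction vs) (auto intro: R_stable assms)
  moreover have "foldr V.X vs x \<in> U"
   by (rule V.stable_word[OF V.datum_stable[OF w_datum] vs assms(2)])
  ultimately have "inner B (foldr M.X vs y) v = 0" by (rule orth)
  moreover have "map M.swap_letter (rev vs) = ws"
   unfolding vs_def by (simp add: rev_map comp_def M.swap_letter_def)
  ultimately show ?thesis using M.adjoint_word[of vs y v] vs D_range by auto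
 qed
 have "inner B y y = 0" by (rule R_snd_orthogonal[OF word assms(1)])
 thus ?thesis by (rule M.supported_inner_self[OF R_snd_supported[OF assms(1)]])
qed

text \<open>\<open>Z\<close> collects the vectors that have a partner in the span \<open>Y\<close>;
  vectors of \<open>U\<close> have the partner 0. A relation on the left therefore gives the word a
  partner in \<open>Y\<close>, and by \<open>compare_left\<close> this partner is the word applied
  to \<open>v\<close>.\<close>

corollary relation_lifts:
 assumes rel: "foldr V.X ws w \<in> V.span (U \<union> {foldr V.X vs w | vs. vs \<in> W})" and ws: "set ws \<subseteq> D"
  and W: "\<And>vs. vs \<in> W ==> set vs \<subseteq> D"
 shows "foldr M.X ws v \<in> vec.span {foldr M.X vs v | vs. vs \<in> W}"
proof -
 define Y where "Y = vec.span {foldr M.X vs v | vs. vs \<in> W}"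
 define Z where "Z = {x. \<exists>y\<in>Y. (x, y) \<in> R}"
 have ZI: "x \<in> Z" if "y \<in> Y" "(x, y) \<in> R" for x y using that unfolding Z_def by blast
 have Y0: "0 \<in> Y" unfolding Y_def by (rule vec.span_zero)
 have R0: "(0, 0) \<in> R" using Pr.subspace_0[OF R_subspace] by (simp only: zero_prod_def)
 have S: "V.subspace Z"
 proof (rule V.subspaceI)
  show "0 \<in> Z" by (rule ZI[OF Y0 R0])
 next
  fix x x' assume "x \<in> Z" "x' \<in> Z"
  then obtain y y' where y: "y \<in> Y" "(x, y) \<in> R" "y' \<in> Y" "(x', y') \<in> R" unfolding Z_def by blast
  have "y + y' \<in> Y" using y(1,3) unfolding Y_def by (rule vec.span_add)
  thus "x + x' \<in> Z" by (rule ZI[OF _ R_add[OF y(2,4)]])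
 next
  fix c x assume "x \<in> Z"
  then obtain y where y: "y \<in> Y" "(x, y) \<in> R" unfolding Z_def by blast
  have "fscale c y \<in> Y" using y(1) unfolding Y_def by (rule vec.span_scale)
  thus "scale c x \<in> Z" by (rule ZI[OF _ R_scale[OF y(2)]])
 qed
 have "U \<union> {foldr V.X vs w | vs. vs \<in> W} \<subseteq> Z"
 proof (intro Un_least subsetI)
  fix x assume "x \<in> U"
  thus "x \<in> Z" by (rule ZI[OF Y0 R_U])
 next
  fix x assume "x \<in> {foldr V.X vs w | vs. vs \<in> W}"
  then obtain vs where vs: "x = foldr V.X vs w" "vs \<in> W" by blast
  have "foldr M.X vs v \<in> Y" unfolding Y_def using vs(2) by (intro vec.span_base) blast
  thus "x \<in> Z" unfolding vs(1) by (rule ZI[OF _ R_word[OF W[OF vs(2)]]])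
 qed
 hence "foldr V.X ws w \<in> Z" using V.span_minimal[OF _ S] rel by blast
 then obtain y where y: "y \<in> Y" "(foldr V.X ws w, y) \<in> R" unfolding Z_def by blast
 have "(0, foldr M.X ws v - y) \<in> R" using R_diff[OF R_word[OF ws] y(2)] by simp
 moreover have "0 \<in> U" by (rule V.subspace_0[OF V.stable_subspace[OF V.datum_stable[OF w_datum]]])
 ultimately have "foldr M.X ws v - y = 0" by (rule compare_left)
 thus ?thesis using y(1) unfolding Y_def by simp
qed

text \<open>Pairing the right component with \<open>v\<close> reads off the coefficient at
  \<open>w\<close>, which would be 0. Then \<open>w\<close> would be negligible up to lower
  eigenvectors, contrary to \<open>coefficient_zero\<close>.\<close>

lemma generator_not_degenerate: "(w, 0) \<notin> R"
proof
 assume "(w, 0) \<in> R"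
 then obtain c u l where cul: "u \<in> U" "l \<in> lower" "w = u + scale c w + l" "inner B 0 v = c * inner B v v"
  using R_decompose by blast
 have "inner B v v \<noteq> 0" using v_nonzero M.supported_inner_self[OF v_supported] by blast
 hence "c = 0" using cul(4) by simp
 hence w: "w = u + l" using cul(3) by simp
 have "- l \<in> lower" using cul(2) unfolding lower_def by (rule V.span_neg)
 moreover have "u - (u + l) = - l" by simp
 have "u + scale (- 1) w + l = 0" unfolding w by simp
 hence "u + scale (- 1) w + l \<in> U"
  using V.subspace_0[OF V.stable_subspace[OF V.datum_stable[OF w_datum]]] by simp
 hence "(- 1 :: complex) = 0" by (rule coefficient_zero[OF cul(1,2)])
 thus False by simp
qed

end

section \<open>Pairs of adjoint operators on finitely supported functions\<close>

definition restrict :: "idx set => vec => vec" where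
 "restrict B t = (%i. if i \<in> B then t i else 0)"

definition adjoint_pair :: "idx set => (vec => vec) => (vec => vec) => bool" where
 "adjoint_pair B T S \<longleftrightarrow> vec.lin T \<and> vec.lin S \<and>
   (\<forall>t. restrict B (T t) = T t \<and> T (restrict B t) = T t) \<and>
   (\<forall>t. restrict B (S t) = S t \<and> S (restrict B t) = S t) \<and>
   (\<forall>s t. inner B (T s) t = inner B s (S t))"

lemma adjoint_pair_lin: "adjoint_pair B T S ==> vec.lin T"
 and adjoint_pair_inner: "adjoint_pair B T S ==> inner B (T s) t = inner B s (S t)"
 and restrict_adjoint_pair: "adjoint_pair B T S ==> restrict B (T t) = T t"
 and adjoint_pair_restrict: "adjoint_pair B T S ==> T (restrict B t) = T t"
 by (auto simp: adjoint_pair_def)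

lemma adjoint_pair_outside: "adjoint_pair B T S ==> i \<notin> B ==> T t i = 0"
 using restrict_adjoint_pair[of B T S t] by (metis restrict_def)

lemma vec_linI:
 assumes "\<And>s t i. T (s + t) i = T s i + T t i" "\<And>c t i. T (fscale c t) i = c * T t i"
 shows "vec.lin T"
 by (auto simp: vec.lin_def fun_eq_iff assms) (simp add: fscale_def)

lemma lin_apply:
 assumes "vec.lin T"
 shows "T (%k. s k + t k) i = T s i + T t i" and "T (%k. c * t k) i = c * T t i"
 using vec.lin_add[OF assms, of s t] vec.lin_scale[OF assms, of c t] by (simp_all add: plus_fun_def fscale_def)

lemma adjoint_pairI:
 assumes "vec.lin T" "vec.lin S" "\<And>t i. i \<notin> B ==> T t i = 0" "\<And>t i. i \<notin> B ==> S t i = 0"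
  "\<And>t i. T (restrict B t) i = T t i" "\<And>t i. S (restrict B t) i = S t i"
  "\<And>s t. inner B (T s) t = inner B s (S t)"
 shows "adjoint_pair B T S"
 using assms by (auto simp: adjoint_pair_def fun_eq_iff restrict_def)

lemma restrict_expand:
 assumes "finite B" shows "restrict B t = (\<Sum>k\<in>B. fscale (t k) (single k))"
proof
 fix i
 have "(\<Sum>k\<in>B. fscale (t k) (single k)) i = (\<Sum>k\<in>B. if k = i then t i else 0)"
  using assms by (induction B rule: finite_induct) (auto simp: fscale_def single_def)
 also have "\<dots> = restrict B t i" using assms by (simp add: restrict_def)
 finally show "restrict B t i = (\<Sum>k\<in>B. fscale (t k) (single k)) i" ..
qed

lemma adjoint_pair_matrix:
 assumes "finite B" "adjoint_pair B T S"
 shows "T t i = (if i \<in> B then \<Sum>k\<in>B. T (single k) i * t k else 0)"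
proof (cases "i \<in> B")
 case True
 have "T t = T (restrict B t)" using adjoint_pair_restrict[OF assms(2)] by simp
 also have "\<dots> = (\<Sum>k\<in>B. fscale (t k) (T (single k)))"
  unfolding restrict_expand[OF assms(1)] vec.lin_sum[OF adjoint_pair_lin[OF assms(2)]]
   vec.lin_scale[OF adjoint_pair_lin[OF assms(2)]] ..
 finally have "T t = (\<Sum>k\<in>B. fscale (t k) (T (single k)))" .
 moreover have "(\<Sum>k\<in>B. fscale (t k) (T (single k))) i = (\<Sum>k\<in>B. T (single k) i * t k)"
  using assms(1) by (induction B rule: finite_induct) (auto simp: fscale_def)
 ultimately show ?thesis using True by simp
qed (use adjoint_pair_outside[OF assms(2)] in simp)

lemma adjoint_pair_comp:
 "adjoint_pair B T S ==> adjoint_pair B T' S' ==> adjoint_pair B (%t. T (T' t)) (%t. S' (S t))"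
 unfolding adjoint_pair_def vec.lin_def by auto

lemma restrict_add: "restrict B (s + t) = restrict B s + restrict B t"
 and restrict_diff: "restrict B (s - t) = restrict B s - restrict B t"
 and restrict_scale: "restrict B (fscale c t) = fscale c (restrict B t)"
 and restrict_idem [simp]: "restrict B (restrict B t) = restrict B t"
 by (auto simp: restrict_def fscale_def fun_eq_iff)

lemma restrict_0 [simp]: "restrict B 0 = 0" by (auto simp: restrict_def)

lemma inner_diff_left: "inner B (s - s') t = inner B s t - inner B s' t"
 and inner_diff_right: "inner B t (s - s') = inner B t s - inner B t s'"
 and inner_restrict_left: "inner B (restrict B s) t = inner B s t"
 and inner_restrict_right: "inner B s (restrict B t) = inner B s t"
 by (simp_all add: inner_def algebra_simps sum_subtractf restrict_def)

lemma adjoint_pair_add: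
 assumes "adjoint_pair B T S" "adjoint_pair B T' S'"
 shows "adjoint_pair B (%t. T t + T' t) (%t. S t + S' t)"
 using assms unfolding adjoint_pair_def vec.lin_def
 by (auto simp: restrict_add inner_add_left inner_add_right vec.scale_right_distrib)

lemma adjoint_pair_diff:
 assumes "adjoint_pair B T S" "adjoint_pair B T' S'"
 shows "adjoint_pair B (%t. T t - T' t) (%t. S t - S' t)"
 using assms unfolding adjoint_pair_def vec.lin_def
 by (auto simp: restrict_diff inner_diff_left inner_diff_right vec.scale_right_diff_distrib)

lemma adjoint_pair_restriction: "adjoint_pair B (%t. fscale (of_real c) (restrict B t)) (%t. fscale (of_real c) (restrict B t))"
 unfolding adjoint_pair_def vec.lin_def
 by (auto simp: restrict_add restrict_scale inner_scale_left inner_scale_right inner_restrict_left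
  inner_restrict_right vec.scale_right_distrib mult.commute)

section \<open>Fermions\<close>

definition window :: "nat => int set" where
 "window n = {- int n..int n}"

definition leaves :: "nat => idx set" where
 "leaves n = Leaf ` Pow (window n)"

text \<open>The sign obtained when \<open>a\<close> is moved past the smaller elements of
  \<open>I\<close> in an ordered wedge product.\<close>

definition fsign :: "int => int set => complex" where
 "fsign a I = (if even (card {x \<in> I. x < a}) then 1 else - 1)"

definition flip :: "int => int set => int set" where
 "flip a I = (if a \<in> I then I - {a} else insert a I)"

text \<open>Creation (\<open>e\<close>) and annihilation operators, acting on coefficients; hence the set is flipped back
 in the argument of \<open>t\<close>.\<close>

fun ferm :: "nat => bool => int => vec => vec" where
 "ferm n e a t (Leaf I) =
   (if I \<subseteq> window n \<and> (a \<in> I \<longleftrightarrow> e) then fsign a I * t (Leaf (flip a I)) else 0)"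
| "ferm n e a t (Node i j) = 0"

lemma finite_window [simp]: "finite (window n)" by (simp add: window_def)

lemma finite_leaves [simp]: "finite (leaves n)" by (simp add: leaves_def)

lemma mem_window: "a \<in> window n \<longleftrightarrow> \<bar>a\<bar> \<le> int n" by (auto simp: window_def)

lemma Leaf_leaves [simp]: "Leaf I \<in> leaves n \<longleftrightarrow> I \<subseteq> window n" "Node i j \<notin> leaves n"
 by (auto simp: leaves_def)

lemma flip_flip [simp]: "flip a (flip a I) = I" by (auto simp: flip_def)

lemma flip_commute: "flip a (flip b I) = flip b (flip a I)" by (auto simp: flip_def)

lemma mem_flip: "b \<in> flip a I \<longleftrightarrow> (if a = b then b \<notin> I else b \<in> I)" by (auto simp: flip_def)

lemma flip_subset: "a \<in> J ==> flip a I \<subseteq> J \<longleftrightarrow> I \<subseteq> J" by (auto simp: flip_def)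

lemma fsign_flip:
 assumes "finite I"
 shows "fsign a (flip b I) = (if b < a then - fsign a I else fsign a I)"
proof (cases "b < a")
 case True
 have fin: "finite {x \<in> I. x < a}" using assms by simp
 show ?thesis
 proof (cases "b \<in> I")
  case bI: True
  have "{x \<in> I. x < a} = insert b {x \<in> flip b I. x < a}" using bI True by (auto simp: flip_def)
  moreover have "b \<notin> {x \<in> flip b I. x < a}" using bI by (simp add: flip_def)
  moreover have "finite {x \<in> flip b I. x < a}" using assms by (simp add: flip_def)
  ultimately have "card {x \<in> I. x < a} = Suc (card {x \<in> flip b I. x < a})" by simp
  thus ?thesis using True by (simp add: fsign_def)
 next
  case bI: False
  have "{x \<in> flip b I. x < a} = insert b {x \<in> I. x < a}" using bI True by (auto simp: flip_def)
  hence "card {x \<in> flip b I. x < a} = Suc (card {x \<in> I. x < a})" using bI fin by simp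
  thus ?thesis using True by (simp add: fsign_def)
 qed
next
 case False
 hence "{x \<in> flip b I. x < a} = {x \<in> I. x < a}" by (auto simp: flip_def)
 thus ?thesis using False by (simp add: fsign_def)
qed

lemma fsign_sq [simp]: "fsign a I * fsign a I = 1" "fsign a I * (fsign a I * c) = c" "cnj (fsign a I) = fsign a I"
 by (simp_all add: fsign_def)

lemma ferm_anticommute:
 assumes "a \<in> window n" "b \<in> window n" "a \<noteq> b"
 shows "ferm n e a (ferm n e' b t) = - ferm n e' b (ferm n e a t)"
proof
 fix i show "ferm n e a (ferm n e' b t) i = (- ferm n e' b (ferm n e a t)) i"
 proof (cases i)
  case (Leaf I)
  show ?thesis
  proof (cases "I \<subseteq> window n")
   case True
   hence fin: "finite I" using finite_subset[OF _ finite_window] by auto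
   show ?thesis using assms True unfolding Leaf
    by (auto simp: fsign_flip[OF fin] mem_flip flip_subset flip_commute)
  qed (simp add: Leaf)
 qed simp
qed

lemma ferm_twice: "ferm n e a (ferm n e a t) = 0"
 by (rule ext, rename_tac i, case_tac i) (auto simp: mem_flip)

lemma ferm_restriction:
 assumes "a \<in> window n"
 shows "ferm n e a (ferm n (\<not> e) a t) + ferm n (\<not> e) a (ferm n e a t) = restrict (leaves n) t"
proof
 fix i show "(ferm n e a (ferm n (\<not> e) a t) + ferm n (\<not> e) a (ferm n e a t)) i = restrict (leaves n) t i"
 proof (cases i)
  case (Leaf I)
  show ?thesis
  proof (cases "I \<subseteq> window n")
   case True
   hence fin: "finite I" using finite_subset[OF _ finite_window] by auto
   show ?thesis using assms True unfolding Leaf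
    by (auto simp: fsign_flip[OF fin] mem_flip flip_subset restrict_def)
  qed (simp add: Leaf restrict_def)
 qed (simp add: restrict_def)
qed

lemma ferm_lin: "vec.lin (ferm n e a)"
 by (rule vec_linI; case_tac i) (auto simp: algebra_simps fscale_def)

lemma ferm_adjoint_pair:
 assumes "a \<in> window n"
 shows "adjoint_pair (leaves n) (ferm n e a) (ferm n (\<not> e) a)"
proof (rule adjoint_pairI)
 have leaf: "inner (leaves n) s t = (\<Sum>I\<in>Pow (window n). s (Leaf I) * cnj (t (Leaf I)))" for s t
  unfolding inner_def leaves_def by (subst sum.reindex) (auto simp: inj_on_def)
 show "inner (leaves n) (ferm n e a s) t = inner (leaves n) s (ferm n (\<not> e) a t)" for s t
  unfolding leaf
 proof (rule sum.reindex_bij_witness[where i = "flip a" and j = "flip a"])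
  fix I assume "I \<in> Pow (window n)"
  hence I: "I \<subseteq> window n" and fin: "finite I" using finite_subset[OF _ finite_window] by auto
  show "s (Leaf (flip a I)) * cnj (ferm n (\<not> e) a t (Leaf (flip a I)))
    = ferm n e a s (Leaf I) * cnj (t (Leaf I))"
   using I assms by (auto simp: mem_flip flip_subset fsign_flip[OF fin] mult_ac)
 qed (use assms in \<open>auto simp: flip_subset\<close>)
 fix t i
 show "ferm n e a (restrict (leaves n) t) i = ferm n e a t i" "ferm n (\<not> e) a (restrict (leaves n) t) i = ferm n (\<not> e) a t i"
  "i \<notin> leaves n ==> ferm n e a t i = 0" "i \<notin> leaves n ==> ferm n (\<not> e) a t i = 0"
  using assms by (cases i; simp add: restrict_def flip_subset)+
qed (rule ferm_lin)+

lemma unitary_repI: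
 assumes B: "finite B" and adj: "\<And>a b. a \<in> window n ==> b \<in> window n ==> adjoint_pair B (G a b) (G b a)"
  and mirror: "\<And>a b u. a \<in> window n ==> b \<in> window n ==> G (- b) (- a) u = - G a b u"
  and comm: "\<And>a b c d u. a \<in> window n ==> b \<in> window n ==> c \<in> window n ==> d \<in> window n ==>
   G a b (G c d u) - G c d (G a b u) = so_bracket G a b c d u"
  and diag: "\<And>a (i::idx) k. a \<in> window n ==> i \<noteq> k ==> G a a (single k) i = 0"
 shows "unitary_rep n G B"
 by (unfold_locales; (fold mem_window)?)
  (rule B comm mirror diag adjoint_pair_lin[OF adj] adjoint_pair_inner[OF adj] adjoint_pair_matrix[OF B adj];
   assumption)+

section \<open>The exterior algebra of the standard representation\<close>

definition hop :: "nat => int => int => vec => vec" where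
 "hop n a b t = ferm n True a (ferm n False b t)"

text \<open>\<open>hop n a b\<close> is the matrix unit \<open>E_ab\<close> extended as a derivation
  of the exterior algebra, so this is the action induced from the standard representation.\<close>

definition exterior :: "nat => int => int => vec => vec" where
 "exterior n a b t = hop n a b t - hop n (- b) (- a) t"

lemma ferm_diff: "ferm n e a (s - t) = ferm n e a s - ferm n e a t"
 and ferm_minus: "ferm n e a (- t) = - ferm n e a t"
 and ferm_0: "ferm n e a 0 = 0"
 using vec.lin_diff[OF ferm_lin] vec.lin_0[OF ferm_lin] vec.lin_minus[OF ferm_lin] by auto

lemma hop_diff: "hop n a b (s - t) = hop n a b s - hop n a b t" by (simp add: hop_def ferm_diff)

lemma ferm_swap:
 assumes "a \<in> window n" "b \<in> window n"
 shows "ferm n False a (ferm n True b t)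
  = (if a = b then restrict (leaves n) t else 0) - ferm n True b (ferm n False a t)"
 using ferm_anticommute[OF assms, of False True t] ferm_restriction[OF assms(1), of False t]
 by (cases "a = b") (auto simp: algebra_simps)

lemma ferm_same:
 assumes "a \<in> window n" "b \<in> window n"
 shows "ferm n e a (ferm n e b t) = - ferm n e b (ferm n e a t)"
 using ferm_anticommute[OF assms, of e e t] ferm_twice by (cases "a = b") auto

lemma hop_comm:
 assumes w: "a \<in> window n" "b \<in> window n" "c \<in> window n" "d \<in> window n"
 shows "hop n a b (hop n c d u) - hop n c d (hop n a b u)
  = (if b = c then hop n a d u else 0) - (if a = d then hop n c b u else 0)"
proof -
 let ?c = "ferm n True" and ?a = "ferm n False"
 have r: "restrict (leaves n) (ferm n e x t) = ferm n e x t" if "x \<in> window n" for e x t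
  by (rule restrict_adjoint_pair[OF ferm_adjoint_pair[OF that]])
 have 1: "?c a (?a b (?c c (?a d u))) = (if b = c then hop n a d u else 0) - ?c a (?c c (?a b (?a d u)))"
  unfolding ferm_swap[OF w(2,3)] ferm_diff by (simp add: r[OF w(4)] hop_def ferm_0)
 have 2: "?c c (?a d (?c a (?a b u))) = (if a = d then hop n c b u else 0) - ?c c (?c a (?a d (?a b u)))"
  unfolding ferm_swap[OF w(4,1)] ferm_diff by (simp add: r[OF w(2)] hop_def ferm_0)
 have 3: "?c a (?c c (?a b (?a d u))) = ?c c (?c a (?a d (?a b u)))"
  using ferm_same[OF w(1,3), of True] ferm_same[OF w(2,4), of False] by (simp add: ferm_minus)
 show ?thesis unfolding hop_def[of n a b] hop_def[of n c d] 1 2 3 by simp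
qed

lemma hop_adjoint_pair:
 assumes "a \<in> window n" "b \<in> window n"
 shows "adjoint_pair (leaves n) (hop n a b) (hop n b a)"
 using adjoint_pair_comp[OF ferm_adjoint_pair[OF assms(1), of True] ferm_adjoint_pair[OF assms(2), of False]]
 unfolding hop_def[abs_def] by simp

lemma window_minus [simp]: "- a \<in> window n \<longleftrightarrow> a \<in> window n" by (simp add: mem_window)

lemma hop_diagonal: "i \<noteq> k ==> hop n a a (single k) i = 0"
 by (cases i) (auto simp: hop_def single_def)

lemma exterior_unitary_rep: "unitary_rep n (exterior n) (leaves n)"
proof (rule unitary_repI)
 fix a b :: int assume w: "a \<in> window n" "b \<in> window n"
 show "adjoint_pair (leaves n) (exterior n a b) (exterior n b a)" unfolding exterior_def[abs_def]
  by (intro adjoint_pair_diff hop_adjoint_pair) (use w in simp_all)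
 show "exterior n (- b) (- a) u = - exterior n a b u" for u by (simp add: exterior_def)
next
 fix a b c d :: int and u
 assume w: "a \<in> window n" "b \<in> window n" "c \<in> window n" "d \<in> window n"
 let ?h = "hop n"
 have "exterior n a b (exterior n c d u) - exterior n c d (exterior n a b u)
   = (?h a b (?h c d u) - ?h c d (?h a b u)) - (?h a b (?h (- d) (- c) u) - ?h (- d) (- c) (?h a b u))
    - (?h (- b) (- a) (?h c d u) - ?h c d (?h (- b) (- a) u))
    + (?h (- b) (- a) (?h (- d) (- c) u) - ?h (- d) (- c) (?h (- b) (- a) u))"
  by (simp add: exterior_def hop_diff)
 also have "\<dots> = ((if b = c then ?h a d u else 0) - (if a = d then ?h c b u else 0))
    - ((if b = - d then ?h a (- c) u else 0) - (if a = - c then ?h (- d) b u else 0))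
    - ((if - a = c then ?h (- b) d u else 0) - (if - b = d then ?h c (- a) u else 0))
    + ((if - a = - d then ?h (- b) (- c) u else 0) - (if - b = - c then ?h (- d) (- a) u else 0))"
  using w by (subst (1 2 3 4) hop_comm) simp_all
 also have "\<dots> = so_bracket (exterior n) a b c d u"
  unfolding exterior_def by (auto simp: equation_minus_iff)
 finally show "exterior n a b (exterior n c d u) - exterior n c d (exterior n a b u)
  = so_bracket (exterior n) a b c d u" .
next
 fix a :: int and i k :: idx assume "i \<noteq> k"
 thus "exterior n a a (single k) i = 0" by (simp add: exterior_def hop_diagonal)
qed simp

text \<open>The factor makes the square \<open>1/2\<close>, as required of the Clifford generator with index \<open>0\<close>.\<close>

fun parity :: "nat => vec => vec" where
 "parity n t (Leaf I) =
   (if I \<subseteq> window n then of_real (sqrt (1 / 2)) * (if even (card I) then 1 else - 1) * t (Leaf I) else 0)"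
| "parity n t (Node i j) = 0"

text \<open>Generators with the anticommutator of indices \<open>a\<close> and \<open>b\<close>
  equal to 1 if \<open>a = - b\<close> and to 0 otherwise. Nonpositive elements of the sets are
  spectators: they enter only through the sign of \<open>parity\<close>.\<close>

definition clifford :: "nat => int => vec => vec" where
 "clifford n a = (if a > 0 then ferm n True a else if a < 0 then ferm n False (- a) else parity n)"

text \<open>One half of the commutator of the generators with indices \<open>a\<close> and
  \<open>- b\<close>. The subtracted half makes it antisymmetric under
  \<open>mirror\<close>.\<close>

definition spin :: "nat => int => int => vec => vec" where
 "spin n a b t = clifford n a (clifford n (- b) t) - (if a = b then fscale (1 / 2) (restrict (leaves n) t) else 0)"

lemma card_flip_even:
 assumes "finite I" shows "even (card (flip a I)) \<longleftrightarrow> odd (card I)"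
proof (cases "a \<in> I")
 case True
 hence "even (card I) \<longleftrightarrow> odd (card (I - {a}))" using card_Suc_Diff1[OF assms True] even_Suc by metis
 thus ?thesis unfolding flip_def if_P[OF True] by blast
qed (use assms in \<open>simp add: flip_def\<close>)

lemma parity_lin: "vec.lin (parity n)"
 by (rule vec_linI; case_tac i) (auto simp: algebra_simps fscale_def)

lemma parity_adjoint_pair: "adjoint_pair (leaves n) (parity n) (parity n)"
proof (rule adjoint_pairI)
 show "inner (leaves n) (parity n s) t = inner (leaves n) s (parity n t)" for s t
  unfolding inner_def
 proof (intro sum.cong refl)
  fix i show "parity n s i * cnj (t i) = s i * cnj (parity n t i)" if "i \<in> leaves n" using that by (cases i) auto
 qed
 fix t i
 show "parity n (restrict (leaves n) t) i = parity n t i" "i \<notin> leaves n ==> parity n t i = 0"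
  by (cases i; simp add: restrict_def)+
 thus "parity n (restrict (leaves n) t) i = parity n t i" "i \<notin> leaves n ==> parity n t i = 0" .
qed (rule parity_lin)+

lemma parity_twice: "parity n (parity n t) = fscale (1 / 2) (restrict (leaves n) t)"
proof
 have *: "complex_of_real (sqrt (1 / 2)) * (complex_of_real (sqrt (1 / 2)) * c) = 1 / 2 * c" for c
  unfolding mult.assoc[symmetric] of_real_mult[symmetric] by simp
 fix i show "parity n (parity n t) i = fscale (1 / 2) (restrict (leaves n) t) i"
  by (cases i) (auto simp: restrict_def fscale_def * simp del: real_sqrt_divide)
qed

lemma parity_ferm:
 assumes "a \<in> window n"
 shows "parity n (ferm n e a t) = - ferm n e a (parity n t)"
proof
 fix i show "parity n (ferm n e a t) i = (- ferm n e a (parity n t)) i"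
 proof (cases i)
  case (Leaf I)
  show ?thesis
  proof (cases "I \<subseteq> window n")
   case True
   hence fin: "finite I" using finite_subset[OF _ finite_window] by auto
   show ?thesis using assms True unfolding Leaf by (auto simp: card_flip_even[OF fin] flip_subset)
  qed (simp add: Leaf)
 qed simp
qed

lemma clifford_adjoint_pair: "a \<in> window n ==> adjoint_pair (leaves n) (clifford n a) (clifford n (- a))"
 using ferm_adjoint_pair[of a n True] ferm_adjoint_pair[of "- a" n False] parity_adjoint_pair
 by (auto simp: clifford_def)

lemma clifford_swap:
 assumes w: "a \<in> window n" "b \<in> window n"
 shows "clifford n a (clifford n b t)
  = (if a = - b then restrict (leaves n) t else 0) - clifford n b (clifford n a t)"
proof -
 have half: "fscale (1 / 2) s = s - fscale (1 / 2) s" for s by (auto simp: fscale_def fun_eq_iff)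
 have w': "- a \<in> window n" "- b \<in> window n" using w by simp_all
 consider "a = 0" "b = 0" | "a = 0" "b \<noteq> 0" | "a \<noteq> 0" "b = 0" | "a > 0" "b > 0" | "a < 0" "b < 0"
  | "a > 0" "b < 0" | "a < 0" "b > 0" by linarith
 thus ?thesis
  using half parity_ferm[OF w(1)] parity_ferm[OF w'(1)] parity_ferm[OF w(2)] parity_ferm[OF w'(2)]
   ferm_same[OF w] ferm_same[OF w'] ferm_swap[OF w'(1) w(2), of t] ferm_swap[OF w'(2) w(1), of t]
  by cases (auto simp: clifford_def parity_twice)
qed

lemma clifford_diagonal: "i \<noteq> k ==> clifford n a (clifford n (- a) (single k)) i = 0"
 by (cases i) (auto simp: clifford_def single_def)

lemma spin_unitary_rep: "unitary_rep n (spin n) (leaves n)"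
proof (rule unitary_repI)
 let ?g = "clifford n" and ?r = "restrict (leaves n)"
 have rg: "?r (?g a t) = ?g a t" if "a \<in> window n" for a t
  by (rule restrict_adjoint_pair[OF clifford_adjoint_pair[OF that]])
 have gr: "?g a (?r t) = ?g a t" if "a \<in> window n" for a t
  by (rule adjoint_pair_restrict[OF clifford_adjoint_pair[OF that]])
 have lin: "vec.lin (?g a)" if "a \<in> window n" for a
  by (rule adjoint_pair_lin[OF clifford_adjoint_pair[OF that]])
 note diff = vec.lin_diff[OF lin] and zero = vec.lin_0[OF lin] and scale = vec.lin_scale[OF lin]
 {
  fix a b :: int assume w: "a \<in> window n" "b \<in> window n"
  show "adjoint_pair (leaves n) (spin n a b) (spin n b a)"
  proof -
   have "adjoint_pair (leaves n) (%t. ?g a (?g (- b) t)) (%t. ?g b (?g (- a) t))"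
    using adjoint_pair_comp[OF clifford_adjoint_pair[OF w(1)] clifford_adjoint_pair[of "- b" n]] w by simp
   from adjoint_pair_diff[OF this adjoint_pair_restriction[of _ "1 / 2"]] this
   show ?thesis by (cases "a = b") (simp_all add: spin_def[abs_def])
  qed
  show "spin n (- b) (- a) u = - spin n a b u" for u
  proof -
   have "fscale (1 / 2) s + fscale (1 / 2) s = s" for s by (auto simp: fscale_def fun_eq_iff)
   hence half: "s - fscale (1 / 2) s = fscale (1 / 2) s" for s by (metis add_diff_cancel)
   have "?g (- b) (?g a u) = (if a = b then ?r u else 0) - ?g a (?g (- b) u)"
    using clifford_swap[of "- b" n a u] w by auto
   thus ?thesis using half[of "?r u"] by (auto simp: spin_def algebra_simps)
  qed
 next
  fix a b c d :: int and u
  assume w: "a \<in> window n" "b \<in> window n" "c \<in> window n" "d \<in> window n"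
  have w': "- a \<in> window n" "- b \<in> window n" "- c \<in> window n" "- d \<in> window n" using w by simp_all
  let ?x = "?g a" and ?y = "?g (- b)" and ?z = "?g c" and ?w = "?g (- d)"
  \<comment> \<open>The generators \<open>?z\<close> and \<open>?w\<close> are moved to the left
    past \<open>?x\<close> and \<open>?y\<close>; the four anticommutators met on the way are the
    four terms of \<open>so_bracket\<close>.\<close>
  have 1: "?x (?y (?z (?w u))) = (if b = c then ?x (?w u) else 0) - ?x (?z (?y (?w u)))"
   unfolding clifford_swap[OF w'(2) w(3)] diff[OF w(1)] using rg[OF w'(4)] zero[OF w(1)] by auto
  have 2: "?x (?z (?y (?w u))) = (if c = - a then ?y (?w u) else 0) - ?z (?x (?y (?w u)))"
   unfolding clifford_swap[OF w(1,3)] using rg[OF w'(2)] by auto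
  have 3: "?z (?x (?y (?w u))) = (if d = - b then ?z (?x u) else 0) - ?z (?x (?w (?y u)))"
   unfolding clifford_swap[OF w'(2,4)] diff[OF w(1)] diff[OF w(3)]
   using gr[OF w(1)] zero[OF w(1)] zero[OF w(3)] by auto
  have 4: "?z (?x (?w (?y u))) = (if a = d then ?z (?y u) else 0) - ?z (?w (?x (?y u)))"
   unfolding clifford_swap[OF w(1) w'(4)] diff[OF w(3)] using rg[OF w'(2)] zero[OF w(3)] by auto
  have c: "?x (?y (?z (?w u))) - ?z (?w (?x (?y u))) = (if b = c then ?x (?w u) else 0)
    - (if a = d then ?z (?y u) else 0) - (if c = - a then ?y (?w u) else 0)
    + (if d = - b then ?z (?x u) else 0)"
   unfolding 1 2 3 4 by simp
  define k where "k e = (if e then fscale (1 / 2) (?r u) else 0)" for e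
  have "spin n a b (spin n c d u) = ?x (?y (?z (?w u))) - (if c = d then fscale (1 / 2) (?x (?y u)) else 0)
    - (if a = b then fscale (1 / 2) (?z (?w u) - k (c = d)) else 0)"
   unfolding spin_def k_def using rg[OF w(3)] gr[OF w'(2)] zero[OF w'(2)] zero[OF w(1)] diff[OF w(1)] diff[OF w'(2)]
    scale[OF w'(2)] scale[OF w(1)] by (auto simp: restrict_diff restrict_scale)
  moreover have "spin n c d (spin n a b u) = ?z (?w (?x (?y u))) - (if a = b then fscale (1 / 2) (?z (?w u)) else 0)
    - (if c = d then fscale (1 / 2) (?x (?y u) - k (a = b)) else 0)"
   unfolding spin_def k_def using rg[OF w(1)] gr[OF w'(4)] zero[OF w'(4)] zero[OF w(3)] diff[OF w(3)] diff[OF w'(4)]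
    scale[OF w'(4)] scale[OF w(3)] by (auto simp: restrict_diff restrict_scale)
  moreover have "(if c = d then fscale (1 / 2) (?x (?y u) - k (a = b)) else 0)
    = (if c = d then fscale (1 / 2) (?x (?y u)) else 0) - (if a = b \<and> c = d then fscale (1 / 2) (k True) else 0)"
   by (auto simp: k_def vec.scale_right_diff_distrib)
  moreover have "(if a = b then fscale (1 / 2) (?z (?w u) - k (c = d)) else 0)
    = (if a = b then fscale (1 / 2) (?z (?w u)) else 0) - (if a = b \<and> c = d then fscale (1 / 2) (k True) else 0)"
   by (auto simp: k_def vec.scale_right_diff_distrib)
  ultimately have "spin n a b (spin n c d u) - spin n c d (spin n a b u)
    = ?x (?y (?z (?w u))) - ?z (?w (?x (?y u)))" by simp
  also have "\<dots> = so_bracket (spin n) a b c d u" unfolding c by (auto simp: spin_def)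
  finally show "spin n a b (spin n c d u) - spin n c d (spin n a b u)
   = so_bracket (spin n) a b c d u" .
 next
  fix a :: int and i k :: idx assume "i \<noteq> k"
  hence "fscale (1 / 2) (?r (single k)) i = 0" by (simp add: fscale_def restrict_def single_def)
  thus "spin n a a (single k) i = 0" using clifford_diagonal[OF \<open>i \<noteq> k\<close>] by (simp add: spin_def)
 }
qed simp

section \<open>Tensor products\<close>

definition nodes :: "idx set => idx set => idx set" where
 "nodes B C = {Node i j | i j. i \<in> B \<and> j \<in> C}"

fun tensor :: "vec => vec => vec" where
 "tensor x y (Node i j) = x i * y j"
| "tensor x y (Leaf I) = 0"

fun act_left :: "idx set => (vec => vec) => vec => vec" where
 "act_left C T t (Node i j) = (if j \<in> C then T (%i. t (Node i j)) i else 0)"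
| "act_left C T t (Leaf I) = 0"

fun act_right :: "idx set => (vec => vec) => vec => vec" where
 "act_right B T t (Node i j) = (if i \<in> B then T (%j. t (Node i j)) j else 0)"
| "act_right B T t (Leaf I) = 0"

lemma nodes_iff [simp]: "Node i j \<in> nodes B C \<longleftrightarrow> i \<in> B \<and> j \<in> C" "Leaf I \<notin> nodes B C"
 by (auto simp: nodes_def)

lemma nodes_image: "nodes B C = (%k. Node (fst k) (snd k)) ` (B \<times> C)"
 by (auto simp: nodes_def image_iff)

lemma finite_nodes: "finite B ==> finite C ==> finite (nodes B C)" by (simp add: nodes_image)

lemma inner_nodes: "inner (nodes B C) s t = (\<Sum>j\<in>C. inner B (%i. s (Node i j)) (%i. t (Node i j)))"
proof -
 have "inner (nodes B C) s t = (\<Sum>k\<in>B \<times> C. s (Node (fst k) (snd k)) * cnj (t (Node (fst k) (snd k))))"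
  unfolding inner_def nodes_image by (subst sum.reindex) (auto simp: inj_on_def)
 also have "\<dots> = (\<Sum>i\<in>B. \<Sum>j\<in>C. s (Node i j) * cnj (t (Node i j)))"
  unfolding sum.cartesian_product by (intro sum.cong refl) auto
 also have "\<dots> = (\<Sum>j\<in>C. \<Sum>i\<in>B. s (Node i j) * cnj (t (Node i j)))" by (rule sum.swap)
 finally show ?thesis unfolding inner_def .
qed

lemma inner_nodes': "inner (nodes B C) s t = (\<Sum>i\<in>B. inner C (%j. s (Node i j)) (%j. t (Node i j)))"
 unfolding inner_nodes unfolding inner_def by (rule sum.swap)

lemma act_lin:
 assumes "vec.lin T" shows "vec.lin (act_left C T)" and "vec.lin (act_right C T)"
 by (rule vec_linI; case_tac i; simp add: lin_apply[OF assms] fscale_def)+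

lemma adjoint_pair_sym:
 assumes "adjoint_pair B T S" shows "adjoint_pair B S T"
proof -
 have "inner B (S s) t = inner B s (T t)" for s t
  using adjoint_pair_inner[OF assms, of t s] inner_commute[of B "S s" t] inner_commute[of B s "T t"] by simp
 thus ?thesis using assms unfolding adjoint_pair_def by blast
qed

lemma restrict_nodes:
 "j \<in> C ==> (%i. restrict (nodes B C) t (Node i j)) = restrict B (%i. t (Node i j))"
 "i \<in> B ==> (%j. restrict (nodes B C) t (Node i j)) = restrict C (%j. t (Node i j))"
 by (auto simp: restrict_def)

lemma act_left_adjoint_pair:
 assumes a: "adjoint_pair B T S"
 shows "adjoint_pair (nodes B C) (act_left C T) (act_left C S)"
proof (rule adjoint_pairI)
 note b = adjoint_pair_sym[OF a]
 show "vec.lin (act_left C T)" "vec.lin (act_left C S)" using a b by (auto intro: act_lin adjoint_pair_lin)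
 fix t i
 show "i \<notin> nodes B C ==> act_left C T t i = 0" "i \<notin> nodes B C ==> act_left C S t i = 0"
  "act_left C T (restrict (nodes B C) t) i = act_left C T t i"
  "act_left C S (restrict (nodes B C) t) i = act_left C S t i"
  by (cases i; auto simp: restrict_nodes adjoint_pair_restrict[OF a] adjoint_pair_restrict[OF b]
    adjoint_pair_outside[OF a] adjoint_pair_outside[OF b])+
qed (simp add: inner_nodes adjoint_pair_inner[OF a])

lemma act_right_adjoint_pair:
 assumes a: "adjoint_pair C T S"
 shows "adjoint_pair (nodes B C) (act_right B T) (act_right B S)"
proof (rule adjoint_pairI)
 note b = adjoint_pair_sym[OF a]
 show "vec.lin (act_right B T)" "vec.lin (act_right B S)" using a b by (auto intro: act_lin adjoint_pair_lin)
 fix t i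
 show "i \<notin> nodes B C ==> act_right B T t i = 0" "i \<notin> nodes B C ==> act_right B S t i = 0"
  "act_right B T (restrict (nodes B C) t) i = act_right B T t i"
  "act_right B S (restrict (nodes B C) t) i = act_right B S t i"
  by (cases i; auto simp: restrict_nodes adjoint_pair_restrict[OF a] adjoint_pair_restrict[OF b]
    adjoint_pair_outside[OF a] adjoint_pair_outside[OF b])+
qed (simp add: inner_nodes' adjoint_pair_inner[OF a])

lemma act_left_right_commute:
 assumes fin: "finite B" "finite C" and T: "adjoint_pair B T S" and T': "adjoint_pair C T' S'"
 shows "act_left C T (act_right B T' t) = act_right B T' (act_left C T t)"
proof
 fix k show "act_left C T (act_right B T' t) k = act_right B T' (act_left C T t) k"
 proof (cases k)
  case (Node i j)
  show ?thesis
  proof (cases "i \<in> B \<and> j \<in> C")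
   case True
   hence ij: "i \<in> B" "j \<in> C" by auto
   have "act_left C T (act_right B T' t) k = T (%i. act_right B T' t (Node i j)) i"
    using ij by (simp add: Node)
   also have "\<dots> = (\<Sum>a\<in>B. T (single a) i * act_right B T' t (Node a j))"
    unfolding adjoint_pair_matrix[OF fin(1) T, of "%i. act_right B T' t (Node i j)"] using ij by simp
   also have "\<dots> = (\<Sum>a\<in>B. T (single a) i * (\<Sum>b\<in>C. T' (single b) j * t (Node a b)))"
   proof (intro sum.cong refl arg_cong2[where f = "(*)"])
    fix a assume "a \<in> B"
    thus "act_right B T' t (Node a j) = (\<Sum>b\<in>C. T' (single b) j * t (Node a b))"
     using adjoint_pair_matrix[OF fin(2) T', of "%j. t (Node a j)" j] ij by simp
   qed
   also have "\<dots> = (\<Sum>b\<in>C. T' (single b) j * (\<Sum>a\<in>B. T (single a) i * t (Node a b)))"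
    unfolding sum_distrib_left by (subst sum.swap) (simp only: mult_ac)
   also have "\<dots> = (\<Sum>b\<in>C. T' (single b) j * act_left C T t (Node i b))"
   proof (intro sum.cong refl arg_cong2[where f = "(*)"])
    fix b assume "b \<in> C"
    thus "(\<Sum>a\<in>B. T (single a) i * t (Node a b)) = act_left C T t (Node i b)"
     using adjoint_pair_matrix[OF fin(1) T, of "%i. t (Node i b)" i] ij by simp
   qed
   also have "\<dots> = T' (%j. act_left C T t (Node i j)) j"
    unfolding adjoint_pair_matrix[OF fin(2) T', of "%j. act_left C T t (Node i j)"] using ij by simp
   also have "\<dots> = act_right B T' (act_left C T t) k" using ij by (simp add: Node)
   finally show ?thesis .
  qed (use adjoint_pair_outside[OF T] adjoint_pair_outside[OF T'] in \<open>auto simp: Node\<close>)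
 qed simp
qed

definition tensor_rep ::
 "idx set => idx set => (int => int => vec => vec) => (int => int => vec => vec) => int => int => vec => vec" where
 "tensor_rep B C G H a b t = act_left C (G a b) t + act_right B (H a b) t"

context unitary_rep
begin

lemma rep_adjoint_pair:
 assumes "\<bar>a\<bar> \<le> int n" "\<bar>b\<bar> \<le> int n"
 shows "adjoint_pair B (G a b) (G b a)"
proof (rule adjoint_pairI)
 fix t i
 show "i \<notin> B ==> G a b t i = 0" "i \<notin> B ==> G b a t i = 0"
  unfolding matrix_form[OF assms, of t i] matrix_form[OF assms(2,1), of t i] by simp_all
 show "G a b (restrict B t) i = G a b t i" "G b a (restrict B t) i = G b a t i"
  unfolding matrix_form[OF assms, of t i] matrix_form[OF assms(2,1), of t i]
   matrix_form[OF assms, of "restrict B t" i] matrix_form[OF assms(2,1), of "restrict B t" i]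
  by (auto simp: restrict_def intro!: sum.cong)
qed (use assms in \<open>auto intro: F_lin adjoint\<close>)

end

lemma act_comp: "act_left C T (act_left C S t) = act_left C (%t. T (S t)) t"
 "act_right C T (act_right C S t) = act_right C (%t. T (S t)) t"
 by (rule ext, rename_tac k, case_tac k; simp)+

lemma act_left_diff: "act_left C T t - act_left C S t = act_left C (%t. T t - S t) t"
 and act_left_add: "act_left C T t + act_left C S t = act_left C (%t. T t + S t) t"
 and act_left_minus: "- act_left C T t = act_left C (%t. - T t) t"
 and act_left_if: "(if e then act_left C T t else 0) = act_left C (%t. if e then T t else 0) t"
 and act_right_diff: "act_right C T t - act_right C S t = act_right C (%t. T t - S t) t"
 and act_right_add: "act_right C T t + act_right C S t = act_right C (%t. T t + S t) t"
 and act_right_minus: "- act_right C T t = act_right C (%t. - T t) t"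
 and act_right_if: "(if e then act_right C T t else 0) = act_right C (%t. if e then T t else 0) t"
 by (rule ext, rename_tac i, case_tac i; simp)+

lemma tensor_unitary_rep:
 assumes "unitary_rep n G B" "unitary_rep n H C"
 shows "unitary_rep n (tensor_rep B C G H) (nodes B C)"
proof (rule unitary_repI)
 interpret G: unitary_rep n G B by (rule assms(1))
 interpret H: unitary_rep n H C by (rule assms(2))
 note mem_window[simp]
 show "finite (nodes B C)" by (rule finite_nodes[OF G.finite_B H.finite_B])
 {
  fix a b :: int assume w: "a \<in> window n" "b \<in> window n"
  show "adjoint_pair (nodes B C) (tensor_rep B C G H a b) (tensor_rep B C G H b a)"
   unfolding tensor_rep_def[abs_def]
   using w by (intro adjoint_pair_add act_left_adjoint_pair act_right_adjoint_pair G.rep_adjoint_pair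
     H.rep_adjoint_pair) simp_all
  show "tensor_rep B C G H (- b) (- a) u = - tensor_rep B C G H a b u" for u
  proof -
   have "G (- b) (- a) = (%u. - G a b u)" "H (- b) (- a) = (%u. - H a b u)"
    using w G.F_mirror H.F_mirror by auto
   thus ?thesis unfolding tensor_rep_def by (simp add: act_left_minus[symmetric] act_right_minus[symmetric])
  qed
 next
  fix a b c d :: int and u
  assume w: "a \<in> window n" "b \<in> window n" "c \<in> window n" "d \<in> window n"
  let ?L = "act_left C" and ?R = "act_right B" and ?T = "tensor_rep B C G H"
  have lin: "vec.lin (?L (G a b))" "vec.lin (?R (H a b))" "vec.lin (?L (G c d))" "vec.lin (?R (H c d))"
   using w by (auto intro!: act_lin G.F_lin H.F_lin)
  have cross: "?L (G a b) (?R (H c d) t) = ?R (H c d) (?L (G a b) t)"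
   "?L (G c d) (?R (H a b) t) = ?R (H a b) (?L (G c d) t)" for t
   using w by (auto intro!: act_left_right_commute[OF G.finite_B H.finite_B G.rep_adjoint_pair H.rep_adjoint_pair])
  have "?T a b (?T c d u) - ?T c d (?T a b u)
   = ?L (%u. G a b (G c d u) - G c d (G a b u)) u + ?R (%u. H a b (H c d u) - H c d (H a b u)) u"
   unfolding tensor_rep_def vec.lin_add[OF lin(1)] vec.lin_add[OF lin(2)] vec.lin_add[OF lin(3)]
    vec.lin_add[OF lin(4)] act_left_diff[symmetric] act_right_diff[symmetric] cross
    act_comp(1)[of C "G a b" "G c d", symmetric] act_comp(1)[of C "G c d" "G a b", symmetric]
    act_comp(2)[of B "H a b" "H c d", symmetric] act_comp(2)[of B "H c d" "H a b", symmetric] by simp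
  also have "(%u. G a b (G c d u) - G c d (G a b u)) = so_bracket G a b c d"
   using w by (intro ext G.F_comm) auto
  also have "(%u. H a b (H c d u) - H c d (H a b u)) = so_bracket H a b c d"
   using w by (intro ext H.F_comm) auto
  also have "?L (so_bracket G a b c d) u + ?R (so_bracket H a b c d) u = so_bracket ?T a b c d u"
   unfolding tensor_rep_def act_left_diff[symmetric] act_left_add[symmetric] act_left_if[symmetric]
    act_right_diff[symmetric] act_right_add[symmetric] act_right_if[symmetric] by simp
  finally show "?T a b (?T c d u) - ?T c d (?T a b u) = so_bracket ?T a b c d u" .
 next
  fix a :: int and i k :: idx assume a: "a \<in> window n" "i \<noteq> k"
  have L0: "G a a 0 = 0" "H a a 0 = 0" using a vec.lin_0[OF G.F_lin] vec.lin_0[OF H.F_lin] by auto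
  show "tensor_rep B C G H a a (single k) i = 0"
  proof (cases i)
   case (Node x y)
   show ?thesis
   proof (cases k)
    case k: (Node x' y')
    have "(%x. single k (Node x y)) = (if y = y' then single x' else 0)"
     "(%y. single k (Node x y)) = (if x = x' then single y' else 0)"
     by (auto simp: k single_def)
    thus ?thesis using a G.diagonal[of a x x'] H.diagonal[of a y y'] L0
     by (auto simp: tensor_rep_def Node k)
   next
    case (Leaf I)
    hence "(%x. single k (Node x y)) = 0" "(%y. single k (Node x y)) = 0" by (auto simp: single_def)
    thus ?thesis using L0 by (simp add: tensor_rep_def Node)
   qed
  qed (simp add: tensor_rep_def)
 }
qed

lemma tensor_linear:
 "tensor (x + x') y = tensor x y + tensor x' y" "tensor x (y + y') = tensor x y + tensor x y'"
 "tensor (fscale c x) y = fscale c (tensor x y)" "tensor x (fscale c y) = fscale c (tensor x y)"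
 "tensor 0 y = 0" "tensor x 0 = 0"
 by (rule ext, rename_tac i, case_tac i; simp add: fscale_def algebra_simps)+

section \<open>Linear independence in tensor products\<close>

lemma separating_functional:
 assumes "m \<notin> vec.span S"
 obtains \<phi> :: "vec => complex" where "\<And>x y. \<phi> (%i. x i + y i) = \<phi> x + \<phi> y"
  "\<And>c x. \<phi> (%i. c * x i) = c * \<phi> x" "\<And>x. x \<in> vec.span S ==> \<phi> x = 0" "\<phi> m = 1"
proof -
 interpret pair: vector_space_pair fscale "(*) :: complex => complex => complex"
  by unfold_locales (simp_all add: algebra_simps)
 obtain B where B: "B \<subseteq> S" "vec.independent B" "S \<subseteq> vec.span B"
  using vec.maximal_independent_subset by blast
 have SB: "vec.span S \<subseteq> vec.span B" by (rule vec.span_minimal[OF B(3)]) simp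
 hence m: "m \<notin> vec.span B" using assms vec.span_mono[OF B(1)] by blast
 hence "vec.independent (insert m B)" using B(2) by (simp add: vec.independent_insert)
 from pair.linear_independent_extend[OF this, of "%x. if x = m then 1 else 0"]
 obtain \<phi> where lin: "Vector_Spaces.linear fscale (*) \<phi>"
  and val: "\<forall>x\<in>insert m B. \<phi> x = (if x = m then 1 else 0)" by blast
 interpret Vector_Spaces.linear fscale "(*)" \<phi> by (rule lin)
 have "m \<notin> B" using m vec.span_base by blast
 hence "\<phi> x = 0" if "x \<in> B" for x using val that by auto
 hence "\<phi> x = 0" if "x \<in> vec.span B" for x using eq_0_on_span[OF _ that] by blast
 hence "\<And>x. x \<in> vec.span S ==> \<phi> x = 0" using SB by blast
 moreover have "\<phi> m = 1" using val by simp
 ultimately show ?thesis by (rule that[OF add[unfolded plus_fun_def] scale[unfolded fscale_def]])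
qed

text \<open>The product of two functionals, each vanishing on one of the spans and equal to 1 at the
  given vector, annihilates all the generators but takes the value 1 at
  \<open>tensor m1 m2\<close>.\<close>

lemma tensor_notin:
 assumes "m1 \<notin> vec.span S1" "m2 \<notin> vec.span S2"
 shows "tensor m1 m2 \<notin> vec.span {tensor x y | x y. x \<in> vec.span S1 \<or> y \<in> vec.span S2}"
proof
 assume mem: "tensor m1 m2 \<in> vec.span {tensor x y | x y. x \<in> vec.span S1 \<or> y \<in> vec.span S2}"
 obtain \<phi> where \<phi>: "\<And>x y. \<phi> (%i. x i + y i) = \<phi> x + \<phi> y" "\<And>c x. \<phi> (%i. c * x i) = c * \<phi> x"
  "\<And>x. x \<in> vec.span S1 ==> \<phi> x = 0" "\<phi> m1 = 1" using separating_functional[OF assms(1)] by blast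
 obtain \<psi> where \<psi>: "\<And>x y. \<psi> (%i. x i + y i) = \<psi> x + \<psi> y" "\<And>c x. \<psi> (%i. c * x i) = c * \<psi> x"
  "\<And>x. x \<in> vec.span S2 ==> \<psi> x = 0" "\<psi> m2 = 1" using separating_functional[OF assms(2)] by blast
 define \<Phi> where "\<Phi> t = \<psi> (%j. \<phi> (%i. t (Node i j)))" for t
 have val: "\<Phi> (tensor x y) = \<phi> x * \<psi> y" for x y
  unfolding \<Phi>_def tensor.simps mult.commute[of "x _"] \<phi>(2) mult.commute[of "y _" "\<phi> x"] \<psi>(2) ..
 have add: "\<Phi> (s + t) = \<Phi> s + \<Phi> t" and scale: "\<Phi> (fscale c t) = c * \<Phi> t" for c s t
  by (simp_all add: \<Phi>_def fscale_def \<phi>(1,2) \<psi>(1,2))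
 have zero: "\<Phi> 0 = 0" using scale[of 0 0] by simp
 have "vec.subspace {t. \<Phi> t = 0}" by (rule vec.subspaceI) (simp_all add: add scale zero)
 moreover have "{tensor x y | x y. x \<in> vec.span S1 \<or> y \<in> vec.span S2} \<subseteq> {t. \<Phi> t = 0}"
  using \<phi>(3) \<psi>(3) val by auto
 ultimately have "vec.span {tensor x y | x y. x \<in> vec.span S1 \<or> y \<in> vec.span S2} \<subseteq> {t. \<Phi> t = 0}"
  by (intro vec.span_minimal)
 thus False using mem val[of m1 m2] \<phi>(4) \<psi>(4) by auto
qed

section \<open>Monomials on tensor products\<close>

locale tensor_pair = G: unitary_rep n G B + H: unitary_rep n H C
 for n :: nat and G :: "int => int => vec => vec" and B :: "idx set"
  and H :: "int => int => vec => vec" and C :: "idx set"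
begin

definition T where "T = tensor_rep B C G H"

sublocale T: unitary_rep n T "nodes B C"
 unfolding T_def by (rule tensor_unitary_rep[OF G.unitary_rep_axioms H.unitary_rep_axioms])

lemma T_tensor:
 assumes r: "x \<in> letter_range n" and s: "G.supported s" "H.supported t"
 shows "T.X x (tensor s t) = tensor (G.X x s) t + tensor s (H.X x t)"
proof
 obtain a b where x: "x = (a, b)" by fastforce
 have ab: "\<bar>a\<bar> \<le> int n" "\<bar>b\<bar> \<le> int n" using r by (auto simp: x letter_range_iff)
 fix k show "T.X x (tensor s t) k = (tensor (G.X x s) t + tensor s (H.X x t)) k"
 proof (cases k)
  case (Node i j)
  have 1: "(%i. tensor s t (Node i j)) = fscale (t j) s" by (simp add: fscale_def mult.commute)
  have 2: "(%j. tensor s t (Node i j)) = fscale (s i) t" by (simp add: fscale_def)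
  have "T.X x (tensor s t) k = (if j \<in> C then G a b (fscale (t j) s) i else 0)
    + (if i \<in> B then H a b (fscale (s i) t) j else 0)"
   unfolding x T.X_pair unfolding T_def tensor_rep_def plus_fun_apply Node act_left.simps act_right.simps 1 2 ..
  also have "(if j \<in> C then G a b (fscale (t j) s) i else 0)
    + (if i \<in> B then H a b (fscale (s i) t) j else 0) = G a b s i * t j + s i * H a b t j"
   using s unfolding G.supported_def H.supported_def vec.lin_scale[OF G.F_lin[OF ab]] vec.lin_scale[OF H.F_lin[OF ab]]
   by (auto simp: fscale_def)
  finally show ?thesis by (simp add: x Node)
 next
  case (Leaf I)
  have "T a b (tensor s t) k = 0" unfolding T_def by (simp add: tensor_rep_def Leaf)
  thus ?thesis by (simp add: x Leaf)
 qed
qed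

lemma supported_tensor: "G.supported s ==> H.supported t ==> T.supported (tensor s t)"
 unfolding G.supported_def H.supported_def T.supported_def
 by (rule allI, rename_tac i, case_tac i) auto

lemma T_pow_tensor:
 assumes r: "x \<in> letter_range n" and s: "G.supported s" "H.supported t"
 shows "(T.X x ^^ k) (tensor s t)
  = (\<Sum>i\<le>k. fscale (of_nat (k choose i)) (tensor ((G.X x ^^ i) s) ((H.X x ^^ (k - i)) t)))"
proof (induction k)
 case (Suc k)
 have lin: "vec.lin (T.X x)" by (rule T.X_lin[OF r])
 have Gs: "G.supported ((G.X x ^^ i) s)" for i using G.supported_word[of "replicate i x" s] r s
  by (cases i) (auto intro: G.supported_X)
 have Hs: "H.supported ((H.X x ^^ i) t)" for i using r s by (cases i) (auto intro: H.supported_X)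
 define m where "m i j = tensor ((G.X x ^^ i) s) ((H.X x ^^ j) t)" for i j
 have step: "T.X x (m i j) = m (Suc i) j + m i (Suc j)" for i j
  unfolding m_def T_tensor[OF r Gs Hs] by simp
 have "(T.X x ^^ Suc k) (tensor s t) = (\<Sum>i\<le>k. fscale (of_nat (k choose i)) (m (Suc i) (k - i) + m i (Suc k - i)))"
  unfolding funpow.simps comp_apply Suc m_def[symmetric] vec.lin_sum[OF lin] vec.lin_scale[OF lin] step
  by (intro sum.cong refl) (simp add: Suc_diff_le)
 also have "\<dots> = (\<Sum>i\<le>k. fscale (of_nat (k choose i)) (m (Suc i) (k - i)))
   + (\<Sum>i\<le>k. fscale (of_nat (k choose i)) (m i (Suc k - i)))"
  by (simp only: vec.scale_right_distrib sum.distrib)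
 also have "(\<Sum>i\<le>k. fscale (of_nat (k choose i)) (m i (Suc k - i)))
   = (\<Sum>i\<le>Suc k. fscale (of_nat (k choose i)) (m i (Suc k - i)))" by simp
 also have "\<dots> = m 0 (Suc k) + (\<Sum>i\<le>k. fscale (of_nat (k choose Suc i)) (m (Suc i) (k - i)))"
  unfolding sum.atMost_Suc_shift by simp
 also have "(\<Sum>i\<le>k. fscale (of_nat (k choose i)) (m (Suc i) (k - i)))
   + (m 0 (Suc k) + (\<Sum>i\<le>k. fscale (of_nat (k choose Suc i)) (m (Suc i) (k - i))))
  = m 0 (Suc k) + (\<Sum>i\<le>k. fscale (of_nat (Suc k choose Suc i)) (m (Suc i) (k - i)))"
  by (simp add: sum.distrib[symmetric] vec.scale_left_distrib[symmetric] add.left_commute)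
 also have "\<dots> = (\<Sum>i\<le>Suc k. fscale (of_nat (Suc k choose i)) (m i (Suc k - i)))"
  unfolding sum.atMost_Suc_shift by simp
 finally show ?case unfolding m_def .
qed simp

lemma mono_supported:
 assumes "letter ` set rs \<subseteq> letter_range n"
 shows "G.supported s ==> G.supported (G.mono rs q s)" "H.supported t ==> H.supported (H.mono rs q t)"
proof -
 have w: "set (letters rs q) \<subseteq> letter_range n" using assms by auto
 show "G.supported s ==> G.supported (G.mono rs q s)" "H.supported t ==> H.supported (H.mono rs q t)"
  unfolding G.mono_eq_word H.mono_eq_word using G.supported_word[OF w] H.supported_word[OF w] by auto
qed

lemma pow_mono_tensor:
 assumes "letter ` set (r # rs) \<subseteq> letter_range n" "distinct (r # rs)" "G.supported s" "H.supported t"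
 shows "(T.X (letter r) ^^ k) (tensor (G.mono rs q1 s) (H.mono rs q2 t))
  = (\<Sum>i\<le>k. fscale (of_nat (k choose i))
    (tensor (G.mono (r # rs) (q1(r := i)) s) (H.mono (r # rs) (q2(r := k - i)) t)))"
proof -
 have eq: "G.mono rs (q1(r := i)) s = G.mono rs q1 s" "H.mono rs (q2(r := i)) t = H.mono rs q2 t" for i
  using assms(2) by (auto intro!: G.mono_cong H.mono_cong simp: agree_def)
 have "(T.X (letter r) ^^ k) (tensor (G.mono rs q1 s) (H.mono rs q2 t))
  = (\<Sum>i\<le>k. fscale (of_nat (k choose i))
    (tensor ((G.X (letter r) ^^ i) (G.mono rs q1 s)) ((H.X (letter r) ^^ (k - i)) (H.mono rs q2 t))))"
  using assms by (intro T_pow_tensor mono_supported) auto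
 thus ?thesis unfolding G.mono_Cons H.mono_Cons fun_upd_same eq .
qed

definition products :: "root list => ((root => nat) => (root => nat) => bool) => vec => vec => vec set" where
 "products rs P s t = vec.span {tensor (G.mono rs q1 s) (H.mono rs q2 t) | q1 q2. P q1 q2}"

text \<open>The scalar is a product of binomial coefficients, which is why it does not vanish.\<close>

lemma T_mono_tensor_leading:
 assumes "letter ` set rs \<subseteq> letter_range n" "distinct rs" "G.supported s" "H.supported t"
 shows "\<exists>c. c \<noteq> 0 \<and> T.mono rs (%r. p1 r + p2 r) (tensor s t)
   - fscale c (tensor (G.mono rs p1 s) (H.mono rs p2 t))
  \<in> products rs (%q1 q2. agree (set rs) (%r. p1 r + p2 r) (%r. q1 r + q2 r) \<and> \<not> agree (set rs) q1 p1) s t"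
 using assms(1,2)
proof (induction rs)
 case Nil
 thus ?case unfolding products_def using vec.span_zero
  by (intro exI[of _ 1]) (simp only: T.mono_Nil G.mono_Nil H.mono_Nil vec.scale_one diff_self, simp)
next
 case (Cons r rs)
 have r: "letter r \<in> letter_range n" using Cons.prems by simp
 let ?p = "%r. p1 r + p2 r"
 let ?P = "%rs q1 q2. agree (set rs) ?p (%r. q1 r + q2 r) \<and> \<not> agree (set rs) q1 p1"
 define Z where "Z = products (r # rs) (?P (r # rs)) s t"
 have Zs: "vec.subspace Z" unfolding Z_def products_def by simp
 let ?X = "T.X (letter r) ^^ ?p r"
 have lin: "vec.lin ?X" by (rule vec.lin_pow[OF T.X_lin[OF r]])
 define m where "m i = tensor (G.mono (r # rs) (p1(r := i)) s) (H.mono (r # rs) (p2(r := ?p r - i)) t)" for i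
 have pr: "letter ` set rs \<subseteq> letter_range n" "distinct rs" using Cons.prems by simp_all
 obtain c where c: "c \<noteq> 0" "T.mono rs ?p (tensor s t) - fscale c (tensor (G.mono rs p1 s) (H.mono rs p2 t))
  \<in> products rs (?P rs) s t" using Cons.IH[OF pr] by blast
 have "?X (T.mono rs ?p (tensor s t) - fscale c (tensor (G.mono rs p1 s) (H.mono rs p2 t))) \<in> Z"
 proof (rule vec.lin_span_into[where f = ?X])
  show "T.mono rs ?p (tensor s t) - fscale c (tensor (G.mono rs p1 s) (H.mono rs p2 t))
   \<in> vec.span {tensor (G.mono rs q1 s) (H.mono rs q2 t) | q1 q2. ?P rs q1 q2}"
   using c(2) unfolding products_def .
 next
  fix z assume "z \<in> {tensor (G.mono rs q1 s) (H.mono rs q2 t) | q1 q2. ?P rs q1 q2}"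
  then obtain q1 q2 where z: "z = tensor (G.mono rs q1 s) (H.mono rs q2 t)" and a: "?P rs q1 q2" by blast
  show "?X z \<in> Z" unfolding z pow_mono_tensor[OF Cons.prems assms(3,4)] Z_def products_def
  proof (intro vec.span_sum vec.span_scale vec.span_base CollectI exI)
   fix i assume "i \<in> {..?p r}"
   hence "?P (r # rs) (q1(r := i)) (q2(r := ?p r - i))"
    using a Cons.prems(2) unfolding agree_def by (auto split: if_splits)
   thus "tensor (G.mono (r # rs) (q1(r := i)) s) (H.mono (r # rs) (q2(r := ?p r - i)) t)
     = tensor (G.mono (r # rs) (q1(r := i)) s) (H.mono (r # rs) (q2(r := ?p r - i)) t) \<and>
    ?P (r # rs) (q1(r := i)) (q2(r := ?p r - i))" by blast
  qed
 qed (rule lin, rule Zs)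
 hence 1: "T.mono (r # rs) ?p (tensor s t) - fscale c (?X (tensor (G.mono rs p1 s) (H.mono rs p2 t))) \<in> Z"
  unfolding T.mono_Cons vec.lin_diff[OF lin] vec.lin_scale[OF lin] .
 have "?X (tensor (G.mono rs p1 s) (H.mono rs p2 t)) = (\<Sum>i\<le>?p r. fscale (of_nat (?p r choose i)) (m i))"
  unfolding m_def by (rule pow_mono_tensor[OF Cons.prems assms(3,4)])
 also have "\<dots> = fscale (of_nat (?p r choose p1 r)) (m (p1 r))
   + (\<Sum>i\<in>{..?p r} - {p1 r}. fscale (of_nat (?p r choose i)) (m i))"
  by (subst sum.remove[of _ "p1 r"]) auto
 finally have 2: "?X (tensor (G.mono rs p1 s) (H.mono rs p2 t)) = fscale (of_nat (?p r choose p1 r)) (m (p1 r))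
   + (\<Sum>i\<in>{..?p r} - {p1 r}. fscale (of_nat (?p r choose i)) (m i))" .
 have 3: "(\<Sum>i\<in>{..?p r} - {p1 r}. fscale (of_nat (?p r choose i)) (m i)) \<in> Z"
 proof (intro vec.subspace_sum vec.subspace_scale Zs)
  fix i assume i: "i \<in> {..?p r} - {p1 r}"
  have "?P (r # rs) (p1(r := i)) (p2(r := ?p r - i))"
   using i Cons.prems(2) unfolding agree_def by auto
  thus "m i \<in> Z" unfolding m_def Z_def products_def by (intro vec.span_base) blast
 qed
 have 4: "m (p1 r) = tensor (G.mono (r # rs) p1 s) (H.mono (r # rs) p2 t)" unfolding m_def by simp
 define d where "d = c * of_nat (?p r choose p1 r)"
 have "T.mono (r # rs) ?p (tensor s t) - fscale d (m (p1 r)) \<in> Z"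
 proof -
  have alg: "a - (x + y) + y = a - x" for a x y :: vec by simp
  have "fscale c (\<Sum>i\<in>{..?p r} - {p1 r}. fscale (of_nat (?p r choose i)) (m i)) \<in> Z"
   by (rule vec.subspace_scale[OF Zs 3])
  from vec.subspace_add[OF Zs 1[unfolded 2 vec.scale_right_distrib vec.scale_scale] this]
  show ?thesis unfolding alg d_def .
 qed
 moreover have "d \<noteq> 0" using c(1) unfolding d_def by simp
 ultimately show ?case unfolding 4 Z_def by blast
qed

lemma T_mono_tensor:
 assumes "letter ` set rs \<subseteq> letter_range n" "distinct rs" "G.supported s" "H.supported t"
 shows "T.mono rs q (tensor s t) \<in> products rs (%q1 q2. agree (set rs) q (%r. q1 r + q2 r)) s t" (is "_ \<in> ?Z")
proof -
 have Z: "vec.subspace ?Z" unfolding products_def by simp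
 let ?m = "tensor (G.mono rs q s) (H.mono rs (%r. 0) t)"
 obtain c where "T.mono rs q (tensor s t) - fscale c ?m
  \<in> products rs (%q1 q2. agree (set rs) q (%r. q1 r + q2 r) \<and> \<not> agree (set rs) q1 q) s t"
  using T_mono_tensor_leading[OF assms, of q "%r. 0"] by auto
 also have "\<dots> \<subseteq> ?Z" unfolding products_def by (intro vec.span_mono) blast
 finally have "T.mono rs q (tensor s t) - fscale c ?m \<in> ?Z" .
 moreover have "?m \<in> ?Z" unfolding products_def agree_def
  by (intro vec.span_base CollectI exI[of _ q] exI[of _ "%r. 0"]) simp
 ultimately have "T.mono rs q (tensor s t) - fscale c ?m + fscale c ?m \<in> ?Z"
  by (intro vec.subspace_add[OF Z] vec.subspace_scale[OF Z])
 thus ?thesis by simp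
qed

lemma tensor_datum:
 assumes D: "D \<subseteq> letter_range n" and s: "G.datum D s {0} \<mu>" "G.supported s"
  and t: "H.datum D t {0} \<nu>" "H.supported t"
 shows "T.datum D (tensor s t) {0} (%i. \<mu> i + \<nu> i)"
 unfolding T.datum_def
proof (intro conjI ballI allI impI)
 have "T.X x 0 = 0" if "x \<in> D" for x using that D vec.lin_0[OF T.X_lin] by blast
 thus "T.stable D {0}" unfolding T.stable_def by simp
next
 fix x assume x: "x \<in> D" "raising n x"
 have "G.X x s = 0" "H.X x t = 0" using G.datum_raising[OF s(1) x] H.datum_raising[OF t(1) x] by auto
 thus "T.X x (tensor s t) \<in> {0}" using T_tensor[OF _ s(2) t(2), of x] x(1) D
  by (auto simp: tensor_linear)
next
 fix i :: int assume i: "i > 0" "(i, i) \<in> D"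
 have "T.X (i, i) (tensor s t) = tensor (G.X (i, i) s) t + tensor s (H.X (i, i) t)"
  using i D s t by (intro T_tensor) auto
 thus "T i i (tensor s t) = fscale (of_real (\<mu> i + \<nu> i)) (tensor s t)"
  unfolding T.X_pair G.X_pair H.X_pair G.datum_weight[OF s(1) i] H.datum_weight[OF t(1) i]
  by (simp add: tensor_linear vec.scale_left_distrib)
qed

lemma tensor_nonzero: "s \<noteq> 0 ==> t \<noteq> 0 ==> tensor s t \<noteq> 0"
proof
 assume "s \<noteq> 0" "t \<noteq> 0" and z: "tensor s t = 0"
 then obtain i j where "s i \<noteq> 0" "t j \<noteq> 0" by (auto simp: fun_eq_iff)
 thus False using fun_cong[OF z, of "Node i j"] by simp
qed

text \<open>By \<open>blocks_less_split\<close>, every splitting of an exponent not above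
  \<open>p1 + p2\<close>, apart from \<open>p1\<close> and \<open>p2\<close> themselves, has a
  smaller component and so falls into \<open>K\<close>. What is left of the leading monomial is a
  nonzero multiple of a product outside \<open>K\<close>.\<close>

lemma tensor_lower_bound:
 assumes rs: "letter ` set (rest @ concat (rev bs)) \<subseteq> letter_range n" "distinct (rest @ concat (rev bs))"
  and st: "G.supported s" "H.supported t"
  and s: "G.mono (concat (rev bs)) p1 s \<notin>
   vec.span {G.mono rest q (G.mono (concat (rev bs)) q s) | q. blocks_less bs q p1}"
  and t: "H.mono (concat (rev bs)) p2 t \<notin>
   vec.span {H.mono rest q (H.mono (concat (rev bs)) q t) | q. blocks_less bs q p2}"
 shows "T.mono (concat (rev bs)) (%r. p1 r + p2 r) (tensor s t) \<notin>
   vec.span {T.mono rest q (T.mono (concat (rev bs)) q (tensor s t)) | q. blocks_less bs q (%r. p1 r + p2 r)}"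
proof
 let ?c = "concat (rev bs)" and ?p = "%r. p1 r + p2 r"
 let ?S1 = "{G.mono rest q (G.mono ?c q s) | q. blocks_less bs q p1}"
 let ?S2 = "{H.mono rest q (H.mono ?c q t) | q. blocks_less bs q p2}"
 define K where "K = vec.span {tensor x y | x y. x \<in> vec.span ?S1 \<or> y \<in> vec.span ?S2}"
 have Ks: "vec.subspace K" unfolding K_def by simp
 have cs: "set ?c = set (concat bs)" by auto
 assume mem: "T.mono ?c ?p (tensor s t) \<in> vec.span {T.mono rest q (T.mono ?c q (tensor s t)) | q. blocks_less bs q ?p}"
 have K: "tensor (G.mono (rest @ ?c) q1 s) (H.mono (rest @ ?c) q2 t) \<in> K"
  if "\<not> blocks_less bs ?p q" "agree (set ?c) q (%r. q1 r + q2 r)"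
   "\<not> (agree (set ?c) q1 p1 \<and> agree (set ?c) q2 p2)" for q q1 q2
 proof -
  have "blocks_less bs q1 p1 \<or> blocks_less bs q2 p2" using blocks_less_split[OF that(1)] that(2,3) unfolding cs by blast
  thus ?thesis unfolding K_def G.mono_append H.mono_append
   by (intro vec.span_base) (blast intro: vec.span_base)
 qed
 have low: "vec.span {T.mono rest q (T.mono ?c q (tensor s t)) | q. blocks_less bs q ?p} \<subseteq> K"
 proof (intro vec.span_minimal[OF _ Ks] subsetI)
  fix z assume "z \<in> {T.mono rest q (T.mono ?c q (tensor s t)) | q. blocks_less bs q ?p}"
  then obtain q where q: "z = T.mono (rest @ ?c) q (tensor s t)" "blocks_less bs q ?p"
   unfolding T.mono_append by blast
  have nl: "\<not> blocks_less bs ?p q" using q(2) blocks_less_trans blocks_less_irrefl by blast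
  have "products (rest @ ?c) (%q1 q2. agree (set (rest @ ?c)) q (%r. q1 r + q2 r)) s t \<subseteq> K"
   unfolding products_def
  proof (intro vec.span_minimal[OF _ Ks] subsetI)
   fix z assume "z \<in> {tensor (G.mono (rest @ ?c) q1 s) (H.mono (rest @ ?c) q2 t) | q1 q2.
    agree (set (rest @ ?c)) q (%r. q1 r + q2 r)}"
   then obtain q1 q2 where z: "z = tensor (G.mono (rest @ ?c) q1 s) (H.mono (rest @ ?c) q2 t)"
    and a: "agree (set ?c) q (%r. q1 r + q2 r)" by (auto simp: agree_def)
   have "\<not> agree (set ?c) q ?p" unfolding cs using q(2) blocks_less_cong blocks_less_irrefl by blast
   thus "z \<in> K" unfolding z using a by (intro K[OF nl]) (unfold agree_def, auto simp del: set_rev set_concat)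
  qed
  thus "z \<in> K" using T_mono_tensor[OF rs st, of q] unfolding q(1) by blast
 qed
 \<comment> \<open>The leading term is extracted for the list that includes \<open>rest\<close>; the
   exponents there are set to 0, so that the monomial itself is unchanged.\<close>
 define cut where "cut p r = (if r \<in> set ?c then p r else 0)" for p :: "root => nat" and r
 have dis: "cut p r = 0" if "r \<in> set rest" for p r using that rs(2) unfolding cut_def by auto
 have agree: "agree (set ?c) p (cut p)" for p by (simp add: agree_def cut_def)
 have mono: "G.mono (rest @ ?c) (cut p) u = G.mono ?c p u" "H.mono (rest @ ?c) (cut p) u = H.mono ?c p u"
  "T.mono (rest @ ?c) (%r. cut p r + cut q r) u = T.mono ?c (%r. p r + q r) u" for p q u
  unfolding G.mono_append H.mono_append T.mono_append
  using dis G.mono_cong[OF agree, of p] H.mono_cong[OF agree, of p]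
   T.mono_cong[of ?c "%r. p r + q r" "%r. cut p r + cut q r"]
  by (auto simp: G.mono_zero H.mono_zero T.mono_zero agree_def cut_def)
 obtain e where e: "e \<noteq> 0" "T.mono ?c ?p (tensor s t) - fscale e (tensor (G.mono ?c p1 s) (H.mono ?c p2 t))
  \<in> products (rest @ ?c) (%q1 q2. agree (set (rest @ ?c)) (%r. cut p1 r + cut p2 r) (%r. q1 r + q2 r) \<and>
   \<not> agree (set (rest @ ?c)) q1 (cut p1)) s t"
  using T_mono_tensor_leading[OF rs st, of "cut p1" "cut p2"] unfolding mono by blast
 have "products (rest @ ?c) (%q1 q2. agree (set (rest @ ?c)) (%r. cut p1 r + cut p2 r) (%r. q1 r + q2 r) \<and>
   \<not> agree (set (rest @ ?c)) q1 (cut p1)) s t \<subseteq> K"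
  unfolding products_def
 proof (intro vec.span_minimal[OF _ Ks] subsetI)
  fix z assume "z \<in> {tensor (G.mono (rest @ ?c) q1 s) (H.mono (rest @ ?c) q2 t) | q1 q2.
   agree (set (rest @ ?c)) (%r. cut p1 r + cut p2 r) (%r. q1 r + q2 r) \<and>
   \<not> agree (set (rest @ ?c)) q1 (cut p1)}"
  then obtain q1 q2 where z: "z = tensor (G.mono (rest @ ?c) q1 s) (H.mono (rest @ ?c) q2 t)"
   and a: "\<And>r. r \<in> set (rest @ ?c) ==> cut p1 r + cut p2 r = q1 r + q2 r"
    "\<not> agree (set (rest @ ?c)) q1 (cut p1)" unfolding agree_def by blast
  have "agree (set ?c) ?p (%r. q1 r + q2 r)"
   using a(1) unfolding agree_def cut_def set_append by (metis UnI2)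
  moreover have "q1 r = cut p1 r" if "r \<in> set rest" for r using a(1)[of r] dis[OF that] that by simp
  hence "\<not> agree (set ?c) q1 p1"
   using a(2) by (auto simp: agree_def cut_def simp del: set_rev set_concat)
  ultimately show "z \<in> K" unfolding z by (intro K[OF blocks_less_irrefl]) auto
 qed
 hence "T.mono ?c ?p (tensor s t) - fscale e (tensor (G.mono ?c p1 s) (H.mono ?c p2 t)) \<in> K" using e(2) by blast
 moreover have "T.mono ?c ?p (tensor s t) \<in> K" using mem low by blast
 moreover have "x - (x - y) = y" for x y :: vec by simp
 ultimately have "fscale e (tensor (G.mono ?c p1 s) (H.mono ?c p2 t)) \<in> K"
  using vec.subspace_diff[OF Ks] by metis
 hence "tensor (G.mono ?c p1 s) (H.mono ?c p2 t) \<in> K" using vec.subspace_scale_cancel[OF Ks _ e(1)] by blast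
 thus False using tensor_notin[OF s t] unfolding K_def by blast
qed

end

section \<open>Modules in which a given exponent survives\<close>

abbreviation "survives G rest bs p v \<equiv> so_rep.mono G (concat (rev bs)) p v \<notin>
 vec.span {so_rep.mono G rest q (so_rep.mono G (concat (rev bs)) q v) | q. blocks_less bs q p}"

text \<open>The module is quantified existentially, so that tensor products may be formed freely;
  only its highest weight is recorded. The roots in \<open>rest\<close> belong to the smaller
  algebra and may be applied in front of smaller monomials, as in \<open>Unew\<close>.\<close>

definition lower_bound ::
 "nat => (int \<times> int) set => root list => root list list => (int => real) => (root => nat) => bool" where
 "lower_bound n D rest bs \<mu> p \<longleftrightarrow> (\<exists>G B v. unitary_rep n G B \<and> so_rep.datum fscale n G D v {0} \<mu> \<and>
   unitary_rep.supported B v \<and> v \<noteq> 0 \<and> survives G rest bs p v)"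

lemma lower_bound_add:
 assumes rs: "letter ` set (rest @ concat (rev bs)) \<subseteq> letter_range n" "distinct (rest @ concat (rev bs))"
  and D: "D \<subseteq> letter_range n"
  and 1: "lower_bound n D rest bs \<mu> p" and 2: "lower_bound n D rest bs \<nu> q"
 shows "lower_bound n D rest bs (%i. \<mu> i + \<nu> i) (%r. p r + q r)"
proof -
 obtain G B s where G: "unitary_rep n G B" "so_rep.datum fscale n G D s {0} \<mu>"
  "unitary_rep.supported B s" "s \<noteq> 0" "survives G rest bs p s"
  using 1 unfolding lower_bound_def by blast
 obtain H C t where H: "unitary_rep n H C" "so_rep.datum fscale n H D t {0} \<nu>"
  "unitary_rep.supported C t" "t \<noteq> 0" "survives H rest bs q t"
  using 2 unfolding lower_bound_def by blast
 interpret tensor_pair n G B H C by (intro tensor_pair.intro G(1) H(1))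
 show ?thesis unfolding lower_bound_def
  by (intro exI[of _ T] exI[of _ "nodes B C"] exI[of _ "tensor s t"] conjI T.unitary_rep_axioms
    tensor_datum[OF D G(2,3) H(2,3)] supported_tensor[OF G(3) H(3)] tensor_nonzero[OF G(4) H(4)]
    tensor_lower_bound[OF rs G(3) H(3) G(5) H(5)])
qed

section \<open>Essential exponents in exterior and spin modules\<close>

lemma block_less_zero: "(\<And>r. r \<in> set b ==> p r = 0) ==> \<not> block_less b q p"
proof -
 assume z: "\<And>r. r \<in> set b ==> p r = 0"
 have "\<not> lexless b q p" using z by (induction b) auto
 moreover have "sum_list (map p b) = 0" using z by (induction b) auto
 ultimately show ?thesis unfolding block_less_alt by (metis not_less_zero)
qed

lemma blocks_less_zero: "(\<And>r. r \<in> set (concat bs) ==> p r = 0) ==> \<not> blocks_less bs q p"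
 by (induction bs) (auto simp: block_less_zero)

lemma lexless_first: "(\<And>x. x \<in> set xs ==> p x = q x) ==> p r < q r ==> lexless (xs @ r # ys) p q"
 by (induction xs) auto

text \<open>Below a unit exponent the degree leaves only zero and unit exponents, and
  lexicographically a unit exponent is smaller when its position is later.\<close>

lemma block_less_single:
 assumes b: "b = xs @ r # ys" "distinct b" and p: "p r = 1" "\<And>x. x \<in> set b ==> x \<noteq> r ==> p x = 0"
  and less: "block_less b q p"
 shows "(\<forall>x\<in>set b. q x = 0) \<or> (\<exists>s\<in>set ys. q s = 1 \<and> (\<forall>x\<in>set b. x \<noteq> s --> q x = 0))"
proof -
 have sp: "sum_list (map p b) = 1"
 proof -
  have "sum_list (map p b) = (\<Sum>x\<in>set b. p x)" using b(2) by (simp add: sum_list_distinct_conv_sum_set)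
  also have "\<dots> = (\<Sum>x\<in>set b. if x = r then 1 else 0)" using p by (intro sum.cong refl) auto
  also have "\<dots> = 1" using b(1) by simp
  finally show ?thesis .
 qed
 have sq: "sum_list (map q b) = (\<Sum>x\<in>set b. q x)" using b(2) by (simp add: sum_list_distinct_conv_sum_set)
 show ?thesis
 proof (cases "sum_list (map q b) = 0")
  case False
  hence 1: "(\<Sum>x\<in>set b. q x) = 1" and lex: "lexless b q p" using less sp sq unfolding block_less_alt by auto
  then obtain s where s: "s \<in> set b" "q s \<noteq> 0" by (metis sum.neutral zero_neq_one)
  have "(\<Sum>x\<in>set b. q x) = q s + (\<Sum>x\<in>set b - {s}. q x)" using s by (subst sum.remove[of _ s]) auto
  hence qs: "q s = 1" "(\<Sum>x\<in>set b - {s}. q x) = 0" using 1 s(2) by linarith+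
  hence z: "q x = 0" if "x \<in> set b" "x \<noteq> s" for x using that by auto
  have "s \<in> set ys"
  proof (rule ccontr)
   assume "s \<notin> set ys"
   then consider "s = r" | "s \<in> set xs" using s b(1) by auto
   hence "\<not> lexless b q p"
   proof cases
    case 1
    hence "q x = p x" if "x \<in> set b" for x using z p qs that by (cases "x = r") auto
    hence "lexless b' q p = lexless b' q q" if "set b' \<subseteq> set b" for b' using that by (induction b') auto
    thus ?thesis using lexless_irrefl by blast
   next
    case 2
    then obtain us vs where us: "xs = us @ s # vs" by (meson split_list)
    have "lexless (us @ s # (vs @ r # ys)) p q"
    proof (rule lexless_first)
     show "p s < q s" using p(2)[OF s(1)] qs b us by auto
     fix x assume x: "x \<in> set us"
     hence "x \<in> set b" "x \<noteq> s" "x \<noteq> r" using b us by auto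
     thus "p x = q x" using z p by simp
    qed
    hence "lexless b p q" using b us by simp
    thus ?thesis using lexless_trans lexless_irrefl by blast
   qed
   thus False using lex by blast
  qed
  thus ?thesis using qs z by blast
 qed (use sq in simp)
qed

context so_rep
begin

lemma mono_single:
 assumes "distinct rs" "r \<in> set rs" "q r = 1" "\<And>x. x \<in> set rs ==> x \<noteq> r ==> q x = 0"
 shows "mono rs q w = X (letter r) w"
proof -
 obtain xs ys where rs: "rs = xs @ r # ys" using assms(2) by (meson split_list)
 have "mono ys q w = w" using assms rs by (intro mono_zero) auto
 moreover have "mono xs q u = u" for u using assms rs by (intro mono_zero) auto
 ultimately show ?thesis unfolding rs mono_append mono_Cons assms(3) by simp
qed

end

lemma distinct_roots: "distinct (plus_roots m)" "distinct (minus_roots m)" "distinct (short_roots m)"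
 by (simp_all add: plus_roots_def minus_roots_def short_roots_def distinct_map inj_on_def)

section \<open>States and marked coordinates\<close>

definition ket :: "int set => vec" where
 "ket I = single (Leaf I)"

lemma ket_apply: "ket I (Leaf J) = (if J = I then 1 else 0)" "ket I (Node i j) = 0"
 by (simp_all add: ket_def single_def)

lemma hop_apply:
 assumes "a \<in> window n"
 shows "hop n a b t (Leaf I) = (if I \<subseteq> window n \<and> a \<in> I \<and> b \<notin> flip a I
  then fsign a I * (fsign b (flip a I) * t (Leaf (flip b (flip a I)))) else 0)"
 using assms by (simp add: hop_def flip_subset)

lemma hop_Node: "hop n a b t (Node i j) = 0" by (simp add: hop_def)

text \<open>Serves as the subspace that contains all smaller monomials: coordinates with a marked
  property \<open>P\<close> vanish on them, while the monomial under consideration has a nonzero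
  coordinate of this kind.\<close>

definition avoids :: "(int set => bool) => vec set" where
 "avoids P = {t. \<forall>I. P I --> t (Leaf I) = 0}"

lemma avoids_subspace: "vec.subspace (avoids P)"
 by (auto simp: vec.subspace_def avoids_def fscale_def)

lemma hop_avoids:
 assumes "a \<in> window n" "\<And>I. P I ==> a \<in> I ==> b \<notin> flip a I ==> P (flip b (flip a I))" "t \<in> avoids P"
 shows "hop n a b t \<in> avoids P"
 using assms unfolding avoids_def by (simp add: hop_apply)

lemma exterior_avoids:
 assumes "a \<in> window n" "b \<in> window n" "t \<in> avoids P"
  and "\<And>I. P I ==> a \<in> I ==> b \<notin> flip a I ==> P (flip b (flip a I))"
  and "\<And>I. P I ==> - b \<in> I ==> - a \<notin> flip (- b) I ==> P (flip (- a) (flip (- b) I))"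
 shows "exterior n a b t \<in> avoids P"
 unfolding exterior_def using assms
 by (intro vec.subspace_diff[OF avoids_subspace] hop_avoids) simp_all

lemma hop_ket_0:
 assumes "a \<in> window n" "b \<notin> I \<or> a \<in> I \<and> a \<noteq> b" shows "hop n a b (ket I) = 0"
proof
 fix i show "hop n a b (ket I) i = 0 i"
  by (cases i) (use assms in \<open>auto simp: hop_apply hop_Node ket_apply mem_flip split: if_splits\<close>)
qed

lemma hop_ket_diag:
 assumes "a \<in> I" "I \<subseteq> window n" shows "hop n a a (ket I) = ket I"
proof
 have fin: "finite I" using finite_subset[OF assms(2) finite_window] .
 fix i show "hop n a a (ket I) i = ket I i"
  by (cases i) (use assms in \<open>auto simp: hop_apply hop_Node ket_apply mem_flip fsign_flip[OF fin] subset_iff\<close>)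
qed

lemma exterior_ket_0:
 assumes "a \<in> window n" "b \<in> window n" "b \<notin> I" "- a \<notin> I"
 shows "exterior n a b (ket I) = 0"
 unfolding exterior_def using assms by (simp add: hop_ket_0)

text \<open>\<open>ket (level i)\<close> is the wedge product of the first \<open>i\<close> basis
  vectors; in the spin module it is the state in which exactly these modes are filled.\<close>

definition level :: "nat => int set" where
 "level i = {1..int i}"

lemma mem_level [simp]: "a \<in> level i \<longleftrightarrow> 1 \<le> a \<and> a \<le> int i" by (simp add: level_def)

lemma level_window: "i \<le> n ==> level i \<subseteq> window n" by (auto simp: level_def window_def)

lemma ket_supported: "I \<subseteq> window n ==> unitary_rep.supported (leaves n) (ket I)"
proof -
 interpret unitary_rep n "exterior n" "leaves n" by (rule exterior_unitary_rep)
 assume "I \<subseteq> window n"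
 thus ?thesis unfolding supported_def ket_def single_def by auto
qed

lemma ket_nonzero: "ket I \<noteq> 0"
proof
 assume "ket I = 0"
 hence "ket I (Leaf I) = 0" by simp
 thus False unfolding ket_apply by simp
qed

lemma exterior_datum:
 assumes i: "i \<le> n" and D: "D \<subseteq> letter_range n"
 shows "so_rep.datum fscale n (exterior n) D (ket (level i)) {0} (%k. if k \<le> int i then 1 else 0)"
proof -
 interpret E: unitary_rep n "exterior n" "leaves n" by (rule exterior_unitary_rep)
 show ?thesis unfolding E.datum_def
 proof (intro conjI ballI allI impI)
  have "E.X x 0 = 0" if "x \<in> D" for x using that D vec.lin_0[OF E.X_lin] by blast
  thus "E.stable D {0}" unfolding E.stable_def by simp
 next
  fix x assume x: "x \<in> D" "raising n x"
  obtain a b where ab: "x = (a, b)" by fastforce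
  have w: "\<bar>a\<bar> \<le> int n" "\<bar>b\<bar> \<le> int n" using D x by (auto simp: ab letter_range_iff)
  hence r: "a > 0 \<and> b \<le> 0 \<or> a > 0 \<and> b > a \<or> a = 0 \<and> b < 0 \<or> a < 0 \<and> b < 0 \<and> b > a"
   using x(2) raising_sgn[OF w] by (simp add: ab)
  have "hop n a b (ket (level i)) = 0" "hop n (- b) (- a) (ket (level i)) = 0"
   by (rule hop_ket_0, use w r in \<open>simp add: mem_window\<close>, unfold mem_level, use r in linarith)+
  thus "E.X x (ket (level i)) \<in> {0}" by (simp add: ab exterior_def)
 next
  fix k :: int assume k: "k > 0" "(k, k) \<in> D"
  hence w: "\<bar>k\<bar> \<le> int n" using D by (auto simp: letter_range_iff)
  have "hop n (- k) (- k) (ket (level i)) = 0" using w k by (intro hop_ket_0) (auto simp: mem_window)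
  moreover have "hop n k k (ket (level i)) = (if k \<le> int i then ket (level i) else 0)"
   using hop_ket_diag[OF _ level_window[OF i], of k] hop_ket_0[of k n k "level i"] w k by (auto simp: mem_window)
  ultimately show "exterior n k k (ket (level i)) = fscale (of_real (if k \<le> int i then 1 else 0)) (ket (level i))"
   by (simp add: exterior_def)
 qed
qed

lemma clifford_pair_avoids:
 assumes "a \<in> window n" "b \<in> window n" "a \<noteq> 0" "b \<noteq> 0" "t \<in> avoids P"
  and P: "\<And>I. P I ==> (if a > 0 then a \<in> I else - a \<notin> I) ==> (if b > 0 then b \<notin> flip \<bar>a\<bar> I else - b \<in> flip \<bar>a\<bar> I)
   ==> P (flip \<bar>b\<bar> (flip \<bar>a\<bar> I))"
  and P': "a = b ==> t \<in> avoids P"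
 shows "spin n a b t \<in> avoids P"
proof -
 have w: "\<bar>a\<bar> \<in> window n" "\<bar>b\<bar> \<in> window n" using assms(1,2) by (auto simp: mem_window)
 have "clifford n a (clifford n (- b) t) \<in> avoids P"
  using assms(3-5) P w assms(1,2) unfolding avoids_def clifford_def
  by (auto simp: flip_subset split: if_splits)
 moreover have "fscale (1 / 2) (restrict (leaves n) t) \<in> avoids P"
  using assms(5) by (auto simp: avoids_def restrict_def fscale_def)
 moreover have "0 \<in> avoids P" by (simp add: avoids_def)
 ultimately show ?thesis unfolding spin_def
  by (intro vec.subspace_diff[OF avoids_subspace]) simp_all
qed

lemma clifford_ket_0:
 assumes "a \<in> window n" "a \<noteq> 0" "if a > 0 then a \<in> I else - a \<notin> I"
 shows "clifford n a (ket I) = 0"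
proof
 fix i show "clifford n a (ket I) i = 0 i"
  by (cases i) (use assms in \<open>auto simp: clifford_def ket_apply mem_flip split: if_splits\<close>)
qed

lemma clifford_anticommute:
 assumes "a \<in> window n" "b \<in> window n" "a \<noteq> - b"
 shows "clifford n a (clifford n b t) = - clifford n b (clifford n a t)"
 using clifford_swap[OF assms(1,2)] assms(3) by simp

lemma clifford_0: "a \<in> window n ==> clifford n a 0 = 0"
 by (rule vec.lin_0[OF adjoint_pair_lin[OF clifford_adjoint_pair]])

lemma spin_ket_0:
 assumes w: "a \<in> window n" "b \<in> window n" "a \<noteq> b"
  and "a \<noteq> 0 \<and> (if a > 0 then a \<in> I else - a \<notin> I) \<or> b \<noteq> 0 \<and> (if b > 0 then b \<notin> I else - b \<in> I)"
 shows "spin n a b (ket I) = 0"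
proof -
 have "clifford n a (ket I) = 0 \<or> clifford n (- b) (ket I) = 0"
  using assms(4) clifford_ket_0[of a n I] clifford_ket_0[of "- b" n I] w by (auto split: if_splits)
 hence "clifford n a (clifford n (- b) (ket I)) = 0"
  using clifford_anticommute[of a n "- b" "ket I"] clifford_0[OF w(1)] clifford_0[of "- b" n] w by auto
 thus ?thesis using w(3) by (simp add: spin_def)
qed

lemma spin_ket_diagonal:
 assumes a: "a > 0" "a \<in> window n" and I: "I \<subseteq> window n"
 shows "spin n a a (ket I) = fscale (of_real (if a \<in> I then 1 / 2 else - 1 / 2)) (ket I)"
proof -
 have fin: "finite I" using finite_subset[OF I finite_window] .
 have r: "restrict (leaves n) (ket I) = ket I" using I by (auto simp: restrict_def ket_def single_def)
 have "clifford n a (clifford n (- a) (ket I)) = (if a \<in> I then ket I else 0)"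
  using hop_ket_diag[OF _ I, of a] hop_ket_0[of a n a I] a unfolding hop_def clifford_def by auto
 thus ?thesis unfolding spin_def r by (auto simp: fscale_def fun_eq_iff)
qed

text \<open>Among the indices occurring in \<open>D\<close> at most \<open>i + 1\<close> is
  unoccupied. The condition \<open>high\<close> excludes the letter \<open>(int i + 1, 0)\<close>,
  which would fill it; in so(2m) with \<open>i = m - 1\<close> the state is then a highest weight
  vector of the other half-spin type.\<close>

lemma spin_datum:
 assumes D: "D \<subseteq> letter_range n" and i: "i \<le> n"
  and high: "\<And>a b. (a, b) \<in> D ==> \<bar>a\<bar> \<le> int i + 1 \<and> \<bar>b\<bar> \<le> int i + 1 \<and>
   (\<bar>a\<bar> = int i + 1 \<or> \<bar>b\<bar> = int i + 1 --> a \<noteq> 0 \<and> b \<noteq> 0 \<and> a + b \<noteq> 0)"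
 shows "so_rep.datum fscale n (spin n) D (ket (level i)) {0} (%k. if k \<le> int i then 1 / 2 else - 1 / 2)"
proof -
 interpret E: unitary_rep n "spin n" "leaves n" by (rule spin_unitary_rep)
 show ?thesis unfolding E.datum_def
 proof (intro conjI ballI allI impI)
  have "E.X x 0 = 0" if "x \<in> D" for x using that D vec.lin_0[OF E.X_lin] by blast
  thus "E.stable D {0}" unfolding E.stable_def by simp
 next
  fix x assume x: "x \<in> D" "raising n x"
  obtain a b where ab: "x = (a, b)" by fastforce
  have w: "\<bar>a\<bar> \<le> int n" "\<bar>b\<bar> \<le> int n" using D x by (auto simp: ab letter_range_iff)
  hence r: "a > 0 \<and> b \<le> 0 \<or> a > 0 \<and> b > a \<or> a = 0 \<and> b < 0 \<or> a < 0 \<and> b < 0 \<and> b > a"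
   using x(2) raising_sgn[OF w] by (simp add: ab)
  note h = high[OF x(1)[unfolded ab]]
  have "a \<noteq> b" using r by linarith
  moreover have "a \<noteq> 0 \<and> (if a > 0 then a \<in> level i else - a \<notin> level i) \<or>
    b \<noteq> 0 \<and> (if b > 0 then b \<notin> level i else - b \<in> level i)"
   unfolding mem_level using r h by (smt (verit))
  ultimately have "spin n a b (ket (level i)) = 0" using w by (intro spin_ket_0) (simp_all add: mem_window)
  thus "E.X x (ket (level i)) \<in> {0}" by (simp add: ab)
 next
  fix k :: int assume k: "k > 0" "(k, k) \<in> D"
  hence w: "\<bar>k\<bar> \<le> int n" using D by (auto simp: letter_range_iff)
  show "spin n k k (ket (level i)) = fscale (of_real (if k \<le> int i then 1 / 2 else - 1 / 2)) (ket (level i))"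
   using spin_ket_diagonal[OF k(1) _ level_window[OF i]] w k(1) by (simp add: mem_window)
 qed
qed

context so_rep
begin

lemma mono_mem:
 assumes "\<And>r t. r \<in> set rs ==> t \<in> S ==> X (letter r) t \<in> S" "t \<in> S"
 shows "mono rs q t \<in> S"
proof -
 have pow: "(X (letter r) ^^ k) t \<in> S" if "r \<in> set rs" "t \<in> S" for r k t
  using that assms(1) by (induction k) auto
 have "set xs \<subseteq> set rs ==> mono xs q t \<in> S" for xs using assms(2) by (induction xs) (auto intro: pow)
 thus ?thesis by simp
qed

lemma mono_block_single:
 assumes "inj R" "1 \<le> j" "j < k" "q (R j) = 1" "\<forall>l\<in>{1..<k}. l \<noteq> j --> q (R l) = 0"
 shows "mono (map R [1..<k]) q t = X (letter (R j)) t"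
 by (rule mono_single) (use assms in \<open>auto simp: distinct_map inj_on_def inj_def\<close>)

lemma mono_block_zero: "\<forall>l\<in>{1..<k}. q (R l) = 0 ==> mono (map R [1..<k]) q t = t"
 by (rule mono_zero) auto

end

abbreviation "D_bound n m \<equiv> lower_bound n (sq_letters m) (long_roots (m - 1)) [plus_roots m, minus_roots m]"
abbreviation "B_bound n \<equiv> lower_bound n (all_letters n) (long_roots n) [short_roots n]"

lemma blocks_less_cong_right:
 "agree (set (concat bs)) p p' ==> blocks_less bs q p = blocks_less bs q p'"
proof (induction bs)
 case (Cons b bs)
 hence a: "agree (set b) p p'" by (simp add: agree_Un)
 have "block_less b q p = block_less b q p'" using block_less_cong[of b q q p p'] a by (auto simp: agree_def)
 moreover have "agree (set b) q p = agree (set b) q p'" using a by (auto simp: agree_def)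
 ultimately show ?case using Cons by (simp add: agree_Un)
qed simp

lemma lower_bound_cong:
 assumes b: "lower_bound n D rest bs \<mu> p" and p: "agree (set (concat bs)) p p'"
  and \<mu>: "\<And>i. 0 < i ==> (i, i) \<in> D ==> \<mu> i = \<nu> i"
 shows "lower_bound n D rest bs \<nu> p'"
proof -
 obtain G B s where G: "unitary_rep n G B" "so_rep.datum fscale n G D s {0} \<mu>"
  "unitary_rep.supported B s" "s \<noteq> 0" "survives G rest bs p s"
  using b unfolding lower_bound_def by blast
 interpret unitary_rep n G B by (rule G(1))
 have "agree (set (concat (rev bs))) p p'" using p by (simp add: agree_def)
 hence "mono (concat (rev bs)) p s = mono (concat (rev bs)) p' s" by (rule mono_cong)
 thus ?thesis unfolding lower_bound_def
  using G(1,3,4) datum_cong[OF G(2) \<mu>] G(5)[unfolded blocks_less_cong_right[OF p]]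
  by (intro exI[of _ G] exI[of _ B] exI[of _ s] conjI) simp_all
qed

lemma lower_boundI:
 assumes G: "unitary_rep n G B" "so_rep.datum fscale n G D v {0} \<mu>" "unitary_rep.supported B v" "v \<noteq> 0"
  and S: "vec.subspace S" "so_rep.mono G (concat (rev bs)) p v \<notin> S"
  and cols: "\<And>q. blocks_less bs q p ==> so_rep.mono G (concat (rev bs)) q v \<in> S"
  and rest: "\<And>a b t. (a, b) \<in> letter ` set rest ==> t \<in> S ==> G a b t \<in> S"
 shows "lower_bound n D rest bs \<mu> p"
proof -
 interpret unitary_rep n G B by (rule G(1))
 have "X (letter r) t \<in> S" if "r \<in> set rest" "t \<in> S" for r t
  using rest[of "fst (letter r)" "snd (letter r)" t] that by (simp add: X_def)
 hence "t \<in> S ==> mono rest q t \<in> S" for q t by (rule mono_mem)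
 hence "{mono rest q (mono (concat (rev bs)) q v) | q. blocks_less bs q p} \<subseteq> S" using cols by auto
 hence "vec.span {mono rest q (mono (concat (rev bs)) q v) | q. blocks_less bs q p} \<subseteq> S"
  by (intro vec.span_minimal S(1))
 thus ?thesis unfolding lower_bound_def using G S(2) by blast
qed

lemma lower_bound_zero:
 assumes G: "unitary_rep n G B" "so_rep.datum fscale n G D v {0} \<mu>" "unitary_rep.supported B v" "v \<noteq> 0"
  and p: "\<And>r. r \<in> set (concat bs) ==> p r = 0"
 shows "lower_bound n D rest bs \<mu> p"
proof -
 interpret unitary_rep n G B by (rule G(1))
 have "mono (concat (rev bs)) p v = v" using p by (intro mono_zero) auto
 moreover have "\<not> blocks_less bs q p" for q using p by (rule blocks_less_zero)
 ultimately show ?thesis unfolding lower_bound_def using G by (intro exI[of _ G] exI[of _ B] exI[of _ v]) simp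
qed

definition marked :: "int set => (int set => bool) => bool" where
 "marked M P \<longleftrightarrow> (\<forall>I J. I \<inter> M = J \<inter> M --> P I = P J)"

lemma marked_flip: "marked M P ==> a \<notin> M ==> P (flip a I) = P I"
proof -
 assume "marked M P" "a \<notin> M"
 moreover from \<open>a \<notin> M\<close> have "flip a I \<inter> M = I \<inter> M" by (auto simp: flip_def)
 ultimately show ?thesis unfolding marked_def by blast
qed

lemma exterior_marked:
 assumes "marked M P" "a \<in> window n" "b \<in> window n" "{a, b, - a, - b} \<inter> M = {}" "t \<in> avoids P"
 shows "exterior n a b t \<in> avoids P"
 using assms by (intro exterior_avoids) (auto simp: marked_flip)

lemma spin_marked:
 assumes "marked M P" "a \<in> window n" "b \<in> window n" "a \<noteq> 0" "b \<noteq> 0" "\<bar>a\<bar> \<notin> M" "\<bar>b\<bar> \<notin> M" "t \<in> avoids P"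
 shows "spin n a b t \<in> avoids P"
 using assms by (intro clifford_pair_avoids) (auto simp: marked_flip)

lemma rest_letters:
 assumes "1 \<le> m" "m \<le> n" "(a, b) \<in> letter ` set (long_roots (m - 1))"
 shows "a \<in> window n" "b \<in> window n" "a \<noteq> 0" "b \<noteq> 0" "\<bar>a\<bar> < int m" "\<bar>b\<bar> < int m"
 using assms unfolding letter_long by (auto simp: mem_window of_nat_diff)

lemma marked_pair: "marked {x, y} (%I. Q (x \<in> I) (y \<in> I))" unfolding marked_def
proof (intro allI impI)
 fix I J assume "I \<inter> {x, y} = J \<inter> {x, y}"
 hence "(x \<in> I) = (x \<in> J)" "(y \<in> I) = (y \<in> J)" by blast+
 thus "Q (x \<in> I) (y \<in> I) = Q (x \<in> J) (y \<in> J)" by simp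
qed

lemma sq_letters_range: "m \<le> n ==> sq_letters m \<subseteq> letter_range n"
 by (auto simp: sq_letters_def letter_range_def)

lemma exterior_bound_zero:
 assumes "i \<le> m" "m \<le> n" "\<And>r. r \<in> set (plus_roots m @ minus_roots m) ==> p r = 0"
 shows "D_bound n m (%k. if k \<le> int i then 1 else 0) p"
proof (rule lower_bound_zero[OF exterior_unitary_rep exterior_datum ket_supported ket_nonzero])
 show "i \<le> n" "sq_letters m \<subseteq> letter_range n" "level i \<subseteq> window n"
  using assms by (simp_all add: sq_letters_range level_window)
 fix r assume "r \<in> set (concat [plus_roots m, minus_roots m])"
 thus "p r = 0" using assms(3) by simp
qed

lemma spin_bound_zero:
 assumes "i = m \<or> Suc i = m" "m \<le> n" "\<And>r. r \<in> set (plus_roots m @ minus_roots m) ==> p r = 0"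
 shows "D_bound n m (%k. if k \<le> int i then 1 / 2 else - 1 / 2) p"
proof (rule lower_bound_zero[OF spin_unitary_rep spin_datum ket_supported ket_nonzero])
 show i: "i \<le> n" using assms by auto
 show "sq_letters m \<subseteq> letter_range n" "level i \<subseteq> window n"
  using assms(2) i by (simp_all add: sq_letters_range level_window)
 fix r assume "r \<in> set (concat [plus_roots m, minus_roots m])"
 thus "p r = 0" using assms(3) by simp
qed (use assms(1) in \<open>auto simp: mem_square\<close>)

lemma inj_roots: "inj (%i. Plus i m)" "inj (%i. Minus i m)" "inj Short" by (simp_all add: inj_def)

lemma block_single:
 assumes R: "inj R" and i: "1 \<le> i" "i < k" and p: "p (R i) = 1" "\<forall>j\<in>{1..<k}. j \<noteq> i --> p (R j) = 0"
  and less: "block_less (map R [1..<k]) q p"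
 shows "(\<forall>j\<in>{1..<k}. q (R j) = 0) \<or>
  (\<exists>j. i < j \<and> j < k \<and> q (R j) = 1 \<and> (\<forall>l\<in>{1..<k}. l \<noteq> j --> q (R l) = 0))"
proof -
 have "[1..<k] = [1..<i] @ i # [Suc i..<k]"
  using i upt_add_eq_append[of 1 i "k - i"] upt_conv_Cons[of i k] by simp
 hence split: "map R [1..<k] = map R [1..<i] @ R i # map R [Suc i..<k]" by simp
 have "(\<forall>x\<in>set (map R [1..<k]). q x = 0) \<or> (\<exists>s\<in>set (map R [Suc i..<k]). q s = 1 \<and>
   (\<forall>x\<in>set (map R [1..<k]). x \<noteq> s --> q x = 0))"
  by (rule block_less_single[OF split _ p(1) _ less])
   (use p(2) R in \<open>auto simp: distinct_map inj_on_def inj_def\<close>)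
 thus ?thesis
 proof
  assume "\<exists>s\<in>set (map R [Suc i..<k]). q s = 1 \<and> (\<forall>x\<in>set (map R [1..<k]). x \<noteq> s --> q x = 0)"
  then obtain s where s: "s \<in> set (map R [Suc i..<k])" "q s = 1"
   "\<forall>x\<in>set (map R [1..<k]). x \<noteq> s --> q x = 0" by blast
  then obtain j where "j \<in> {Suc i..<k}" "s = R j" by auto
  with s show ?thesis using R by (intro disjI2 exI[of _ j]) (simp add: inj_eq)
 qed simp
qed

interpretation exterior: unitary_rep n "exterior n" "leaves n" for n by (rule exterior_unitary_rep)

interpretation spin: unitary_rep n "spin n" "leaves n" for n by (rule spin_unitary_rep)

lemmas plus_single = block_single[where k = m and R = "%i. Plus i m" for m, OF inj_roots(1), folded plus_roots_def]
 and minus_single = block_single[where k = m and R = "%i. Minus i m" for m, OF inj_roots(2), folded minus_roots_def]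
 and exterior_plus = exterior.mono_block_single[where k = m and R = "%i. Plus i m" for m,
  OF inj_roots(1), folded plus_roots_def, unfolded letter.simps exterior.X_pair]
 and exterior_minus = exterior.mono_block_single[where k = m and R = "%i. Minus i m" for m,
  OF inj_roots(2), folded minus_roots_def, unfolded letter.simps exterior.X_pair]
 and exterior_zero = exterior.mono_block_zero[where k = m and R = "%i. Plus i m" for m, folded plus_roots_def]
  exterior.mono_block_zero[where k = m and R = "%i. Minus i m" for m, folded minus_roots_def]
 and spin_plus = spin.mono_block_single[where k = m and R = "%i. Plus i m" for m,
  OF inj_roots(1), folded plus_roots_def, unfolded letter.simps spin.X_pair]
 and spin_minus = spin.mono_block_single[where k = m and R = "%i. Minus i m" for m,
  OF inj_roots(2), folded minus_roots_def, unfolded letter.simps spin.X_pair]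
 and spin_zero = spin.mono_block_zero[where k = m and R = "%i. Plus i m" for m, folded plus_roots_def]
  spin.mono_block_zero[where k = m and R = "%i. Minus i m" for m, folded minus_roots_def]

lemma not_block_less_zero: "\<forall>j\<in>{1..<m}. p (Plus j m) = 0 ==> \<not> block_less (plus_roots m) q p"
 "\<forall>j\<in>{1..<m}. p (Minus j m) = 0 ==> \<not> block_less (minus_roots m) q p"
 by (rule block_less_zero, force simp: set_plus_roots set_minus_roots)+

lemma hop_coefficient:
 assumes "a \<in> window n" "J \<subseteq> window n" "a \<in> J" "b \<notin> flip a J" "flip b (flip a J) = I" "t (Leaf I) \<noteq> 0"
 shows "hop n a b t (Leaf J) \<noteq> 0"
 unfolding hop_apply[OF assms(1)] assms(5) using assms by (simp add: fsign_def)

lemma exterior_coefficient: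
 assumes "a \<in> window n" "b \<in> window n" "J \<subseteq> window n" "a \<in> J" "b \<notin> flip a J" "flip b (flip a J) = I" "t (Leaf I) \<noteq> 0"
  and "- b \<notin> J"
 shows "exterior n a b t (Leaf J) \<noteq> 0"
proof -
 have "hop n (- b) (- a) t (Leaf J) = 0" using assms(2,8) by (subst hop_apply) simp_all
 thus ?thesis using hop_coefficient[where t = t, OF assms(1,3-7)] by (simp add: exterior_def)
qed

lemma notin_avoidsI: "P J ==> t (Leaf J) \<noteq> 0 ==> t \<notin> avoids P" by (auto simp: avoids_def)

lemma zero_avoids: "0 \<in> avoids P" by (simp add: avoids_def)

abbreviation "avoids_pair m Q \<equiv> avoids (%I. Q (int m \<in> I) (- int m \<in> I))"

section \<open>0-1 exponents surviving in a column of long roots\<close>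

context
 fixes n m :: nat
 assumes m: "2 \<le> m" "m \<le> n"
begin

lemma D_boundI:
 assumes G: "unitary_rep n G B" "so_rep.datum fscale n G (sq_letters m) v {0} \<mu>" "unitary_rep.supported B v" "v \<noteq> 0"
  and target: "so_rep.mono G (minus_roots m) p (so_rep.mono G (plus_roots m) p v) \<notin> avoids P"
  and plus: "\<And>q. block_less (plus_roots m) q p ==>
   so_rep.mono G (minus_roots m) q (so_rep.mono G (plus_roots m) q v) \<in> avoids P"
  and minus: "\<And>q. block_less (minus_roots m) q p ==>
   so_rep.mono G (minus_roots m) q (so_rep.mono G (plus_roots m) p v) \<in> avoids P"
  and rest: "\<And>a b t. a \<in> window n ==> b \<in> window n ==> a \<noteq> 0 ==> b \<noteq> 0 ==> \<bar>a\<bar> < int m ==> \<bar>b\<bar> < int m ==>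
   t \<in> avoids P ==> G a b t \<in> avoids P"
 shows "D_bound n m \<mu> p"
proof (rule lower_boundI[OF G avoids_subspace])
 interpret unitary_rep n G B by (rule G(1))
 show "mono (concat (rev [plus_roots m, minus_roots m])) p v \<notin> avoids P"
  using target by (simp add: mono_append)
 fix q assume "blocks_less [plus_roots m, minus_roots m] q p"
 then consider "block_less (plus_roots m) q p" | "agree (set (plus_roots m)) q p" "block_less (minus_roots m) q p"
  by auto
 thus "mono (concat (rev [plus_roots m, minus_roots m])) q v \<in> avoids P"
 proof cases
  case 2
  thus ?thesis using minus mono_cong[OF 2(1)] by (simp add: mono_append)
 qed (use plus in \<open>simp add: mono_append\<close>)
qed (use rest rest_letters[OF _ m(2)] m(1) in auto)

lemma exterior_boundI:
 assumes i: "i < m"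
  and "exterior.mono n (minus_roots m) p (exterior.mono n (plus_roots m) p (ket (level i))) \<notin> avoids_pair m Q"
  and "\<And>q. block_less (plus_roots m) q p ==>
   exterior.mono n (minus_roots m) q (exterior.mono n (plus_roots m) q (ket (level i))) \<in> avoids_pair m Q"
  and "\<And>q. block_less (minus_roots m) q p ==>
   exterior.mono n (minus_roots m) q (exterior.mono n (plus_roots m) p (ket (level i))) \<in> avoids_pair m Q"
 shows "D_bound n m (%k. if k \<le> int i then 1 else 0) p"
proof (rule D_boundI[OF exterior_unitary_rep exterior_datum ket_supported ket_nonzero assms(2-4)])
 show "i \<le> n" "sq_letters m \<subseteq> letter_range n" "level i \<subseteq> window n"
  using i m by (simp_all add: sq_letters_range level_window)
 show "exterior n a b t \<in> avoids_pair m Q" if "a \<in> window n" "b \<in> window n" "\<bar>a\<bar> < int m" "\<bar>b\<bar> < int m" "t \<in> avoids_pair m Q" for a b t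
  using that by (intro exterior_marked[OF marked_pair]) auto
qed

lemma spin_boundI:
 assumes i: "i = m \<or> Suc i = m"
  and "spin.mono n (minus_roots m) p (spin.mono n (plus_roots m) p (ket (level i))) \<notin> avoids_pair m Q"
  and "\<And>q. block_less (plus_roots m) q p ==>
   spin.mono n (minus_roots m) q (spin.mono n (plus_roots m) q (ket (level i))) \<in> avoids_pair m Q"
  and "\<And>q. block_less (minus_roots m) q p ==>
   spin.mono n (minus_roots m) q (spin.mono n (plus_roots m) p (ket (level i))) \<in> avoids_pair m Q"
 shows "D_bound n m (%k. if k \<le> int i then 1 / 2 else - 1 / 2) p"
proof (rule D_boundI[OF spin_unitary_rep spin_datum ket_supported ket_nonzero assms(2-4)])
 show le: "i \<le> n" using i m by auto
 show "sq_letters m \<subseteq> letter_range n" "level i \<subseteq> window n"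
  using le m by (simp_all add: sq_letters_range level_window)
 show "spin n a b t \<in> avoids_pair m Q" if "a \<in> window n" "b \<in> window n" "a \<noteq> 0" "b \<noteq> 0" "\<bar>a\<bar> < int m" "\<bar>b\<bar> < int m"
  "t \<in> avoids_pair m Q" for a b t
  using that m by (intro spin_marked[OF marked_pair]) auto
qed (use i in \<open>auto simp: mem_square\<close>)

text \<open>The marker is that the index \<open>m\<close> is filled: \<open>F m i\<close> fills it
  from \<open>i\<close>, the zero exponent leaves it empty, and a later position finds its source
  index empty. Letters with indices below \<open>m\<close> do not affect the marker.\<close>

lemma exterior_bound_minus:
 assumes i: "1 \<le> i" "i < m" and p: "\<forall>j\<in>{1..<m}. p (Plus j m) = 0" "p (Minus i m) = 1"
  "\<forall>j\<in>{1..<m}. j \<noteq> i --> p (Minus j m) = 0"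
 shows "D_bound n m (%k. if k \<le> int i then 1 else 0) p"
proof (rule exterior_boundI[where Q = "%x y. x", OF i(2)], unfold exterior_zero(1)[OF p(1)])
 have wm: "int m \<in> window n" "int i \<in> window n" using m i by (auto simp: mem_window)
 show "exterior.mono n (minus_roots m) p (ket (level i)) \<notin> avoids (%I. int m \<in> I)"
  unfolding exterior_minus[OF i p(2,3)]
 proof (rule notin_avoidsI[where P = "(\<in>) (int m)" and J = "insert (int m) (level i - {int i})"])
  show "exterior n (int m) (int i) (ket (level i)) (Leaf (insert (int m) (level i - {int i}))) \<noteq> 0"
  proof (rule exterior_coefficient[OF wm])
   show "flip (int i) (flip (int m) (insert (int m) (level i - {int i}))) = level i" using i by (auto simp: flip_def)
  qed (use i wm in \<open>auto simp: mem_flip ket_apply mem_window\<close>)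
 qed simp
 fix q assume "block_less (minus_roots m) q p"
 from minus_single[OF i p(2,3) this]
 show "exterior.mono n (minus_roots m) q (ket (level i)) \<in> avoids (%I. int m \<in> I)"
 proof (elim disjE exE conjE)
  fix j assume j: "i < j" "j < m" "q (Minus j m) = 1" "\<forall>l\<in>{1..<m}. l \<noteq> j --> q (Minus l m) = 0"
  have "exterior n (int m) (int j) (ket (level i)) = 0"
   using i j m by (intro exterior_ket_0) (auto simp: mem_window)
  thus ?thesis using exterior_minus[of j m q n] i j zero_avoids by simp
 qed (use i in \<open>auto simp: exterior_zero avoids_def ket_apply\<close>)
qed (use not_block_less_zero(1)[OF p(1)] in simp)

text \<open>Smaller exponents leave the index \<open>- m\<close> empty, and letters of the
  \<open>Minus\<close> block cannot fill it, whatever their exponents are.\<close>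

lemma exterior_plus_less:
 assumes i: "1 \<le> i" "i < m" and p: "p (Plus i m) = 1" "\<forall>j\<in>{1..<m}. j \<noteq> i --> p (Plus j m) = 0"
  and less: "block_less (plus_roots m) q p"
 shows "exterior.mono n (minus_roots m) q (exterior.mono n (plus_roots m) q (ket (level i)))
  \<in> avoids (%I. - int m \<in> I)"
proof (rule exterior.mono_mem)
 fix r t assume r: "r \<in> set (minus_roots m)" and t: "t \<in> avoids (%I. - int m \<in> I)"
 have "exterior n (int m) (int j) t \<in> avoids (%I. - int m \<in> I)" if "1 \<le> j" "j < m" for j
  using that t m by (intro exterior_avoids) (auto simp: mem_window mem_flip)
 thus "exterior.X n (letter r) t \<in> avoids (%I. - int m \<in> I)" using r unfolding set_minus_roots by auto
next
 from plus_single[OF i p less]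
 show "exterior.mono n (plus_roots m) q (ket (level i)) \<in> avoids (%I. - int m \<in> I)"
 proof (elim disjE exE conjE)
  fix j assume j: "i < j" "j < m" "q (Plus j m) = 1" "\<forall>l\<in>{1..<m}. l \<noteq> j --> q (Plus l m) = 0"
  have "exterior n (- int m) (int j) (ket (level i)) = 0"
   using i j m by (intro exterior_ket_0) (auto simp: mem_window)
  thus ?thesis using exterior_plus[of j m q n] i j zero_avoids by simp
 qed (use i in \<open>auto simp: exterior_zero avoids_def ket_apply\<close>)
qed

lemma exterior_plus_coefficient:
 assumes i: "1 \<le> i" "i < m"
 shows "exterior n (- int m) (int i) (ket (level i)) (Leaf (insert (- int m) (level i - {int i}))) \<noteq> 0"
proof (rule exterior_coefficient)
 show "flip (int i) (flip (- int m) (insert (- int m) (level i - {int i}))) = level i"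
  using i by (auto simp: flip_def)
qed (use i m in \<open>auto simp: mem_flip ket_apply mem_window\<close>)

lemma exterior_bound_plus:
 assumes i: "1 \<le> i" "i < m" and p: "p (Plus i m) = 1" "\<forall>j\<in>{1..<m}. j \<noteq> i --> p (Plus j m) = 0"
  "\<forall>j\<in>{1..<m}. p (Minus j m) = 0"
 shows "D_bound n m (%k. if k \<le> int i then 1 else 0) p"
proof (rule exterior_boundI[where Q = "%x y. y", OF i(2)])
 show "exterior.mono n (minus_roots m) p (exterior.mono n (plus_roots m) p (ket (level i))) \<notin> avoids (%I. - int m \<in> I)"
  unfolding exterior_zero(2)[OF p(3)] exterior_plus[OF i p(1,2)]
  by (rule notin_avoidsI[where P = "(\<in>) (- int m)" and J = "insert (- int m) (level i - {int i})"])
   (simp, rule exterior_plus_coefficient[OF i])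
qed (use exterior_plus_less[OF i p(1,2)] not_block_less_zero(2)[OF p(3)] in blast)+

text \<open>The marker is that both \<open>m\<close> and \<open>- m\<close> are filled, the latter
  from \<open>i\<close> and the former from \<open>i-1\<close>. After the first step all indices
  from \<open>i\<close> to \<open>m-1\<close> are empty (\<open>uj\<close>), so a smaller
  \<open>Minus\<close> exponent at such an index cannot fill \<open>m\<close>.\<close>

lemma exterior_bound_pair:
 assumes i: "1 < i" "i < m" and p: "p (Plus i m) = 1" "\<forall>j\<in>{1..<m}. j \<noteq> i --> p (Plus j m) = 0"
  "p (Minus (i - 1) m) = 1" "\<forall>j\<in>{1..<m}. j \<noteq> i - 1 --> p (Minus j m) = 0"
 shows "D_bound n m (%k. if k \<le> int i then 1 else 0) p"
proof (rule exterior_boundI[where Q = "(\<and>)", OF i(2)])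
 have i1: "1 \<le> i" "1 \<le> i - 1" "i - 1 < m" "int (i - 1) = int i - 1" using i by auto
 let ?P = "%I::int set. int m \<in> I \<and> - int m \<in> I"
 define u where "u = exterior n (- int m) (int i) (ket (level i))"
 have wm: "int m \<in> window n" "- int m \<in> window n" "int i \<in> window n" "int i - 1 \<in> window n"
  using m i by (auto simp: mem_window)
 have u: "exterior.mono n (plus_roots m) p (ket (level i)) = u"
  unfolding u_def by (rule exterior_plus[OF i1(1) i(2) p(1,2)])
 let ?J = "insert (int m) (insert (- int m) (level i - {int i, int i - 1}))"
 have "exterior n (int m) (int i - 1) u (Leaf ?J) \<noteq> 0"
 proof (rule exterior_coefficient[OF wm(1,4)])
  show "?J \<subseteq> window n" using level_window[of i n] i m wm by auto
  show "flip (int i - 1) (flip (int m) ?J) = insert (- int m) (level i - {int i})"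
   using i by (auto simp: flip_def)
  show "u (Leaf (insert (- int m) (level i - {int i}))) \<noteq> 0"
   unfolding u_def by (rule exterior_plus_coefficient[OF i1(1) i(2)])
 qed (use i in \<open>auto simp: mem_flip\<close>)
 thus "exterior.mono n (minus_roots m) p (exterior.mono n (plus_roots m) p (ket (level i))) \<notin> avoids ?P"
  unfolding u exterior_minus[OF i1(2,3) p(3,4)] i1(4) by (intro notin_avoidsI[of ?P ?J]) simp_all
 show "exterior.mono n (minus_roots m) q (exterior.mono n (plus_roots m) q (ket (level i))) \<in> avoids ?P"
  if "block_less (plus_roots m) q p" for q
  using exterior_plus_less[OF i1(1) i(2) p(1,2) that] by (simp add: avoids_def)
 have "u \<in> avoids (%I. int m \<in> I)" unfolding u_def
  using wm i by (intro exterior_avoids) (auto simp: mem_flip avoids_def ket_apply)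
 hence um: "u \<in> avoids ?P" by (simp add: avoids_def)
 have uj: "u \<in> avoids (%I. int j \<in> I)" if j: "i \<le> j" "j < m" for j
 proof -
  have "hop n (- int i) (- (- int m)) (ket (level i)) = 0" using wm i by (intro hop_ket_0) auto
  moreover have "hop n (- int m) (int i) (ket (level i)) (Leaf I) = 0" if jI: "int j \<in> I" for I
  proof (cases "- int m \<in> I \<and> int i \<notin> flip (- int m) I")
   case True
   hence "i \<noteq> j" using jI i m by (auto simp: mem_flip split: if_splits)
   hence "int j \<in> flip (int i) (flip (- int m) I)" using jI j i by (auto simp: mem_flip)
   hence "flip (int i) (flip (- int m) I) \<noteq> level i" using j \<open>i \<noteq> j\<close> by auto
   thus ?thesis unfolding hop_apply[OF wm(2)] by (simp add: ket_apply)
  qed (auto simp: hop_apply[OF wm(2)])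
  ultimately show ?thesis unfolding u_def avoids_def exterior_def by simp
 qed
 fix q assume "block_less (minus_roots m) q p"
 from minus_single[OF i1(2,3) p(3,4) this]
 show "exterior.mono n (minus_roots m) q (exterior.mono n (plus_roots m) p (ket (level i))) \<in> avoids ?P"
 proof (elim disjE exE conjE)
  fix j assume j: "i - 1 < j" "j < m" "q (Minus j m) = 1" "\<forall>l\<in>{1..<m}. l \<noteq> j --> q (Minus l m) = 0"
  have j1: "1 \<le> j" "i \<le> j" using i j by simp_all
  have "exterior n (int m) (int j) u (Leaf I) = 0" if I: "int m \<in> I" "- int m \<in> I" for I
  proof -
   have "hop n (- int j) (- int m) u (Leaf I) = 0"
    using I m j1 j by (subst hop_apply) (auto simp: mem_window mem_flip)
   moreover have "int j \<in> flip (int j) (flip (int m) I)" if "int j \<notin> flip (int m) I"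
    using that by (simp add: mem_flip)
   hence "hop n (int m) (int j) u (Leaf I) = 0"
    using uj[OF j1(2) j(2)] unfolding hop_apply[OF wm(1)] avoids_def by simp
   ultimately show ?thesis by (simp add: exterior_def)
  qed
  thus ?thesis unfolding u exterior_minus[OF j1(1) j(2-4)] by (simp add: avoids_def)
 qed (use um in \<open>simp add: u exterior_zero\<close>)
qed

lemma last_index: "1 \<le> m - 1" "m - 1 < m" "int (m - 1) = int m - 1" using m by auto

text \<open>The highest weight state has the single mode \<open>m\<close> empty, and
  \<open>F m (m-1)\<close> fills it. Position \<open>m-1\<close> is the last one, so only the zero
  exponent is smaller.\<close>

lemma spin_bound_minus:
 assumes p: "\<forall>j\<in>{1..<m}. p (Plus j m) = 0" "p (Minus (m - 1) m) = 1"
  "\<forall>j\<in>{1..<m}. j \<noteq> m - 1 --> p (Minus j m) = 0"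
 shows "D_bound n m (%k. if k \<le> int (m - 1) then 1 / 2 else - 1 / 2) p"
proof (rule spin_boundI[where Q = "%x y. x"], unfold spin_zero(1)[OF p(1)])
 have wm: "int m \<in> window n" using m by (auto simp: mem_window)
 have sp: "spin n (int m) (int m - 1) t = hop n (int m) (int m - 1) t" for t
  using m by (simp add: spin_def hop_def clifford_def)
 let ?J = "insert (int m) (level (m - 1) - {int m - 1})"
 have "hop n (int m) (int m - 1) (ket (level (m - 1))) (Leaf ?J) \<noteq> 0"
 proof (rule hop_coefficient[OF wm])
  show "flip (int m - 1) (flip (int m) ?J) = level (m - 1)" using m last_index by (auto simp: flip_def)
 qed (use m last_index in \<open>auto simp: mem_flip ket_apply mem_window\<close>)
 thus "spin.mono n (minus_roots m) p (ket (level (m - 1))) \<notin> avoids (%I. int m \<in> I)"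
  unfolding spin_minus[OF last_index(1,2) p(2,3)] last_index(3) sp by (intro notin_avoidsI[of _ ?J]) simp_all
 fix q assume "block_less (minus_roots m) q p"
 hence "\<forall>j\<in>{1..<m}. q (Minus j m) = 0" using minus_single[OF last_index(1,2) p(2,3), of q] by auto
 thus "spin.mono n (minus_roots m) q (ket (level (m - 1))) \<in> avoids (%I. int m \<in> I)"
  using last_index by (auto simp: spin_zero avoids_def ket_apply)
qed (use m not_block_less_zero(1)[OF p(1)] in auto)

text \<open>The marker is that the mode \<open>m\<close> is empty. It is filled in the highest
  weight state, \<open>F (-m) (m-1)\<close> empties it together with \<open>m-1\<close>, and letters
  of the \<open>Minus\<close> block can only fill it again.\<close>

lemma spin_bound_plus:
 assumes p: "p (Plus (m - 1) m) = 1" "\<forall>j\<in>{1..<m}. j \<noteq> m - 1 --> p (Plus j m) = 0"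
  "\<forall>j\<in>{1..<m}. p (Minus j m) = 0"
 shows "D_bound n m (%k. if k \<le> int m then 1 / 2 else - 1 / 2) p"
proof (rule spin_boundI[where Q = "%x y. \<not> x"])
 let ?P = "%I::int set. int m \<notin> I" and ?J = "level m - {int m, int m - 1}"
 have wm: "int m \<in> window n" "int m - 1 \<in> window n" using m by (auto simp: mem_window)
 have sp: "spin n (- int m) (int m - 1) t = ferm n False (int m) (ferm n False (int m - 1) t)" for t
  using m by (simp add: spin_def clifford_def)
 have J: "?J \<subseteq> window n" "flip (int m) ?J \<subseteq> window n" using level_window[of m n] m wm by (auto simp: flip_subset)
 have f: "flip (int m - 1) (flip (int m) ?J) = level m" using m last_index by (auto simp: flip_def)
 have "int m - 1 \<notin> flip (int m) ?J" by (simp add: mem_flip)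
 hence "ferm n False (int m) (ferm n False (int m - 1) (ket (level m))) (Leaf ?J) \<noteq> 0"
  using J by (simp add: f ket_apply fsign_def)
 thus "spin.mono n (minus_roots m) p (spin.mono n (plus_roots m) p (ket (level m))) \<notin> avoids ?P"
  unfolding spin_zero(2)[OF p(3)] spin_plus[OF last_index(1,2) p(1,2)] last_index(3) sp
  by (intro notin_avoidsI[of _ ?J]) simp_all
 show "spin.mono n (minus_roots m) q (spin.mono n (plus_roots m) q (ket (level m))) \<in> avoids ?P"
  if less: "block_less (plus_roots m) q p" for q
 proof (rule spin.mono_mem)
  fix r t assume r: "r \<in> set (minus_roots m)" and t: "t \<in> avoids ?P"
  have "spin n (int m) (int j) t \<in> avoids ?P" if j: "1 \<le> j" "j < m" for j
   using j t m by (intro clifford_pair_avoids) (auto simp: mem_window mem_flip)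
  thus "spin.X n (letter r) t \<in> avoids ?P" using r unfolding set_minus_roots by auto
 next
  have "\<forall>j\<in>{1..<m}. q (Plus j m) = 0" using plus_single[OF last_index(1,2) p(1,2) less] by auto
  thus "spin.mono n (plus_roots m) q (ket (level m)) \<in> avoids ?P"
   using m by (auto simp: spin_zero avoids_def ket_apply)
 qed
qed (use not_block_less_zero(2)[OF p(3)] in auto)

end

section \<open>Unit exponents surviving in the column of short roots\<close>

lemmas short_single = block_single[where k = "n + 1" and R = Short for n, OF inj_roots(3), folded short_roots_def,
  unfolded Suc_eq_plus1[symmetric] atLeastLessThanSuc_atLeastAtMost less_Suc_eq_le]
 and exterior_short = exterior.mono_block_single[where k = "n + 1" and R = Short for n, OF inj_roots(3), folded short_roots_def,
  unfolded Suc_eq_plus1[symmetric] atLeastLessThanSuc_atLeastAtMost less_Suc_eq_le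
  letter.simps exterior.X_pair]
 and spin_short = spin.mono_block_single[where k = "n + 1" and R = Short for n, OF inj_roots(3), folded short_roots_def,
  unfolded Suc_eq_plus1[symmetric] atLeastLessThanSuc_atLeastAtMost less_Suc_eq_le
  letter.simps spin.X_pair]
 and short_zero = exterior.mono_block_zero[where k = "n + 1" and R = Short for n, folded short_roots_def,
  unfolded Suc_eq_plus1[symmetric] atLeastLessThanSuc_atLeastAtMost less_Suc_eq_le]
  spin.mono_block_zero[where k = "n + 1" and R = Short for n, folded short_roots_def,
  unfolded Suc_eq_plus1[symmetric] atLeastLessThanSuc_atLeastAtMost less_Suc_eq_le]

lemma all_letters_range: "all_letters n \<subseteq> letter_range n"
 by (auto simp: sq_letters_def letter_range_def col_letters_def)

lemma long_letters:
 assumes "(a, b) \<in> letter ` set (long_roots n)"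
 shows "a \<in> window n" "b \<in> window n" "a \<noteq> 0" "b \<noteq> 0" "a \<noteq> b"
 using assms unfolding letter_long by (auto simp: mem_window)

lemma exterior_short_zero:
 assumes i: "i \<le> n" and p: "\<forall>j\<in>{1..n}. p (Short j) = 0"
 shows "B_bound n (%k. if k \<le> int i then 1 else 0) p"
proof (rule lower_bound_zero[OF exterior_unitary_rep exterior_datum[OF i all_letters_range] ket_supported ket_nonzero])
 show "level i \<subseteq> window n" using i by (rule level_window)
 fix r assume "r \<in> set (concat [short_roots n])"
 thus "p r = 0" using p by (auto simp: set_short_roots)
qed

lemma spin_short_datum: "so_rep.datum fscale n (spin n) (all_letters n) (ket (level n)) {0}
  (%k. if k \<le> int n then 1 / 2 else - 1 / 2)"
 by (rule spin_datum[OF all_letters_range order_refl]) (auto simp: mem_square col_letters_def)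

lemma spin_short_zero:
 assumes p: "\<forall>j\<in>{1..n}. p (Short j) = 0"
 shows "B_bound n (%k. if k \<le> int n then 1 / 2 else - 1 / 2) p"
proof (rule lower_bound_zero[OF spin_unitary_rep spin_short_datum ket_supported ket_nonzero])
 show "level n \<subseteq> window n" by (rule level_window) simp
 fix r assume "r \<in> set (concat [short_roots n])"
 thus "p r = 0" using p by (auto simp: set_short_roots)
qed

lemma concat_single: "concat (rev [b]) = b" by simp

text \<open>The marker is that the index 0 is filled: long roots do not touch it, and
  \<open>F 0 j\<close> with \<open>j > i\<close> finds \<open>j\<close> empty.\<close>

lemma exterior_bound_short:
 assumes i: "1 \<le> i" "i \<le> n" and p: "p (Short i) = 1" "\<forall>j\<in>{1..n}. j \<noteq> i --> p (Short j) = 0"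
 shows "B_bound n (%k. if k \<le> int i then 1 else 0) p"
proof (rule lower_boundI[OF exterior_unitary_rep exterior_datum[OF i(2) all_letters_range]
   ket_supported ket_nonzero avoids_subspace])
 show lw: "level i \<subseteq> window n" using i(2) by (rule level_window)
 let ?P = "%I::int set. 0 \<in> I"
 have w: "0 \<in> window n" "int i \<in> window n" using i by (auto simp: mem_window)
 show "exterior.mono n (concat (rev [short_roots n])) p (ket (level i)) \<notin> avoids ?P"
  unfolding concat_single exterior_short[OF i p]
 proof (rule notin_avoidsI)
  let ?J = "insert 0 (level i - {int i})"
  show "0 \<in> ?J" by simp
  show "exterior n 0 (int i) (ket (level i)) (Leaf ?J) \<noteq> 0"
  proof (rule exterior_coefficient[OF w])
   show "?J \<subseteq> window n" using lw w by auto
   show "flip (int i) (flip 0 ?J) = level i" using i by (auto simp: flip_def)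
  qed (use i in \<open>auto simp: mem_flip ket_apply\<close>)
 qed
 have base: "ket (level i) \<in> avoids ?P" by (auto simp: avoids_def ket_apply)
 show "exterior.mono n (concat (rev [short_roots n])) q (ket (level i)) \<in> avoids ?P"
  if less: "blocks_less [short_roots n] q p" for q
  unfolding concat_single
 proof -
  have "block_less (short_roots n) q p" using less by simp
  from short_single[OF i p this] show "exterior.mono n (short_roots n) q (ket (level i)) \<in> avoids ?P"
  proof (elim disjE exE conjE)
   assume "\<forall>j\<in>{1..n}. q (Short j) = 0"
   thus ?thesis using base by (simp only: short_zero)
  next
   fix j assume j: "i < j" "j \<le> n" "q (Short j) = 1" "\<forall>l\<in>{1..n}. l \<noteq> j --> q (Short l) = 0"
   have j1: "1 \<le> j" using i j by simp
   have "exterior n 0 (int j) (ket (level i)) = 0"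
    using i j by (intro exterior_ket_0) (auto simp: mem_window)
   thus ?thesis unfolding exterior_short[OF j1 j(2-4)] using zero_avoids by simp
  qed
 qed
 show "exterior n a b t \<in> avoids ?P" if ab: "(a, b) \<in> letter ` set (long_roots n)" and t: "t \<in> avoids ?P" for a b t
  using long_letters[OF ab] t
  by (intro exterior_marked[OF marked_pair[of 0 0 "%x y. x"]]) auto
qed

text \<open>The marker is the parity of the number of filled modes: letters of long roots change two
  modes, and \<open>F 0 n\<close> changes one.\<close>

lemma spin_bound_short:
 assumes n: "1 \<le> n" and p: "p (Short n) = 1" "\<forall>j\<in>{1..n}. j \<noteq> n --> p (Short j) = 0"
 shows "B_bound n (%k. if k \<le> int n then 1 / 2 else - 1 / 2) p"
proof (rule lower_boundI[OF spin_unitary_rep spin_short_datum ket_supported ket_nonzero avoids_subspace])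
 show lw: "level n \<subseteq> window n" by (rule level_window) simp
 let ?P = "%I::int set. I \<subseteq> window n \<and> (even (card I) \<longleftrightarrow> odd n)"
 have w: "int n \<in> window n" using n by (auto simp: mem_window)
 have cl: "card (level k) = k" for k by (simp add: level_def)
 have sp: "spin n 0 (int n) t = parity n (ferm n False (int n) t)" for t
  using n by (simp add: spin_def clifford_def)
 show "spin.mono n (concat (rev [short_roots n])) p (ket (level n)) \<notin> avoids ?P"
  unfolding concat_single spin_short[OF n order_refl p] sp
 proof (rule notin_avoidsI)
  let ?J = "level (n - 1)"
  show J: "?J \<subseteq> window n \<and> (even (card ?J) \<longleftrightarrow> odd n)" using n level_window[of "n - 1" n] by (simp add: cl)
  have n1: "int (n - 1) = int n - 1" using n by simp
  have f: "flip (int n) ?J = level n" unfolding flip_def level_def n1 using n by auto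
  have "int n \<notin> ?J" using n by simp
  thus "parity n (ferm n False (int n) (ket (level n))) (Leaf ?J) \<noteq> 0"
   using J by (simp add: f ket_apply fsign_def del: One_nat_def)
 qed
 have base: "ket (level n) \<in> avoids ?P" by (simp add: avoids_def ket_apply cl)
 show "spin.mono n (concat (rev [short_roots n])) q (ket (level n)) \<in> avoids ?P"
  if less: "blocks_less [short_roots n] q p" for q
 proof -
  have "block_less (short_roots n) q p" using less by simp
  hence "\<forall>j\<in>{1..n}. q (Short j) = 0" using short_single[OF n order_refl p, of q] by auto
  thus ?thesis unfolding concat_single using base by (simp only: short_zero)
 qed
 show "spin n a b t \<in> avoids ?P" if ab: "(a, b) \<in> letter ` set (long_roots n)" and t: "t \<in> avoids ?P" for a b t
 proof (rule clifford_pair_avoids[OF long_letters(1-4)[OF ab] t])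
  fix I assume P: "?P I"
  have fin: "finite I" using P finite_subset[OF _ finite_window] by auto
  hence fin': "finite (flip \<bar>a\<bar> I)" by (simp add: flip_def)
  have "\<bar>a\<bar> \<in> window n" "\<bar>b\<bar> \<in> window n" using long_letters[OF ab] by (auto simp: mem_window)
  thus "?P (flip \<bar>b\<bar> (flip \<bar>a\<bar> I))" using P card_flip_even[OF fin] card_flip_even[OF fin'] by (simp add: flip_subset)
 qed (rule t)
qed

section \<open>Decomposition of admissible exponents\<close>

text \<open>The coordinates of a weight of so(2m) with Dynkin labels \<open>l\<close>: the label
  \<open>i < m\<close> is the difference of the coordinates \<open>i\<close> and \<open>i+1\<close>,
  and the label \<open>m\<close> is the sum of the last two.\<close>

definition D_weight :: "nat => (nat => nat) => int => real" where
 "D_weight m l i = (if i = int m then (real (l m) - real (l (m - 1))) / 2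
   else (\<Sum>j = nat i..<m - 1. real (l j)) + (real (l (m - 1)) + real (l m)) / 2)"

text \<open>The same for so(2n+1), where the last label is twice the last coordinate.\<close>

definition B_weight :: "nat => (nat => nat) => int => real" where
 "B_weight n k i = (\<Sum>j = nat i..<n. real (k j)) + real (k n) / 2"

definition unit :: "'r set => 'r => nat" where
 "unit R r = (if r \<in> R then 1 else 0)"

text \<open>\<open>column_cond\<close> in terms of Dynkin labels, with subtracted terms brought to
  the other side so that natural numbers suffice.\<close>

definition D_cond :: "nat => (nat => nat) => (root => nat) => bool" where
 "D_cond m l p \<longleftrightarrow> (\<forall>i\<in>{1..m - 2}. p (Plus i m) \<le> l i) \<and> p (Plus (m - 1) m) \<le> l m \<and>
  (\<forall>i\<in>{1..m - 2}. p (Minus i m) + p (Plus i m) \<le> l i + p (Plus (Suc i) m)) \<and>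
  p (Minus (m - 1) m) \<le> l (m - 1) \<and>
  (3 \<le> m --> p (Minus (m - 1) m) + p (Plus (m - 2) m) + p (Minus (m - 2) m) \<le> l (m - 2) + l (m - 1))"

lemma D_weight_add: "D_weight m (%i. l i + l' i) i = D_weight m l i + D_weight m l' i"
 by (simp add: D_weight_def sum.distrib add_divide_distrib diff_divide_distrib)

lemma B_weight_add: "B_weight m (%i. l i + l' i) i = B_weight m l i + B_weight m l' i"
 by (simp add: B_weight_def sum.distrib add_divide_distrib)

lemma sum_unit_interval: "(\<Sum>j = a..<b. real (unit {i :: nat} j)) = (if a \<le> i \<and> i < b then 1 else 0)"
proof -
 have "(\<Sum>j = a..<b. real (unit {i} j)) = (\<Sum>j = a..<b. if j = i then 1 else (0 :: real))"
  by (intro sum.cong refl) (simp add: unit_def)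
 also have "\<dots> = (if a \<le> i \<and> i < b then 1 else 0)" by simp
 finally show ?thesis .
qed

lemma B_weight_unit:
 assumes "1 \<le> i" "i < n" "0 < k" "k \<le> int n"
 shows "B_weight n (unit {i}) k = (if k \<le> int i then 1 else 0)"
 using assms unfolding B_weight_def sum_unit_interval by (auto simp: unit_def)

lemma B_weight_last: "B_weight n (unit {n}) k = 1 / 2"
 unfolding B_weight_def sum_unit_interval by (simp add: unit_def)

lemma D_weight_unit:
 assumes "2 \<le> m" "1 \<le> i" "i < m - 1" "0 < k" "k \<le> int m"
 shows "D_weight m (unit {i}) k = (if k \<le> int i then 1 else 0)"
 using assms unfolding D_weight_def sum_unit_interval by (auto simp: unit_def)

lemma D_weight_last:
 assumes "2 \<le> m" "0 < k" "k \<le> int m"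
 shows "D_weight m (unit {m}) k = 1 / 2"
  and "D_weight m (unit {m - 1}) k = (if k \<le> int (m - 1) then 1 / 2 else - 1 / 2)"
 using assms unfolding D_weight_def sum_unit_interval by (auto simp: unit_def)

lemma D_weight_pair:
 assumes "2 \<le> m" "0 < k" "k \<le> int m"
 shows "D_weight m (unit {m - 1, m}) k = (if k \<le> int (m - 1) then 1 else 0)"
proof -
 have "m - 1 \<noteq> m" using assms by simp
 hence "unit {m - 1, m} = (%j. unit {m - 1} j + unit {m} j)" by (auto simp: unit_def)
 thus ?thesis by (simp only: D_weight_add D_weight_last[OF assms]) simp
qed

lemma D_bound_cong:
 assumes "D_bound n m \<mu> p" "\<And>i. 0 < i ==> i \<le> int m ==> \<mu> i = \<nu> i"
  and "\<And>i. i \<in> {1..<m} ==> p (Plus i m) = q (Plus i m) \<and> p (Minus i m) = q (Minus i m)"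
 shows "D_bound n m \<nu> q"
 by (rule lower_bound_cong[OF assms(1)])
  (use assms(2,3) in \<open>auto simp: agree_def set_plus_roots set_minus_roots mem_square\<close>)

lemma B_bound_cong:
 assumes "B_bound n \<mu> p" "\<And>i. 0 < i ==> i \<le> int n ==> \<mu> i = \<nu> i"
  and "\<And>i. i \<in> {1..n} ==> p (Short i) = q (Short i)"
 shows "B_bound n \<nu> q"
 by (rule lower_bound_cong[OF assms(1)])
  (use assms(2,3) in \<open>auto simp: agree_def set_short_roots mem_square col_letters_def\<close>)

lemma distinct_long: "distinct (long_roots m)"
proof (induction m)
 case (Suc m)
 show ?case
 proof (cases "2 \<le> Suc m")
  case True
  have "letter r \<notin> letter ` set (minus_roots (Suc m) @ plus_roots (Suc m))" if "r \<in> set (long_roots m)" for r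
  proof -
   have "letter r \<in> letter ` set (long_roots m)" using that by simp
   thus ?thesis unfolding letter_long set_append image_Un letter_minus letter_plus by auto
  qed
  hence "set (long_roots m) \<inter> set (minus_roots (Suc m) @ plus_roots (Suc m)) = {}" by blast
  moreover have "set (minus_roots (Suc m)) \<inter> set (plus_roots (Suc m)) = {}"
   by (auto simp: set_minus_roots set_plus_roots)
  ultimately show ?thesis using Suc long_roots_Suc[OF True] distinct_roots by auto
 qed (simp add: long_roots_small)
qed (simp add: long_roots_small)

lemma D_bound_add:
 assumes m: "2 \<le> m" "m \<le> n" and 1: "D_bound n m \<mu> p" and 2: "D_bound n m \<nu> q"
 shows "D_bound n m (%i. \<mu> i + \<nu> i) (%r. p r + q r)"
proof (rule lower_bound_add[OF _ _ sq_letters_range[OF m(2)] 1 2])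
 have eq: "long_roots (m - 1) @ concat (rev [plus_roots m, minus_roots m]) = long_roots m"
  using long_roots_Suc[OF m(1)] by simp
 show "distinct (long_roots (m - 1) @ concat (rev [plus_roots m, minus_roots m]))"
  unfolding eq by (rule distinct_long)
 show "letter ` set (long_roots (m - 1) @ concat (rev [plus_roots m, minus_roots m])) \<subseteq> letter_range n"
  unfolding eq letter_long using m by (auto simp: letter_range_def)
qed

lemma distinct_long_short: "distinct (long_roots n @ short_roots n)"
proof -
 have "letter r \<notin> letter ` set (short_roots n)" if "r \<in> set (long_roots n)" for r
 proof -
  have "letter r \<in> letter ` set (long_roots n)" using that by simp
  thus ?thesis unfolding letter_long letter_short by auto
 qed
 thus ?thesis using distinct_long distinct_roots by auto
qed

lemma B_bound_add:
 assumes 1: "B_bound n \<mu> p" and 2: "B_bound n \<nu> q"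
 shows "B_bound n (%i. \<mu> i + \<nu> i) (%r. p r + q r)"
proof (rule lower_bound_add[OF _ _ all_letters_range 1 2])
 show "distinct (long_roots n @ concat (rev [short_roots n]))" using distinct_long_short by simp
 show "letter ` set (long_roots n @ concat (rev [short_roots n])) \<subseteq> letter_range n"
  unfolding concat_single set_append image_Un letter_long letter_short by (auto simp: letter_range_def)
qed

text \<open>The conditions for different \<open>i\<close> are independent. So a fundamental weight
  with positive label can be split off together with one unit of \<open>Short i\<close>, if there is
  one; for \<open>i < n\<close> it is realised in the exterior algebra and for \<open>i = n\<close>
  in the spin module.\<close>

theorem B_lower:
 assumes "1 \<le> n" "\<forall>i\<in>{1..n}. p (Short i) \<le> k i"
 shows "B_bound n (B_weight n k) p"
 using assms(2)
proof (induction "\<Sum>i = 1..n. k i" arbitrary: k p rule: less_induct)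
 case less
 show ?case
 proof (cases "\<exists>i\<in>{1..n}. k i > 0")
  case False
  hence k: "k i = 0" if "i \<in> {1..n}" for i using that by auto
  have p0: "\<forall>j\<in>{1..n}. p (Short j) = 0" using less.prems k by fastforce
  show ?thesis
  proof (rule B_bound_cong[OF exterior_short_zero[OF _ p0, of 0]])
   fix i :: int assume "0 < i" "i \<le> int n"
   hence "(\<Sum>j = nat i..<n. real (k j)) = 0" using k by (intro sum.neutral) auto
   thus "(if i \<le> int 0 then 1 else 0) = B_weight n k i"
    using k[of n] assms(1) \<open>0 < i\<close> by (simp add: B_weight_def)
  qed simp_all
 next
  case True
  then obtain i where i: "i \<in> {1..n}" "k i > 0" by blast
  define g where "g = (if p (Short i) > 0 then unit {Short i} else (%_. 0))"
  have gen: "B_bound n (B_weight n (unit {i})) g"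
  proof (cases "i = n")
   case True
   have "B_bound n (%k. if k \<le> int n then 1 / 2 else - 1 / 2) g"
    using spin_bound_short[OF assms(1), of "unit {Short n}"] spin_short_zero[of n "%_. 0"] True
    unfolding g_def by (simp add: unit_def)
   thus ?thesis by (rule B_bound_cong) (simp_all add: True B_weight_last)
  next
   case False
   have "B_bound n (%k. if k \<le> int i then 1 else 0) g"
    using exterior_bound_short[of i n "unit {Short i}"] exterior_short_zero[of i n "%_. 0"] i
    unfolding g_def by (simp add: unit_def)
   thus ?thesis by (rule B_bound_cong) (use False i in \<open>simp_all add: B_weight_unit\<close>)
  qed
  define k' where "k' j = k j - unit {i} j" for j
  define p' where "p' r = p r - g r" for r
  have kk: "k = (%j. k' j + unit {i} j)" using i by (auto simp: k'_def unit_def)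
  have pp: "p = (%r. p' r + g r)" by (auto simp: p'_def g_def unit_def)
  have "(\<Sum>j = 1..n. k' j) < (\<Sum>j = 1..n. k j)"
   by (rule sum_strict_mono_ex1) (use i in \<open>auto simp: k'_def unit_def\<close>)
  moreover have "\<forall>j\<in>{1..n}. p' (Short j) \<le> k' j"
  proof
   fix j assume "j \<in> {1..n}"
   hence "p (Short j) \<le> k j" using less.prems by blast
   thus "p' (Short j) \<le> k' j" by (auto simp: p'_def k'_def g_def unit_def)
  qed
  ultimately have "B_bound n (B_weight n k') p'" by (rule less.hyps)
  from B_bound_add[OF this gen] show ?thesis
   unfolding B_weight_add[symmetric] kk[symmetric] pp[symmetric] by (simp add: B_weight_add[abs_def])
 qed
qed

context
 fixes n m :: nat
 assumes m: "2 \<le> m" "m \<le> n"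
begin

text \<open>Splits off the weight with labels 1 on \<open>A\<close> and the exponent with value 1 on
  \<open>R\<close>. The slack hypotheses express, in additive form, that the remainder still
  satisfies all conditions.\<close>

lemma D_bound_step:
 assumes IH: "\<forall>l' p'. (\<Sum>i = 1..m. l' i) < (\<Sum>i = 1..m. l i) --> D_cond m l' p' --> D_bound n m (D_weight m l') p'"
  and cond: "D_cond m l p" and gen: "D_bound n m (D_weight m (unit A)) (unit R)"
  and A: "A \<noteq> {}" "A \<subseteq> {1..m}" "\<And>i. i \<in> A ==> l i > 0"
  and R: "\<And>r. r \<in> R ==> p r > 0"
  and slack: "\<And>j. j \<in> {1..m - 2} ==> p (Plus j m) \<le> l j ==>
    p (Minus j m) + p (Plus j m) \<le> l j + p (Plus (Suc j) m) ==>
    p (Plus j m) + unit A j \<le> l j + unit R (Plus j m) \<and>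
    p (Minus j m) + p (Plus j m) + unit A j + unit R (Plus (Suc j) m)
     \<le> l j + p (Plus (Suc j) m) + unit R (Minus j m) + unit R (Plus j m)"
   "p (Plus (m - 1) m) + unit A m \<le> l m + unit R (Plus (m - 1) m)"
   "p (Minus (m - 1) m) + unit A (m - 1) \<le> l (m - 1) + unit R (Minus (m - 1) m)"
   "3 \<le> m ==> p (Minus (m - 1) m) + p (Plus (m - 2) m) + p (Minus (m - 2) m) + unit A (m - 2) + unit A (m - 1)
    \<le> l (m - 2) + l (m - 1) + unit R (Minus (m - 1) m) + unit R (Plus (m - 2) m) + unit R (Minus (m - 2) m)"
 shows "D_bound n m (D_weight m l) p"
proof -
 have ul: "unit A i \<le> l i" and up: "unit R r \<le> p r" for i r
  using A(3)[of i] R[of r] by (auto simp: unit_def)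
 have c: "p (Plus j m) \<le> l j" "p (Minus j m) + p (Plus j m) \<le> l j + p (Plus (Suc j) m)" if "j \<in> {1..m - 2}" for j
  using cond that unfolding D_cond_def by blast+
 have "D_cond m (%i. l i - unit A i) (%r. p r - unit R r)" unfolding D_cond_def
 proof (intro conjI ballI impI)
  fix j assume j: "j \<in> {1..m - 2}"
  note u = slack(1)[OF j c[OF j]] ul[of j] up[of "Plus j m"] up[of "Minus j m"] up[of "Plus (Suc j) m"]
  show "p (Plus j m) - unit R (Plus j m) \<le> l j - unit A j" using u by linarith
  show "p (Minus j m) - unit R (Minus j m) + (p (Plus j m) - unit R (Plus j m))
    \<le> l j - unit A j + (p (Plus (Suc j) m) - unit R (Plus (Suc j) m))" using u by linarith
 next
  note u = ul[of m] ul[of "m - 1"] ul[of "m - 2"] up[of "Plus (m - 1) m"] up[of "Minus (m - 1) m"]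
   up[of "Plus (m - 2) m"] up[of "Minus (m - 2) m"]
  show "p (Plus (m - 1) m) - unit R (Plus (m - 1) m) \<le> l m - unit A m" using u slack(2) by linarith
  show "p (Minus (m - 1) m) - unit R (Minus (m - 1) m) \<le> l (m - 1) - unit A (m - 1)" using u slack(3) by linarith
  show "p (Minus (m - 1) m) - unit R (Minus (m - 1) m) + (p (Plus (m - 2) m) - unit R (Plus (m - 2) m))
    + (p (Minus (m - 2) m) - unit R (Minus (m - 2) m))
   \<le> l (m - 2) - unit A (m - 2) + (l (m - 1) - unit A (m - 1))" if "3 \<le> m"
   using u slack(4)[OF that] by linarith
 qed
 moreover have "(\<Sum>i = 1..m. l i - unit A i) < (\<Sum>i = 1..m. l i)"
 proof (rule sum_strict_mono_ex1)
  obtain i where "i \<in> A" using A(1) by blast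
  thus "\<exists>i\<in>{1..m}. l i - unit A i < l i" using A by (intro bexI[of _ i]) (auto simp: unit_def)
 qed auto
 ultimately have "D_bound n m (D_weight m (%i. (l i - unit A i) + unit A i)) (%r. (p r - unit R r) + unit R r)"
  using D_bound_add[OF m IH[rule_format] gen] by (simp add: D_weight_add[abs_def])
 thus ?thesis using ul up by simp
qed

lemma gen_zero:
 assumes "1 \<le> i" "i < m - 1" shows "D_bound n m (D_weight m (unit {i})) (unit {})"
 by (rule D_bound_cong[OF exterior_bound_zero[of i m n "unit {}"]])
  (use assms m D_weight_unit in \<open>auto simp: unit_def\<close>)

lemma gen_minus:
 assumes "1 \<le> i" "i < m - 1" shows "D_bound n m (D_weight m (unit {i})) (unit {Minus i m})"
 by (rule D_bound_cong[OF exterior_bound_minus[OF m, of i "unit {Minus i m}"]])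
  (use assms m D_weight_unit in \<open>auto simp: unit_def\<close>)

lemma gen_plus:
 assumes "1 \<le> i" "i < m - 1" shows "D_bound n m (D_weight m (unit {i})) (unit {Plus i m})"
 by (rule D_bound_cong[OF exterior_bound_plus[OF m, of i "unit {Plus i m}"]])
  (use assms m D_weight_unit in \<open>auto simp: unit_def\<close>)

lemma gen_pair:
 assumes "1 \<le> i" "Suc i < m - 1" shows "D_bound n m (D_weight m (unit {Suc i})) (unit {Plus (Suc i) m, Minus i m})"
 by (rule D_bound_cong[OF exterior_bound_pair[OF m, of "Suc i" "unit {Plus (Suc i) m, Minus i m}"]])
  (use assms m D_weight_unit in \<open>auto simp: unit_def\<close>)

text \<open>The one generator whose weight is not fundamental: the exterior power of degree
  \<open>m-1\<close> has as highest weight the sum of the two half-spin weights. It cannot be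
  divided between them, as the exponent at \<open>Minus (m - 2) m\<close> requires the one at
  \<open>Plus (m - 1) m\<close> while the last condition bounds it by the label
  \<open>m-1\<close>.\<close>

lemma gen_last_pair:
 assumes "3 \<le> m" shows "D_bound n m (D_weight m (unit {m - 1, m})) (unit {Plus (m - 1) m, Minus (m - 2) m})"
proof (rule D_bound_cong[OF exterior_bound_pair[OF m, of "m - 1" "unit {Plus (m - 1) m, Minus (m - 2) m}"]])
 have "m - 1 - 1 = m - 2" by simp
 thus "unit {Plus (m - 1) m, Minus (m - 2) m} (Minus (m - 1 - 1) m) = 1"
  "\<forall>j\<in>{1..<m}. j \<noteq> m - 1 - 1 --> unit {Plus (m - 1) m, Minus (m - 2) m} (Minus j m) = 0"
  by (simp_all add: unit_def)
 show "1 < m - 1" "m - 1 < m" using assms by auto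
qed (use m D_weight_pair in \<open>auto simp: unit_def\<close>)

lemma gen_spin:
 shows "D_bound n m (D_weight m (unit {m})) (unit {})"
  and "D_bound n m (D_weight m (unit {m})) (unit {Plus (m - 1) m})"
  and "D_bound n m (D_weight m (unit {m - 1})) (unit {})"
  and "D_bound n m (D_weight m (unit {m - 1})) (unit {Minus (m - 1) m})"
proof -
 show "D_bound n m (D_weight m (unit {m})) (unit {})"
  by (rule D_bound_cong[OF spin_bound_zero[of m m n "unit {}"]])
   (use m D_weight_last in \<open>auto simp: unit_def\<close>)
 show "D_bound n m (D_weight m (unit {m})) (unit {Plus (m - 1) m})"
  by (rule D_bound_cong[OF spin_bound_plus[OF m, of "unit {Plus (m - 1) m}"]])
   (use m D_weight_last in \<open>auto simp: unit_def\<close>)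
 show "D_bound n m (D_weight m (unit {m - 1})) (unit {})"
  by (rule D_bound_cong[OF spin_bound_zero[of "m - 1" m n "unit {}"]])
   (use m D_weight_last in \<open>auto simp: unit_def\<close>)
 show "D_bound n m (D_weight m (unit {m - 1})) (unit {Minus (m - 1) m})"
  by (rule D_bound_cong[OF spin_bound_minus[OF m, of "unit {Minus (m - 1) m}"]])
   (use m D_weight_last in \<open>auto simp: unit_def\<close>)
qed

text \<open>Removing a unit of \<open>Plus i\<close> lowers the right-hand side of the condition at
  \<open>i-1\<close>. If that condition relies on it, a unit of \<open>Minus (i-1)\<close> has to be
  removed at the same time; this is the origin of the generators with two units.\<close>

theorem D_lower: "D_cond m l p ==> D_bound n m (D_weight m l) p"
proof (induction "\<Sum>i = 1..m. l i" arbitrary: l p rule: less_induct)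
 case less
 have c1: "p (Plus j m) \<le> l j" and c3: "p (Minus j m) + p (Plus j m) \<le> l j + p (Plus (Suc j) m)"
  if "j \<in> {1..m - 2}" for j using less.prems that unfolding D_cond_def by blast+
 have c2: "p (Plus (m - 1) m) \<le> l m" and c4: "p (Minus (m - 1) m) \<le> l (m - 1)"
  and c5: "3 \<le> m ==> p (Minus (m - 1) m) + p (Plus (m - 2) m) + p (Minus (m - 2) m) \<le> l (m - 2) + l (m - 1)"
  using less.prems unfolding D_cond_def by blast+
 have IH: "\<forall>l' p'. (\<Sum>i = 1..m. l' i) < (\<Sum>i = 1..m. l i) --> D_cond m l' p' --> D_bound n m (D_weight m l') p'"
  using less.hyps by blast
 note step = D_bound_step[OF IH less.prems]
 consider (low) i where "i \<in> {1..m - 2}" "l i > 0" | (high) "\<forall>i\<in>{1..m - 2}. l i = 0" by blast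
 thus ?case
 proof cases
  case low
  have i: "1 \<le> i" "i < m - 1" and li: "l i > 0" using low by auto
  note ci = c1[OF low(1)] c3[OF low(1)]
  consider (pair) k where "p (Plus i m) > 0" "i = Suc k" "1 \<le> k" "p (Minus k m) + p (Plus k m) > l k"
   | (plus) "p (Plus i m) > 0" "\<And>k. i = Suc k ==> 1 \<le> k ==> p (Minus k m) + p (Plus k m) \<le> l k"
   | (minus) "p (Plus i m) = 0" "p (Minus i m) > 0" | (zero) "p (Plus i m) = 0" "p (Minus i m) = 0"
   by (metis gr0I not_less)
  thus ?thesis
  proof cases
   case pair
   have k: "k \<in> {1..m - 2}" "Suc k < m - 1" using pair i by auto
   have "p (Plus k m) \<le> l k" by (rule c1[OF k(1)])
   hence "p (Minus k m) > 0" using pair(4) by simp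
   thus ?thesis
    by (intro step[OF gen_pair[OF pair(3) k(2)]]) (use pair k li ci c2 c4 c5 m in \<open>auto simp: unit_def\<close>)
  next
   case plus
   thus ?thesis by (intro step[OF gen_plus[OF i]]) (use i li ci c2 c4 c5 m in \<open>auto simp: unit_def\<close>)
  next
   case minus
   thus ?thesis
    by (intro step[OF gen_minus[OF i]]) (use i li ci c2 c4 c5 m in \<open>auto simp: unit_def\<close>)
  next
   case zero
   thus ?thesis by (intro step[OF gen_zero[OF i]]) (use i li ci c2 c4 c5 m in \<open>auto simp: unit_def\<close>)
  qed
 next
  case high
  have pz: "p (Plus j m) = 0" if "j \<in> {1..m - 2}" for j using c1[OF that] high that by simp
  have az: "3 \<le> m ==> p (Plus (m - 2) m) = 0" and lz: "3 \<le> m ==> l (m - 2) = 0"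
   using pz[of "m - 2"] high by simp_all
  \<comment> \<open>With all labels up to \<open>m-2\<close> equal to 0, the \<open>Plus\<close>
    exponents there vanish. If \<open>Minus (m - 2) m\<close> still has an exponent, the conditions
    force the exponent of \<open>Plus (m - 1) m\<close> and both last labels to be positive.\<close>
  consider (pair) "3 \<le> m" "p (Minus (m - 2) m) > 0"
   | (nopair) "\<And>j. j \<in> {1..m - 2} ==> Suc j = m - 1 ==> p (Minus j m) = 0" "3 \<le> m --> p (Minus (m - 2) m) = 0"
  proof (cases "3 \<le> m \<and> p (Minus (m - 2) m) > 0")
   case False
   have "j = m - 2" "3 \<le> m" if "j \<in> {1..m - 2}" "Suc j = m - 1" for j using that by auto
   thus ?thesis using nopair False by (metis gr0I)
  qed (use pair in blast)
  thus ?thesis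
  proof cases
   case pair
   have m2: "m - 2 \<in> {1..m - 2}" "Suc (m - 2) = m - 1" using pair(1) by auto
   have ap: "p (Plus (m - 1) m) > 0" using c3[OF m2(1)] pair(2) high m2 pz[OF m2(1)] by simp
   have "l m > 0" "l (m - 1) > 0" using ap c2 c5[OF pair(1)] pair(2) lz[OF pair(1)] by auto
   thus ?thesis by (intro step[OF gen_last_pair[OF pair(1)]])
     (use pair ap m2 lz az c2 c4 c5 m in \<open>auto simp: unit_def\<close>)
  next
   case nopair
   consider (plus) "l m > 0" "p (Plus (m - 1) m) > 0" | (plus0) "l m > 0" "p (Plus (m - 1) m) = 0"
    | (minus) "l (m - 1) > 0" "p (Minus (m - 1) m) > 0" | (minus0) "l (m - 1) > 0" "p (Minus (m - 1) m) = 0"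
    | (zero) "l m = 0" "l (m - 1) = 0" by linarith
   thus ?thesis
   proof cases
    case plus
    thus ?thesis
     by (intro step[OF gen_spin(2)]) (use nopair pz az lz c2 c4 c5 m in \<open>auto simp: unit_def\<close>)
   next
    case plus0
    thus ?thesis
     by (intro step[OF gen_spin(1)]) (use nopair pz az lz c2 c4 c5 m in \<open>auto simp: unit_def\<close>)
   next
    case minus
    thus ?thesis
     by (intro step[OF gen_spin(4)]) (use nopair pz az lz c2 c4 c5 m in \<open>auto simp: unit_def\<close>)
   next
    case minus0
    thus ?thesis
     by (intro step[OF gen_spin(3)]) (use nopair pz az lz c2 c4 c5 m in \<open>auto simp: unit_def\<close>)
   next
    case zero
    have l0: "l j = 0" if j: "j \<in> {1..m}" for j
    proof -
     have "j \<in> {1..m - 2} \<or> j = m - 1 \<or> j = m" using j by auto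
     thus ?thesis using zero high by auto
    qed
    have p0: "p (Plus j m) = 0" if "j \<in> {1..<m}" for j
     using that pz[of j] c2 zero(1) by (cases "j = m - 1") auto
    have q0: "p (Minus j m) = 0" if j: "j \<in> {1..<m}" for j
    proof (cases "j = m - 1")
     case False
     hence "j \<in> {1..m - 2}" "Suc j \<in> {1..<m}" using j by auto
     thus ?thesis using c3[of j] high p0[of "Suc j"] by simp
    qed (use c4 zero(2) in simp)
    show ?thesis
    proof (rule D_bound_cong[OF exterior_bound_zero[of 0 m n p]])
     fix i :: int assume i: "0 < i" "i \<le> int m"
     have "(\<Sum>j = nat i..<m - 1. real (l j)) = 0" proof (intro sum.neutral ballI)
      fix j assume "j \<in> {nat i..<m - 1}"
      hence "j \<in> {1..m}" using i by auto
      thus "real (l j) = 0" using l0 by simp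
     qed
     thus "(if i \<le> int 0 then 1 else 0) = D_weight m l i" using zero i by (simp add: D_weight_def)
    qed (use m p0 q0 in \<open>auto simp: set_plus_roots set_minus_roots\<close>)
   qed
  qed
 qed
qed

end

section \<open>Essential exponents of a column\<close>

context so_rep
begin

text \<open>By \<open>relation_lifts\<close>, a relation on \<open>w\<close> modulo \<open>U\<close>
  would also hold on the highest weight vector of the unitary module that witnesses
  \<open>bound\<close>, where the exponent survives.\<close>

lemma lower_transfer:
 assumes D: "D \<subseteq> letter_range n" "mirror ` D \<subseteq> D" "transpose_closed D" "bracket_in D D D" "lowering_list D rs"
  and datum: "datum D w U \<mu>" and w: "w \<notin> U" and bound: "lower_bound n D rest bs \<mu> p"
  and letters: "letter ` set (rest @ concat (rev bs)) \<subseteq> D"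
 shows "mono (concat (rev bs)) p w \<notin> span (U \<union> {mono (rest @ concat (rev bs)) q w | q. blocks_less bs q p})"
proof
 let ?c = "concat (rev bs)"
 define W where "W rs q = letters rs q" for rs and q :: "root => nat"
 have WD: "set (W xs q) \<subseteq> D" if "set xs \<subseteq> set (rest @ ?c)" for xs q
 proof -
  have "letter ` set xs \<subseteq> D" using that letters by blast
  thus ?thesis unfolding W_def by auto
 qed
 assume mem: "mono ?c p w \<in> span (U \<union> {mono (rest @ ?c) q w | q. blocks_less bs q p})"
 obtain G B v where G: "unitary_rep n G B" "so_rep.datum fscale n G D v {0} \<mu>"
  "unitary_rep.supported B v" "v \<noteq> 0" "survives G rest bs p v"
  using bound unfolding lower_bound_def by blast
 interpret R: rep_pair scale n F G B D rs w U v \<mu>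
  by (intro rep_pair.intro so_rep_axioms G(1) rep_pair_axioms.intro D datum w G(2-4))
 have eq: "{foldr X vs w | vs. vs \<in> {W (rest @ ?c) q | q. blocks_less bs q p}}
   = {mono (rest @ ?c) q w | q. blocks_less bs q p}"
  unfolding mono_eq_word W_def by blast
 have eq': "{foldr R.M.X vs v | vs. vs \<in> {W (rest @ ?c) q | q. blocks_less bs q p}}
   = {R.M.mono rest q (R.M.mono ?c q v) | q. blocks_less bs q p}"
  unfolding R.M.mono_append[symmetric] unfolding R.M.mono_eq_word W_def by blast
 have "foldr R.M.X (W ?c p) v \<in> vec.span {foldr R.M.X vs v | vs. vs \<in> {W (rest @ ?c) q | q. blocks_less bs q p}}"
 proof (rule R.relation_lifts)
  show "foldr X (W ?c p) w \<in> span (U \<union> {foldr X vs w | vs. vs \<in> {W (rest @ ?c) q | q. blocks_less bs q p}})"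
   unfolding eq using mem unfolding mono_eq_word[of ?c p w] W_def .
  show "set (W ?c p) \<subseteq> D" by (rule WD) simp
  fix vs assume "vs \<in> {W (rest @ ?c) q | q. blocks_less bs q p}"
  thus "set vs \<subseteq> D" using WD[of "rest @ ?c"] by blast
 qed
 hence "R.M.mono ?c p v \<in> vec.span {R.M.mono rest q (R.M.mono ?c q v) | q. blocks_less bs q p}"
  unfolding eq' unfolding R.M.mono_eq_word[of ?c p v] W_def .
 thus False using G(5) by blast
qed

lemma lowering_list_square: "m \<le> n ==> lowering_list (sq_letters m) (long_roots m)"
 unfolding lowering_list_def using normal_square rank_sorted_long by blast

lemma lowering_list_short: "lowering_list (all_letters n) (long_roots n @ short_roots n)"
proof -
 have "{x \<in> all_letters n. normal_lowering x}
   = {x \<in> sq_letters n. normal_lowering x} \<union> {x \<in> col_letters 0 n. normal_lowering x}" by blast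
 also have "{x \<in> col_letters 0 n. normal_lowering x} = letter ` set (short_roots n)"
  unfolding letter_short by (auto simp: col_letters_def normal_lowering_def)
 finally show ?thesis unfolding lowering_list_def normal_square using rank_sorted_long_short by auto
qed

lemma square_closed: "mirror ` sq_letters m \<subseteq> sq_letters m" "transpose_closed (sq_letters m)"
 "bracket_in (sq_letters m) (sq_letters m) (sq_letters m)"
proof -
 show mir: "mirror ` sq_letters m \<subseteq> sq_letters m" by (rule mirror_subsetI) (auto simp: mem_square)
 show "transpose_closed (sq_letters m)" unfolding transpose_closed_def by (auto simp: mem_square)
 show "bracket_in (sq_letters m) (sq_letters m) (sq_letters m)"
  by (rule bracket_inI[OF mir]) (auto simp: mem_square)
qed

lemma short_closed: defines "D \<equiv> all_letters n"
 shows "mirror ` D \<subseteq> D" "transpose_closed D" "bracket_in D D D"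
proof -
 have mem: "(a, b) \<in> D \<longleftrightarrow> \<bar>a\<bar> \<le> int n \<and> \<bar>b\<bar> \<le> int n \<and> a + b \<noteq> 0" for a b
  unfolding D_def col_letters_def sq_letters_def by auto
 show mir: "mirror ` D \<subseteq> D" by (rule mirror_subsetI) (auto simp: mem)
 show "transpose_closed D" unfolding transpose_closed_def by (auto simp: mem)
 show "bracket_in D D D" by (rule bracket_inI[OF mir]) (auto simp: mem)
qed

lemma short_lower:
 assumes n: "1 \<le> n" and datum: "datum (all_letters n) w U \<mu>" and w: "w \<notin> U"
  and \<mu>: "\<And>i. 0 < i ==> i \<le> int n ==> \<mu> i = B_weight n k i" and p: "\<forall>i\<in>{1..n}. p (Short i) \<le> k i"
 shows "mono (short_roots n) p w \<notin> U_short w U p"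
proof -
 have b: "B_bound n \<mu> p" by (rule B_bound_cong[OF B_lower[OF n p]]) (simp_all add: \<mu>)
 have l: "letter ` set (long_roots n @ concat (rev [short_roots n])) \<subseteq> all_letters n"
  using lowering_list_short unfolding lowering_list_def concat_single by blast
 have "mono (concat (rev [short_roots n])) p w
   \<notin> span (U \<union> {mono (long_roots n @ concat (rev [short_roots n])) q w | q. blocks_less [short_roots n] q p})"
  by (rule lower_transfer[OF all_letters_range short_closed lowering_list_short datum w b l])
 thus ?thesis unfolding Ublock_def by (simp add: mono_append)
qed

lemma D_lower_datum:
 assumes m: "2 \<le> m" "m \<le> n" and datum: "datum (sq_letters m) w U \<mu>" and w: "w \<notin> U"
  and \<mu>: "\<And>i. 0 < i ==> i \<le> int m ==> \<mu> i = D_weight m l i" and p: "D_cond m l p"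
 defines "w1 \<equiv> mono (plus_roots m) p w" and "U1 \<equiv> U_plus m w U p"
 shows "mono (minus_roots m) p w1 \<notin> U_minus m w1 U1 p"
proof -
 let ?c = "concat (rev [plus_roots m, minus_roots m])" and ?r = "long_roots (m - 1)"
 have b: "D_bound n m \<mu> p" by (rule D_bound_cong[OF D_lower[OF m p]]) (simp_all add: \<mu>)
 have lr: "long_roots m = ?r @ ?c" using long_roots_Suc[OF m(1)] by simp
 have l: "letter ` set (?r @ ?c) \<subseteq> sq_letters m"
  using lowering_list_square[OF m(2)] unfolding lowering_list_def lr by blast
 define Z where "Z = span (U \<union> {mono (?r @ ?c) q w | q. blocks_less [plus_roots m, minus_roots m] q p})"
 have main: "mono ?c p w \<notin> Z" unfolding Z_def
  by (rule lower_transfer[OF sq_letters_range[OF m(2)] square_closed lowering_list_square[OF m(2)] datum w b l])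
 have Zs: "subspace Z" unfolding Z_def by simp
 have gen: "mono ?r q (mono (minus_roots m) q (mono (plus_roots m) q w)) \<in> Z"
  if "blocks_less [plus_roots m, minus_roots m] q p" for q
  unfolding Z_def using that by (intro span_base) (auto simp: mono_append)
 have U1: "U1 \<subseteq> Z" unfolding U1_def Ublock_def
 proof (intro span_minimal[OF _ Zs] Un_least subsetI)
  fix u assume "u \<in> U" thus "u \<in> Z" unfolding Z_def by (intro span_base) blast
 next
  fix u assume "u \<in> {mono (?r @ minus_roots m) q (mono (plus_roots m) q w) | q. block_less (plus_roots m) q p}"
  then obtain q where "u = mono ?r q (mono (minus_roots m) q (mono (plus_roots m) q w))"
   "block_less (plus_roots m) q p" unfolding mono_append by blast
  thus "u \<in> Z" using gen[of q] by simp
 qed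
 have "U_minus m w1 U1 p \<subseteq> Z" unfolding Ublock_def
 proof (intro span_minimal[OF _ Zs] Un_least U1 subsetI)
  fix u assume "u \<in> {mono ?r q (mono (minus_roots m) q w1) | q. block_less (minus_roots m) q p}"
  then obtain q where u: "u = mono ?r q (mono (minus_roots m) q w1)" "block_less (minus_roots m) q p" by blast
  \<comment> \<open>The two nested negligible spaces are compared with the single space
    \<open>Z\<close> for both blocks; for this the exponent of the \<open>Minus\<close> block is
    completed by that of \<open>p\<close> on the \<open>Plus\<close> block.\<close>
  define q' where "q' r = (if r \<in> set (plus_roots m) then p r else q r)" for r
  have dis: "distinct (?r @ minus_roots m @ plus_roots m)" using distinct_long[of m] lr by simp
  hence "r \<notin> set (plus_roots m)" if "r \<in> set ?r \<union> set (minus_roots m)" for r using that by auto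
  hence a: "agree (set ?r) q q'" "agree (set (minus_roots m)) q q'" "agree (set (plus_roots m)) q' p"
   unfolding agree_def q'_def by auto
  have "u = mono ?r q' (mono (minus_roots m) q' (mono (plus_roots m) q' w))"
   unfolding u(1) w1_def mono_cong[OF a(1)] mono_cong[OF a(2)] mono_cong[OF a(3)] ..
  moreover have "block_less (minus_roots m) q' p"
   using u(2) block_less_cong[OF a(2), of p p] by (simp add: agree_def)
  hence "blocks_less [plus_roots m, minus_roots m] q' p" using a(3) by simp
  ultimately show "u \<in> Z" using gen[of q'] by simp
 qed
 moreover have "mono ?c p w = mono (minus_roots m) p w1" unfolding w1_def by (simp add: mono_append)
 ultimately show ?thesis using main by auto
qed

text \<open>Strings of the simple roots of so(2m) terminate, and on a vector outside
  \<open>U\<close> this is possible only for nonnegative integral values.\<close>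

lemma integral_weights:
 assumes m: "2 \<le> m" "m \<le> n" and datum: "datum (sq_letters m) w U \<mu>" and w: "w \<notin> U" and nil: loc_nilpotent
 shows "\<exists>l. (\<forall>i\<in>{1..<m}. \<mu> (int i) - \<mu> (int (Suc i)) = real (l i)) \<and> \<mu> (int (m - 1)) + \<mu> (int m) = real (l m)"
proof -
 have diff: "\<exists>j. \<mu> (int i) - \<mu> (int (Suc i)) = real j" if i: "i \<in> {1..<m}" for i
 proof -
  have mem: "(int i, int (Suc i)) \<in> sq_letters m" "(int (Suc i), int i) \<in> sq_letters m"
   "(int i, int i) \<in> sq_letters m" "(int (Suc i), int (Suc i)) \<in> sq_letters m"
   using i by (auto simp: mem_square)
  have r: "raising n (int i, int (Suc i))" using i m by (subst raising_sgn) auto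
  have "F (int i) (int i) w - F (int (Suc i)) (int (Suc i)) w
    = scale (of_real (\<mu> (int i) - \<mu> (int (Suc i)))) w"
   using i by (intro datum_eigen_diff[OF datum mem(3,4)]) auto
  from datum_sl2(1)[OF datum nil mem(1,2) r _ _ _ _ _ this] show ?thesis using w i m by auto
 qed
 have last: "\<exists>j. \<mu> (int (m - 1)) + \<mu> (int m) = real j"
 proof -
  have mi: "int (m - 1) = int m - 1" using m by simp
  have mem: "(int (m - 1), - int m) \<in> sq_letters m" "(- int m, int (m - 1)) \<in> sq_letters m"
   "(int (m - 1), int (m - 1)) \<in> sq_letters m" "(int m, int m) \<in> sq_letters m"
   using m unfolding mi by (auto simp: mem_square)
  have r: "raising n (int (m - 1), - int m)" using m by (subst raising_sgn) auto
  have "F (int (m - 1)) (int (m - 1)) w = scale (of_real (\<mu> (int (m - 1)))) w"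
   "F (int m) (int m) w = scale (of_real (\<mu> (int m))) w"
   using m by (intro datum_weight[OF datum] mem; simp)+
  moreover have "F (- int m) (- int m) w = - F (int m) (int m) w"
   using F_mirror[of "int m" "int m" w] m by simp
  ultimately have "F (int (m - 1)) (int (m - 1)) w - F (- int m) (- int m) w
    = scale (of_real (\<mu> (int (m - 1)) + \<mu> (int m))) w"
   by (simp add: scale_left_distrib)
  from datum_sl2(1)[OF datum nil mem(1,2) r _ _ _ _ _ this] show ?thesis using w m by auto
 qed
 obtain l' where l': "\<And>i. i \<in> {1..<m} ==> \<mu> (int i) - \<mu> (int (Suc i)) = real (l' i)" using diff by metis
 obtain j where j: "\<mu> (int (m - 1)) + \<mu> (int m) = real j" using last by blast
 show ?thesis by (rule exI[of _ "l'(m := j)"]) (use l' j in auto)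
qed

lemma D_weight_eq:
 assumes m: "2 \<le> m" and l: "\<forall>i\<in>{1..<m}. \<mu> (int i) - \<mu> (int (Suc i)) = real (l i)"
  "\<mu> (int (m - 1)) + \<mu> (int m) = real (l m)" and i: "0 < i" "i \<le> int m"
 shows "\<mu> i = D_weight m l i"
proof -
 have lm: "\<mu> (int (m - 1)) - \<mu> (int m) = real (l (m - 1))" using bspec[OF l(1), of "m - 1"] m by simp
 have tel: "(\<Sum>j = k..<m - 1. real (l j)) = \<mu> (int k) - \<mu> (int (m - 1))" if "1 \<le> k" "k \<le> m - 1" for k
 proof -
  have "(\<Sum>j = k..<m - 1. real (l j)) = (\<Sum>j = k..<m - 1. - \<mu> (int (Suc j)) - - \<mu> (int j))"
   using l(1) that by (intro sum.cong refl) auto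
  also have "\<dots> = \<mu> (int k) - \<mu> (int (m - 1))"
   using sum_Suc_diff'[OF that(2), of "%j. - \<mu> (int j)"] by simp
  finally show ?thesis .
 qed
 show ?thesis
 proof (cases "i = int m")
  case False
  hence "1 \<le> nat i" "nat i \<le> m - 1" "int (nat i) = i" using i by auto
  thus ?thesis using tel[of "nat i"] False lm l(2) by (simp add: D_weight_def)
 qed (use lm l(2) in \<open>simp add: D_weight_def\<close>)
qed

lemma column_cond_iff:
 assumes m: "2 \<le> m" and l: "\<forall>i\<in>{1..<m}. \<mu> (int i) - \<mu> (int (Suc i)) = real (l i)"
  "\<mu> (int (m - 1)) + \<mu> (int m) = real (l m)"
 shows "column_cond m \<mu> p \<longleftrightarrow> D_cond m l p"
proof -
 have l1: "\<mu> (int i) - \<mu> (int (Suc i)) = real (l i)" if "i \<in> {1..m - 2}" for i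
  using l(1) that by auto
 have l2: "\<mu> (int (m - 1)) - \<mu> (int m) = real (l (m - 1))" using bspec[OF l(1), of "m - 1"] m by simp
 have l3: "\<mu> (int (m - 2)) - \<mu> (int m) = real (l (m - 2)) + real (l (m - 1))" if "3 \<le> m"
 proof -
  have s: "Suc (m - 2) = m - 1" and i: "m - 2 \<in> {1..m - 2}" using that by auto
  show ?thesis using l1[OF i, unfolded s] l2 by linarith
 qed
 have 1: "(\<forall>i\<in>{1..m - 2}. real (p (Plus i m)) \<le> \<mu> (int i) - \<mu> (int (Suc i)))
   \<longleftrightarrow> (\<forall>i\<in>{1..m - 2}. p (Plus i m) \<le> l i)"
  by (rule ball_cong[OF refl]) (simp only: l1 of_nat_le_iff)
 have 2: "(\<forall>i\<in>{1..m - 2}. real (p (Minus i m)) + real (p (Plus i m)) - real (p (Plus (Suc i) m))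
    \<le> \<mu> (int i) - \<mu> (int (Suc i)))
   \<longleftrightarrow> (\<forall>i\<in>{1..m - 2}. p (Minus i m) + p (Plus i m) \<le> l i + p (Plus (Suc i) m))"
 proof (rule ball_cong[OF refl])
  fix i assume i: "i \<in> {1..m - 2}"
  show "real (p (Minus i m)) + real (p (Plus i m)) - real (p (Plus (Suc i) m))
    \<le> \<mu> (int i) - \<mu> (int (Suc i)) \<longleftrightarrow> p (Minus i m) + p (Plus i m) \<le> l i + p (Plus (Suc i) m)"
   unfolding l1[OF i] by linarith
 qed
 have 3: "(3 \<le> m --> real (p (Minus (m - 1) m)) + real (p (Plus (m - 2) m)) + real (p (Minus (m - 2) m))
   \<le> \<mu> (int (m - 2)) - \<mu> (int m)) \<longleftrightarrow>
  (3 \<le> m --> p (Minus (m - 1) m) + p (Plus (m - 2) m) + p (Minus (m - 2) m) \<le> l (m - 2) + l (m - 1))"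
  using l3 by (intro imp_cong refl) linarith
 show ?thesis unfolding column_cond_def D_cond_def 1 2 3 l2 l(2) of_nat_le_iff ..
qed

text \<open>Upper and lower bounds meet here. The lower one requires Dynkin labels, and these exist
  only if \<open>w\<close> is not negligible; otherwise both sides fail.\<close>

theorem column_step:
 fixes p :: "root => nat"
 assumes m: "2 \<le> m" "m \<le> n" and datum: "datum (sq_letters m) w U \<mu>" and nil: loc_nilpotent
 defines "w1 \<equiv> mono (plus_roots m) p w" and "U1 \<equiv> U_plus m w U p"
 shows "mono (minus_roots m) p w1 \<notin> U_minus m w1 U1 p \<longleftrightarrow> w \<notin> U \<and> column_cond m \<mu> p"
proof (cases "w \<in> U")
 case True
 have st: "stable (sq_letters m) U" by (rule datum_stable[OF datum])
 have ls: "letter ` set (long_roots m) \<subseteq> sq_letters m"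
  using lowering_list_square[OF m(2)] unfolding lowering_list_def by blast
 have "set (minus_roots m @ plus_roots m) \<subseteq> set (long_roots m)" using long_roots_Suc[OF m(1)] by auto
 hence "letter ` set (minus_roots m @ plus_roots m) \<subseteq> sq_letters m" using ls by blast
 from stable_mono[OF st this True, of p] have "mono (minus_roots m) p w1 \<in> U"
  unfolding mono_append w1_def .
 hence "mono (minus_roots m) p w1 \<in> U_minus m w1 U1 p" using U_sub_Ublock unfolding U1_def by blast
 thus ?thesis using True by blast
next
 case False
 obtain l where l: "\<forall>i\<in>{1..<m}. \<mu> (int i) - \<mu> (int (Suc i)) = real (l i)" "\<mu> (int (m - 1)) + \<mu> (int m) = real (l m)"
  using integral_weights[OF m datum False nil] by blast
 show ?thesis
  using D_upper[OF m datum nil, of p] D_lower_datum[OF m datum False D_weight_eq[OF m(1) l], of p] False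
  unfolding column_cond_iff[OF m(1) l] w1_def U1_def by blast
qed

text \<open>There are no roots in so(2), so the conditions begin with index 2, which is the reason
  for the guard.\<close>

fun long_conds :: "nat => (int => real) => (root => nat) => bool" where
 "long_conds 0 \<mu> p = True"
| "long_conds (Suc m) \<mu> p \<longleftrightarrow> (1 \<le> m --> column_cond (Suc m) \<mu> p \<and>
  long_conds m (minus_shift (Suc m) p (plus_shift (Suc m) p \<mu>)) p)"

theorem long_ess:
 assumes "m \<le> n" "datum (sq_letters m) w U \<mu>" and nil: loc_nilpotent
 shows "ess (long_blocks m) w U p \<longleftrightarrow> w \<notin> U \<and> long_conds m \<mu> p"
 using assms(1,2)
proof (induction m arbitrary: w U \<mu>)
 case 0
 have "span U = U" using stable_subspace[OF datum_stable[OF 0(2)]] by (simp add: span_eq_iff)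
 thus ?case by (simp add: long_blocks_small ess_def del: span_eq_iff)
next
 case (Suc m)
 show ?case
 proof (cases "1 \<le> m")
  case False
  have "span U = U" using stable_subspace[OF datum_stable[OF Suc(3)]] by (simp add: span_eq_iff)
  thus ?thesis using False by (simp add: long_blocks_small ess_def del: span_eq_iff)
 next
  case True
  hence m: "2 \<le> Suc m" "Suc m \<le> n" using Suc.prems by auto
  define w1 U1 where "w1 = mono (plus_roots (Suc m)) p w" and "U1 = U_plus (Suc m) w U p"
  have d1: "datum (par_letters (Suc m)) w1 U1 (plus_shift (Suc m) p \<mu>)"
   unfolding w1_def U1_def by (rule plus_block(1)[OF m Suc.prems(2)])
  note step = minus_block[OF m d1, of p]
  have "ess (long_blocks (Suc m)) w U p \<longleftrightarrow> ess (long_blocks m) (mono (minus_roots (Suc m)) p w1) (U_minus (Suc m) w1 U1 p) p"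
   using plus_block(2)[OF m Suc.prems(2), of p] step(2) unfolding w1_def U1_def by simp
  also have "\<dots> \<longleftrightarrow> mono (minus_roots (Suc m)) p w1 \<notin> U_minus (Suc m) w1 U1 p \<and>
    long_conds m (minus_shift (Suc m) p (plus_shift (Suc m) p \<mu>)) p"
   using Suc.IH[of "mono (minus_roots (Suc m)) p w1"] step(1) m by simp
  also have "\<dots> \<longleftrightarrow> w \<notin> U \<and> long_conds (Suc m) \<mu> p"
   using column_step[OF m Suc.prems(2) nil, of p] True unfolding w1_def U1_def by auto
  finally show ?thesis .
 qed
qed

theorem full_ess:
 assumes n: "1 \<le> n" and datum: "datum (all_letters n) w {0} \<mu>" and w: "w \<noteq> 0"
  and nil: loc_nilpotent and \<mu>: "\<And>i. 0 < i ==> i \<le> int n ==> \<mu> i = B_weight n k i"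
 shows "ess (short_roots n # long_blocks n) w {0} p \<longleftrightarrow>
  (\<forall>i\<in>{1..n}. p (Short i) \<le> k i) \<and> long_conds n (short_shift p \<mu>) p"
proof -
 have k1: "\<mu> (int i) - \<mu> (int (Suc i)) = real (k i)" if "i \<in> {1..<n}" for i
  using that \<mu>[of "int i"] \<mu>[of "int (Suc i)"] sum.atLeast_Suc_lessThan[of i n "%j. real (k j)"]
  by (simp add: B_weight_def nat_add_distrib)
 have k2: "2 * \<mu> (int n) = real (k n)" using \<mu>[of "int n"] n by (simp add: B_weight_def)
 have "mono (short_roots n) p w \<notin> U_short w {0} p \<longleftrightarrow> (\<forall>i\<in>{1..n}. p (Short i) \<le> k i)"
 proof
  assume "\<forall>i\<in>{1..n}. p (Short i) \<le> k i"
  thus "mono (short_roots n) p w \<notin> U_short w {0} p" using w by (intro short_lower[OF n datum _ \<mu>]) auto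
 next
  assume not: "mono (short_roots n) p w \<notin> U_short w {0} p"
  show "\<forall>i\<in>{1..n}. p (Short i) \<le> k i"
  proof (rule ccontr)
   assume "\<not> ?thesis"
   then obtain i where i: "i \<in> {1..n}" "k i < p (Short i)" by auto
   have "(\<exists>i\<in>{1..<n}. real (p (Short i)) > \<mu> (int i) - \<mu> (int (Suc i))) \<or> real (p (Short n)) > 2 * \<mu> (int n)"
   proof (cases "i = n")
    case False
    hence "i \<in> {1..<n}" using i by auto
    thus ?thesis using k1[of i] i(2) by (intro disjI1 bexI[of _ i]) auto
   qed (use i k2 in simp)
   thus False using short_upper[OF n datum nil] not by blast
  qed
 qed
 thus ?thesis using short_block[OF datum, of p] long_ess[OF order_refl _ nil] by simp
qed

end

section \<open>Matrices of type B\<close>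

text \<open>Rows are ordered as \<open>1, ..., n, 0, -n, ..., -1\<close>, so that the antidiagonal
  form pairs \<open>a\<close> with \<open>- a\<close> and the diagonal entries agree with the
  coordinates of the torus.\<close>

definition pos :: "nat => int => nat" where
 "pos n a = nat (if a > 0 then a - 1 else if a = 0 then int n else 2 * int n + 1 + a)"

abbreviation "square_mats n \<equiv> carrier_mat (2 * n + 1) (2 * n + 1)"

definition delta :: "int => int => complex" where
 "delta a b = (if a = b then 1 else 0)"

definition entry :: "nat => complex mat => int => int => complex" where
 "entry n x s t = x $$ (pos n s, pos n t)"

lemma pos_bound: "a \<in> window n ==> pos n a < 2 * n + 1" by (auto simp: pos_def mem_window)

lemma pos_inj: "a \<in> window n ==> b \<in> window n ==> pos n a = pos n b \<longleftrightarrow> a = b"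
 by (auto simp: pos_def mem_window split: if_splits)

lemma pos_minus: "a \<in> window n ==> pos n a + pos n (- a) = 2 * n" by (auto simp: pos_def mem_window)

lemma pos_surj: "i < 2 * n + 1 ==> \<exists>a\<in>window n. pos n a = i"
 by (rule bexI[of _ "if i < n then int i + 1 else if i = n then 0 else int i - 2 * int n - 1"])
  (auto simp: pos_def mem_window)

lemma pos_bij: "bij_betw (pos n) (window n) {..<2 * n + 1}"
 unfolding bij_betw_def inj_on_def using pos_inj pos_bound pos_surj by (auto simp: image_iff) metis

lemma entry_eqI:
 assumes "x \<in> square_mats n" "y \<in> square_mats n"
  and "\<And>s t. s \<in> window n ==> t \<in> window n ==> entry n x s t = entry n y s t"
 shows "x = y"
proof (rule eq_matI)
 fix i j assume "i < dim_row y" "j < dim_col y"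
 hence "i < 2 * n + 1" "j < 2 * n + 1" using assms(2) by auto
 then obtain s t where "s \<in> window n" "t \<in> window n" "pos n s = i" "pos n t = j" using pos_surj by metis
 thus "x $$ (i, j) = y $$ (i, j)" using assms(3)[of s t] by (simp add: entry_def)
qed (use assms in auto)

lemma entry_mult:
 assumes x: "x \<in> square_mats n" and y: "y \<in> square_mats n" and st: "s \<in> window n" "t \<in> window n"
 shows "entry n (x * y) s t = (\<Sum>r\<in>window n. entry n x s r * entry n y r t)"
proof -
 have p: "pos n s < 2 * n + 1" "pos n t < 2 * n + 1" using st pos_bound by auto
 have "entry n (x * y) s t = (\<Sum>i = 0..<2 * n + 1. x $$ (pos n s, i) * y $$ (i, pos n t))"
  unfolding entry_def using x y p by (simp add: scalar_prod_def)
 also have "\<dots> = (\<Sum>i\<in>{..<2 * n + 1}. x $$ (pos n s, i) * y $$ (i, pos n t))"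
  by (simp only: atLeast0LessThan)
 also have "\<dots> = (\<Sum>r\<in>window n. x $$ (pos n s, pos n r) * y $$ (pos n r, pos n t))"
  by (rule sum.reindex_bij_betw[OF pos_bij, symmetric])
 finally show ?thesis by (simp add: entry_def)
qed

lemma delta_sum:
 assumes "a \<in> window n"
 shows "(\<Sum>r\<in>window n. delta r a * f r) = f a" "(\<Sum>r\<in>window n. f r * delta r a) = f a"
  "(\<Sum>r\<in>window n. delta a r * f r) = f a" "(\<Sum>r\<in>window n. f r * delta a r) = f a"
proof -
 have "delta r a * f r = (if r = a then f a else 0)" "f r * delta r a = (if r = a then f a else 0)"
  "delta a r * f r = (if r = a then f a else 0)" "f r * delta a r = (if r = a then f a else 0)" for r
  by (simp_all add: delta_def)
 thus "(\<Sum>r\<in>window n. delta r a * f r) = f a" "(\<Sum>r\<in>window n. f r * delta r a) = f a"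
  "(\<Sum>r\<in>window n. delta a r * f r) = f a" "(\<Sum>r\<in>window n. f r * delta a r) = f a"
  using assms by simp_all
qed

lemma entry_antidiag:
 assumes "s \<in> window n" "t \<in> window n"
 shows "entry n (antidiag_form n) s t = delta s (- t)"
proof -
 have "pos n s + pos n t = 2 * n \<longleftrightarrow> s = - t"
  using pos_minus[of t n] pos_inj[of s n "- t"] assms by auto
 thus ?thesis unfolding entry_def antidiag_form_def delta_def using pos_bound assms by auto
qed

text \<open>With the antidiagonal Gram matrix, invariance of the form is antisymmetry under
  \<open>(s, t) -> (- t, - s)\<close>, the reflection used in \<open>mirror\<close>.\<close>

lemma so_odd_iff: "x \<in> so_odd n \<longleftrightarrow> x \<in> square_mats n \<and>
  (\<forall>s\<in>window n. \<forall>t\<in>window n. entry n x (- t) (- s) = - entry n x s t)"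
proof (cases "x \<in> square_mats n")
 case True
 let ?N = "2 * n + 1"
 have A: "antidiag_form n \<in> carrier_mat ?N ?N" by (simp add: antidiag_form_def)
 have T: "transpose_mat x \<in> carrier_mat ?N ?N" using True by simp
 define y where "y = transpose_mat x * antidiag_form n + antidiag_form n * x"
 have Y: "y \<in> carrier_mat ?N ?N" unfolding y_def using True A T by auto
 have ey: "entry n y s t = entry n x (- t) s + entry n x (- s) t" if st: "s \<in> window n" "t \<in> window n" for s t
 proof -
  have "entry n y s t = entry n (transpose_mat x * antidiag_form n) s t + entry n (antidiag_form n * x) s t"
   unfolding y_def entry_def using st pos_bound True A by (subst index_add_mat) auto
  also have "entry n (transpose_mat x * antidiag_form n) s t
    = (\<Sum>r\<in>window n. entry n x r s * delta r (- t))"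
   unfolding entry_mult[OF T A st] using st pos_bound True
   by (intro sum.cong refl arg_cong2[where f = "(*)"] entry_antidiag) (auto simp: entry_def)
  also have "\<dots> = entry n x (- t) s" using st by (intro delta_sum) simp
  also have "entry n (antidiag_form n * x) s t = (\<Sum>r\<in>window n. delta (- s) r * entry n x r t)"
   unfolding entry_mult[OF A True st] using st
   by (intro sum.cong refl arg_cong2[where f = "(*)"]) (auto simp: entry_antidiag delta_def)
  also have "\<dots> = entry n x (- s) t" using st by (intro delta_sum) simp
  finally show ?thesis .
 qed
 have "x \<in> so_odd n \<longleftrightarrow> y = 0\<^sub>m ?N ?N" using True by (simp add: so_odd_def y_def)
 also have "\<dots> \<longleftrightarrow> (\<forall>s\<in>window n. \<forall>t\<in>window n. entry n x (- t) s + entry n x (- s) t = 0)"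
 proof
  assume y0: "y = 0\<^sub>m ?N ?N"
  show "\<forall>s\<in>window n. \<forall>t\<in>window n. entry n x (- t) s + entry n x (- s) t = 0"
  proof (intro ballI)
   fix s t assume "s \<in> window n" "t \<in> window n"
   thus "entry n x (- t) s + entry n x (- s) t = 0" using ey[of s t] pos_bound by (simp add: y0 entry_def)
  qed
 next
  assume z: "\<forall>s\<in>window n. \<forall>t\<in>window n. entry n x (- t) s + entry n x (- s) t = 0"
  show "y = 0\<^sub>m ?N ?N" by (rule entry_eqI[OF Y]) (use ey z pos_bound in \<open>auto simp: entry_def\<close>)
 qed
 also have "\<dots> \<longleftrightarrow> (\<forall>s\<in>window n. \<forall>t\<in>window n. entry n x (- t) (- s) = - entry n x s t)"
 proof -
  have "(\<forall>s\<in>window n. P s) \<longleftrightarrow> (\<forall>s\<in>window n. P (- s))" for P using window_minus minus_minus by metis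
  from this[of "%s. \<forall>t\<in>window n. entry n x (- t) s + entry n x (- s) t = 0"]
  show ?thesis by (simp add: eq_neg_iff_add_eq_0)
 qed
 finally show ?thesis using True by blast
qed (simp add: so_odd_def)

lemma so_odd_carrier: "x \<in> so_odd n ==> x \<in> square_mats n" by (simp add: so_odd_def)

lemma entry_add: "x \<in> so_odd n ==> y \<in> so_odd n ==> s \<in> window n ==> t \<in> window n ==>
  entry n (x + y) s t = entry n x s t + entry n y s t"
 and entry_smult: "x \<in> so_odd n ==> s \<in> window n ==> t \<in> window n ==> entry n (c \<cdot>\<^sub>m x) s t = c * entry n x s t"
 using pos_bound so_odd_carrier[of x n] so_odd_carrier[of y n] by (auto simp: entry_def)

lemma so_odd_add: "x \<in> so_odd n ==> y \<in> so_odd n ==> x + y \<in> so_odd n"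
 and so_odd_smult: "x \<in> so_odd n ==> c \<cdot>\<^sub>m x \<in> so_odd n"
proof -
 show "x \<in> so_odd n ==> y \<in> so_odd n ==> x + y \<in> so_odd n"
  unfolding so_odd_iff[of "x + y"] using so_odd_iff[of x n] so_odd_iff[of y n] by (simp add: entry_add)
 show "x \<in> so_odd n ==> c \<cdot>\<^sub>m x \<in> so_odd n"
  unfolding so_odd_iff[of "c \<cdot>\<^sub>m x"] using so_odd_iff[of x n] by (simp add: entry_smult)
qed

definition generator :: "nat => int => int => complex mat" where
 "generator n a b = mat (2 * n + 1) (2 * n + 1) (%(i, j).
   (if i = pos n a \<and> j = pos n b then 1 else 0) - (if i = pos n (- b) \<and> j = pos n (- a) then 1 else 0))"

lemma generator_carrier: "generator n a b \<in> square_mats n" by (simp add: generator_def)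

lemma entry_generator:
 assumes "a \<in> window n" "b \<in> window n" "s \<in> window n" "t \<in> window n"
 shows "entry n (generator n a b) s t = delta s a * delta t b - delta s (- b) * delta t (- a)"
proof -
 have p: "pos n s < 2 * n + 1" "pos n t < 2 * n + 1" by (rule pos_bound[OF assms(3)], rule pos_bound[OF assms(4)])
 have i: "pos n s = pos n a \<longleftrightarrow> s = a" "pos n t = pos n b \<longleftrightarrow> t = b" "pos n s = pos n (- b) \<longleftrightarrow> s = - b"
  "pos n t = pos n (- a) \<longleftrightarrow> t = - a" using assms by (simp_all add: pos_inj)
 have "entry n (generator n a b) s t
  = (if s = a \<and> t = b then 1 else 0) - (if s = - b \<and> t = - a then 1 else 0)"
  unfolding entry_def generator_def index_mat(1)[OF p] prod.case i ..
 moreover have "delta x y * delta x' y' = (if x = y \<and> x' = y' then 1 else 0)" for x y x' y'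
  by (simp add: delta_def)
 ultimately show ?thesis by (simp only:)
qed

lemma delta_neg: "delta (- a) (- b) = delta a b" "delta (- a) b = delta a (- b)"
 by (auto simp: delta_def)

lemma generator_so: "a \<in> window n ==> b \<in> window n ==> generator n a b \<in> so_odd n"
 unfolding so_odd_iff using generator_carrier by (auto simp: entry_generator delta_neg)

lemma generator_mirror:
 assumes "a \<in> window n" "b \<in> window n"
 shows "generator n (- b) (- a) = (- 1) \<cdot>\<^sub>m generator n a b"
proof (rule entry_eqI[OF generator_carrier smult_carrier_mat[OF generator_carrier]])
 fix s t assume "s \<in> window n" "t \<in> window n"
 thus "entry n (generator n (- b) (- a)) s t = entry n ((- 1) \<cdot>\<^sub>m generator n a b) s t"
  using assms by (simp add: entry_smult generator_so entry_generator)
qed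

lemma entry_bracket:
 assumes "x \<in> so_odd n" "y \<in> so_odd n" "s \<in> window n" "t \<in> window n"
 shows "entry n (lie_bracket x y) s t = entry n (x * y) s t - entry n (y * x) s t"
 using assms pos_bound so_odd_carrier[of x n] so_odd_carrier[of y n] unfolding lie_bracket_def entry_def by auto

lemma bracket_carrier: "x \<in> so_odd n ==> y \<in> so_odd n ==> lie_bracket x y \<in> square_mats n"
 using so_odd_carrier[of x n] so_odd_carrier[of y n] unfolding lie_bracket_def by auto

lemma entry_generator_mult:
 assumes w: "a \<in> window n" "b \<in> window n" and y: "y \<in> so_odd n" and st: "s \<in> window n" "t \<in> window n"
 shows "entry n (generator n a b * y) s t = delta s a * entry n y b t - delta s (- b) * entry n y (- a) t"
proof -
 have "entry n (generator n a b * y) s t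
   = (\<Sum>r\<in>window n. delta s a * (delta r b * entry n y r t) - delta s (- b) * (delta r (- a) * entry n y r t))"
  unfolding entry_mult[OF generator_carrier so_odd_carrier[OF y] st]
  using w st by (intro sum.cong refl) (simp add: entry_generator algebra_simps)
 also have "\<dots> = delta s a * entry n y b t - delta s (- b) * entry n y (- a) t"
  unfolding sum_subtractf sum_distrib_left[symmetric] using w by (simp add: delta_sum)
 finally show ?thesis .
qed

lemma generator_bracket:
 assumes w: "a \<in> window n" "b \<in> window n" "c \<in> window n" "d \<in> window n"
 shows "lie_bracket (generator n a b) (generator n c d)
  = delta b c \<cdot>\<^sub>m generator n a d + ((- delta a d) \<cdot>\<^sub>m generator n c b
   + ((- delta c (- a)) \<cdot>\<^sub>m generator n (- b) d + delta d (- b) \<cdot>\<^sub>m generator n c (- a)))"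
  (is "_ = ?r")
proof (rule entry_eqI[OF bracket_carrier])
 note so = generator_so so_odd_smult so_odd_add
 show "generator n a b \<in> so_odd n" "generator n c d \<in> so_odd n" using w by (simp_all add: so)
 show "?r \<in> square_mats n" using w by (intro so_odd_carrier so) simp_all
 fix s t assume st: "s \<in> window n" "t \<in> window n"
 have n: "delta (- a) c = delta c (- a)" "delta b (- d) = delta d (- b)" "delta d a = delta a d"
  "delta (- a) (- d) = delta a d" "delta (- c) (- b) = delta b c" "delta (- c) a = delta c (- a)"
  by (auto simp: delta_def)
 have L: "entry n (lie_bracket (generator n a b) (generator n c d)) s t
  = delta s a * (delta b c * delta t d - delta d (- b) * delta t (- c))
   - delta s (- b) * (delta c (- a) * delta t d - delta a d * delta t (- c))
   - (delta s c * (delta a d * delta t b - delta d (- b) * delta t (- a))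
   - delta s (- d) * (delta c (- a) * delta t b - delta b c * delta t (- a)))"
  using w st by (simp add: entry_bracket so entry_generator_mult entry_generator n)
 have R: "entry n ?r s t = delta b c * (delta s a * delta t d - delta s (- d) * delta t (- a))
   + (- delta a d * (delta s c * delta t b - delta s (- b) * delta t (- c))
   + (- delta c (- a) * (delta s (- b) * delta t d - delta s (- d) * delta t b)
   + delta d (- b) * (delta s c * delta t (- a) - delta s a * delta t (- c))))"
  using w st by (simp add: entry_add entry_smult so entry_generator)
 show "entry n (lie_bracket (generator n a b) (generator n c d)) s t = entry n ?r s t"
  unfolding L R by (simp add: algebra_simps)
qed

section \<open>The torus and the root spaces\<close>

lemma torus_iff:
 "h \<in> torus n \<longleftrightarrow> h \<in> so_odd n \<and> (\<forall>s\<in>window n. \<forall>t\<in>window n. s \<noteq> t --> entry n h s t = 0)"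
proof (cases "h \<in> so_odd n")
 case True
 hence c: "h \<in> square_mats n" by (rule so_odd_carrier)
 have "diagonal_mat h \<longleftrightarrow> (\<forall>s\<in>window n. \<forall>t\<in>window n. s \<noteq> t --> entry n h s t = 0)"
 proof
  assume "diagonal_mat h"
  thus "\<forall>s\<in>window n. \<forall>t\<in>window n. s \<noteq> t --> entry n h s t = 0"
   unfolding diagonal_mat_def entry_def using c pos_bound pos_inj by auto
 next
  assume d: "\<forall>s\<in>window n. \<forall>t\<in>window n. s \<noteq> t --> entry n h s t = 0"
  show "diagonal_mat h" unfolding diagonal_mat_def
  proof (intro allI impI)
   fix i j assume ij: "i < dim_row h" "j < dim_col h" "i \<noteq> j"
   hence "i < 2 * n + 1" "j < 2 * n + 1" using c by auto
   then obtain s t where st: "s \<in> window n" "t \<in> window n" "pos n s = i" "pos n t = j" using pos_surj by metis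
   hence "s \<noteq> t" using ij(3) by auto
   hence "entry n h s t = 0" using d st(1,2) by blast
   thus "h $$ (i, j) = 0" unfolding entry_def st(3,4) .
  qed
 qed
 thus ?thesis unfolding torus_def using True by simp
qed (simp add: torus_def)

definition root_value :: "nat => complex mat => int => complex" where
 "root_value n h a = entry n h a a"

lemma root_value_minus: "h \<in> torus n ==> a \<in> window n ==> root_value n h (- a) = - root_value n h a"
 unfolding root_value_def torus_iff so_odd_iff by blast

lemma root_value_zero: "h \<in> torus n ==> root_value n h 0 = 0"
 using root_value_minus[of h n 0] by (simp add: mem_window)

lemma root_value_epsilon: "1 \<le> i ==> i \<le> n ==> \<epsilon> i h = root_value n h (int i)"
 by (simp add: \<epsilon>_def root_value_def entry_def pos_def nat_diff_distrib)

lemma entry_torus_bracket: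
 assumes h: "h \<in> torus n" and x: "x \<in> so_odd n" and st: "s \<in> window n" "t \<in> window n"
 shows "entry n (lie_bracket h x) s t = (root_value n h s - root_value n h t) * entry n x s t"
proof -
 have hs: "h \<in> so_odd n" using h by (simp add: torus_def)
 have e: "entry n h r r' = delta r r' * root_value n h r" if "r \<in> window n" "r' \<in> window n" for r r'
  using h that unfolding torus_iff by (auto simp: delta_def root_value_def)
 have 1: "entry n (h * x) s t = (\<Sum>r\<in>window n. delta s r * (root_value n h s * entry n x r t))"
  unfolding entry_mult[OF so_odd_carrier[OF hs] so_odd_carrier[OF x] st]
  using st by (intro sum.cong refl) (simp add: e)
 have 2: "entry n (x * h) s t = (\<Sum>r\<in>window n. (entry n x s r * root_value n h r) * delta r t)"
  unfolding entry_mult[OF so_odd_carrier[OF x] so_odd_carrier[OF hs] st]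
  using st by (intro sum.cong refl) (simp add: e)
 show ?thesis unfolding entry_bracket[OF hs x st] 1 2 delta_sum(3)[OF st(1)] delta_sum(2)[OF st(2)]
  by (simp add: algebra_simps)
qed

lemma root_weight_letter:
 assumes h: "h \<in> torus n" and \<alpha>: "\<alpha> \<in> set (long_roots n @ short_roots n)"
 shows "root_weight \<alpha> h = root_value n h (snd (letter \<alpha>)) - root_value n h (fst (letter \<alpha>))"
proof (cases \<alpha>)
 case (Minus i j)
 hence "\<alpha> \<in> set (long_roots n)" using \<alpha> by (auto simp: set_short_roots)
 hence "letter \<alpha> \<in> letter ` set (long_roots n)" by blast
 hence "1 \<le> i" "i < j" "j \<le> n" unfolding letter_long Minus by auto
 thus ?thesis using Minus by (simp add: root_value_epsilon[symmetric])
next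
 case (Plus i j)
 hence "\<alpha> \<in> set (long_roots n)" using \<alpha> by (auto simp: set_short_roots)
 hence "letter \<alpha> \<in> letter ` set (long_roots n)" by blast
 hence "1 \<le> i" "i < j" "j \<le> n" unfolding letter_long Plus by auto
 thus ?thesis using Plus root_value_minus[OF h, of "int j"]
  by (simp add: root_value_epsilon[symmetric] mem_window)
next
 case (Short i)
 have "letter \<alpha> \<in> letter ` set (long_roots n @ short_roots n)" using \<alpha> by blast
 hence "1 \<le> i" "i \<le> n" unfolding set_append image_Un letter_long letter_short Short by auto
 thus ?thesis using Short root_value_zero[OF h] by (simp add: root_value_epsilon[symmetric])
qed

lemma generator_weight:
 assumes w: "a \<in> window n" "b \<in> window n" and h: "h \<in> torus n"
 shows "lie_bracket h (generator n a b) = (root_value n h a - root_value n h b) \<cdot>\<^sub>m generator n a b"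
proof (rule entry_eqI[OF _ smult_carrier_mat[OF generator_carrier]])
 have hs: "h \<in> so_odd n" using h by (simp add: torus_def)
 show "lie_bracket h (generator n a b) \<in> square_mats n"
  by (rule bracket_carrier[OF hs generator_so[OF w]])
 fix s t assume st: "s \<in> window n" "t \<in> window n"
 have d: "root_value n h s * (delta s x * c) = root_value n h x * (delta s x * c)"
  "root_value n h t * (c * delta t x) = root_value n h x * (c * delta t x)" for x c
  by (auto simp: delta_def)
 show "entry n (lie_bracket h (generator n a b)) s t
  = entry n ((root_value n h a - root_value n h b) \<cdot>\<^sub>m generator n a b) s t"
  unfolding entry_torus_bracket[OF h generator_so[OF w] st] entry_smult[OF generator_so[OF w] st] entry_generator[OF w st]
  by (simp only: left_diff_distrib right_diff_distrib d) (simp add: root_value_minus[OF h] w)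
qed

lemma generator_nonzero:
 assumes w: "a \<in> window n" "b \<in> window n" and ab: "a + b \<noteq> 0"
 shows "generator n a b \<noteq> 0\<^sub>m (2 * n + 1) (2 * n + 1)"
proof
 assume z: "generator n a b = 0\<^sub>m (2 * n + 1) (2 * n + 1)"
 have "entry n (generator n a b) a b = 0" unfolding z entry_def using pos_bound[OF w(1)] pos_bound[OF w(2)] by simp
 moreover have "entry n (generator n a b) a b = 1" unfolding entry_generator[OF w w] using ab by (auto simp: delta_def)
 ultimately show False by simp
qed

lemma generator_torus: "a \<in> window n ==> generator n a a \<in> torus n"
 unfolding torus_iff by (auto simp: generator_so entry_generator delta_def)

text \<open>Root spaces are one-dimensional: a nonzero entry must have the same weight as the entry
  \<open>(a, b)\<close> for every diagonal generator, and this determines its position up to the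
  reflection in \<open>mirror\<close>.\<close>

lemma root_vector_generator:
 assumes \<alpha>: "\<alpha> \<in> set (long_roots n @ short_roots n)" and x: "is_root_vector n (%h. - root_weight \<alpha> h) x"
 shows "\<exists>c. c \<noteq> 0 \<and> x = c \<cdot>\<^sub>m generator n (fst (letter \<alpha>)) (snd (letter \<alpha>))"
proof -
 obtain a b where ab: "letter \<alpha> = (a, b)" by fastforce
 have "letter \<alpha> \<in> letter ` set (long_roots n @ short_roots n)" using \<alpha> by blast
 hence b: "1 \<le> b" "b \<le> int n" "\<bar>a\<bar> \<le> int n" "a = 0 \<or> b < \<bar>a\<bar>"
  unfolding ab set_append image_Un letter_long letter_short by auto
 hence w: "a \<in> window n" "b \<in> window n" "- a \<in> window n" "- b \<in> window n" by (auto simp: mem_window)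
 have xs: "x \<in> so_odd n" and x0: "x \<noteq> 0\<^sub>m (2 * n + 1) (2 * n + 1)"
  and br: "\<And>h. h \<in> torus n ==> lie_bracket h x = (- root_weight \<alpha> h) \<cdot>\<^sub>m x"
  using x unfolding is_root_vector_def by auto
 have van: "entry n x s t = 0" if st: "s \<in> window n" "t \<in> window n" "(s, t) \<noteq> (a, b)" "(s, t) \<noteq> (- b, - a)" for s t
 proof (rule ccontr)
  assume nz: "entry n x s t \<noteq> 0"
  define e where "e i r = (if r = i then 1 else if r = - i then - 1 else (0 :: int))" for i r :: int
  have eq: "e i s - e i t = e i a - e i b" if i: "0 < i" "i \<le> int n" for i
  proof -
   have iw: "i \<in> window n" using i by (auto simp: mem_window)
   have h: "generator n i i \<in> torus n" by (rule generator_torus[OF iw])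
   have v: "root_value n (generator n i i) r = of_int (e i r)" if "r \<in> window n" for r
    unfolding root_value_def entry_generator[OF iw iw that that] using i by (auto simp: delta_def e_def)
   have "(root_value n (generator n i i) s - root_value n (generator n i i) t) * entry n x s t
     = - root_weight \<alpha> (generator n i i) * entry n x s t"
    using entry_torus_bracket[OF h xs st(1,2)] br[OF h] entry_smult[OF xs st(1,2)] by simp
   hence "root_value n (generator n i i) s - root_value n (generator n i i) t
     = root_value n (generator n i i) a - root_value n (generator n i i) b"
    using nz unfolding root_weight_letter[OF h \<alpha>] ab by simp
   hence "complex_of_int (e i s - e i t) = of_int (e i a - e i b)" using v st w by simp
   thus ?thesis unfolding of_int_eq_iff .
  qed
  have inj: "r = r'" if "r \<in> window n" "r' \<in> window n" "\<And>i. 0 < i ==> i \<le> int n ==> e i r = e i r'" for r r'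
 proof (cases "r = 0")
   case False
   thus ?thesis using that(3)[of "\<bar>r\<bar>"] that(1) by (auto simp: e_def mem_window split: if_splits)
  next
   case True
   thus ?thesis using that(3)[of "\<bar>r'\<bar>"] that(2) by (cases "r' = 0") (auto simp: e_def mem_window split: if_splits)
  qed
  \<comment> \<open>The coordinate \<open>b\<close> of the root is -1. It can only come from
    \<open>t = b\<close> or from \<open>s = - b\<close>, and the remaining index is then determined
    by the other coordinates.\<close>
  have "e b a = 0" "e b b = 1" using b by (auto simp: e_def)
  hence "e b s - e b t = - 1" using eq[of b] b by simp
  hence "t = b \<or> s = - b" by (auto simp: e_def split: if_splits)
  thus False
  proof
   assume 1: "t = b"
   have "s = a" by (rule inj[OF st(1) w(1)]) (use eq 1 in simp)
   thus False using st(3) 1 by simp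
  next
   assume 2: "s = - b"
   have neg: "e i (- r) = - e i r" if "0 < i" for i r using that by (auto simp: e_def)
   hence "e i (- t) = e i a" if "0 < i" "i \<le> int n" for i
    using eq[OF that] neg[OF that(1)] unfolding 2 by simp
   moreover have "- t \<in> window n" using st(2) by simp
   ultimately have "- t = a" using inj[OF _ w(1)] by blast
   thus False using st(4) 2 by auto
  qed
 qed
 let ?c = "entry n x a b"
 have ne: "a \<noteq> - b" using b by auto
 have eq: "x = ?c \<cdot>\<^sub>m generator n a b"
 proof (rule entry_eqI[OF so_odd_carrier[OF xs] smult_carrier_mat[OF generator_carrier]])
  fix s t assume st: "s \<in> window n" "t \<in> window n"
  have m: "entry n x (- b) (- a) = - ?c" using xs w unfolding so_odd_iff by blast
  consider "s = a" "t = b" | "s = - b" "t = - a" | "(s, t) \<noteq> (a, b)" "(s, t) \<noteq> (- b, - a)" by auto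
  thus "entry n x s t = entry n (?c \<cdot>\<^sub>m generator n a b) s t"
   unfolding entry_smult[OF generator_so[OF w(1,2)] st] entry_generator[OF w(1,2) st]
   by cases (use ne m in \<open>simp_all add: delta_def van[OF st]\<close>)

 qed
 have "?c \<noteq> 0"
 proof
  assume c: "?c = 0"
  have "x = 0\<^sub>m (2 * n + 1) (2 * n + 1)"
   by (rule eq_matI) (use eq c generator_carrier[of n a b] in \<open>auto simp: generator_def\<close>)
  thus False using x0 by blast
 qed
 thus ?thesis using eq ab by auto
qed

lemma mem_all_letters: "(a, b) \<in> all_letters n \<longleftrightarrow> a \<in> window n \<and> b \<in> window n \<and> a + b \<noteq> 0"
 by (auto simp: sq_letters_def col_letters_def mem_window)

section \<open>Local nilpotence in irreducible modules\<close>

context so_rep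
begin

text \<open>The relation between the module and a unitary module with the same highest weight is
  total on the left and has trivial kernel there, both by irreducibility. So a power that
  annihilates the partner of \<open>u\<close> annihilates \<open>u\<close>.\<close>

theorem irreducible_loc_nilpotent:
 assumes n: "1 \<le> n" and irr: "\<And>W. stable (all_letters n) W ==> W = {0} \<or> W = UNIV"
  and datum: "datum (all_letters n) w {0} \<mu>" and w: "w \<noteq> 0"
  and \<mu>: "\<And>i. 0 < i ==> i \<le> int n ==> \<mu> i = B_weight n k i"
 shows loc_nilpotent
proof -
 \<comment> \<open>The zero exponent serves only to obtain a unitary module with highest weight
   \<mu>.\<close>
 have "B_bound n \<mu> (%_. 0)" by (rule B_bound_cong[OF B_lower[OF n, of "%_. 0" k]]) (simp_all add: \<mu>)
 then obtain G B v where G: "unitary_rep n G B" "so_rep.datum fscale n G (all_letters n) v {0} \<mu>"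
  "unitary_rep.supported B v" "v \<noteq> 0" unfolding lower_bound_def by blast
 have wn: "w \<notin> {0}" using w by simp
 interpret R: rep_pair scale n F G B "all_letters n" "long_roots n @ short_roots n" w "{0}" v \<mu>
  by (intro rep_pair.intro so_rep_axioms G(1) rep_pair_axioms.intro all_letters_range short_closed
    lowering_list_short datum wn G(2-4))
 have R0: "(0, 0) \<in> R.R" using R.Pr.subspace_0[OF R.R_subspace] by (simp only: zero_prod_def)
 let ?N = "{x. (x, 0) \<in> R.R}" and ?D = "{x. \<exists>y. (x, y) \<in> R.R}"
 have null: "x = 0" if "(x, 0) \<in> R.R" for x
 proof -
  have M0: "R.M.X z 0 = 0" if "z \<in> all_letters n" for z
   using vec.lin_0[OF R.M.X_lin] all_letters_range that by blast
  have "stable (all_letters n) ?N" unfolding stable_def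
  proof (intro conjI subspaceI ballI)
   show "0 \<in> ?N" using R0 by simp
   show "x + y \<in> ?N" if "x \<in> ?N" "y \<in> ?N" for x y using R.R_add[of x 0 y 0] that by simp
   show "scale c x \<in> ?N" if "x \<in> ?N" for c x using R.R_scale[of x 0 c] that by simp
   show "X z x \<in> ?N" if "z \<in> all_letters n" "x \<in> ?N" for z x
    using R.R_stable[of x 0 z] that M0 by simp
  qed
  hence "?N = {0} \<or> ?N = UNIV" by (rule irr)
  thus ?thesis using that R.generator_not_degenerate by blast
 qed
 have dom: "\<exists>y. (x, y) \<in> R.R" for x
 proof -
  have "stable (all_letters n) ?D" unfolding stable_def
  proof (intro conjI subspaceI ballI)
   show "0 \<in> ?D" using R0 by blast
   show "x + y \<in> ?D" if "x \<in> ?D" "y \<in> ?D" for x y using that R.R_add by blast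
   show "scale c x \<in> ?D" if "x \<in> ?D" for c x using that R.R_scale by blast
   show "X z x \<in> ?D" if "z \<in> all_letters n" "x \<in> ?D" for z x using that R.R_stable by blast
  qed
  hence "?D = {0} \<or> ?D = UNIV" by (rule irr)
  moreover have "(w, v) \<in> R.R" using R.R_word[of "[]"] by simp
  ultimately show ?thesis using w by blast
 qed
 show ?thesis unfolding loc_nilpotent_def
 proof (intro allI impI)
  fix a b u assume ab: "\<bar>a\<bar> \<le> int n" "\<bar>b\<bar> \<le> int n" "a \<noteq> b" "a + b \<noteq> 0"
  obtain y where y: "(u, y) \<in> R.R" using dom by blast
  obtain N where N: "(G a b ^^ N) y = 0"
   using R.M.rep_loc_nilpotent ab unfolding R.M.loc_nilpotent_def by blast
  have mem: "(a, b) \<in> all_letters n" using ab by (simp only: mem_all_letters mem_window) simp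
  have "((F a b ^^ j) u, (G a b ^^ j) y) \<in> R.R" for j
  proof (induction j)
   case (Suc j)
   thus ?case using R.R_stable[OF Suc mem] by simp
  qed (simp add: y)
  from this[of N] have "(F a b ^^ N) u = 0" unfolding N by (rule null)
  thus "\<exists>N. (F a b ^^ N) u = 0" ..
 qed
qed

end

lemma pos_roots_eq: "pos_roots n = long_roots n @ short_roots n"
 by (simp add: pos_roots_def long_roots_def)

lemma exponents_less_eq: "exponents_less n q p \<longleftrightarrow> blocks_less (short_roots n # long_blocks n) q p"
 unfolding exponents_less_def blocks_less_def exponent_blocks_def long_blocks.simps by simp

section \<open>From modules over so(2n+1) to operators indexed by letters\<close>

locale so_module = lie_module scale "so_odd n" act
 for scale :: "complex => 'v::ab_group_add => 'v" and n :: nat and act :: "complex mat => 'v => 'v"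
begin

sublocale complex_space scale ..

definition F :: "int => int => 'v => 'v" where
 "F a b = act (generator n a b)"

lemma act_lin: "x \<in> so_odd n ==> lin (act x)"
 using act_linear[of x] unfolding lin_def Vector_Spaces.linear_def module_hom_def module_hom_axioms_def by blast

sublocale so_rep scale n F
proof
 fix a b :: int assume ab: "\<bar>a\<bar> \<le> int n" "\<bar>b\<bar> \<le> int n"
 hence w: "a \<in> window n" "b \<in> window n" by (simp_all add: mem_window)
 show "lin (F a b)" unfolding F_def by (rule act_lin[OF generator_so[OF w]])
 show "F (- b) (- a) u = - F a b u" for u
  unfolding F_def generator_mirror[OF w] act_smult[OF generator_so[OF w]] by simp
next
 fix a b c d :: int and u
 assume "\<bar>a\<bar> \<le> int n" "\<bar>b\<bar> \<le> int n" "\<bar>c\<bar> \<le> int n" "\<bar>d\<bar> \<le> int n"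
 hence w: "a \<in> window n" "b \<in> window n" "c \<in> window n" "d \<in> window n" by (simp_all add: mem_window)
 have s: "scale (delta x y) z = (if x = y then z else 0)" for x y z by (simp add: delta_def)
 have "F a b (F c d u) - F c d (F a b u) = act (lie_bracket (generator n a b) (generator n c d)) u"
  unfolding F_def using act_bracket[OF generator_so[OF w(1,2)] generator_so[OF w(3,4)]] by simp
 also have "\<dots> = scale (delta b c) (F a d u) + (scale (- delta a d) (F c b u)
   + (scale (- delta c (- a)) (F (- b) d u) + scale (delta d (- b)) (F c (- a) u)))"
  unfolding generator_bracket[OF w] F_def using w
  by (simp only: act_add act_smult so_odd_add so_odd_smult generator_so window_minus)
 finally show "F a b (F c d u) - F c d (F a b u) = so_bracket F a b c d u"
  by (simp add: s scale_minus_left)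
qed

lemma generators_span:
 assumes W: "stable (all_letters n) W" and x: "x \<in> so_odd n" and u: "u \<in> W"
 shows "act x u \<in> W"
proof -
 have Ws: "subspace W" by (rule stable_subspace[OF W])
 have FW: "F a b u \<in> W" if w: "a \<in> window n" "b \<in> window n" and u: "u \<in> W" for a b u
 proof (cases "a + b = 0")
  case True
  hence "b = - a" by simp
  thus ?thesis using F_antidiag[of a u] w subspace_0[OF Ws] by (simp add: mem_window)
 next
  case False
  hence "(a, b) \<in> all_letters n" using w by (simp only: mem_all_letters) simp
  thus ?thesis using stable_X[OF W _ u, of "(a, b)"] by simp
 qed
 have "\<exists>y\<in>so_odd n. (\<forall>s\<in>window n. \<forall>t\<in>window n. entry n y s t
   = (\<Sum>z\<in>S. entry n x (fst z) (snd z) * entry n (generator n (fst z) (snd z)) s t))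
  \<and> (\<forall>u\<in>W. act y u \<in> W)" if "S \<subseteq> window n \<times> window n" "finite S" for S
  using that(2,1)
 proof (induction S rule: finite_induct)
  case empty
  \<comment> \<open>Represents the zero matrix as a multiple of a generator, so that membership and
    action follow from the rules for scalars.\<close>
  have z: "0 \<cdot>\<^sub>m generator n 0 0 \<in> so_odd n" by (intro so_odd_smult generator_so) (simp_all add: mem_window)
  have g: "generator n 0 0 \<in> so_odd n" by (intro generator_so) (simp_all add: mem_window)
  show ?case by (rule bexI[OF _ z]) (use g subspace_0[OF Ws] in \<open>simp add: entry_smult act_smult\<close>)
 next
  case (insert z S)
  obtain a b where ab: "z = (a, b)" by fastforce
  hence w: "a \<in> window n" "b \<in> window n" using insert.prems by auto
  obtain y where y: "y \<in> so_odd n" "\<And>s t. s \<in> window n ==> t \<in> window n ==> entry n y s t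
   = (\<Sum>z\<in>S. entry n x (fst z) (snd z) * entry n (generator n (fst z) (snd z)) s t)"
   "\<And>u. u \<in> W ==> act y u \<in> W" using insert by blast
  let ?y = "entry n x a b \<cdot>\<^sub>m generator n a b + y"
  have g: "generator n a b \<in> so_odd n" by (rule generator_so[OF w])
  have cg: "entry n x a b \<cdot>\<^sub>m generator n a b \<in> so_odd n" by (rule so_odd_smult[OF g])
  show ?case
  proof (rule bexI[OF _ so_odd_add[OF cg y(1)]], intro conjI ballI)
   fix s t assume st: "s \<in> window n" "t \<in> window n"
   show "entry n ?y s t = (\<Sum>z\<in>insert z S. entry n x (fst z) (snd z) *
     entry n (generator n (fst z) (snd z)) s t)"
    unfolding entry_add[OF cg y(1) st] entry_smult[OF g st] y(2)[OF st]
     sum.insert[OF insert.hyps] unfolding ab by simp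
  next
   fix u assume u: "u \<in> W"
   have "act ?y u = scale (entry n x a b) (F a b u) + act y u"
    unfolding act_add[OF cg y(1)] act_smult[OF g] F_def ..
   thus "act ?y u \<in> W" using subspace_add[OF Ws subspace_scale[OF Ws FW[OF w u]] y(3)[OF u]] by simp
  qed
 qed
 from this[of "window n \<times> window n"] obtain y where y: "y \<in> so_odd n"
  "\<And>s t. s \<in> window n ==> t \<in> window n ==> entry n y s t = (\<Sum>z\<in>window n \<times> window n. entry n x (fst z) (snd z) *
   entry n (generator n (fst z) (snd z)) s t)"
  "\<And>u. u \<in> W ==> act y u \<in> W" by auto
 \<comment> \<open>The sum runs over all pairs of indices, so a letter and its mirror contribute the
   same matrix twice.\<close>
 have "y = 2 \<cdot>\<^sub>m x"
 proof (rule entry_eqI[OF so_odd_carrier[OF y(1)] so_odd_carrier[OF so_odd_smult[OF x]]])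
  fix s t assume st: "s \<in> window n" "t \<in> window n"
  have "entry n y s t = (\<Sum>a\<in>window n. \<Sum>b\<in>window n. entry n x a b * entry n (generator n a b) s t)"
   unfolding y(2)[OF st] by (simp only: sum.cartesian_product case_prod_unfold)
  also have "\<dots> = (\<Sum>a\<in>window n. delta s a * (\<Sum>b\<in>window n. entry n x a b * delta t b))
    - (\<Sum>a\<in>window n. delta t (- a) * (\<Sum>b\<in>window n. entry n x a b * delta s (- b)))"
   unfolding sum_distrib_left sum_subtractf[symmetric] by (intro sum.cong refl) (simp add: entry_generator[OF _ _ st] algebra_simps)
  also have "\<dots> = entry n x s t - entry n x (- t) (- s)"
  proof -
   have d: "delta r (- a) = delta (- r) a" for r a by (auto simp: delta_def)
   show ?thesis unfolding d using st by (simp add: delta_sum)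
  qed
  also have "\<dots> = 2 * entry n x s t" using x st unfolding so_odd_iff by simp
  finally show "entry n y s t = entry n (2 \<cdot>\<^sub>m x) s t" unfolding entry_smult[OF x st] .
 qed
 hence "scale 2 (act x u) \<in> W" using y(3)[OF u] act_smult[OF x, of 2 u] by simp
 thus ?thesis by (rule subspace_scale_cancel[OF Ws]) simp
qed

lemma signature_vector_mono:
 assumes f: "\<And>\<alpha>. \<alpha> \<in> set (pos_roots n) ==> is_root_vector n (%h. - root_weight \<alpha> h) (f \<alpha>)"
 shows "\<exists>c. c \<noteq> 0 \<and> signature_vector scale n act f w q = scale c (mono (pos_roots n) q w)"
proof -
 have one: "\<exists>c. c \<noteq> 0 \<and> (\<forall>u. act (f \<alpha>) u = scale c (X (letter \<alpha>) u))" and l: "lin (X (letter \<alpha>))"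
  if \<alpha>: "\<alpha> \<in> set (pos_roots n)" for \<alpha>
 proof -
  obtain a b where ab: "letter \<alpha> = (a, b)" by fastforce
  have "letter \<alpha> \<in> letter ` set (long_roots n @ short_roots n)" using \<alpha> unfolding pos_roots_eq by blast
  hence w: "a \<in> window n" "b \<in> window n"
   unfolding ab set_append image_Un letter_long letter_short by (auto simp: mem_window)
  thus "lin (X (letter \<alpha>))" unfolding ab X_pair by (intro F_lin) (simp_all add: mem_window)
  obtain c where c: "c \<noteq> 0" "f \<alpha> = c \<cdot>\<^sub>m generator n a b"
   using root_vector_generator[of \<alpha> n "f \<alpha>"] \<alpha> f[OF \<alpha>] unfolding pos_roots_eq ab by auto
  have "act (f \<alpha>) u = scale c (X (letter \<alpha>) u)" for u
   unfolding c(2) act_smult[OF generator_so[OF w]] ab X_pair F_def ..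
  thus "\<exists>c. c \<noteq> 0 \<and> (\<forall>u. act (f \<alpha>) u = scale c (X (letter \<alpha>) u))" using c(1) by blast
 qed
 have "\<exists>c. c \<noteq> 0 \<and> foldr (%\<alpha> w. scale (1 / fact (q \<alpha>)) ((act (f \<alpha>) ^^ q \<alpha>) w)) rs w = scale c (mono rs q w)"
  if "set rs \<subseteq> set (pos_roots n)" for rs
  using that
 proof (induction rs)
  case Nil
  thus ?case by (intro exI[of _ 1]) simp
 next
  case (Cons \<alpha> rs)
  have \<alpha>: "\<alpha> \<in> set (pos_roots n)" using Cons.prems by simp
  obtain c where c: "c \<noteq> 0" "foldr (%\<alpha> w. scale (1 / fact (q \<alpha>)) ((act (f \<alpha>) ^^ q \<alpha>) w)) rs w = scale c (mono rs q w)"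
   using Cons by auto
  obtain d where d: "d \<noteq> 0" "\<And>u. act (f \<alpha>) u = scale d (X (letter \<alpha>) u)" using one[OF \<alpha>] by blast
  have pow: "(act (f \<alpha>) ^^ k) u = scale (d ^ k) ((X (letter \<alpha>) ^^ k) u)" for k u
   by (induction k) (simp_all add: d(2) lin_scale[OF l[OF \<alpha>]])
  have "foldr (%\<alpha> w. scale (1 / fact (q \<alpha>)) ((act (f \<alpha>) ^^ q \<alpha>) w)) (\<alpha> # rs) w
    = scale (1 / fact (q \<alpha>) * d ^ q \<alpha> * c) (mono (\<alpha> # rs) q w)"
   by (simp add: c(2) pow lin_scale[OF lin_pow[OF l[OF \<alpha>]]])
  thus ?case using c(1) d(1) by (intro exI[of _ "1 / fact (q \<alpha>) * d ^ q \<alpha> * c"]) simp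
 qed
 thus ?thesis unfolding signature_vector_def by blast
qed

text \<open>The choice of root vectors and the divided powers multiply each monomial by a nonzero
  scalar depending on its exponent. Neither spans nor membership in subspaces are affected.\<close>

lemma essential_iff_ess:
 assumes f: "\<And>\<alpha>. \<alpha> \<in> set (pos_roots n) ==> is_root_vector n (%h. - root_weight \<alpha> h) (f \<alpha>)"
 shows "essential scale n act f w p \<longleftrightarrow> ess (short_roots n # long_blocks n) w {0} p"
proof -
 let ?s = "signature_vector scale n act f w" and ?m = "%q. mono (pos_roots n) q w"
 have "\<forall>q. \<exists>c. c \<noteq> 0 \<and> ?s q = scale c (?m q)" using signature_vector_mono[OF f] by blast
 then obtain c where c: "\<And>q. c q \<noteq> 0" "\<And>q. ?s q = scale (c q) (?m q)" by metis
 have c': "?m q = scale (inverse (c q)) (?s q)" for q using c[of q] by simp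
 have "span {?s q | q. exponents_less n q p} = span {?m q | q. exponents_less n q p}"
 proof
  show "span {?s q | q. exponents_less n q p} \<subseteq> span {?m q | q. exponents_less n q p}"
   using c(2) by (intro span_minimal subsetI) (auto intro: span_scale span_base)
  show "span {?m q | q. exponents_less n q p} \<subseteq> span {?s q | q. exponents_less n q p}"
  proof (intro span_minimal subsetI)
   fix u assume "u \<in> {?m q | q. exponents_less n q p}"
   then obtain q where q: "u = scale (inverse (c q)) (?s q)" "exponents_less n q p" using c' by blast
   thus "u \<in> span {?s q | q. exponents_less n q p}"
    unfolding q(1) by (intro span_scale span_base) blast
  qed simp
 qed
 moreover have "?s p \<in> S \<longleftrightarrow> ?m p \<in> S" if "subspace S" for S
  unfolding c(2) using subspace_scale_cancel[OF that _ c(1)] subspace_scale[OF that] by blast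
 moreover have "concat (rev (short_roots n # long_blocks n)) = pos_roots n"
  by (simp add: concat_long_blocks pos_roots_eq)
 ultimately show ?thesis unfolding essential_def ess_def exponents_less_eq[symmetric] by simp
qed

end

section \<open>The highest weight in coordinates, and the recursive description of essential
  exponents\<close>

lemma fundamental_weight_generator:
 assumes i: "1 \<le> i" "i \<le> n" and j: "1 \<le> j" "j \<le> n"
 shows "fundamental_weight n j (generator n (int i) (int i)) = (if j < n then if i \<le> j then 1 else 0 else 1 / 2)"
proof -
 have w: "int l \<in> window n" if "l \<le> n" for l using that by (simp add: mem_window)
 have "\<epsilon> l (generator n (int i) (int i)) = (if l = i then 1 else 0)" if "1 \<le> l" "l \<le> n" for l
  unfolding root_value_epsilon[OF that] root_value_def entry_generator[OF w[OF i(2)] w[OF i(2)] w[OF that(2)] w[OF that(2)]]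
  using that i by (simp add: delta_def)
 hence "(\<Sum>l = 1..j'. \<epsilon> l (generator n (int i) (int i))) = (\<Sum>l = 1..j'. if l = i then 1 else 0)" if "j' \<le> n" for j'
  using that by (intro sum.cong refl) auto
 hence e: "(\<Sum>l = 1..j'. \<epsilon> l (generator n (int i) (int i))) = (if i \<le> j' then 1 else 0)" if "j' \<le> n" for j'
  using that i by simp
 show ?thesis unfolding fundamental_weight_def using e[OF j(2)] e[OF order_refl] i by simp
qed

lemma dominant_weight_generator:
 assumes i: "1 \<le> i" "i \<le> n"
 shows "dominant_weight n k (generator n (int i) (int i)) = of_real (B_weight n k (int i))"
proof -
 have "dominant_weight n k (generator n (int i) (int i))
   = (\<Sum>j = 1..n. of_nat (k j) * (if j < n then if i \<le> j then 1 else 0 else 1 / 2))"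
  unfolding dominant_weight_def using fundamental_weight_generator[OF i] by (intro sum.cong refl) simp
 also have "{1..n} = insert n {1..<n}" using i by auto
 also have "(\<Sum>j\<in>insert n {1..<n}. of_nat (k j) * (if j < n then if i \<le> j then 1 else 0 else 1 / 2))
   = complex_of_nat (k n) / 2 + (\<Sum>j = 1..<n. if i \<le> j then of_nat (k j) else 0)"
  by (simp, intro sum.cong refl) auto
 also have "(\<Sum>j = 1..<n. if i \<le> j then complex_of_nat (k j) else 0) = (\<Sum>j = i..<n. of_nat (k j))"
  using i by (intro sum.mono_neutral_cong_right) auto
 finally show ?thesis unfolding B_weight_def by simp
qed

theorem essential_iff_conds:
 assumes n: "1 \<le> n" and module: "irreducible_highest_weight_module scale n act (dominant_weight n k) v"
  and f: "\<And>\<alpha>. \<alpha> \<in> set (pos_roots n) ==> is_root_vector n (%h. - root_weight \<alpha> h) (f \<alpha>)"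
 shows "essential scale n act f v p \<longleftrightarrow> (\<forall>i\<in>{1..n}. p (Short i) \<le> k i) \<and>
  so_rep.long_conds n (so_rep.short_shift p (B_weight n k)) p"
proof -
 interpret I: irreducible_highest_weight_module scale n act "dominant_weight n k" v by (rule module)
 interpret M: so_module scale n act ..
 have irr: "W = {0} \<or> W = UNIV" if "M.stable (all_letters n) W" for W
 proof -
  have "I.submodule W" unfolding I.submodule_def
   using M.generators_span[OF that] M.stable_subspace[OF that] by blast
  thus ?thesis using I.irreducible unfolding I.irreducible_module_def by blast
 qed
 have datum: "M.datum (all_letters n) v {0} (B_weight n k)" unfolding M.datum_def
 proof (intro conjI ballI allI impI)
  have "M.X x 0 = 0" if "x \<in> all_letters n" for x
   using that all_letters_range M.lin_0[OF M.X_lin] by blast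
  thus "M.stable (all_letters n) {0}" unfolding M.stable_def by simp
 next
  fix x assume x: "x \<in> all_letters n" "raising n x"
  \<comment> \<open>The transpose \<open>(b, a)\<close> is the letter of a positive root, so
    \<open>generator n a b\<close> is a root vector for this root and annihilates the highest weight
    vector.\<close>
  have low: "M.F a b v = 0" if r: "normal_lowering (b, a)" "(b, a) \<in> all_letters n" for a b
  proof -
   have w: "a \<in> window n" "b \<in> window n" "a + b \<noteq> 0" using r(2) unfolding mem_all_letters by (simp_all add: add.commute)
   have "(b, a) \<in> letter ` set (pos_roots n)"
    using M.lowering_list_short r unfolding M.lowering_list_def pos_roots_eq by blast
   then obtain \<alpha> where \<alpha>: "\<alpha> \<in> set (pos_roots n)" "letter \<alpha> = (b, a)" by auto
   have "is_root_vector n (root_weight \<alpha>) (generator n a b)" unfolding is_root_vector_def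
    using generator_so[OF w(1,2)] generator_nonzero[OF w] generator_weight[OF w(1,2)] root_weight_letter[of _ n \<alpha>] \<alpha>
    by (simp add: pos_roots_eq)
   thus ?thesis unfolding M.F_def by (rule I.hw_annihilated[OF \<alpha>(1)])
  qed
  obtain a b where ab: "x = (a, b)" by fastforce
  have w: "a \<in> window n" "b \<in> window n" "a + b \<noteq> 0" using x(1) unfolding ab mem_all_letters by simp_all
  have ba: "(b, a) \<in> all_letters n" "(- a, - b) \<in> all_letters n" using w by (auto simp: mem_all_letters simp del: Un_iff)
  have "(b, a) \<in> letter_range n" using w by (simp add: letter_range_iff mem_window)
  moreover have "b \<noteq> a" "\<not> raising n (b, a)" using x(2) unfolding ab raising_def by auto
  ultimately have "normal_lowering (b, a) \<or> normal_lowering (- a, - b)"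
   using letter_cases[of "(b, a)" n] w(3) by (auto simp: mirror_def)
  moreover have "M.F (- b) (- a) v = - M.F a b v" using w by (intro M.F_mirror) (simp_all add: mem_window)
  ultimately show "M.X x v \<in> {0}" using low[of b a] low[of "- a" "- b"] ba unfolding ab by auto
 next
  fix i :: int assume i: "0 < i" "(i, i) \<in> all_letters n"
  hence w: "i \<in> window n" by (simp only: mem_all_letters)
  hence ii: "1 \<le> nat i" "nat i \<le> n" "int (nat i) = i" using i by (auto simp: mem_window)
  show "M.F i i v = scale (of_real (B_weight n k i)) v"
   unfolding M.F_def I.hw_weight[OF generator_torus[OF w]]
   using dominant_weight_generator[OF ii(1,2), of k] by (simp only: ii(3))
 qed
 have nil: "M.loc_nilpotent" by (rule M.irreducible_loc_nilpotent[OF n irr datum I.hw_nonzero refl])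
 have "essential scale n act f v p \<longleftrightarrow> M.ess (short_roots n # long_blocks n) v {0} p"
  using f by (rule M.essential_iff_ess)
 thus ?thesis using M.full_ess[OF n datum I.hw_nonzero nil refl, of p] by simp
qed

section \<open>The inequalities\<close>

context so_rep
begin

lemma column_cond_cong:
 assumes m: "2 \<le> m" and eq: "\<And>i. i \<in> {1..m} ==> \<mu> (int i) = \<nu> (int i)"
 shows "column_cond m \<mu> p \<longleftrightarrow> column_cond m \<nu> p"
proof -
 have A: "\<mu> (int i) = \<nu> (int i)" "\<mu> (int (Suc i)) = \<nu> (int (Suc i))" if "i \<in> {1..m - 2}" for i
  using that by (intro eq; auto)+
 have B: "\<mu> (int m) = \<nu> (int m)" "\<mu> (int (m - 1)) = \<nu> (int (m - 1))" using m by (intro eq; auto)+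
 have C: "\<mu> (int (m - 2)) = \<nu> (int (m - 2))" if "3 \<le> m" using that by (intro eq) auto
 show ?thesis unfolding column_cond_def
  by (intro conj_cong ball_cong imp_cong refl; simp only: A B C)
qed

definition tail_sum :: "(root => nat) => nat => nat => real" where
 "tail_sum p i m = (\<Sum>l = m + 1..n. real (p (Plus i l)) + real (p (Minus i l)))"

lemma tail_sum_step: "1 \<le> m ==> m \<le> n ==> tail_sum p i (m - 1) = real (p (Plus i m)) + real (p (Minus i m)) + tail_sum p i m"
 unfolding tail_sum_def by (simp add: sum.atLeast_Suc_atMost)

text \<open>The successive shifts telescope: \<open>tail_sum\<close> collects what the columns with
  index above \<open>m\<close> have removed from coordinate \<open>i\<close>.\<close>

lemma long_conds_iff:
 assumes "m \<le> n" "\<And>i. i \<in> {1..m} ==> \<mu> (int i) = \<mu>' i - tail_sum p i m"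
 shows "long_conds m \<mu> p \<longleftrightarrow> (\<forall>j\<in>{2..m}. column_cond j (%i. \<mu>' (nat i) - tail_sum p (nat i) j) p)"
 using assms
proof (induction m arbitrary: \<mu>)
 case (Suc m)
 show ?case
 proof (cases "1 \<le> m")
  case True
  have "column_cond (Suc m) \<mu> p \<longleftrightarrow> column_cond (Suc m) (%i. \<mu>' (nat i) - tail_sum p (nat i) (Suc m)) p"
   using True Suc.prems by (intro column_cond_cong) auto
  moreover have "long_conds m (minus_shift (Suc m) p (plus_shift (Suc m) p \<mu>)) p
    \<longleftrightarrow> (\<forall>j\<in>{2..m}. column_cond j (%i. \<mu>' (nat i) - tail_sum p (nat i) j) p)"
  proof (rule Suc.IH)
   fix i assume i: "i \<in> {1..m}"
   thus "minus_shift (Suc m) p (plus_shift (Suc m) p \<mu>) (int i) = \<mu>' i - tail_sum p i m"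
    using Suc.prems tail_sum_step[of "Suc m" p i] by (simp add: minus_shift_def plus_shift_def)
  qed (use Suc.prems in simp)
  moreover have "{2..Suc m} = insert (Suc m) {2..m}" using True by auto
  ultimately show ?thesis using True by simp
 qed simp
qed simp

end

text \<open>The conditions arise column by column, with the larger index fixed first, whereas the
  inequalities fix the smaller index first.\<close>

lemma ball_pairs: "(\<forall>m\<in>{2..n::nat}. \<forall>i\<in>{1..m - 2}. P i m) \<longleftrightarrow> (\<forall>i\<in>{1..n - 2}. \<forall>j\<in>{i + 2..n}. P i j)"
proof (intro iffI ballI)
 fix i j assume h: "\<forall>m\<in>{2..n}. \<forall>i\<in>{1..m - 2}. P i m" "i \<in> {1..n - 2}" "j \<in> {i + 2..n}"
 hence "j \<in> {2..n}" "i \<in> {1..j - 2}" by auto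
 thus "P i j" using h(1) by blast
next
 fix i m assume h: "\<forall>i\<in>{1..n - 2}. \<forall>j\<in>{i + 2..n}. P i j" "m \<in> {2..n}" "i \<in> {1..m - 2}"
 hence "i \<in> {1..n - 2}" "m \<in> {i + 2..n}" by auto
 thus "P i m" using h(1) by blast
qed

lemma ball_shift1: "(\<forall>m\<in>{2..n::nat}. P m) \<longleftrightarrow> (\<forall>i\<in>{1..n - 1}. P (i + 1))"
proof (intro iffI ballI)
 fix m assume h: "\<forall>i\<in>{1..n - 1}. P (i + 1)" "m \<in> {2..n}"
 hence "m - 1 \<in> {1..n - 1}" "m - 1 + 1 = m" by auto
 thus "P m" using h(1) by metis
qed auto

lemma ball_shift2: "(\<forall>m\<in>{2..n::nat}. 3 \<le> m --> P m) \<longleftrightarrow> (\<forall>i\<in>{1..n - 2}. P (i + 2))"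
proof (intro iffI ballI impI)
 fix m assume h: "\<forall>i\<in>{1..n - 2}. P (i + 2)" "m \<in> {2..n}" "3 \<le> m"
 hence "m - 2 \<in> {1..n - 2}" "m - 2 + 2 = m" by auto
 thus "P m" using h(1) by metis
qed auto

lemma B_weight_diff: "1 \<le> i ==> i < n ==> B_weight n k (int i) = real (k i) + B_weight n k (int (i + 1))"
 unfolding B_weight_def nat_int by (subst sum.atLeast_Suc_lessThan) auto

theorem theorem4:
  fixes n :: nat
    and scale :: "complex \<Rightarrow> 'v::ab_group_add \<Rightarrow> 'v"
    and act :: "complex mat \<Rightarrow> 'v \<Rightarrow> 'v"
    and k :: "nat \<Rightarrow> nat"
    and v :: 'v
    and f :: "root \<Rightarrow> complex mat"
    and p :: "root \<Rightarrow> nat"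
  defines "pp \<equiv> exp_plus p" and "pm \<equiv> exp_minus p" and "s \<equiv> exp_short p"
  assumes "n \<ge> 2"
    and "irreducible_highest_weight_module scale n act (dominant_weight n k) v"
    and "\<And>\<alpha>. \<alpha> \<in> set (pos_roots n) \<Longrightarrow> is_root_vector n (\<lambda>h. - root_weight \<alpha> h) (f \<alpha>)"
  shows "essential scale n act f v p \<longleftrightarrow>
      (\<forall>i\<in>{1..n-2}. \<forall>j\<in>{i+2..n}.
         s i - s (i+1) + pp i j
           + (\<Sum>l = j+1..n. pp i l + pm i l - pp (i+1) l - pm (i+1) l) \<le> real (k i))
    \<and> (\<forall>i\<in>{1..n-2}. \<forall>j\<in>{i+2..n}.
         s i - s (i+1) + pm (i+1) j
           + (\<Sum>l = j..n. pp i l + pm i l - pp (i+1) l - pm (i+1) l) \<le> real (k i))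
    \<and> (\<forall>i\<in>{1..n-1}.
         s i - s (i+1) + pm i (i+1)
           + (\<Sum>l = i+2..n. pp i l + pm i l - pp (i+1) l - pm (i+1) l) \<le> real (k i))
    \<and> (\<forall>i\<in>{1..n-2}.
         s i + pm (i+1) (i+2)
           + (\<Sum>l = i+2..n. pp i l + pm i l - pp (i+2) l - pm (i+2) l) \<le> real (k i) + real (k (i+1)))
    \<and> (\<forall>i\<in>{1..n-1}.
         s i - pm i (i+1)
           + (\<Sum>l = i+1..n. pp i l + pm i l + pp (i+1) l + pm (i+1) l)
           \<le> real (k i) + real (k n) + 2 * (\<Sum>j = i+1..n-1. real (k j)))
    \<and> (\<forall>i\<in>{1..n}. s i \<le> real (k i))"
 (is "_ \<longleftrightarrow> ?f1 \<and> ?f2 \<and> ?f3 \<and> ?f4 \<and> ?f5 \<and> ?f6")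
proof -
 interpret spin: unitary_rep n "spin n" "leaves n" by (rule spin_unitary_rep)
 define a where "a i l = real (p (Plus i l))" for i l
 define b where "b i l = real (p (Minus i l))" for i l
 define T where "T i m = (\<Sum>l = m + 1..n. a i l + b i l)" for i m
 define L where "L i = B_weight n k (int i)" for i
 \<comment> \<open>\<open>N m i\<close> is coordinate \<open>i\<close> of the weight that is left when the roots with index \<open>m\<close> are reached.\<close>
 define N where "N m i = L (nat i) - s (nat i) - T (nat i) m" for m and i :: int
 have s: "s i = real (p (Short i))" for i unfolding s_def exp_short_def ..
 have neq: "pp i l = a i l" "pm i l = b i l" if "i \<noteq> l" for i l
  using that unfolding pp_def pm_def exp_plus_def exp_minus_def a_def b_def by simp_all
 \<comment> \<open>The convention for equal indices enters only through this sum.\<close>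
 have diag: "pp i i + pm i i = s i" for i unfolding pp_def pm_def s exp_plus_def exp_minus_def by simp
 have T0: "T i m = (a i (m + 1) + b i (m + 1)) + T i (m + 1)" if "m < n" for i m
  unfolding T_def using that by (subst sum.atLeast_Suc_atMost) auto
 have Tdiff: "(\<Sum>l = m + 1..n. pp i l + pm i l - pp j l - pm j l) = T i m - T j m" if "i \<le> m" "j \<le> m" for i j m
 proof -
  have "(\<Sum>l = m + 1..n. pp i l + pm i l - pp j l - pm j l) = (\<Sum>l = m + 1..n. (a i l + b i l) - (a j l + b j l))"
   using that by (intro sum.cong refl) (simp add: neq)
  thus ?thesis unfolding T_def by (simp only: sum_subtractf)
 qed
 have Tadd: "(\<Sum>l = m + 1..n. pp i l + pm i l + pp j l + pm j l) = T i m + T j m" if "i \<le> m" "j \<le> m" for i j m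
 proof -
  have "(\<Sum>l = m + 1..n. pp i l + pm i l + pp j l + pm j l) = (\<Sum>l = m + 1..n. (a i l + b i l) + (a j l + b j l))"
   using that by (intro sum.cong refl) (simp add: neq)
  thus ?thesis unfolding T_def by (simp only: sum.distrib)
 qed
 have first: "(\<Sum>l = m..n. g l) = g m + (\<Sum>l = m + 1..n. g l)" if "m \<le> n" for m and g :: "nat => real"
  using that by (simp add: sum.atLeast_Suc_atMost)
 have Ld: "L i = real (k i) + L (i + 1)" if "1 \<le> i" "i < n" for i unfolding L_def by (rule B_weight_diff[OF that])
 have Ls: "L i + L (i + 1) = real (k i) + real (k n) + 2 * (\<Sum>j = i+1..n-1. real (k j))" if i: "1 \<le> i" "i < n" for i
 proof -
  have "{i + 1..n - 1} = {i + 1..<n}" using i by auto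
  hence "L (i + 1) = (\<Sum>j = i+1..n-1. real (k j)) + real (k n) / 2"
   unfolding L_def B_weight_def nat_int by simp
  thus ?thesis using Ld[OF i] by simp
 qed
 have nat1: "nat (int i) = i" for i by simp
 have "essential scale n act f v p \<longleftrightarrow> (\<forall>i\<in>{1..n}. p (Short i) \<le> k i) \<and>
   spin.long_conds n (spin.short_shift p (B_weight n k)) p"
  using assms(4-6) by (intro essential_iff_conds) auto
 also have "spin.long_conds n (spin.short_shift p (B_weight n k)) p \<longleftrightarrow>
   (\<forall>m\<in>{2..n}. column_cond m (%i. (L (nat i) - s (nat i)) - spin.tail_sum n p (nat i) m) p)"
  by (rule spin.long_conds_iff[OF order_refl]) (simp add: spin.short_shift_def spin.tail_sum_def L_def s)
 also have "\<dots> \<longleftrightarrow> (\<forall>m\<in>{2..n}. column_cond m (N m) p)"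
  unfolding N_def[abs_def] T_def spin.tail_sum_def a_def b_def ..
 also have "\<dots> \<longleftrightarrow> (\<forall>m\<in>{2..n}. \<forall>i\<in>{1..m - 2}. a i m \<le> N m (int i) - N m (int (Suc i))) \<and>
   (\<forall>m\<in>{2..n}. a (m - 1) m \<le> N m (int (m - 1)) + N m (int m)) \<and>
   (\<forall>m\<in>{2..n}. \<forall>i\<in>{1..m - 2}. b i m + a i m - a (Suc i) m \<le> N m (int i) - N m (int (Suc i))) \<and>
   (\<forall>m\<in>{2..n}. b (m - 1) m \<le> N m (int (m - 1)) - N m (int m)) \<and>
   (\<forall>m\<in>{2..n}. 3 \<le> m --> b (m - 1) m + a (m - 2) m + b (m - 2) m \<le> N m (int (m - 2)) - N m (int m))"
  unfolding column_cond_def a_def[symmetric] b_def[symmetric] by blast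
 also have "(\<forall>m\<in>{2..n}. \<forall>i\<in>{1..m - 2}. a i m \<le> N m (int i) - N m (int (Suc i))) \<longleftrightarrow> ?f1"
  unfolding ball_pairs
 proof (intro ball_cong refl, goal_cases)
  case (1 i j)
  hence ij: "1 \<le> i" "i < n" "i \<le> j" "i + 1 \<le> j" "i \<noteq> j" by auto
  show ?case
   unfolding N_def nat1 Tdiff[OF ij(3,4)] neq(1)[OF ij(5)] using Ld[OF ij(1,2)] by (simp; linarith)
 qed
 also have "(\<forall>m\<in>{2..n}. \<forall>i\<in>{1..m - 2}. b i m + a i m - a (Suc i) m \<le> N m (int i) - N m (int (Suc i))) \<longleftrightarrow> ?f2"
  unfolding ball_pairs
 proof (intro ball_cong refl, goal_cases)
  case (1 i j)
  hence ij: "1 \<le> i" "i < n" "i \<le> j" "i + 1 \<le> j" "i \<noteq> j" "i + 1 \<noteq> j" "j \<le> n" by auto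
  show ?case unfolding N_def nat1 first[OF ij(7)] Tdiff[OF ij(3,4)] neq[OF ij(5)] neq[OF ij(6)]
   using Ld[OF ij(1,2)] by (simp; linarith)
 qed
 also have "(\<forall>m\<in>{2..n}. b (m - 1) m \<le> N m (int (m - 1)) - N m (int m)) \<longleftrightarrow> ?f3" unfolding ball_shift1
 proof (intro ball_cong refl, goal_cases)
  case (1 i)
  hence i: "1 \<le> i" "i < n" "i \<le> i + 1" "i \<noteq> i + 1" "i + 2 = i + 1 + 1" by auto
  show ?case unfolding N_def nat1 i(5) Tdiff[OF i(3) order_refl] neq[OF i(4)] diff_add_inverse2
   using Ld[OF i(1,2)] by linarith
 qed
 \<comment> \<open>Here the sum begins at the index of the subtracted row, so by \<open>diag\<close>
   its first summand supplies \<open>- s (i + 2)\<close>.\<close>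
 also have "(\<forall>m\<in>{2..n}. 3 \<le> m --> b (m - 1) m + a (m - 2) m + b (m - 2) m \<le> N m (int (m - 2)) - N m (int m)) \<longleftrightarrow> ?f4"
  unfolding ball_shift2
 proof (intro ball_cong refl, goal_cases)
  case (1 i)
  hence i: "1 \<le> i" "i < n" "1 \<le> i + 1" "i + 1 < n" "i \<le> i + 2" "i \<noteq> i + 2" "i + 1 \<noteq> i + 2" "i + 2 \<le> n" by auto
  have e: "i + 2 - 1 = i + 1" "i + 1 + 1 = i + 2" by auto
  show ?case
   unfolding N_def nat1 first[OF i(8)] Tdiff[OF i(5) order_refl] neq[OF i(6)] neq[OF i(7)] diff_add_inverse2 e(1)
   using Ld[OF i(1,2)] Ld[OF i(3,4), unfolded e(2)] diag[of "i + 2"] by linarith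
 qed
 \<comment> \<open>In the first summand \<open>pm i (i + 1)\<close> cancels against the subtracted
   term, and \<open>diag\<close> supplies \<open>s (i + 1)\<close>. The right-hand side is the sum
   of the coordinates \<open>i\<close> and \<open>i + 1\<close> of the highest weight.\<close>
 also have "(\<forall>m\<in>{2..n}. a (m - 1) m \<le> N m (int (m - 1)) + N m (int m)) \<longleftrightarrow> ?f5" unfolding ball_shift1
 proof (intro ball_cong refl, goal_cases)
  case (1 i)
  hence i: "1 \<le> i" "i < n" "i \<le> i + 1" "i \<noteq> i + 1" "i + 1 \<le> n" by auto
  show ?case
   unfolding N_def nat1 first[OF i(5)] Tadd[OF i(3) order_refl] neq[OF i(4)] diff_add_inverse2
   using Ls[OF i(1,2)] diag[of "i + 1"] by linarith
 qed
 also have "(\<forall>i\<in>{1..n}. p (Short i) \<le> k i) \<longleftrightarrow> ?f6" unfolding s of_nat_le_iff ..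
 finally show ?thesis by blast
qed

end
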